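(* Let $A<0$ and $B,C,L>0$. With the domain $\Omega=\Omega_{\rho,\varepsilon}$, boundary data $\mathbf Q_{\mathrm b}$, admissible class $\mathscr A$, energy $I_\lambda$ and notion of WORS given in the context: (i) (small squares) for every $\rho\in(0,1)$, every $0<\varepsilon<\min\{1/2,1-\rho\}$ and every admissible boundary profile $g$, there exists $\lambda_0>0$ such that for all $0<\lambda<\lambda_0$ the WORS is the unique critical point of $I_\lambda$ in $\mathscr A$ (and hence it is the global minimizer of $I_\lambda$ in $\mathscr A$); (ii) (aspect ratio close to one) for every $\lambda>0$ there exists $\rho_0\in(0,1)$ such that for all $\rho\in(\rho_0,1)$, all $0<\varepsilon<\min\{1/2,1-\rho\}$ and all admissible boundary profiles $g$, the WORS is the unique critical point of $I_\lambda$ in $\mathscr A$ (and hence it is the global minimizer of $I_\lambda$ in $\mathscr A$). Here "the WORS is the unique critical point" means that $I_\lambda$ has exactly one critical point in $\mathscr A$ and this critical point is a WORS.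
   Context: Domain. For $0<\rho<1$ and $0<\varepsilon<\min\{1/2,1-\rho\}$, $$\Omega=\{(x,y)\in\mathbb{R}^2: |x|<1-\varepsilon,\ |y|<1-\varepsilon,\ \rho<\max(|x+y|,|x-y|)<1\}.$$ Its boundary consists of the inner boundary $\Gamma_{\mathrm{in}}=\{\max(|x+y|,|x-y|)=\rho\}$ and the outer boundary $\Gamma_{\mathrm{out}}$. The latter is made of four long edges $C_1,\dots,C_4$, labeled counterclockwise, where $C_1=\{x+y=1,\ \varepsilon\le x\le 1-\varepsilon\}$ and $C_i$ lies in the $i$-th quadrant, and four short edges $S_1,\dots,S_4$, labeled counterclockwise: $S_1=\{(1-\varepsilon,y):|y|\le\varepsilon\}$, $S_2=\{(x,1-\varepsilon):|x|\le\varepsilon\}$, $S_3=\{(-(1-\varepsilon),y):|y|\le\varepsilon\}$, $S_4=\{(x,-(1-\varepsilon)):|x|\le\varepsilon\}$. Constants and vectors. $s_+=\dfrac{B+\sqrt{B^2+24|A|C}}{4C}$, $\mathbf n_1=\frac1{\sqrt2}(-1,1,0)$, $\mathbf n_2=\frac1{\sqrt2}(1,1,0)$, $\hat{\mathbf z}=(0,0,1)$. Admissible boundary profile: $g:[-\varepsilon,\varepsilon]\to[-s_+/2,s_+/2]$ of class $C^1$, odd, with $g(\varepsilon)=s_+/2$. Boundary data. $q_{1,\mathrm b}=0$ on $\Gamma_{\mathrm{in}}$, $q_{1,\mathrm b}=s_+/2$ on $C_1\cup C_3$, $q_{1,\mathrm b}=-s_+/2$ on $C_2\cup C_4$, $q_{1,\mathrm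 b}=g(y)$ on $S_1$, $q_{1,\mathrm b}=-g(y)$ on $S_3$, $q_{1,\mathrm b}=g(x)$ on $S_2$, $q_{1,\mathrm b}=-g(x)$ on $S_4$; and $q_{3,\mathrm b}=0$ on $\Gamma_{\mathrm{in}}$, $q_{3,\mathrm b}=-s_+/6$ on $\Gamma_{\mathrm{out}}$. Set $$\mathbf Q_{\mathrm b}=q_{1,\mathrm b}(\mathbf n_1\otimes\mathbf n_1-\mathbf n_2\otimes\mathbf n_2)+q_{3,\mathrm b}(2\hat{\mathbf z}\otimes\hat{\mathbf z}-\mathbf n_1\otimes\mathbf n_1-\mathbf n_2\otimes\mathbf n_2).$$ Landau-de Gennes energy. $S_0$ is the space of real symmetric traceless $3\times3$ matrices, $|\mathbf Q|^2=\operatorname{tr}\mathbf Q^2$, $\mathscr A=\{\mathbf Q\in W^{1,2}(\Omega,S_0):\mathbf Q=\mathbf Q_{\mathrm b}\text{ on }\partial\Omega\}$ (traces), and $$I_\lambda[\mathbf Q]=\int_\Omega\Big(\tfrac12|\nabla\mathbf Q|^2+\tfrac{\lambda^2}{L}\big(\tfrac A2\operatorname{tr}\mathbf Q^2-\tfrac B3\operatorname{tr}\mathbf Q^3+\tfrac C4(\operatorname{tr}\mathbf Q^2)^2\big)\Big)\mathrm dA.$$ A critical point of $I_\lambda$ in $\mathscr A$ is a weak solution $\mathbf Q\in\mathscr A$ of $$\Delta\mathbf Q=\frac{\lambda^2}{L}\Big\{A\mathbf Q-B\big(\mathbf Q\mathbf Q-\tfrac{\mathbf I}{3}|\mathbf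 Q|^2\big)+C|\mathbf Q|^2\mathbf Q\Big\}.$$ WORS (Well Order Reconstruction Solution): a critical point of $I_\lambda$ in $\mathscr A$ of the form $$\mathbf{Q}_s=q_1^s\,(\mathbf{n}_1\otimes\mathbf{n}_1-\mathbf{n}_2\otimes\mathbf{n}_2)+q_3^s\,(2\hat{\mathbf z}\otimes\hat{\mathbf z}-\mathbf{n}_1\otimes\mathbf{n}_1-\mathbf{n}_2\otimes\mathbf{n}_2),$$ with scalar functions $q_1^s,q_3^s\in W^{1,2}(\Omega)$ such that $q_1^s=0$ on $\Omega\cap\{x=0\}$ and on $\Omega\cap\{y=0\}$. *)

theory Defs
  imports "HOL-Analysis.Analysis"
begin

section \<open>First order Sobolev spaces on subsets of the plane\<close>

text \<open>
  Functions are total on the plane; only their values on the domain matter.  An element of a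
  Lebesgue or Sobolev space is represented by a Borel function, and equality of such elements is
  equality almost everywhere on the domain.
\<close>

type_synonym pt = "real \<times> real"
type_synonym mat3 = "real^3^3"

definition L2_on :: "pt set \<Rightarrow> (pt \<Rightarrow> 'b::euclidean_space) \<Rightarrow> bool" where
  "L2_on \<Omega> u \<longleftrightarrow> set_borel_measurable lborel \<Omega> u \<and> set_integrable lborel \<Omega> (\<lambda>p. (norm (u p))\<^sup>2)"

definition C1_grad :: "(pt \<Rightarrow> real) \<Rightarrow> (pt \<Rightarrow> pt) \<Rightarrow> bool" where
  "C1_grad \<phi> D\<phi> \<longleftrightarrow> (\<forall>p. GDERIV \<phi> p :> D\<phi> p) \<and> continuous_on UNIV D\<phi>"

definition test_function :: "pt set \<Rightarrow> (pt \<Rightarrow> real) \<Rightarrow> (pt \<Rightarrow> pt) \<Rightarrow> bool" where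
  "test_function \<Omega> \<phi> D\<phi> \<longleftrightarrow> C1_grad \<phi> D\<phi> \<and> (\<exists>K. compact K \<and> K \<subseteq> \<Omega> \<and> (\<forall>p. p \<notin> K \<longrightarrow> \<phi> p = 0))"

definition has_weak_gradient :: "pt set \<Rightarrow> (pt \<Rightarrow> real) \<Rightarrow> (pt \<Rightarrow> pt) \<Rightarrow> bool" where
  "has_weak_gradient \<Omega> u G \<longleftrightarrow>
     (\<forall>\<phi> D\<phi>. test_function \<Omega> \<phi> D\<phi> \<longrightarrow>
        (LINT p:\<Omega>|lborel. u p *\<^sub>R D\<phi> p) = - (LINT p:\<Omega>|lborel. \<phi> p *\<^sub>R G p))"

definition W12 :: "pt set \<Rightarrow> (pt \<Rightarrow> real) \<Rightarrow> bool" where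
  "W12 \<Omega> u \<longleftrightarrow> L2_on \<Omega> u \<and> (\<exists>G. L2_on \<Omega> G \<and> has_weak_gradient \<Omega> u G)"

text \<open>The weak gradient is only determined almost everywhere; this picks a representative.\<close>

definition weak_grad :: "pt set \<Rightarrow> (pt \<Rightarrow> real) \<Rightarrow> pt \<Rightarrow> pt" where
  "weak_grad \<Omega> u = (SOME G. L2_on \<Omega> G \<and> has_weak_gradient \<Omega> u G)"

text \<open>
  The trace operator is the closure of the restriction operator: \<open>h\<close> is the trace of \<open>u\<close> on a curve
  if there are continuously differentiable functions on the plane that tend to \<open>u\<close> in
  \<open>W\<^sup>1\<^sup>,\<^sup>2(\<Omega>)\<close> and whose restrictions to the curve tend to \<open>h\<close> in the \<open>L\<^sup>2\<close> space of arc length.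
  The curve is a finite union of line segments, given by their pairs of end points.
\<close>

definition L2_segment_tendsto :: "pt \<Rightarrow> pt \<Rightarrow> (nat \<Rightarrow> pt \<Rightarrow> real) \<Rightarrow> (pt \<Rightarrow> real) \<Rightarrow> bool" where
  "L2_segment_tendsto a b \<phi> h \<longleftrightarrow>
     set_borel_measurable lborel {0..1} (\<lambda>t. h (linepath a b t)) \<and>
     set_integrable lborel {0..1} (\<lambda>t. (h (linepath a b t))\<^sup>2) \<and>
     (\<lambda>k. dist a b * (LINT t:{0..1}|lborel. (\<phi> k (linepath a b t) - h (linepath a b t))\<^sup>2))
       \<longlonglongrightarrow> 0"

definition has_trace :: "pt set \<Rightarrow> (pt \<times> pt) set \<Rightarrow> (pt \<Rightarrow> real) \<Rightarrow> (pt \<Rightarrow> real) \<Rightarrow> bool" where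
  "has_trace \<Omega> \<Sigma> u h \<longleftrightarrow> W12 \<Omega> u \<and>
     (\<exists>\<phi> D\<phi>. (\<forall>k. C1_grad (\<phi> k) (D\<phi> k)) \<and>
        (\<lambda>k. LINT p:\<Omega>|lborel. (\<phi> k p - u p)\<^sup>2 + (norm (D\<phi> k p - weak_grad \<Omega> u p))\<^sup>2) \<longlonglongrightarrow> 0 \<and>
        (\<forall>(a, b)\<in>\<Sigma>. L2_segment_tendsto a b \<phi> h))"

section \<open>The domain and its boundary\<close>

definition Om :: "real \<Rightarrow> real \<Rightarrow> pt set" where
  "Om \<rho> \<epsilon> = {(x, y). \<bar>x\<bar> < 1 - \<epsilon> \<and> \<bar>y\<bar> < 1 - \<epsilon> \<and> \<rho> < max \<bar>x + y\<bar> \<bar>x - y\<bar> \<and> max \<bar>x + y\<bar> \<bar>x - y\<bar> < 1}"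

definition Gamma_in :: "real \<Rightarrow> pt set" where
  "Gamma_in \<rho> = {(x, y). max \<bar>x + y\<bar> \<bar>x - y\<bar> = \<rho>}"

definition C1 :: "real \<Rightarrow> pt set" where "C1 \<epsilon> = {(x, y). x + y = 1 \<and> \<epsilon> \<le> x \<and> x \<le> 1 - \<epsilon>}"
definition C2 :: "real \<Rightarrow> pt set" where "C2 \<epsilon> = {(x, y). y - x = 1 \<and> \<epsilon> \<le> - x \<and> - x \<le> 1 - \<epsilon>}"
definition C3 :: "real \<Rightarrow> pt set" where "C3 \<epsilon> = {(x, y). - x - y = 1 \<and> \<epsilon> \<le> - x \<and> - x \<le> 1 - \<epsilon>}"
definition C4 :: "real \<Rightarrow> pt set" where "C4 \<epsilon> = {(x, y). x - y = 1 \<and> \<epsilon> \<le> x \<and> x \<le> 1 - \<epsilon>}"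
definition S1 :: "real \<Rightarrow> pt set" where "S1 \<epsilon> = {(x, y). x = 1 - \<epsilon> \<and> \<bar>y\<bar> \<le> \<epsilon>}"
definition S2 :: "real \<Rightarrow> pt set" where "S2 \<epsilon> = {(x, y). y = 1 - \<epsilon> \<and> \<bar>x\<bar> \<le> \<epsilon>}"
definition S3 :: "real \<Rightarrow> pt set" where "S3 \<epsilon> = {(x, y). x = - (1 - \<epsilon>) \<and> \<bar>y\<bar> \<le> \<epsilon>}"
definition S4 :: "real \<Rightarrow> pt set" where "S4 \<epsilon> = {(x, y). y = - (1 - \<epsilon>) \<and> \<bar>x\<bar> \<le> \<epsilon>}"

definition Gamma_out :: "real \<Rightarrow> pt set" where
  "Gamma_out \<epsilon> = C1 \<epsilon> \<union> C2 \<epsilon> \<union> C3 \<epsilon> \<union> C4 \<epsilon> \<union> S1 \<epsilon> \<union> S2 \<epsilon> \<union> S3 \<epsilon> \<union> S4 \<epsilon>"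

definition inner_edges :: "real \<Rightarrow> (pt \<times> pt) set" where
  "inner_edges \<rho> =
     {((\<rho>, 0), (0, \<rho>)), ((0, \<rho>), (-\<rho>, 0)), ((-\<rho>, 0), (0, -\<rho>)), ((0, -\<rho>), (\<rho>, 0))}"

definition outer_edges :: "real \<Rightarrow> (pt \<times> pt) set" where
  "outer_edges \<epsilon> =
     {((1 - \<epsilon>, -\<epsilon>), (1 - \<epsilon>, \<epsilon>)), ((1 - \<epsilon>, \<epsilon>), (\<epsilon>, 1 - \<epsilon>)),
      ((\<epsilon>, 1 - \<epsilon>), (-\<epsilon>, 1 - \<epsilon>)), ((-\<epsilon>, 1 - \<epsilon>), (-(1 - \<epsilon>), \<epsilon>)),
      ((-(1 - \<epsilon>), \<epsilon>), (-(1 - \<epsilon>), -\<epsilon>)), ((-(1 - \<epsilon>), -\<epsilon>), (-\<epsilon>, -(1 - \<epsilon>))),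
      ((-\<epsilon>, -(1 - \<epsilon>)), (\<epsilon>, -(1 - \<epsilon>))), ((\<epsilon>, -(1 - \<epsilon>)), (1 - \<epsilon>, -\<epsilon>))}"

definition boundary_edges :: "real \<Rightarrow> real \<Rightarrow> (pt \<times> pt) set" where
  "boundary_edges \<rho> \<epsilon> = inner_edges \<rho> \<union> outer_edges \<epsilon>"

text \<open>The part of the coordinate axes inside the domain, up to end points.\<close>

definition axis_edges :: "real \<Rightarrow> real \<Rightarrow> (pt \<times> pt) set" where
  "axis_edges \<rho> \<epsilon> =
     {((0, \<rho>), (0, 1 - \<epsilon>)), ((0, -\<rho>), (0, -(1 - \<epsilon>))),
      ((\<rho>, 0), (1 - \<epsilon>, 0)), ((-\<rho>, 0), (-(1 - \<epsilon>), 0))}"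

lemma max_abs_sum_diff: "max \<bar>x + y\<bar> \<bar>x - y\<bar> = \<bar>x\<bar> + \<bar>y\<bar>" for x y :: real
  by linarith

lemma frontier_Om:
  assumes "0 < \<rho>" "\<rho> < 1" "0 < \<epsilon>" "\<epsilon> < min (1/2) (1 - \<rho>)"
  shows "frontier (Om \<rho> \<epsilon>) = Gamma_in \<rho> \<union> Gamma_out \<epsilon>"
proof -
  define K where "K = {p::pt. \<bar>fst p\<bar> \<le> 1 - \<epsilon> \<and> \<bar>snd p\<bar> \<le> 1 - \<epsilon> \<and> \<rho> \<le> \<bar>fst p\<bar> + \<bar>snd p\<bar> \<and> \<bar>fst p\<bar> + \<bar>snd p\<bar> \<le> 1}"
  have Om: "Om \<rho> \<epsilon> = {p. \<bar>fst p\<bar> < 1 - \<epsilon> \<and> \<bar>snd p\<bar> < 1 - \<epsilon> \<and> \<rho> < \<bar>fst p\<bar> + \<bar>snd p\<bar> \<and> \<bar>fst p\<bar> + \<bar>snd p\<bar> < 1}"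
    unfolding Om_def by (auto simp: max_abs_sum_diff)
  have op: "open (Om \<rho> \<epsilon>)"
    unfolding Om by (intro open_Collect_conj open_Collect_less continuous_intros)
  have "closed K"
    unfolding K_def by (intro closed_Collect_conj closed_Collect_le continuous_intros)
  moreover have "Om \<rho> \<epsilon> \<subseteq> K" unfolding Om K_def by auto
  ultimately have "closure (Om \<rho> \<epsilon>) \<subseteq> K" by (simp add: closure_minimal)
  moreover have "K \<subseteq> closure (Om \<rho> \<epsilon>)"
  proof
    fix p assume p: "p \<in> K"
    define c where "c = ((if fst p < 0 then -1 else 1) * ((1 + \<rho>)/4), (if snd p < 0 then -1 else 1) * ((1 + \<rho>)/4))"
    define X where "X = (\<lambda>n. p + (1 / real (Suc n)) *\<^sub>R (c - p))"
    have "X n \<in> Om \<rho> \<epsilon>" for n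
    proof -
      define t where "t = 1 / real (Suc n)"
      have t: "0 < t" "t \<le> 1" unfolding t_def by auto
      have f: "\<bar>fst (X n)\<bar> = (1 - t) * \<bar>fst p\<bar> + t * ((1 + \<rho>)/4)"
      proof (cases "fst p < 0")
        case True
        have "fst (X n) = - ((1 - t) * \<bar>fst p\<bar> + t * ((1 + \<rho>)/4))"
          using True unfolding X_def c_def t_def[symmetric] by (simp add: field_simps)
        moreover have "0 \<le> (1 - t) * \<bar>fst p\<bar> + t * ((1 + \<rho>)/4)" using t assms by simp
        ultimately show ?thesis by linarith
      next
        case False
        have "fst (X n) = ((1 - t) * \<bar>fst p\<bar> + t * ((1 + \<rho>)/4))"
          using False unfolding X_def c_def t_def[symmetric] by (simp add: algebra_simps)
        moreover have "0 \<le> (1 - t) * \<bar>fst p\<bar> + t * ((1 + \<rho>)/4)" using t assms by simp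
        ultimately show ?thesis by linarith
      qed
      have s: "\<bar>snd (X n)\<bar> = (1 - t) * \<bar>snd p\<bar> + t * ((1 + \<rho>)/4)"
      proof (cases "snd p < 0")
        case True
        have "snd (X n) = - ((1 - t) * \<bar>snd p\<bar> + t * ((1 + \<rho>)/4))"
          using True unfolding X_def c_def t_def[symmetric] by (simp add: field_simps)
        moreover have "0 \<le> (1 - t) * \<bar>snd p\<bar> + t * ((1 + \<rho>)/4)" using t assms by simp
        ultimately show ?thesis by linarith
      next
        case False
        have "snd (X n) = ((1 - t) * \<bar>snd p\<bar> + t * ((1 + \<rho>)/4))"
          using False unfolding X_def c_def t_def[symmetric] by (simp add: algebra_simps)
        moreover have "0 \<le> (1 - t) * \<bar>snd p\<bar> + t * ((1 + \<rho>)/4)" using t assms by simp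
        ultimately show ?thesis by linarith
      qed
      have *: "(1 - t) * a + t * b < d" if "a \<le> d" "b < d" for a b d :: real
      proof -
        have "(1 - t) * a \<le> (1 - t) * d" "t * b < t * d" using t that by (auto intro: mult_left_mono)
        thus ?thesis by (simp add: algebra_simps)
      qed
      have **: "d < (1 - t) * a + t * b" if "d \<le> a" "d < b" for a b d :: real
        using *[of "-a" "-d" "-b"] that by simp
      have sum: "\<bar>fst (X n)\<bar> + \<bar>snd (X n)\<bar> = (1 - t) * (\<bar>fst p\<bar> + \<bar>snd p\<bar>) + t * ((1 + \<rho>)/2)"
        unfolding f s by (simp add: algebra_simps)
      show ?thesis
        unfolding Om mem_Collect_eq sum unfolding f s
        by (intro conjI * **) (use p assms in \<open>auto simp: K_def\<close>)
    qed
    moreover have "X \<longlonglongrightarrow> p"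
    proof -
      have "X \<longlonglongrightarrow> p + 0 *\<^sub>R (c - p)"
        unfolding X_def using LIMSEQ_inverse_real_of_nat
        by (intro tendsto_intros) (simp add: inverse_eq_divide)
      thus ?thesis by simp
    qed
    ultimately show "p \<in> closure (Om \<rho> \<epsilon>)" unfolding closure_sequential by blast
  qed
  ultimately have "frontier (Om \<rho> \<epsilon>) = K - Om \<rho> \<epsilon>"
    using op by (simp add: frontier_def interior_open)
  also have "\<dots> = Gamma_in \<rho> \<union> Gamma_out \<epsilon>"
  proof (rule set_eqI)
    fix p :: pt
    obtain x y where p: "p = (x, y)" by force
    show "p \<in> K - Om \<rho> \<epsilon> \<longleftrightarrow> p \<in> Gamma_in \<rho> \<union> Gamma_out \<epsilon>"
      unfolding p K_def Om Gamma_in_def Gamma_out_def C1_def C2_def C3_def C4_def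
        S1_def S2_def S3_def S4_def mem_Collect_eq Un_iff Diff_iff case_prod_conv fst_conv snd_conv
        max_abs_sum_diff
      using assms by (cases "0 \<le> x"; cases "0 \<le> y"; simp add: abs_of_nonneg abs_of_neg not_le; safe?; linarith)
  qed
  finally show ?thesis .
qed

lemma closed_segment_pt:
  "(x, y) \<in> closed_segment (a, b) (c, d) \<longleftrightarrow>
     (\<exists>u. 0 \<le> u \<and> u \<le> 1 \<and> x = a + u * (c - a) \<and> y = b + u * (d - b))" for a b c d x y :: real
  by (auto simp: closed_segment_def algebra_simps)

lemma closed_segment_fst: fixes a b c d x y :: real assumes "a \<noteq> c"
  shows "(x, y) \<in> closed_segment (a, b) (c, d) \<longleftrightarrow>
     0 \<le> (x - a)/(c - a) \<and> (x - a)/(c - a) \<le> 1 \<and> y = b + (x - a)/(c - a) * (d - b)"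
proof -
  have "x = a + u * (c - a) \<longleftrightarrow> u = (x - a)/(c - a)" for u using assms by (auto simp: field_simps)
  thus ?thesis unfolding closed_segment_pt by auto
qed

lemma closed_segment_snd: fixes a b c d x y :: real assumes "b \<noteq> d"
  shows "(x, y) \<in> closed_segment (a, b) (c, d) \<longleftrightarrow>
     0 \<le> (y - b)/(d - b) \<and> (y - b)/(d - b) \<le> 1 \<and> x = a + (y - b)/(d - b) * (c - a)"
proof -
  have "y = b + u * (d - b) \<longleftrightarrow> u = (y - b)/(d - b)" for u using assms by (auto simp: field_simps)
  thus ?thesis unfolding closed_segment_pt by auto
qed

lemma inner_edges_Gamma_in: assumes "0 < \<rho>"
  shows "(\<Union>(a, b)\<in>inner_edges \<rho>. closed_segment a b) = Gamma_in \<rho>"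
proof (rule set_eqI)
  fix p :: pt
  obtain x y where p: "p = (x, y)" by force
  show "p \<in> (\<Union>(a, b)\<in>inner_edges \<rho>. closed_segment a b) \<longleftrightarrow> p \<in> Gamma_in \<rho>"
    unfolding p using assms
    by (simp add: inner_edges_def Gamma_in_def max_abs_sum_diff closed_segment_fst divide_simps) (smt (verit) mult_minus_left mult_minus_right mult.commute mult_left_cancel)
qed

lemma closed_segment_diag: fixes a b c d x y :: real assumes "a \<noteq> c" "d - b = s * (c - a)"
  shows "(x, y) \<in> closed_segment (a, b) (c, d) \<longleftrightarrow>
     0 \<le> (x - a)/(c - a) \<and> (x - a)/(c - a) \<le> 1 \<and> y = b + s * (x - a)"
  using assms by (simp add: closed_segment_fst mult.commute)

lemma outer_edges_pieces: assumes "0 < \<epsilon>" "\<epsilon> < 1/2"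
  shows
   "closed_segment (1 - \<epsilon>, \<epsilon>) (\<epsilon>, 1 - \<epsilon>) = C1 \<epsilon>"
   "closed_segment (-\<epsilon>, 1 - \<epsilon>) (-(1 - \<epsilon>), \<epsilon>) = C2 \<epsilon>"
   "closed_segment (-(1 - \<epsilon>), -\<epsilon>) (-\<epsilon>, -(1 - \<epsilon>)) = C3 \<epsilon>"
   "closed_segment (\<epsilon>, -(1 - \<epsilon>)) (1 - \<epsilon>, -\<epsilon>) = C4 \<epsilon>"
   "closed_segment (1 - \<epsilon>, -\<epsilon>) (1 - \<epsilon>, \<epsilon>) = S1 \<epsilon>"
   "closed_segment (\<epsilon>, 1 - \<epsilon>) (-\<epsilon>, 1 - \<epsilon>) = S2 \<epsilon>"
   "closed_segment (-(1 - \<epsilon>), \<epsilon>) (-(1 - \<epsilon>), -\<epsilon>) = S3 \<epsilon>"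
   "closed_segment (-\<epsilon>, -(1 - \<epsilon>)) (\<epsilon>, -(1 - \<epsilon>)) = S4 \<epsilon>"
     subgoal using assms by (auto simp: closed_segment_diag[where s="-1"] C1_def field_simps)
     subgoal using assms by (auto simp: closed_segment_diag[where s="1"] C2_def field_simps)
     subgoal using assms by (auto simp: closed_segment_diag[where s="-1"] C3_def field_simps)
     subgoal using assms by (auto simp: closed_segment_diag[where s="1"] C4_def field_simps)
     subgoal using assms by (auto simp: closed_segment_fst closed_segment_snd S1_def field_simps)
     subgoal using assms by (auto simp: closed_segment_fst closed_segment_snd S2_def field_simps)
     subgoal using assms by (auto simp: closed_segment_fst closed_segment_snd S3_def field_simps)
     subgoal using assms by (auto simp: closed_segment_fst closed_segment_snd S4_def field_simps)
     done

lemma boundary_edges_frontier: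
  assumes "0 < \<rho>" "\<rho> < 1" "0 < \<epsilon>" "\<epsilon> < min (1/2) (1 - \<rho>)"
  shows "(\<Union>(a, b)\<in>boundary_edges \<rho> \<epsilon>. closed_segment a b) = frontier (Om \<rho> \<epsilon>)"
proof -
  have "(\<Union>(a, b)\<in>outer_edges \<epsilon>. closed_segment a b) = Gamma_out \<epsilon>"
    unfolding outer_edges_def Gamma_out_def using assms
    by (simp only: UN_insert UN_empty case_prod_conv outer_edges_pieces min_less_iff_conj) auto
  with inner_edges_Gamma_in[of \<rho>] assms show ?thesis
    by (simp add: frontier_Om boundary_edges_def UN_Un)
qed


section \<open>Boundary data\<close>

definition s_plus :: "real \<Rightarrow> real \<Rightarrow> real \<Rightarrow> real" where
  "s_plus A B C = (B + sqrt (B\<^sup>2 + 24 * \<bar>A\<bar> * C)) / (4 * C)"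

definition admissible_profile :: "real \<Rightarrow> real \<Rightarrow> (real \<Rightarrow> real) \<Rightarrow> bool" where
  "admissible_profile s \<epsilon> g \<longleftrightarrow>
     g ` {-\<epsilon>..\<epsilon>} \<subseteq> {-(s/2)..s/2} \<and>
     (\<exists>g'. continuous_on {-\<epsilon>..\<epsilon>} g' \<and>
        (\<forall>t\<in>{-\<epsilon>..\<epsilon>}. (g has_real_derivative g' t) (at t within {-\<epsilon>..\<epsilon>}))) \<and>
     (\<forall>t\<in>{-\<epsilon>..\<epsilon>}. g (- t) = - g t) \<and>
     g \<epsilon> = s/2"

text \<open>
  The pieces of the outer boundary overlap in the corners, where the values prescribed for an
  admissible profile agree.  Away from the boundary the value is irrelevant.
\<close>

definition q1b :: "real \<Rightarrow> real \<Rightarrow> real \<Rightarrow> (real \<Rightarrow> real) \<Rightarrow> pt \<Rightarrow> real" where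
  "q1b s \<rho> \<epsilon> g p =
     (if p \<in> Gamma_in \<rho> then 0
      else if p \<in> C1 \<epsilon> \<union> C3 \<epsilon> then s/2
      else if p \<in> C2 \<epsilon> \<union> C4 \<epsilon> then - (s/2)
      else if p \<in> S1 \<epsilon> then g (snd p)
      else if p \<in> S3 \<epsilon> then - g (snd p)
      else if p \<in> S2 \<epsilon> then g (fst p)
      else if p \<in> S4 \<epsilon> then - g (fst p)
      else 0)"

definition q3b :: "real \<Rightarrow> real \<Rightarrow> real \<Rightarrow> pt \<Rightarrow> real" where
  "q3b s \<rho> \<epsilon> p = (if p \<in> Gamma_in \<rho> then 0 else if p \<in> Gamma_out \<epsilon> then - (s/6) else 0)"

definition outer_product :: "real^3 \<Rightarrow> real^3 \<Rightarrow> mat3" where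
  "outer_product u v = (\<chi> i j. u $ i * v $ j)"

definition n1 :: "real^3" where "n1 = (1 / sqrt 2) *\<^sub>R vector [-1, 1, 0]"
definition n2 :: "real^3" where "n2 = (1 / sqrt 2) *\<^sub>R vector [1, 1, 0]"
definition z_hat :: "real^3" where "z_hat = vector [0, 0, 1]"

definition Q_of :: "real \<Rightarrow> real \<Rightarrow> mat3" where
  "Q_of q1 q3 =
     q1 *\<^sub>R (outer_product n1 n1 - outer_product n2 n2) +
     q3 *\<^sub>R (2 *\<^sub>R outer_product z_hat z_hat - outer_product n1 n1 - outer_product n2 n2)"

definition Qb :: "real \<Rightarrow> real \<Rightarrow> real \<Rightarrow> (real \<Rightarrow> real) \<Rightarrow> pt \<Rightarrow> mat3" where
  "Qb s \<rho> \<epsilon> g p = Q_of (q1b s \<rho> \<epsilon> g p) (q3b s \<rho> \<epsilon> p)"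

section \<open>The Landau--de Gennes problem\<close>

definition S0 :: "mat3 set" where
  "S0 = {M. transpose M = M \<and> trace M = 0}"

definition admissible_class :: "real \<Rightarrow> real \<Rightarrow> real \<Rightarrow> (real \<Rightarrow> real) \<Rightarrow> (pt \<Rightarrow> mat3) set" where
  "admissible_class s \<rho> \<epsilon> g =
     {Q. (AE p in lborel. p \<in> Om \<rho> \<epsilon> \<longrightarrow> Q p \<in> S0) \<and>
         (\<forall>i j. W12 (Om \<rho> \<epsilon>) (\<lambda>p. Q p $ i $ j)) \<and>
         (\<forall>i j. has_trace (Om \<rho> \<epsilon>) (boundary_edges \<rho> \<epsilon>)
                  (\<lambda>p. Q p $ i $ j) (\<lambda>p. Qb s \<rho> \<epsilon> g p $ i $ j))}"

definition bulk :: "real \<Rightarrow> real \<Rightarrow> real \<Rightarrow> mat3 \<Rightarrow> real" where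
  "bulk A B C M = A/2 * trace (M ** M) - B/3 * trace (M ** M ** M) + C/4 * (trace (M ** M))\<^sup>2"

definition LdG_energy ::
    "real \<Rightarrow> real \<Rightarrow> real \<Rightarrow> real \<Rightarrow> real \<Rightarrow> pt set \<Rightarrow> (pt \<Rightarrow> mat3) \<Rightarrow> real" where
  "LdG_energy A B C L lam \<Omega> Q =
     (LINT p:\<Omega>|lborel.
        1/2 * (\<Sum>i\<in>UNIV. \<Sum>j\<in>UNIV. (norm (weak_grad \<Omega> (\<lambda>p. Q p $ i $ j) p))\<^sup>2) +
        lam\<^sup>2 / L * bulk A B C (Q p))"

definition EL_rhs :: "real \<Rightarrow> real \<Rightarrow> real \<Rightarrow> real \<Rightarrow> real \<Rightarrow> mat3 \<Rightarrow> mat3" where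
  "EL_rhs A B C L lam M =
     (lam\<^sup>2 / L) *\<^sub>R
       (A *\<^sub>R M - B *\<^sub>R (M ** M - (trace (M ** M) / 3) *\<^sub>R mat 1) + (C * trace (M ** M)) *\<^sub>R M)"

definition weak_solution ::
    "real \<Rightarrow> real \<Rightarrow> real \<Rightarrow> real \<Rightarrow> real \<Rightarrow> pt set \<Rightarrow> (pt \<Rightarrow> mat3) \<Rightarrow> bool" where
  "weak_solution A B C L lam \<Omega> Q \<longleftrightarrow>
     (\<forall>i j \<phi> D\<phi>. test_function \<Omega> \<phi> D\<phi> \<longrightarrow>
        - (LINT p:\<Omega>|lborel. weak_grad \<Omega> (\<lambda>p. Q p $ i $ j) p \<bullet> D\<phi> p) =
        (LINT p:\<Omega>|lborel. EL_rhs A B C L lam (Q p) $ i $ j * \<phi> p))"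

definition critical_point ::
    "real \<Rightarrow> real \<Rightarrow> real \<Rightarrow> real \<Rightarrow> real \<Rightarrow> real \<Rightarrow> real \<Rightarrow> (real \<Rightarrow> real) \<Rightarrow> (pt \<Rightarrow> mat3) \<Rightarrow> bool" where
  "critical_point A B C L lam \<rho> \<epsilon> g Q \<longleftrightarrow>
     Q \<in> admissible_class (s_plus A B C) \<rho> \<epsilon> g \<and> weak_solution A B C L lam (Om \<rho> \<epsilon>) Q"

text \<open>
  \<open>q\<^sub>1\<close> is a Sobolev function, so that its vanishing on the axes is understood in the sense of traces.
\<close>

definition is_WORS ::
    "real \<Rightarrow> real \<Rightarrow> real \<Rightarrow> real \<Rightarrow> real \<Rightarrow> real \<Rightarrow> real \<Rightarrow> (real \<Rightarrow> real) \<Rightarrow> (pt \<Rightarrow> mat3) \<Rightarrow> bool" where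
  "is_WORS A B C L lam \<rho> \<epsilon> g Q \<longleftrightarrow>
     critical_point A B C L lam \<rho> \<epsilon> g Q \<and>
     (\<exists>q1 q3. W12 (Om \<rho> \<epsilon>) q1 \<and> W12 (Om \<rho> \<epsilon>) q3 \<and>
        (AE p in lborel. p \<in> Om \<rho> \<epsilon> \<longrightarrow> Q p = Q_of (q1 p) (q3 p)) \<and>
        has_trace (Om \<rho> \<epsilon>) (axis_edges \<rho> \<epsilon>) q1 (\<lambda>_. 0))"

definition eq_ae_on :: "pt set \<Rightarrow> (pt \<Rightarrow> mat3) \<Rightarrow> (pt \<Rightarrow> mat3) \<Rightarrow> bool" where
  "eq_ae_on \<Omega> P Q \<longleftrightarrow> (AE p in lborel. p \<in> \<Omega> \<longrightarrow> P p = Q p)"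

definition unique_critical_point ::
    "real \<Rightarrow> real \<Rightarrow> real \<Rightarrow> real \<Rightarrow> real \<Rightarrow> real \<Rightarrow> real \<Rightarrow> (real \<Rightarrow> real) \<Rightarrow> (pt \<Rightarrow> mat3) \<Rightarrow> bool" where
  "unique_critical_point A B C L lam \<rho> \<epsilon> g Q \<longleftrightarrow>
     critical_point A B C L lam \<rho> \<epsilon> g Q \<and>
     (\<forall>P. critical_point A B C L lam \<rho> \<epsilon> g P \<longrightarrow> eq_ae_on (Om \<rho> \<epsilon>) P Q)"

text \<open>\<^emph>\<open>The\<close> global minimizer: a minimizer, and the only one.\<close>

definition the_global_minimizer ::
    "real \<Rightarrow> real \<Rightarrow> real \<Rightarrow> real \<Rightarrow> real \<Rightarrow> real \<Rightarrow> real \<Rightarrow> (real \<Rightarrow> real) \<Rightarrow> (pt \<Rightarrow> mat3) \<Rightarrow> bool" where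
  "the_global_minimizer A B C L lam \<rho> \<epsilon> g Q \<longleftrightarrow>
     Q \<in> admissible_class (s_plus A B C) \<rho> \<epsilon> g \<and>
     (\<forall>P\<in>admissible_class (s_plus A B C) \<rho> \<epsilon> g.
        LdG_energy A B C L lam (Om \<rho> \<epsilon>) Q \<le> LdG_energy A B C L lam (Om \<rho> \<epsilon>) P \<and>
        (LdG_energy A B C L lam (Om \<rho> \<epsilon>) P = LdG_energy A B C L lam (Om \<rho> \<epsilon>) Q \<longrightarrow>
           eq_ae_on (Om \<rho> \<epsilon>) P Q))"

end

theory Submission
  imports Defs
begin

text \<open>
  The bulk potential is semiconvex: it becomes convex after adding \<open>K/2 |Q|\<^sup>2\<close> for some \<open>K\<close> depending
  only on \<open>A\<close>, \<open>B\<close>, \<open>C\<close>.  Every point of \<open>\<Omega>\<close> leaves \<open>\<Omega>\<close> horizontally, in one of the two directions,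
  within the distance \<open>1 - \<rho>\<close>, which gives the Poincare inequality with constant \<open>2 (1 - \<rho>)\<^sup>2\<close>.
  Hence the energy is strictly convex on the admissible class as soon as
  \<open>\<lambda>\<^sup>2/L K 2 (1 - \<rho>)\<^sup>2 < 1\<close>, which covers both regimes, and then a critical point is the only one
  and the strict global minimizer.  To get a critical point that is a WORS, minimize over the matrices
  \<open>Q_of q1 q3\<close>: by convexity, averaging with the reflection in an axis
  does not increase the energy, so that \<open>q1\<close> can be taken odd in both variables throughout a minimizing
  sequence.  Convexity makes the sequence Cauchy in \<open>W\<^sup>1\<^sup>,\<^sup>2\<close>.  Its limit is critical in all
  directions because the gradient of the bulk potential maps the span of the two basic matrices to itself.
\<close>

section \<open>Square integrable functions\<close>

text \<open>The main obstacle lies in the boundary conditions. A trace is given by approximation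
  with C1 functions on the plane, whereas the weak equation and the inequalities are available for
  functions of compact support. The bridge is that two functions with the same trace differ by a
  limit of test functions. Its proof cuts off at distance \<delta> from the boundary; the squared
  gradient of the cut-off is of size 1 / \<delta>^2, so a matching estimate on a strip along the
  polygonal boundary is required. Inequalities are then proved for test functions, by integration
  along lines, and pass to such limits. Because the Euler-Lagrange term is cubic, these limits must
  also hold in L4; this is the task of Ladyzhenskaya's inequality, which is tied to dimension two.
  The constant K is uniform over all matrices because the quartic term of the potential absorbs the
  growth of the indefinite cubic remainder. Competitors have the form of a fixed C1 extension plus a
  test function: integrands stay continuous, and oddness means pointwise zeros on the axes, which
  the approximants hand over to the trace of the limit.\<close>

definition L2 :: "'a measure \<Rightarrow> ('a \<Rightarrow> 'b::euclidean_space) \<Rightarrow> bool" where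
  "L2 M u \<longleftrightarrow> u \<in> borel_measurable M \<and> integrable M (\<lambda>x. (norm (u x))\<^sup>2)"

text \<open>Square integrability of all terms and of the limit is part of the notion, so that the
  limit laws below carry no integrability conditions.\<close>

definition L2_lim :: "'a measure \<Rightarrow> (nat \<Rightarrow> 'a \<Rightarrow> 'b::euclidean_space) \<Rightarrow> ('a \<Rightarrow> 'b) \<Rightarrow> bool" where
  "L2_lim M f u \<longleftrightarrow> (\<forall>k. L2 M (f k)) \<and> L2 M u \<and> (\<lambda>k. LINT x|M. (norm (f k x - u x))\<^sup>2) \<longlonglongrightarrow> 0"

lemma L2_measurable: "L2 M u \<Longrightarrow> u \<in> borel_measurable M"
  by (simp add: L2_def)

lemma L2_sq_integrable: "L2 M u \<Longrightarrow> integrable M (\<lambda>x. (norm (u x))\<^sup>2)"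
  by (simp add: L2_def)

lemma L2I_bound:
  assumes "f \<in> borel_measurable M" "integrable M g" "\<And>x. x \<in> space M \<Longrightarrow> (norm (f x))\<^sup>2 \<le> g x"
  shows "L2 M f"
  unfolding L2_def
proof
  show "integrable M (\<lambda>x. (norm (f x))\<^sup>2)"
    using assms(1,2)
    by (elim Bochner_Integration.integrable_bound) (use assms(1,3) in \<open>auto intro!: AE_I2 intro: order.trans[OF _ abs_ge_self]\<close>)
qed fact

lemma two_mult_le_squares: "a * b \<le> a\<^sup>2 + b\<^sup>2" if "0 \<le> a" "0 \<le> b" for a b :: real
  using sum_squares_bound[of a b] that mult_nonneg_nonneg[of a b] by linarith

lemma L2_inner_integrable:
  assumes f: "L2 M f" and g: "L2 M g"
  shows "integrable M (\<lambda>x. f x \<bullet> g x)"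
proof (rule Bochner_Integration.integrable_bound)
  show "integrable M (\<lambda>x. (norm (f x))\<^sup>2 + (norm (g x))\<^sup>2)"
    using f g by (auto simp: L2_def)
  show "(\<lambda>x. f x \<bullet> g x) \<in> borel_measurable M"
    using f g by (auto simp: L2_def)
  show "AE x in M. norm (f x \<bullet> g x) \<le> norm ((norm (f x))\<^sup>2 + (norm (g x))\<^sup>2)"
  proof (rule AE_I2)
    fix x
    show "norm (f x \<bullet> g x) \<le> norm ((norm (f x))\<^sup>2 + (norm (g x))\<^sup>2)"
      using Cauchy_Schwarz_ineq2[of "f x" "g x"] two_mult_le_squares[of "norm (f x)" "norm (g x)"] by simp
  qed
qed

lemma norm_add_sq_le: "(norm (a + b))\<^sup>2 \<le> 2 * (norm a)\<^sup>2 + 2 * (norm b)\<^sup>2" for a b :: "'a::real_normed_vector"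
proof -
  have "(norm (a + b))\<^sup>2 \<le> (norm a + norm b)\<^sup>2" by (intro power_mono norm_triangle_ineq) auto
  also have "\<dots> \<le> 2 * (norm a)\<^sup>2 + 2 * (norm b)\<^sup>2"
    using sum_squares_bound[of "norm a" "norm b"] by (simp add: power2_sum)
  finally show ?thesis .
qed

lemma norm_diff_sq_le: "(norm (a - b))\<^sup>2 \<le> 2 * (norm a)\<^sup>2 + 2 * (norm b)\<^sup>2" for a b :: "'a::real_normed_vector"
  using norm_add_sq_le[of a "-b"] by simp

lemma L2_add: "L2 M f \<Longrightarrow> L2 M g \<Longrightarrow> L2 M (\<lambda>x. f x + g x)"
  by (rule L2I_bound[where g="\<lambda>x. 2 * (norm (f x))\<^sup>2 + 2 * (norm (g x))\<^sup>2"])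
     (auto simp: L2_def norm_add_sq_le)

lemma L2_scaleR: "L2 M f \<Longrightarrow> L2 M (\<lambda>x. c *\<^sub>R f x)"
  by (auto simp: L2_def power_mult_distrib)

lemma L2_uminus: "L2 M f \<Longrightarrow> L2 M (\<lambda>x. - f x)"
  by (auto simp: L2_def)

lemma L2_diff: "L2 M f \<Longrightarrow> L2 M g \<Longrightarrow> L2 M (\<lambda>x. f x - g x)"
  using L2_add[OF _ L2_uminus, of M f g] by simp

lemma L2_norm: "L2 M f \<Longrightarrow> L2 M (\<lambda>x. norm (f x))"
  by (auto simp: L2_def)

lemma L2_mult_bounded:
  assumes f: "L2 M f" and h: "h \<in> borel_measurable M" "\<And>x. x \<in> space M \<Longrightarrow> \<bar>h x\<bar> \<le> c"
  shows "L2 M (\<lambda>x. h x *\<^sub>R f x)"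
proof (rule L2I_bound[where g="\<lambda>x. c\<^sup>2 * (norm (f x))\<^sup>2"])
  fix x assume "x \<in> space M"
  then have "\<bar>h x\<bar>\<^sup>2 \<le> c\<^sup>2" using h by (intro power_mono) auto
  then show "(norm (h x *\<^sub>R f x))\<^sup>2 \<le> c\<^sup>2 * (norm (f x))\<^sup>2"
    by (simp add: power_mult_distrib mult_right_mono)
qed (use f h in \<open>auto simp: L2_def\<close>)

lemma (in finite_measure) L2_bounded:
  assumes h: "h \<in> borel_measurable M" "\<And>x. x \<in> space M \<Longrightarrow> norm (h x) \<le> c"
  shows "L2 M h"
  by (rule L2I_bound[where g="\<lambda>x. c\<^sup>2"]) (use assms in \<open>auto intro: power_mono\<close>)

lemma (in finite_measure) L2_integrable:
  assumes "L2 M f" shows "integrable M f"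
proof (rule Bochner_Integration.integrable_bound)
  show "integrable M (\<lambda>x. 1 + (norm (f x))\<^sup>2)" using assms by (auto simp: L2_def)
  have "norm (f x) \<le> 1 + (norm (f x))\<^sup>2" for x
    using two_mult_le_squares[of 1 "norm (f x)"] by simp
  then show "AE x in M. norm (f x) \<le> norm (1 + (norm (f x))\<^sup>2)" by auto
qed (use assms in \<open>auto simp: L2_def\<close>)

lemma L2_inner_const:
  assumes "L2 M f" shows "L2 M (\<lambda>x. f x \<bullet> c)"
proof (rule L2I_bound[where g="\<lambda>x. (norm c)\<^sup>2 * (norm (f x))\<^sup>2"])
  fix x
  have "\<bar>f x \<bullet> c\<bar>\<^sup>2 \<le> (norm (f x) * norm c)\<^sup>2" by (intro power_mono Cauchy_Schwarz_ineq2) auto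
  then show "(norm (f x \<bullet> c))\<^sup>2 \<le> (norm c)\<^sup>2 * (norm (f x))\<^sup>2" by (simp add: power_mult_distrib mult.commute)
qed (use assms in \<open>auto simp: L2_def\<close>)

lemma L2_cong_AE:
  assumes "L2 M f" "g \<in> borel_measurable M" "AE x in M. f x = g x"
  shows "L2 M g"
  using assms unfolding L2_def
  by (auto intro: integrable_cong_AE_imp[where g="\<lambda>x. (norm (f x))\<^sup>2"])

text \<open>The quadratic polynomial has its minimum at - c / a; if the leading coefficient
  vanishes, a nonnegative affine function must be constant.\<close>

lemma quadratic_nonneg_discrim:
  fixes a b c :: real
  assumes "\<And>t. 0 \<le> t\<^sup>2 * a + 2 * t * c + b" "0 \<le> a"
  shows "c\<^sup>2 \<le> a * b"
proof (cases "a = 0")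
  case True
  have "c = 0"
  proof (rule ccontr)
    assume "c \<noteq> 0"
    \<comment> \<open>At this t the affine function 2 * t * c + b takes the value -1.\<close>
    then show False using assms(1)[of "- (b + 1) / (2 * c)"] True by (simp add: field_simps)
  qed
  then show ?thesis using True by simp
next
  case False
  with assms(1)[of "- c / a"] assms(2) show ?thesis
    by (simp add: power2_eq_square field_simps)
qed

text \<open>The integral of |t f + g|^2 is a nonnegative quadratic polynomial in t, so its
  discriminant is not positive.\<close>

lemma L2_Cauchy_Schwarz:
  assumes f: "L2 M f" and g: "L2 M g"
  shows "(LINT x|M. f x \<bullet> g x)\<^sup>2 \<le> (LINT x|M. (norm (f x))\<^sup>2) * (LINT x|M. (norm (g x))\<^sup>2)"
proof (rule quadratic_nonneg_discrim)
  fix t :: real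
  have "0 \<le> (LINT x|M. (norm (t *\<^sub>R f x + g x))\<^sup>2)" by simp
  also have "\<dots> = (LINT x|M. t\<^sup>2 * (norm (f x))\<^sup>2 + 2 * t * (f x \<bullet> g x) + (norm (g x))\<^sup>2)"
    by (intro Bochner_Integration.integral_cong refl)
       (simp only: power2_norm_eq_inner, simp add: inner_add_left inner_add_right algebra_simps power2_eq_square inner_commute)
  also have "\<dots> = t\<^sup>2 * (LINT x|M. (norm (f x))\<^sup>2) + 2 * t * (LINT x|M. f x \<bullet> g x) + (LINT x|M. (norm (g x))\<^sup>2)"
    using L2_inner_integrable[OF f g] L2_sq_integrable[OF f] L2_sq_integrable[OF g] by simp
  finally show "0 \<le> t\<^sup>2 * (LINT x|M. (norm (f x))\<^sup>2) + 2 * t * (LINT x|M. f x \<bullet> g x) + (LINT x|M. (norm (g x))\<^sup>2)" .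
qed simp

text \<open>Expand both factors around their limits. Each of the three error terms contains a factor
  tending to zero in L2, so Cauchy-Schwarz makes it vanish.\<close>

lemma L2_lim_inner:
  assumes f: "L2_lim M f u" and g: "L2_lim M g v"
  shows "(\<lambda>k. LINT x|M. f k x \<bullet> g k x) \<longlonglongrightarrow> (LINT x|M. u x \<bullet> v x)"
proof -
  have L: "L2 M (f k)" "L2 M (g k)" "L2 M u" "L2 M v" for k
    using f g by (auto simp: L2_lim_def)
  have tf: "(\<lambda>k. LINT x|M. (norm (f k x - u x))\<^sup>2) \<longlonglongrightarrow> 0"
    and tg: "(\<lambda>k. LINT x|M. (norm (g k x - v x))\<^sup>2) \<longlonglongrightarrow> 0" using f g by (auto simp: L2_lim_def)
  have zero: "a \<longlonglongrightarrow> 0" if "\<And>k. (a k)\<^sup>2 \<le> b k" "b \<longlonglongrightarrow> 0" for a b :: "nat \<Rightarrow> real"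
  proof -
    have "(\<lambda>k. (a k)\<^sup>2) \<longlonglongrightarrow> 0"
      by (rule tendsto_sandwich[OF _ _ tendsto_const that(2)]) (use that in auto)
    then show ?thesis by simp
  qed
  have 1: "(\<lambda>k. LINT x|M. (f k x - u x) \<bullet> (g k x - v x)) \<longlonglongrightarrow> 0"
    by (rule zero, rule L2_Cauchy_Schwarz) (use L tendsto_mult[OF tf tg] in \<open>auto intro: L2_diff\<close>)
  have 2: "(\<lambda>k. LINT x|M. (f k x - u x) \<bullet> v x) \<longlonglongrightarrow> 0"
    by (rule zero, rule L2_Cauchy_Schwarz) (use L tendsto_mult_right[OF tf] in \<open>auto intro: L2_diff\<close>)
  have 3: "(\<lambda>k. LINT x|M. u x \<bullet> (g k x - v x)) \<longlonglongrightarrow> 0"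
    by (rule zero, rule L2_Cauchy_Schwarz) (use L tendsto_mult_left[OF tg] in \<open>auto intro: L2_diff\<close>)
  have eq: "(LINT x|M. f k x \<bullet> g k x) = (LINT x|M. (f k x - u x) \<bullet> (g k x - v x)) + (LINT x|M. (f k x - u x) \<bullet> v x)
      + (LINT x|M. u x \<bullet> (g k x - v x)) + (LINT x|M. u x \<bullet> v x)" for k
  proof -
    have "(LINT x|M. f k x \<bullet> g k x) = (LINT x|M. (f k x - u x) \<bullet> (g k x - v x) + (f k x - u x) \<bullet> v x
      + u x \<bullet> (g k x - v x) + u x \<bullet> v x)"
      by (intro Bochner_Integration.integral_cong refl) (simp add: algebra_simps)
    then show ?thesis
      using L by (simp add: L2_inner_integrable L2_diff)
  qed
  show ?thesis unfolding eq
    using tendsto_add[OF tendsto_add[OF tendsto_add[OF 1 2] 3] tendsto_const] by simp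
qed

lemma L2_lim_norm_sq:
  "L2_lim M f u \<Longrightarrow> (\<lambda>k. LINT x|M. (norm (f k x))\<^sup>2) \<longlonglongrightarrow> (LINT x|M. (norm (u x))\<^sup>2)"
  using L2_lim_inner[of M f u f u] by (simp add: power2_norm_eq_inner)

lemma L2_lim_const: "L2 M u \<Longrightarrow> L2_lim M (\<lambda>_. u) u"
  by (simp add: L2_lim_def)

lemma L2_lim_add:
  assumes "L2_lim M f u" "L2_lim M g v"
  shows "L2_lim M (\<lambda>k x. f k x + g k x) (\<lambda>x. u x + v x)"
proof -
  have L: "L2 M (f k)" "L2 M (g k)" "L2 M u" "L2 M v" for k
    using assms by (auto simp: L2_lim_def)
  have "(\<lambda>k. LINT x|M. (norm (f k x + g k x - (u x + v x)))\<^sup>2) \<longlonglongrightarrow> 0"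
  proof (rule tendsto_sandwich[OF _ _ tendsto_const])
    show "(\<lambda>k. 2 * (LINT x|M. (norm (f k x - u x))\<^sup>2) + 2 * (LINT x|M. (norm (g k x - v x))\<^sup>2)) \<longlonglongrightarrow> 0"
      using assms by (auto simp: L2_lim_def intro!: tendsto_eq_intros)
    have "(LINT x|M. (norm (f k x + g k x - (u x + v x)))\<^sup>2) \<le>
       (LINT x|M. 2 * (norm (f k x - u x))\<^sup>2 + 2 * (norm (g k x - v x))\<^sup>2)" for k
    proof (rule integral_mono)
      show "integrable M (\<lambda>x. (norm (f k x + g k x - (u x + v x)))\<^sup>2)"
        using L by (intro L2_sq_integrable L2_diff L2_add)
      show "integrable M (\<lambda>x. 2 * (norm (f k x - u x))\<^sup>2 + 2 * (norm (g k x - v x))\<^sup>2)"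
        using L by (intro Bochner_Integration.integrable_add integrable_mult_right L2_sq_integrable L2_diff)
      show "(norm (f k x + g k x - (u x + v x)))\<^sup>2 \<le> 2 * (norm (f k x - u x))\<^sup>2 + 2 * (norm (g k x - v x))\<^sup>2" for x
        using norm_add_sq_le[of "f k x - u x" "g k x - v x"] by (simp add: algebra_simps)
    qed
    then show "\<forall>\<^sub>F k in sequentially. (LINT x|M. (norm (f k x + g k x - (u x + v x)))\<^sup>2) \<le>
       2 * (LINT x|M. (norm (f k x - u x))\<^sup>2) + 2 * (LINT x|M. (norm (g k x - v x))\<^sup>2)"
      using L by (simp add: L2_diff L2_sq_integrable)
  qed auto
  with L show ?thesis by (auto simp: L2_lim_def intro: L2_add)
qed

lemma L2_lim_scaleR:
  assumes "L2_lim M f u" shows "L2_lim M (\<lambda>k x. c *\<^sub>R f k x) (\<lambda>x. c *\<^sub>R u x)"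
proof -
  have "(norm (c *\<^sub>R f k x - c *\<^sub>R u x))\<^sup>2 = c\<^sup>2 * (norm (f k x - u x))\<^sup>2" for k x
    by (simp add: scaleR_diff_right[symmetric] power_mult_distrib)
  then show ?thesis
    using assms by (auto simp: L2_lim_def intro: L2_scaleR tendsto_mult_right_zero)
qed

lemma L2_lim_diff:
  assumes "L2_lim M f u" "L2_lim M g v"
  shows "L2_lim M (\<lambda>k x. f k x - g k x) (\<lambda>x. u x - v x)"
  using L2_lim_add[OF assms(1) L2_lim_scaleR[OF assms(2), of "-1"]] by simp

lemma L2_lim_subseq: "L2_lim M f u \<Longrightarrow> strict_mono r \<Longrightarrow> L2_lim M (\<lambda>k. f (r k)) u"
  using LIMSEQ_subseq_LIMSEQ[of "\<lambda>k. LINT x|M. (norm (f k x - u x))\<^sup>2" 0 r]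
  by (auto simp: L2_lim_def comp_def)

lemma L2_lim_AE_subseq:
  assumes "L2_lim M f u"
  obtains r :: "nat \<Rightarrow> nat" where "strict_mono r" "AE x in M. (\<lambda>k. f (r k) x) \<longlonglongrightarrow> u x"
proof -
  have "\<exists>r::nat\<Rightarrow>nat. strict_mono r \<and> (AE x in M. (\<lambda>k. (norm (f (r k) x - u x))\<^sup>2) \<longlonglongrightarrow> 0)"
    by (rule tendsto_L1_AE_subseq[where u="\<lambda>k x. (norm (f k x - u x))\<^sup>2"])
       (use assms in \<open>auto simp: L2_lim_def intro!: L2_sq_integrable L2_diff\<close>)
  then obtain r where r: "strict_mono (r::nat\<Rightarrow>nat)" "AE x in M. (\<lambda>k. (norm (f (r k) x - u x))\<^sup>2) \<longlonglongrightarrow> 0" by blast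
  have "AE x in M. (\<lambda>k. f (r k) x) \<longlonglongrightarrow> u x"
    using r(2) by eventually_elim (simp add: tendsto_norm_zero_iff LIM_zero_iff)
  with r(1) that show ?thesis by blast
qed

text \<open>Fatou's lemma for real integrands. Integrability of the limit is a conclusion: the
  eventual bound survives in the extended integral.\<close>

lemma Fatou_integral:
  fixes f :: "nat \<Rightarrow> 'a \<Rightarrow> real"
  assumes f: "\<And>k. integrable M (f k)" "\<And>k x. 0 \<le> f k x" and u: "u \<in> borel_measurable M"
    and lim: "AE x in M. (\<lambda>k. f k x) \<longlonglongrightarrow> u x"
    and bd: "\<forall>\<^sub>F k in sequentially. (LINT x|M. f k x) \<le> c"
  shows "integrable M u \<and> (LINT x|M. u x) \<le> c"
proof -
  obtain k where "(LINT x|M. f k x) \<le> c"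
    using eventually_happens'[OF sequentially_bot bd] by blast
  moreover have "0 \<le> (LINT x|M. f k x)" using f(2) by simp
  ultimately have c: "0 \<le> c" by simp
  have u0: "AE x in M. 0 \<le> u x"
    using lim by eventually_elim (use f(2) in \<open>auto intro: LIMSEQ_le_const\<close>)
  have "(\<integral>\<^sup>+x. ennreal (u x) \<partial>M) = (\<integral>\<^sup>+x. liminf (\<lambda>k. ennreal (f k x)) \<partial>M)"
  proof (rule nn_integral_cong_AE, use lim in eventually_elim)
    fix x assume "(\<lambda>k. f k x) \<longlonglongrightarrow> u x"
    then have "(\<lambda>k. ennreal (f k x)) \<longlonglongrightarrow> ennreal (u x)" by (rule tendsto_ennrealI)
    then show "ennreal (u x) = liminf (\<lambda>k. ennreal (f k x))" by (simp add: lim_imp_Liminf)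
  qed
  also have "\<dots> \<le> liminf (\<lambda>k. \<integral>\<^sup>+x. ennreal (f k x) \<partial>M)"
    by (rule nn_integral_liminf) (use f in auto)
  also have "\<dots> = liminf (\<lambda>k. ennreal (LINT x|M. f k x))"
    using f by (subst nn_integral_eq_integral) auto
  also have "\<dots> \<le> ennreal c"
    by (rule order_trans[OF Liminf_mono[where g="\<lambda>_. ennreal c"]])
       (use bd in \<open>auto elim!: eventually_mono intro: ennreal_leI simp: Liminf_const\<close>)
  finally have *: "(\<integral>\<^sup>+x. ennreal (u x) \<partial>M) \<le> ennreal c" .
  have int: "integrable M u"
    by (rule integrableI_nonneg[OF u u0]) (use * in \<open>auto intro: le_less_trans\<close>)
  then have "ennreal (LINT x|M. u x) \<le> ennreal c"
    using * by (subst nn_integral_eq_integral[symmetric]) (use u0 in auto)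
  then show ?thesis using int c by simp
qed

text \<open>Riesz-Fischer. A fast subsequence has summable L1 increments, because the measure is
  finite, and hence converges almost everywhere. Fatou's lemma turns the Cauchy estimate into
  convergence of the whole sequence to this pointwise limit.\<close>

lemma (in finite_measure) L2_complete:
  fixes f :: "nat \<Rightarrow> 'a \<Rightarrow> 'b::euclidean_space"
  assumes L: "\<And>k. L2 M (f k)"
    and cauchy: "\<And>e. e > 0 \<Longrightarrow> \<exists>N. \<forall>m\<ge>N. \<forall>n\<ge>N. (LINT x|M. (norm (f m x - f n x))\<^sup>2) < e"
  obtains u where "L2_lim M f u"
proof -
  note [measurable] = L2_measurable[OF L]
  have "\<exists>N. \<forall>m\<ge>N. \<forall>n\<ge>N. (LINT x|M. (norm (f m x - f n x))\<^sup>2) < (1/4)^k" for k :: nat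
    by (rule cauchy) simp
  then obtain N where N: "\<And>k m n. N k \<le> m \<Longrightarrow> N k \<le> n \<Longrightarrow> (LINT x|M. (norm (f m x - f n x))\<^sup>2) < (1/4)^k"
    by metis
  \<comment> \<open>The sum makes \<open>r\<close> monotone and at least \<open>N k\<close>; the
    summand \<open>k\<close> makes it exceed every given index.\<close>
  define r where "r k = (\<Sum>i\<le>k. N i) + k" for k
  have rN: "N k \<le> r k" for k unfolding r_def by (simp add: member_le_sum trans_le_add1)
  have r_Suc: "r k \<le> r (Suc k)" for k unfolding r_def by simp
  have rk: "k \<le> r k" for k unfolding r_def by simp
  define d where "d k x = norm (f (r (Suc k)) x - f (r k) x)" for k x
  have d2: "(LINT x|M. (d k x)\<^sup>2) \<le> (1/4)^k" and d2i: "integrable M (\<lambda>x. (d k x)\<^sup>2)" for k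
    unfolding d_def using N[of k "r (Suc k)" "r k"] rN[of k] r_Suc[of k] L
    by (auto intro!: L2_sq_integrable L2_diff)
  have di: "integrable M (d k)" for k
    unfolding d_def by (intro L2_integrable L2_norm L2_diff L)
  have dI: "(LINT x|M. d k x) \<le> (1/2)^k * (measure M (space M) + 1)" for k
  proof -
    have "(LINT x|M. d k x) \<le> (LINT x|M. (1/2)^k + 2^k * (d k x)\<^sup>2)"
    proof (rule integral_mono[OF di])
      show "integrable M (\<lambda>x. (1/2)^k + 2^k * (d k x)\<^sup>2)" using d2i by simp
      fix x
      \<comment> \<open>Young's inequality with weight 2^k, which balances the squared increment of
        size 4^-k.\<close>
      have "d k x \<le> 1/2^k + 2^k * (d k x)\<^sup>2"
      proof -
        define a :: real where "a = 2^k"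
        have "a > 0" by (simp add: a_def)
        moreover have "a * d k x \<le> 1 + (a * d k x)\<^sup>2"
          using two_mult_le_squares[of 1 "a * d k x"] \<open>a > 0\<close> by (simp add: d_def)
        ultimately have "d k x \<le> 1/a + a * (d k x)\<^sup>2"
          by (simp add: field_simps power2_eq_square)
        then show ?thesis by (simp add: a_def)
      qed
      then show "d k x \<le> (1/2)^k + 2^k * (d k x)\<^sup>2" by (simp add: power_one_over)
    qed
    also have "\<dots> = (1/2)^k * measure M (space M) + 2^k * (LINT x|M. (d k x)\<^sup>2)"
      using d2i by simp
    also have "\<dots> \<le> (1/2)^k * measure M (space M) + 2^k * (1/4)^k"
      using d2 by (intro add_left_mono mult_left_mono) auto
    also have "(2::real)^k * (1/4)^k = (1/2)^k" by (simp flip: power_mult_distrib)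
    finally show ?thesis by (simp add: algebra_simps)
  qed
  have sm: "summable (\<lambda>k. LINT x|M. d k x)"
    by (rule summable_comparison_test'[where g="\<lambda>k. (1/2)^k * (measure M (space M) + 1)" and N=0])
       (use dI in \<open>auto intro!: summable_mult2 summable_geometric simp: d_def\<close>)
  have "(\<integral>\<^sup>+x. (\<Sum>k. ennreal (d k x)) \<partial>M) = (\<Sum>k. \<integral>\<^sup>+x. ennreal (d k x) \<partial>M)"
    by (rule nn_integral_suminf) (simp add: d_def)
  also have "\<dots> = (\<Sum>k. ennreal (LINT x|M. d k x))"
    using di by (subst nn_integral_eq_integral) (auto simp: d_def)
  also have "\<dots> = ennreal (\<Sum>k. LINT x|M. d k x)"
    by (rule suminf_ennreal2[OF _ sm]) (simp add: d_def)
  finally have "(\<integral>\<^sup>+x. (\<Sum>k. ennreal (d k x)) \<partial>M) \<noteq> \<infinity>" by simp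
  then have "AE x in M. (\<Sum>k. ennreal (d k x)) \<noteq> \<infinity>"
    by (intro nn_integral_PInf_AE) (auto simp: d_def)
  then have "AE x in M. convergent (\<lambda>k. f (r k) x)"
  proof eventually_elim
    fix x assume "(\<Sum>k. ennreal (d k x)) \<noteq> \<infinity>"
    then have "summable (\<lambda>k. norm (f (r (Suc k)) x - f (r k) x))"
      using summable_suminf_not_top[of "\<lambda>k. d k x"] by (simp add: d_def)
    then have "summable (\<lambda>k. f (r (Suc k)) x - f (r k) x)" by (rule summable_norm_cancel)
    then have "convergent (\<lambda>n. \<Sum>k<n. f (r (Suc k)) x - f (r k) x)"
      by (simp add: summable_iff_convergent)
    then have "convergent (\<lambda>n. f (r n) x - f (r 0) x)"
      unfolding sum_lessThan_telescope[of "\<lambda>k. f (r k) x"] .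
    then show "convergent (\<lambda>k. f (r k) x)" by (simp add: convergent_diff_const_right_iff)
  qed
  then have ae: "AE x in M. (\<lambda>k. f (r k) x) \<longlonglongrightarrow> lim (\<lambda>k. f (r k) x)"
    by (simp add: convergent_LIMSEQ_iff)
  define u where "u x = lim (\<lambda>k. f (r k) x)" for x
  have [measurable]: "u \<in> borel_measurable M" unfolding u_def by measurable
  have key: "integrable M (\<lambda>x. (norm (f m x - u x))\<^sup>2) \<and> (LINT x|M. (norm (f m x - u x))\<^sup>2) \<le> (1/4)^k"
    if "N k \<le> m" for m k
  proof (rule Fatou_integral[where f="\<lambda>j x. (norm (f m x - f (r j) x))\<^sup>2"])
    show "AE x in M. (\<lambda>j. (norm (f m x - f (r j) x))\<^sup>2) \<longlonglongrightarrow> (norm (f m x - u x))\<^sup>2"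
      using ae by eventually_elim (auto simp: u_def intro!: tendsto_intros)
    show "\<forall>\<^sub>F j in sequentially. (LINT x|M. (norm (f m x - f (r j) x))\<^sup>2) \<le> (1/4)^k"
    proof (rule eventually_sequentiallyI[of "N k"])
      fix j assume "N k \<le> j" then show "(LINT x|M. (norm (f m x - f (r j) x))\<^sup>2) \<le> (1/4)^k"
        using N[OF that, of "r j"] rk[of j] by simp
    qed
  qed (use L in \<open>auto intro!: L2_sq_integrable L2_diff\<close>)
  have Lu: "L2 M u"
  proof -
    have "L2 M (\<lambda>x. f (N 0) x - u x)" using key[of 0 "N 0"] by (auto simp: L2_def)
    from L2_diff[OF L this, of "N 0"] show ?thesis by simp
  qed
  have "(\<lambda>k. LINT x|M. (norm (f k x - u x))\<^sup>2) \<longlonglongrightarrow> 0"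
  proof (rule LIMSEQ_I)
    fix e :: real assume "0 < e"
    then obtain k where "(1/4)^k < e" using real_arch_pow_inv[of e "1/4"] by auto
    then have "\<forall>m\<ge>N k. norm ((LINT x|M. (norm (f m x - u x))\<^sup>2) - 0) < e"
      using key[of k] by (auto intro: le_less_trans)
    then show "\<exists>no. \<forall>m\<ge>no. norm ((LINT x|M. (norm (f m x - u x))\<^sup>2) - 0) < e" by blast
  qed
  with L Lu have "L2_lim M f u" by (simp add: L2_lim_def)
  then show ?thesis by (rule that)
qed

section \<open>Lebesgue measure restricted to a plane set\<close>

declare split_paired_All [simp del] split_paired_Ex [simp del]

abbreviation mu :: "pt set \<Rightarrow> pt measure" where "mu \<Omega> \<equiv> restrict_space lborel \<Omega>"

lemma set_lint_mu: "\<Omega> \<in> sets borel \<Longrightarrow> (LINT p:\<Omega>|lborel. f p) = (LINT p|mu \<Omega>. f p)"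
  for f :: "pt \<Rightarrow> 'b::{banach, second_countable_topology}"
  by (simp add: set_lebesgue_integral_def integral_restrict_space)

lemma L2_on_mu: "\<Omega> \<in> sets borel \<Longrightarrow> L2_on \<Omega> u \<longleftrightarrow> L2 (mu \<Omega>) u"
  by (simp add: L2_on_def L2_def set_borel_measurable_def set_integrable_def
      borel_measurable_restrict_space_iff integrable_restrict_space)

lemma AE_mu: "\<Omega> \<in> sets borel \<Longrightarrow> (AE p in mu \<Omega>. P p) \<longleftrightarrow> (AE p in lborel. p \<in> \<Omega> \<longrightarrow> P p)"
  by (simp add: AE_restrict_space_iff)

section \<open>Continuously differentiable functions\<close>

lemma C1_grad_GDERIV: "C1_grad \<phi> D\<phi> \<Longrightarrow> GDERIV \<phi> p :> D\<phi> p"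
  unfolding C1_grad_def by blast

lemma C1_grad_continuous: "C1_grad \<phi> D\<phi> \<Longrightarrow> continuous_on UNIV \<phi>" "C1_grad \<phi> D\<phi> \<Longrightarrow> continuous_on UNIV D\<phi>"
  by (auto simp: C1_grad_def gderiv_def intro!: differentiable_imp_continuous_on)
     (auto simp: differentiable_on_def differentiable_def)

lemma C1_grad_borel: "C1_grad \<phi> D\<phi> \<Longrightarrow> \<phi> \<in> borel_measurable borel" "C1_grad \<phi> D\<phi> \<Longrightarrow> D\<phi> \<in> borel_measurable borel"
  using C1_grad_continuous[of \<phi> D\<phi>] by (auto intro: borel_measurable_continuous_onI)

lemma borel_measurable_mu: "f \<in> borel_measurable borel \<Longrightarrow> f \<in> borel_measurable (mu \<Omega>)"
  by (rule measurable_restrict_space1) simp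

lemma C1_grad_const: "C1_grad (\<lambda>_. c) (\<lambda>_. 0)"
  by (simp add: C1_grad_def GDERIV_const)

lemma C1_grad_add:
  "C1_grad \<phi> D\<phi> \<Longrightarrow> C1_grad \<psi> D\<psi> \<Longrightarrow> C1_grad (\<lambda>p. \<phi> p + \<psi> p) (\<lambda>p. D\<phi> p + D\<psi> p)"
  by (auto simp: C1_grad_def intro!: GDERIV_add continuous_intros)

lemma C1_grad_diff:
  "C1_grad \<phi> D\<phi> \<Longrightarrow> C1_grad \<psi> D\<psi> \<Longrightarrow> C1_grad (\<lambda>p. \<phi> p - \<psi> p) (\<lambda>p. D\<phi> p - D\<psi> p)"
  by (auto simp: C1_grad_def intro!: GDERIV_diff continuous_intros)

lemma C1_grad_mult:
  assumes "C1_grad \<phi> D\<phi>" "C1_grad \<psi> D\<psi>"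
  shows "C1_grad (\<lambda>p. \<phi> p * \<psi> p) (\<lambda>p. \<phi> p *\<^sub>R D\<psi> p + \<psi> p *\<^sub>R D\<phi> p)"
  unfolding C1_grad_def
proof (intro conjI allI)
  show "GDERIV (\<lambda>p. \<phi> p * \<psi> p) p :> \<phi> p *\<^sub>R D\<psi> p + \<psi> p *\<^sub>R D\<phi> p" for p
    by (intro GDERIV_mult C1_grad_GDERIV assms)
  show "continuous_on UNIV (\<lambda>p. \<phi> p *\<^sub>R D\<psi> p + \<psi> p *\<^sub>R D\<phi> p)"
    by (intro continuous_intros C1_grad_continuous(1)[OF assms(1)] C1_grad_continuous(1)[OF assms(2)]
        C1_grad_continuous(2)[OF assms(1)] C1_grad_continuous(2)[OF assms(2)])
qed

lemma C1_grad_cmult: "C1_grad \<phi> D\<phi> \<Longrightarrow> C1_grad (\<lambda>p. c * \<phi> p) (\<lambda>p. c *\<^sub>R D\<phi> p)"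
  using C1_grad_mult[OF C1_grad_const[of c]] by simp

lemma C1_grad_compose:
  assumes \<phi>: "C1_grad \<phi> D\<phi>" and h: "\<And>t. (h has_real_derivative h' t) (at t)" "continuous_on UNIV h'"
  shows "C1_grad (\<lambda>p. h (\<phi> p)) (\<lambda>p. h' (\<phi> p) *\<^sub>R D\<phi> p)"
  unfolding C1_grad_def
proof (intro conjI allI)
  show "GDERIV (\<lambda>p. h (\<phi> p)) p :> h' (\<phi> p) *\<^sub>R D\<phi> p" for p
    by (intro GDERIV_DERIV_compose C1_grad_GDERIV[OF \<phi>] h)
  show "continuous_on UNIV (\<lambda>p. h' (\<phi> p) *\<^sub>R D\<phi> p)"
    by (intro continuous_on_scaleR C1_grad_continuous(2)[OF \<phi>] continuous_on_compose2[OF h(2) C1_grad_continuous(1)[OF \<phi>]]) auto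
qed

lemma C1_grad_affine: "C1_grad (\<lambda>p. a * fst p + b * snd p + c) (\<lambda>_. (a, b))"
proof -
  have "((\<lambda>p::pt. a * fst p + b * snd p + c) has_derivative (\<lambda>h. h \<bullet> (a, b))) (at p)" for p
    by (auto intro!: derivative_eq_intros simp: inner_prod_def fun_eq_iff)
  then show ?thesis by (auto simp: C1_grad_def gderiv_def)
qed

lemma C1_grad_compose_linear:
  assumes \<phi>: "C1_grad \<phi> D\<phi>" and T: "bounded_linear T" "\<And>x y. T x \<bullet> y = x \<bullet> T' y" "bounded_linear T'"
  shows "C1_grad (\<lambda>p. \<phi> (T p)) (\<lambda>p. T' (D\<phi> (T p)))"
  unfolding C1_grad_def
proof (intro conjI allI)
  fix p
  have "((\<lambda>p. \<phi> (T p)) has_derivative (\<lambda>h. T h \<bullet> D\<phi> (T p))) (at p)"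
    using has_derivative_compose[OF bounded_linear_imp_has_derivative[OF T(1)], of \<phi> "\<lambda>h. h \<bullet> D\<phi> (T p)" p UNIV]
      C1_grad_GDERIV[OF \<phi>, of "T p"] by (simp add: gderiv_def)
  then show "GDERIV (\<lambda>p. \<phi> (T p)) p :> T' (D\<phi> (T p))"
    unfolding gderiv_def T(2) .
  show "continuous_on UNIV (\<lambda>p. T' (D\<phi> (T p)))"
    by (intro bounded_linear.continuous_on[OF T(3)] continuous_on_compose2[OF C1_grad_continuous(2)[OF \<phi>]]
        linear_continuous_on T(1)) auto
qed

lemma C1_grad_along_line:
  assumes "C1_grad \<phi> D\<phi>"
  shows "((\<lambda>t. \<phi> (p + t *\<^sub>R v)) has_real_derivative (D\<phi> (p + t *\<^sub>R v) \<bullet> v)) (at t)"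
proof -
  have "((\<lambda>t. \<phi> (p + t *\<^sub>R v)) has_derivative (\<lambda>h. (h *\<^sub>R v) \<bullet> D\<phi> (p + t *\<^sub>R v))) (at t)"
    by (rule has_derivative_compose[where f="\<lambda>t. p + t *\<^sub>R v" and g=\<phi>, of "\<lambda>h. h *\<^sub>R v"])
       (use C1_grad_GDERIV[OF assms] in \<open>auto simp: gderiv_def intro!: derivative_eq_intros\<close>)
  then show ?thesis
    by (auto simp: has_field_derivative_def inner_commute elim!: has_derivative_eq_rhs)
qed

text \<open>Meant for cut-offs: where they attain their maximal value 1, the gradient vanishes
  without any computation.\<close>

lemma C1_grad_max_zero:
  assumes "C1_grad \<phi> D\<phi>" "\<And>q. \<phi> q \<le> \<phi> p" shows "D\<phi> p = 0"
proof -
  have "(\<lambda>h. h \<bullet> D\<phi> p) = (\<lambda>h. 0)"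
    by (rule has_derivative_local_max[of \<phi> _ p])
       (use assms(2) C1_grad_GDERIV[OF assms(1), of p] in \<open>simp_all add: gderiv_def\<close>)
  then have "D\<phi> p \<bullet> D\<phi> p = 0" by meson
  then show ?thesis by simp
qed

lemma C1_grad_bounded_diff:
  assumes \<phi>: "C1_grad \<phi> D\<phi>" and bd: "\<And>q. norm (D\<phi> q) \<le> c"
  shows "\<bar>\<phi> p - \<phi> q\<bar> \<le> c * norm (p - q)"
proof -
  have "norm (\<phi> p - \<phi> q) \<le> c * norm (p - q)"
  proof (rule differentiable_bound[OF convex_UNIV])
    show "(\<phi> has_derivative (\<lambda>h. h \<bullet> D\<phi> x)) (at x within UNIV)" for x
      using C1_grad_GDERIV[OF \<phi>] by (simp add: gderiv_def)
    show "onorm (\<lambda>h. h \<bullet> D\<phi> x) \<le> c" for x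
    proof (rule onorm_le)
      fix h show "norm (h \<bullet> D\<phi> x) \<le> c * norm h"
        using Cauchy_Schwarz_ineq2[of h "D\<phi> x"] mult_left_mono[OF bd[of x] norm_ge_zero[of h]] by (simp add: mult.commute)
    qed
  qed auto
  then show ?thesis by simp
qed

text \<open>The Hermite cubic between the values 0 and 1. It is C1, which matches the regularity
  demanded of test functions.\<close>

definition smoothstep :: "real \<Rightarrow> real" where
  "smoothstep t = (if t \<le> 0 then 0 else if 1 \<le> t then 1 else 3 * t\<^sup>2 - 2 * t ^ 3)"

text \<open>The product t (1 - t) is negative outside [0, 1], where the step is constant; the
  maximum with 0 replaces a case distinction and shows continuity.\<close>

definition smoothstep' :: "real \<Rightarrow> real" where
  "smoothstep' t = 6 * max 0 (t * (1 - t))"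

text \<open>At the junction both pieces have the same derivative, so the one-sided derivatives
  agree. Serves the smooth step, the squared positive part and the rescaling of the boundary
  profile.\<close>

lemma has_real_derivative_If_le:
  fixes f g :: "real \<Rightarrow> real"
  assumes f: "\<And>t. t \<le> a \<Longrightarrow> (f has_real_derivative D t) (at t)"
    and g: "\<And>t. a \<le> t \<Longrightarrow> (g has_real_derivative D t) (at t)" and eq: "f a = g a"
  shows "((\<lambda>t. if t \<le> a then f t else g t) has_real_derivative D t) (at t)"
proof -
  have "((\<lambda>t. if t \<in> {..a} then f t else g t) has_vector_derivative (if t \<in> {..a} then D t else D t)) (at t within UNIV)"
    by (rule has_vector_derivative_If_within_closures[where T="{a..}"])
       (use f g eq in \<open>auto simp: has_real_derivative_iff_has_vector_derivative intro: has_vector_derivative_at_within\<close>)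
  then show ?thesis by (simp add: has_real_derivative_iff_has_vector_derivative)
qed

lemma smoothstep_derivative: "(smoothstep has_real_derivative smoothstep' t) (at t)"
proof -
  have "((\<lambda>t. if t \<le> 0 then 0 else (if t \<le> 1 then 3 * t\<^sup>2 - 2 * t ^ 3 else 1)) has_real_derivative smoothstep' t) (at t)"
  proof (rule has_real_derivative_If_le)
    fix t :: real assume "t \<le> 0"
    then have "smoothstep' t = 0" by (simp add: smoothstep'_def mult_nonpos_nonneg)
    then show "((\<lambda>t. 0) has_real_derivative smoothstep' t) (at t)" by simp
  next
    fix t :: real assume t: "0 \<le> t"
    have "((\<lambda>t. if t \<le> 1 then 3 * t\<^sup>2 - 2 * t ^ 3 else 1) has_real_derivative
       (if 0 \<le> t then smoothstep' t else 6 * (t * (1 - t)))) (at t)"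
    proof (rule has_real_derivative_If_le)
      fix t :: real assume "t \<le> 1"
      then have "(if 0 \<le> t then smoothstep' t else 6 * (t * (1 - t))) = 6 * (t * (1 - t))" by (simp add: smoothstep'_def)
      moreover have "((\<lambda>t. 3 * t\<^sup>2 - 2 * t ^ 3) has_real_derivative 6 * (t * (1 - t))) (at t)"
        by (auto intro!: derivative_eq_intros simp: algebra_simps power2_eq_square)
      ultimately show "((\<lambda>t. 3 * t\<^sup>2 - 2 * t ^ 3) has_real_derivative (if 0 \<le> t then smoothstep' t else 6 * (t * (1 - t)))) (at t)" by simp
    next
      fix t :: real assume "1 \<le> t"
      then have "(if 0 \<le> t then smoothstep' t else 6 * (t * (1 - t))) = 0" by (simp add: smoothstep'_def mult_nonneg_nonpos)
      then show "((\<lambda>t. 1) has_real_derivative (if 0 \<le> t then smoothstep' t else 6 * (t * (1 - t)))) (at t)" by simp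
    qed simp
    then show "((\<lambda>t. if t \<le> 1 then 3 * t\<^sup>2 - 2 * t ^ 3 else 1) has_real_derivative smoothstep' t) (at t)"
      using t by simp
  qed simp
  moreover have "smoothstep = (\<lambda>t. if t \<le> 0 then 0 else (if t \<le> 1 then 3 * t\<^sup>2 - 2 * t ^ 3 else 1))"
    by (auto simp: smoothstep_def fun_eq_iff)
  ultimately show ?thesis by simp
qed

lemma smoothstep'_continuous: "continuous_on UNIV smoothstep'"
  unfolding smoothstep'_def by (intro continuous_intros)

lemma smoothstep'_le: "\<bar>smoothstep' t\<bar> \<le> 2"
proof -
  have "0 \<le> (t - 1/2)\<^sup>2" by simp
  then have "t * (1 - t) \<le> 1/4" by (simp add: power2_eq_square algebra_simps)
  then show ?thesis by (simp add: smoothstep'_def max_def)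
qed

lemma smoothstep_bounds: "0 \<le> smoothstep t" "smoothstep t \<le> 1"
proof -
  have "0 \<le> t\<^sup>2 * (3 - 2 * t)" if "0 < t" "t < 1" using that by simp
  moreover have "0 \<le> (1 - t)\<^sup>2 * (1 + 2 * t)" if "0 < t" "t < 1" using that by simp
  ultimately show "0 \<le> smoothstep t" "smoothstep t \<le> 1"
    by (auto simp: smoothstep_def algebra_simps power2_eq_square power3_eq_cube)
qed

lemma smoothstep_eq: "t \<le> 0 \<Longrightarrow> smoothstep t = 0" "1 \<le> t \<Longrightarrow> smoothstep t = 1"
  by (auto simp: smoothstep_def)

lemma C1_grad_smoothstep: "C1_grad \<phi> D\<phi> \<Longrightarrow> C1_grad (\<lambda>p. smoothstep (\<phi> p)) (\<lambda>p. smoothstep' (\<phi> p) *\<^sub>R D\<phi> p)"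
  by (rule C1_grad_compose[OF _ smoothstep_derivative smoothstep'_continuous])

section \<open>Test functions\<close>

lemma test_function_C1: "test_function \<Omega> \<phi> D\<phi> \<Longrightarrow> C1_grad \<phi> D\<phi>"
  by (simp add: test_function_def)

text \<open>The definition makes only the function vanish off the compact set; the gradient vanishes
  there as well, because the complement is open.\<close>

lemma test_function_support:
  assumes "test_function \<Omega> \<phi> D\<phi>"
  obtains K where "compact K" "K \<subseteq> \<Omega>" "\<And>p. p \<notin> K \<Longrightarrow> \<phi> p = 0" "\<And>p. p \<notin> K \<Longrightarrow> D\<phi> p = 0"
proof -
  obtain K where K: "compact K" "K \<subseteq> \<Omega>" "\<And>p. p \<notin> K \<Longrightarrow> \<phi> p = 0" and C: "C1_grad \<phi> D\<phi>"
    using assms by (auto simp: test_function_def)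
  have "D\<phi> p = 0" if "p \<notin> K" for p
  proof -
    have "((\<lambda>_. 0) has_derivative (\<lambda>h. h \<bullet> D\<phi> p)) (at p)"
      by (rule has_derivative_transform_within_open[where s="- K" and f=\<phi>])
         (use K that C1_grad_GDERIV[OF C] in \<open>auto simp: gderiv_def open_Compl compact_imp_closed\<close>)
    then have "(\<lambda>h. h \<bullet> D\<phi> p) = (\<lambda>h. 0)" by (rule has_derivative_unique) simp
    then have "D\<phi> p \<bullet> D\<phi> p = 0" by meson
    then show ?thesis by simp
  qed
  with K that show ?thesis by blast
qed

lemma bounded_of_compact_support:
  fixes f :: "'a::t2_space \<Rightarrow> 'b::real_normed_vector"
  assumes "compact K" "\<And>p. p \<notin> K \<Longrightarrow> f p = 0" "continuous_on UNIV f"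
  obtains c where "0 \<le> c" "\<And>p. norm (f p) \<le> c"
proof -
  have "bounded (f ` K)"
    using assms by (intro compact_imp_bounded compact_continuous_image) (auto intro: continuous_on_subset)
  then obtain c where c: "\<And>p. p \<in> K \<Longrightarrow> norm (f p) \<le> c" by (auto simp: bounded_iff)
  have "norm (f p) \<le> max 0 c" for p using c[of p] assms(2)[of p] by (cases "p \<in> K") auto
  then show ?thesis by (intro that[of "max 0 c"]) auto
qed

lemma test_function_bounded:
  assumes "test_function \<Omega> \<phi> D\<phi>"
  obtains c where "0 \<le> c" "\<And>p. \<bar>\<phi> p\<bar> \<le> c" "\<And>p. norm (D\<phi> p) \<le> c"
proof -
  obtain K where K: "compact K" "\<And>p. p \<notin> K \<Longrightarrow> \<phi> p = 0" "\<And>p. p \<notin> K \<Longrightarrow> D\<phi> p = 0"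
    using test_function_support[OF assms] by metis
  note C = C1_grad_continuous[OF test_function_C1[OF assms]]
  obtain a b where "0 \<le> a" "\<And>p. norm (\<phi> p) \<le> a" "0 \<le> b" "\<And>p. norm (D\<phi> p) \<le> b"
    using bounded_of_compact_support[OF K(1,2) C(1)] bounded_of_compact_support[OF K(1,3) C(2)] by metis
  then show ?thesis by (intro that[of "max a b"]) (auto simp: le_max_iff_disj)
qed

lemma test_function_zero: "test_function \<Omega> (\<lambda>_. 0) (\<lambda>_. 0)"
  unfolding test_function_def using C1_grad_const[of 0] by (auto intro: exI[of _ "{}"])

lemma test_function_add:
  assumes "test_function \<Omega> \<phi> D\<phi>" "test_function \<Omega> \<psi> D\<psi>"
  shows "test_function \<Omega> (\<lambda>p. \<phi> p + \<psi> p) (\<lambda>p. D\<phi> p + D\<psi> p)"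
proof -
  obtain K K' where "compact K" "K \<subseteq> \<Omega>" "\<forall>p. p \<notin> K \<longrightarrow> \<phi> p = 0" "compact K'" "K' \<subseteq> \<Omega>" "\<forall>p. p \<notin> K' \<longrightarrow> \<psi> p = 0"
    using assms by (auto simp: test_function_def)
  then have "compact (K \<union> K') \<and> K \<union> K' \<subseteq> \<Omega> \<and> (\<forall>p. p \<notin> K \<union> K' \<longrightarrow> \<phi> p + \<psi> p = 0)" by auto
  moreover have "C1_grad (\<lambda>p. \<phi> p + \<psi> p) (\<lambda>p. D\<phi> p + D\<psi> p)"
    using assms by (auto simp: test_function_def intro: C1_grad_add)
  ultimately show ?thesis unfolding test_function_def by blast
qed

lemma test_function_mult:
  assumes "C1_grad \<phi> D\<phi>" "test_function \<Omega> \<psi> D\<psi>"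
  shows "test_function \<Omega> (\<lambda>p. \<phi> p * \<psi> p) (\<lambda>p. \<phi> p *\<^sub>R D\<psi> p + \<psi> p *\<^sub>R D\<phi> p)"
  using C1_grad_mult[OF assms(1) test_function_C1[OF assms(2)]] assms(2) by (auto simp: test_function_def)

lemma test_function_scale:
  assumes "test_function \<Omega> \<psi> D\<psi>"
  shows "test_function \<Omega> (\<lambda>p. c * \<psi> p) (\<lambda>p. c *\<^sub>R D\<psi> p)"
  using test_function_mult[OF C1_grad_const assms, of c] by simp

lemma test_function_diff:
  assumes "test_function \<Omega> \<phi> D\<phi>" "test_function \<Omega> \<psi> D\<psi>"
  shows "test_function \<Omega> (\<lambda>p. \<phi> p - \<psi> p) (\<lambda>p. D\<phi> p - D\<psi> p)"
  using test_function_add[OF assms(1) test_function_scale[OF assms(2), of "-1"]] by simp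

lemma integrable_compact_support:
  fixes f :: "pt \<Rightarrow> 'b::{banach, second_countable_topology}"
  assumes K: "compact K" "\<And>p. p \<notin> K \<Longrightarrow> f p = 0" "continuous_on UNIV f"
  shows "integrable lborel f"
proof -
  have "integrable lborel (\<lambda>x. indicator K x *\<^sub>R f x)"
    using assms by (intro borel_integrable_compact) (auto intro: continuous_on_subset)
  moreover have "(\<lambda>x. indicator K x *\<^sub>R f x) = f" using K(2) by (auto simp: fun_eq_iff indicator_def)
  ultimately show ?thesis by simp
qed

lemma lborel_integral_translate:
  fixes f :: "'a::euclidean_space \<Rightarrow> 'b::{banach, second_countable_topology}"
  assumes "f \<in> borel_measurable borel"
  shows "(LINT p|lborel. f (p + v)) = (LINT p|lborel. f p)"
proof -
  have "(LINT p|lborel. f p) = (LINT p|distr lborel borel ((+) v). f p)" by (simp add: lborel_distr_plus)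
  also have "\<dots> = (LINT p|lborel. f (v + p))" by (rule integral_distr) (use assms in auto)
  finally show ?thesis by (simp add: add.commute)
qed

text \<open>The divergence theorem for compact support: difference quotients integrate to zero by
  translation invariance and converge, dominated, to the directional derivative.\<close>

lemma test_function_integral_grad:
  assumes \<psi>: "test_function \<Omega> \<psi> D\<psi>" shows "(LINT p|lborel. D\<psi> p) = 0"
proof -
  obtain K where K: "compact K" "\<And>p. p \<notin> K \<Longrightarrow> \<psi> p = 0" "\<And>p. p \<notin> K \<Longrightarrow> D\<psi> p = 0"
    using test_function_support[OF \<psi>] by metis
  obtain c where c: "0 \<le> c" "\<And>p. norm (D\<psi> p) \<le> c" using test_function_bounded[OF \<psi>] by metis
  note C = test_function_C1[OF \<psi>]
  note [measurable] = C1_grad_borel[OF C]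
  obtain R where R: "\<And>p. p \<in> K \<Longrightarrow> norm p \<le> R" using compact_imp_bounded[OF K(1)] by (auto simp: bounded_iff)
  have int: "integrable lborel \<psi>" "integrable lborel D\<psi>"
    using integrable_compact_support[OF K(1,2) C1_grad_continuous(1)[OF C]]
      integrable_compact_support[OF K(1,3) C1_grad_continuous(2)[OF C]] by auto
  have "(LINT p|lborel. D\<psi> p) \<bullet> v = 0" for v
  proof -
    define h where "h n = 1 / real (Suc n)" for n
    have h: "0 < h n" "h n \<le> 1" for n by (auto simp: h_def)
    have h0: "h \<longlonglongrightarrow> 0" unfolding h_def using LIMSEQ_inverse_real_of_nat by (simp add: inverse_eq_divide)
    define s where "s n p = (\<psi> (p + h n *\<^sub>R v) - \<psi> p) / h n" for n p
    have int_t: "integrable lborel (\<lambda>p. \<psi> (p + h n *\<^sub>R v))" for n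
    proof (rule integrable_compact_support)
      show "compact ((\<lambda>p. p - h n *\<^sub>R v) ` K)"
        by (intro compact_continuous_image continuous_intros K)
      show "\<psi> (p + h n *\<^sub>R v) = 0" if "p \<notin> (\<lambda>p. p - h n *\<^sub>R v) ` K" for p
        using K(2) that by (metis add_diff_cancel imageI)
      show "continuous_on UNIV (\<lambda>p. \<psi> (p + h n *\<^sub>R v))"
        by (intro continuous_on_compose2[OF C1_grad_continuous(1)[OF C]] continuous_intros) auto
    qed
    have s0: "(LINT p|lborel. s n p) = 0" for n
      using int int_t lborel_integral_translate[of \<psi> "h n *\<^sub>R v"] by (simp add: s_def)
    have "(\<lambda>n. LINT p|lborel. s n p) \<longlonglongrightarrow> (LINT p|lborel. D\<psi> p \<bullet> v)"
    \<comment> \<open>Since h n \<le> 1, all difference quotients are supported in this ball, and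
      the mean value estimate bounds them by c * norm v.\<close>
    proof (rule integral_dominated_convergence[where w="\<lambda>p. indicator (cball 0 (R + norm v)) p *\<^sub>R (c * norm v)"])
      show "integrable lborel (\<lambda>p. indicator (cball 0 (R + norm v)) p *\<^sub>R (c * norm v))"
        by (intro borel_integrable_compact continuous_intros) auto
      show "AE p in lborel. (\<lambda>n. s n p) \<longlonglongrightarrow> D\<psi> p \<bullet> v"
      proof (rule AE_I2)
        fix p
        have "((\<lambda>t. \<psi> (p + t *\<^sub>R v)) has_real_derivative (D\<psi> (p + 0 *\<^sub>R v) \<bullet> v)) (at 0)"
          by (rule C1_grad_along_line[OF C])
        then have "((\<lambda>t. (\<psi> (p + t *\<^sub>R v) - \<psi> p) / t) \<longlongrightarrow> D\<psi> p \<bullet> v) (at 0)"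
          by (simp add: DERIV_def)
        moreover have "filterlim h (at 0) sequentially"
          using h0 h by (auto simp: filterlim_at less_imp_neq[symmetric] intro!: always_eventually)
        ultimately show "(\<lambda>n. s n p) \<longlonglongrightarrow> D\<psi> p \<bullet> v"
          unfolding s_def by (rule filterlim_compose)
      qed
      show "AE p in lborel. norm (s n p) \<le> indicator (cball 0 (R + norm v)) p *\<^sub>R (c * norm v)" for n
      proof (rule AE_I2)
        fix p
        have "\<bar>\<psi> (p + h n *\<^sub>R v) - \<psi> p\<bar> \<le> c * norm (h n *\<^sub>R v)"
          using C1_grad_bounded_diff[OF C c(2), of "p + h n *\<^sub>R v" p] by simp
        then have "\<bar>s n p\<bar> \<le> c * norm v" using h[of n] by (simp add: s_def field_simps)
        moreover have "s n p = 0" if "p \<notin> cball 0 (R + norm v)"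
        proof -
          have "R + norm v < norm p" using that by auto
          moreover have "norm (h n *\<^sub>R v) \<le> norm v" using h[of n] by (simp add: mult_left_le_one_le)
          moreover have "norm p \<le> norm (p + h n *\<^sub>R v) + norm (h n *\<^sub>R v)"
            using norm_triangle_ineq4[of "p + h n *\<^sub>R v" "h n *\<^sub>R v"] by simp
          moreover have "0 \<le> norm v" by simp
          ultimately have "R < norm p" "R < norm (p + h n *\<^sub>R v)" by linarith+
          then have "p \<notin> K" "p + h n *\<^sub>R v \<notin> K" using R leD by blast+
          then show ?thesis using K(2) by (simp add: s_def)
        qed
        ultimately show "norm (s n p) \<le> indicator (cball 0 (R + norm v)) p *\<^sub>R (c * norm v)"
          by (auto simp: indicator_def)
      qed
    qed (auto simp: s_def)
    then have "(LINT p|lborel. D\<psi> p \<bullet> v) = 0" unfolding s0 by (simp add: LIMSEQ_const_iff)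
    then show ?thesis using int(2) by simp
  qed
  then show ?thesis using inner_eq_zero_iff by blast
qed

section \<open>Weak gradients\<close>

locale plane_domain =
  fixes \<Omega> :: "pt set" assumes open_dom: "open \<Omega>" and bounded_dom: "bounded \<Omega>"
begin

lemma dom_borel [simp, measurable]: "\<Omega> \<in> sets borel"
  using open_dom by simp

abbreviation "\<mu> \<equiv> mu \<Omega>"

text \<open>Boundedness of the domain gives finite measure, on which square integrability of
  continuous functions and \<open>L2_complete\<close> rest.\<close>

sublocale finite_measure \<mu>
proof
  have "emeasure lborel \<Omega> < \<infinity>" using bounded_dom by (rule emeasure_bounded_finite)
  then show "emeasure \<mu> (space \<mu>) \<noteq> \<infinity>" by (simp add: space_restrict_space emeasure_restrict_space)
qed

lemma test_function_borel:
  "test_function \<Omega> \<phi> D\<phi> \<Longrightarrow> \<phi> \<in> borel_measurable borel" "test_function \<Omega> \<phi> D\<phi> \<Longrightarrow> D\<phi> \<in> borel_measurable borel"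
  using C1_grad_borel[OF test_function_C1] by auto

lemma continuous_L2:
  fixes f :: "pt \<Rightarrow> 'b::euclidean_space"
  assumes "continuous_on UNIV f" shows "L2 \<mu> f"
proof -
  have "compact (closure \<Omega>)" using bounded_dom by simp
  then have "bounded (f ` closure \<Omega>)"
    using assms by (intro compact_imp_bounded compact_continuous_image) (auto intro: continuous_on_subset)
  then obtain c where c: "\<And>p. p \<in> closure \<Omega> \<Longrightarrow> norm (f p) \<le> c" by (auto simp: bounded_iff)
  show ?thesis
    by (rule L2_bounded[where c=c])
       (use c closure_subset[of \<Omega>] assms in
         \<open>auto simp: space_restrict_space intro!: borel_measurable_mu borel_measurable_continuous_onI\<close>)
qed

lemma C1_L2: "C1_grad \<phi> D\<phi> \<Longrightarrow> L2 \<mu> \<phi>" "C1_grad \<phi> D\<phi> \<Longrightarrow> L2 \<mu> D\<phi>"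
  using C1_grad_continuous continuous_L2 by blast+

lemma test_L2: "test_function \<Omega> \<phi> D\<phi> \<Longrightarrow> L2 \<mu> \<phi>" "test_function \<Omega> \<phi> D\<phi> \<Longrightarrow> L2 \<mu> D\<phi>"
  using C1_L2 test_function_C1 by blast+

lemma integral_mu_support:
  fixes f :: "pt \<Rightarrow> 'b::{banach, second_countable_topology}"
  assumes "\<And>p. p \<notin> \<Omega> \<Longrightarrow> f p = 0"
  shows "(LINT p|\<mu>. f p) = (LINT p|lborel. f p)"
proof -
  have "(\<lambda>p. indicator \<Omega> p *\<^sub>R f p) = f" using assms by (auto simp: indicator_def fun_eq_iff)
  then show ?thesis by (simp add: integral_restrict_space)
qed

lemma has_weak_gradient_mu:
  "has_weak_gradient \<Omega> u G \<longleftrightarrow> (\<forall>\<phi> D\<phi>. test_function \<Omega> \<phi> D\<phi> \<longrightarrow>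
     (LINT p|\<mu>. u p *\<^sub>R D\<phi> p) = - (LINT p|\<mu>. \<phi> p *\<^sub>R G p))"
  by (simp add: has_weak_gradient_def set_lint_mu)

lemma test_mult_integrable:
  assumes \<phi>: "test_function \<Omega> \<phi> D\<phi>" and u: "L2 \<mu> u" and G: "L2 \<mu> (G :: pt \<Rightarrow> 'b::euclidean_space)"
  shows "integrable \<mu> (\<lambda>p. u p *\<^sub>R D\<phi> p)" "integrable \<mu> (\<lambda>p. \<phi> p *\<^sub>R G p)"
proof -
  obtain c where c: "\<And>p. \<bar>\<phi> p\<bar> \<le> c" "\<And>p. norm (D\<phi> p) \<le> c" using test_function_bounded[OF \<phi>] by metis
  note [measurable] = L2_measurable[OF u] L2_measurable[OF G] borel_measurable_mu[OF test_function_borel(1)[OF \<phi>]]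
    borel_measurable_mu[OF test_function_borel(2)[OF \<phi>]]
  show "integrable \<mu> (\<lambda>p. \<phi> p *\<^sub>R G p)"
    by (intro L2_integrable L2_mult_bounded[OF G, where c=c]) (use c in auto)
  show "integrable \<mu> (\<lambda>p. u p *\<^sub>R D\<phi> p)"
  proof (rule Bochner_Integration.integrable_bound)
    show "integrable \<mu> (\<lambda>p. c * u p)" using L2_integrable[OF u] by simp
    show "AE p in \<mu>. norm (u p *\<^sub>R D\<phi> p) \<le> norm (c * u p)"
    proof (rule AE_I2)
      fix p have "0 \<le> c" using c(1)[of p] by linarith
      with c(2)[of p] show "norm (u p *\<^sub>R D\<phi> p) \<le> norm (c * u p)"
        using mult_left_mono[OF c(2)[of p], of "\<bar>u p\<bar>"] by (simp add: abs_mult mult.commute)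
    qed
  qed measurable
qed

text \<open>The product with a test function is again a test function, so its gradient integrates to
  zero.\<close>

lemma C1_has_weak_gradient:
  assumes C: "C1_grad \<phi> D\<phi>" shows "has_weak_gradient \<Omega> \<phi> D\<phi>"
  unfolding has_weak_gradient_mu
proof (intro allI impI)
  fix \<psi> D\<psi> assume \<psi>: "test_function \<Omega> \<psi> D\<psi>"
  obtain K where K: "K \<subseteq> \<Omega>" "\<And>p. p \<notin> K \<Longrightarrow> \<psi> p = 0" "\<And>p. p \<notin> K \<Longrightarrow> D\<psi> p = 0"
    using test_function_support[OF \<psi>] by metis
  have "0 = (LINT p|\<mu>. \<phi> p *\<^sub>R D\<psi> p + \<psi> p *\<^sub>R D\<phi> p)"
  proof (subst integral_mu_support)
    show "\<phi> p *\<^sub>R D\<psi> p + \<psi> p *\<^sub>R D\<phi> p = 0" if "p \<notin> \<Omega>" for p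
      using K(2,3)[of p] K(1) that by force
  qed (use test_function_integral_grad[OF test_function_mult[OF C \<psi>]] in simp)
  also have "\<dots> = (LINT p|\<mu>. \<phi> p *\<^sub>R D\<psi> p) + (LINT p|\<mu>. \<psi> p *\<^sub>R D\<phi> p)"
    using test_mult_integrable[OF \<psi> C1_L2[OF C]] by simp
  finally show "(LINT p|\<mu>. \<phi> p *\<^sub>R D\<psi> p) = - (LINT p|\<mu>. \<psi> p *\<^sub>R D\<phi> p)" by (simp add: eq_neg_iff_add_eq_0)
qed

text \<open>Both sides of the defining identity are continuous in L2. Taking the inner product with
  each vector b reduces the identity to scalar integrals.\<close>

lemma has_weak_gradient_lim:
  assumes w: "\<And>k. has_weak_gradient \<Omega> (f k) (F k)" and f: "L2_lim \<mu> f u" and F: "L2_lim \<mu> F G"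
  shows "has_weak_gradient \<Omega> u G"
  unfolding has_weak_gradient_mu
proof (intro allI impI)
  fix \<psi> D\<psi> assume \<psi>: "test_function \<Omega> \<psi> D\<psi>"
  have L: "L2 \<mu> (f k)" "L2 \<mu> u" "L2 \<mu> (F k)" "L2 \<mu> G" for k using f F by (auto simp: L2_lim_def)
  show "(LINT p|\<mu>. u p *\<^sub>R D\<psi> p) = - (LINT p|\<mu>. \<psi> p *\<^sub>R G p)"
  proof (rule euclidean_eqI)
    fix b :: pt
    have 1: "(\<lambda>k. LINT p|\<mu>. f k p \<bullet> (D\<psi> p \<bullet> b)) \<longlonglongrightarrow> (LINT p|\<mu>. u p \<bullet> (D\<psi> p \<bullet> b))"
      by (intro L2_lim_inner f L2_lim_const L2_inner_const test_L2[OF \<psi>])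
    have 2: "(\<lambda>k. LINT p|\<mu>. F k p \<bullet> (\<psi> p *\<^sub>R b)) \<longlonglongrightarrow> (LINT p|\<mu>. G p \<bullet> (\<psi> p *\<^sub>R b))"
    proof (intro L2_lim_inner F L2_lim_const)
      show "L2 \<mu> (\<lambda>p. \<psi> p *\<^sub>R b)"
        by (rule continuous_L2) (intro continuous_intros C1_grad_continuous(1)[OF test_function_C1[OF \<psi>]])
    qed
    have "(LINT p|\<mu>. f k p \<bullet> (D\<psi> p \<bullet> b)) = - (LINT p|\<mu>. F k p \<bullet> (\<psi> p *\<^sub>R b))" for k
    proof -
      have "(LINT p|\<mu>. f k p *\<^sub>R D\<psi> p) \<bullet> b = - (LINT p|\<mu>. \<psi> p *\<^sub>R F k p) \<bullet> b"
        using w \<psi> by (simp add: has_weak_gradient_mu)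
      then show ?thesis
        using test_mult_integrable[OF \<psi> L(1,3)] by (simp add: integral_inner_left[symmetric] del: integral_inner_left)
    qed
    then have "(LINT p|\<mu>. u p \<bullet> (D\<psi> p \<bullet> b)) = - (LINT p|\<mu>. G p \<bullet> (\<psi> p *\<^sub>R b))"
      using LIMSEQ_unique[OF 1] tendsto_minus[OF 2] by simp
    then show "(LINT p|\<mu>. u p *\<^sub>R D\<psi> p) \<bullet> b = - (LINT p|\<mu>. \<psi> p *\<^sub>R G p) \<bullet> b"
      using test_mult_integrable[OF \<psi> L(2,4)] by (simp add: integral_inner_left[symmetric] del: integral_inner_left)
  qed
qed

text \<open>The indicator of the open box is the pointwise limit of products of four smooth steps,
  one for each side, with support in the closed box.\<close>

lemma integral_box_zero:
  fixes H :: "pt \<Rightarrow> real"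
  assumes H: "integrable \<mu> H" and z: "\<And>\<phi> D\<phi>. test_function \<Omega> \<phi> D\<phi> \<Longrightarrow> (LINT p|\<mu>. \<phi> p * H p) = 0"
    and sub: "cbox a b \<subseteq> \<Omega>"
  shows "(LINT p|\<mu>. indicator (box a b) p * H p) = 0"
proof -
  define s where "s k t = smoothstep (real k * t)" for k t
  define \<psi> where "\<psi> k p = s k (fst p - fst a) * s k (fst b - fst p) * (s k (snd p - snd a) * s k (snd b - snd p))" for k and p :: pt
  have C1: "\<exists>D. C1_grad (\<lambda>p. s k (c * fst p + d * snd p + e)) D" for k c d e
    unfolding s_def by (rule exI, rule C1_grad_smoothstep, rule C1_grad_cmult, rule C1_grad_affine)
  have "\<exists>D. C1_grad (\<psi> k) D" for k
  proof -
    obtain D1 D2 D3 D4 where "C1_grad (\<lambda>p. s k (fst p - fst a)) D1" "C1_grad (\<lambda>p. s k (fst b - fst p)) D2"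
       "C1_grad (\<lambda>p. s k (snd p - snd a)) D3" "C1_grad (\<lambda>p. s k (snd b - snd p)) D4"
      using C1[of k 1 0 "- fst a"] C1[of k "-1" 0 "fst b"] C1[of k 0 1 "- snd a"] C1[of k 0 "-1" "snd b"] by auto
    from C1_grad_mult[OF C1_grad_mult[OF this(1,2)] C1_grad_mult[OF this(3,4)]] show ?thesis
      unfolding \<psi>_def by blast
  qed
  then obtain D where D: "\<And>k. C1_grad (\<psi> k) (D k)" by metis
  have s0: "s k t = 0" if "t \<le> 0" for k t using that by (simp add: s_def smoothstep_eq mult_nonneg_nonpos)
  have s1: "0 \<le> s k t" "s k t \<le> 1" for k t by (auto simp: s_def smoothstep_bounds)
  have slim: "(\<lambda>k. s k t) \<longlonglongrightarrow> 1" if t: "0 < t" for t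
  proof (rule tendsto_eventually, rule eventually_sequentiallyI[of "nat \<lceil>1/t\<rceil>"])
    fix k assume "nat \<lceil>1/t\<rceil> \<le> k"
    then have "1/t \<le> real k" by linarith
    then have "1 \<le> real k * t" using t by (simp add: field_simps)
    then show "s k t = 1" by (simp add: s_def smoothstep_eq)
  qed
  have box: "p \<in> box a b \<longleftrightarrow> fst a < fst p \<and> fst p < fst b \<and> snd a < snd p \<and> snd p < snd b" for p
    by (cases a; cases b; cases p) (auto simp: box_def Basis_prod_def)
  have \<psi>0: "\<psi> k p = 0" if "p \<notin> box a b" for k p
  proof -
    have "s k (fst p - fst a) = 0 \<or> s k (fst b - fst p) = 0 \<or> s k (snd p - snd a) = 0 \<or> s k (snd b - snd p) = 0"
      using that s0 unfolding box by (metis diff_ge_0_iff_ge diff_le_0_iff_le not_less)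
    then show ?thesis by (auto simp: \<psi>_def)
  qed
  have test: "test_function \<Omega> (\<psi> k) (D k)" for k
    unfolding test_function_def using D[of k] sub \<psi>0[of _ k] box_subset_cbox[of a b] compact_cbox[of a b] by blast
  have "(\<lambda>k. LINT p|\<mu>. \<psi> k p * H p) \<longlonglongrightarrow> (LINT p|\<mu>. indicator (box a b) p * H p)"
  proof (rule integral_dominated_convergence[where w="\<lambda>p. \<bar>H p\<bar>"])
    have [measurable]: "H \<in> borel_measurable \<mu>" using H by auto
    have [measurable]: "\<psi> k \<in> borel_measurable \<mu>" for k using borel_measurable_mu C1_grad_borel(1)[OF D] by blast
    have [measurable]: "(\<lambda>p. indicator (box a b) p :: real) \<in> borel_measurable \<mu>" by (rule borel_measurable_mu) auto
    show "(\<lambda>p. indicator (box a b) p * H p) \<in> borel_measurable \<mu>" "\<And>k. (\<lambda>p. \<psi> k p * H p) \<in> borel_measurable \<mu>"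
      by measurable
    show "integrable \<mu> (\<lambda>p. \<bar>H p\<bar>)" using H by simp
    show "AE p in \<mu>. (\<lambda>k. \<psi> k p * H p) \<longlonglongrightarrow> indicator (box a b) p * H p"
    proof (rule AE_I2)
      fix p
      have "(\<lambda>k. \<psi> k p) \<longlonglongrightarrow> indicator (box a b) p"
      proof (cases "p \<in> box a b")
        case True
        then have "(\<lambda>k. \<psi> k p) \<longlonglongrightarrow> 1 * 1 * (1 * 1)"
          unfolding \<psi>_def box by (intro tendsto_mult slim) auto
        then show ?thesis using True by simp
      next
        case False then show ?thesis using \<psi>0 by simp
      qed
      then show "(\<lambda>k. \<psi> k p * H p) \<longlonglongrightarrow> indicator (box a b) p * H p" by (intro tendsto_intros)
    qed
    show "AE p in \<mu>. norm (\<psi> k p * H p) \<le> \<bar>H p\<bar>" for k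
    proof (rule AE_I2)
      fix p
      have "\<bar>\<psi> k p\<bar> \<le> 1" unfolding \<psi>_def by (simp add: abs_mult s1 mult_le_one)
      then show "norm (\<psi> k p * H p) \<le> \<bar>H p\<bar>" by (simp add: abs_mult mult_left_le_one_le)
    qed
  qed
  then show ?thesis using z[OF test] by (simp add: LIMSEQ_const_iff)
qed

text \<open>If the integrals over all boxes vanish, the positive and the negative part of the
  integrand define measures that agree on an intersection-stable generator. This is carried out
  inside one box at a time, where every other box can be cut down to one compactly contained in the
  domain.\<close>

lemma fundamental_lemma:
  fixes H :: "pt \<Rightarrow> real"
  assumes H: "integrable \<mu> H" and z: "\<And>\<phi> D\<phi>. test_function \<Omega> \<phi> D\<phi> \<Longrightarrow> (LINT p|\<mu>. \<phi> p * H p) = 0"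
  shows "AE p in \<mu>. H p = 0"
proof -
  have local: "AE p in lborel. p \<in> box a b \<longrightarrow> H p = 0" if sub: "cbox a b \<subseteq> \<Omega>" for a b
  proof -
    define h where "h p = indicator (box a b) p * H p" for p
    have sub': "box a b \<subseteq> \<Omega>" using sub box_subset_cbox by blast
    have h_eq: "h p = indicator (box a b) p *\<^sub>R (indicator \<Omega> p *\<^sub>R H p)" for p
      using sub' by (auto simp: h_def indicator_def)
    have H': "integrable lborel (\<lambda>p. indicator \<Omega> p *\<^sub>R H p)"
      using H by (simp add: integrable_restrict_space)
    have h: "integrable lborel h"
      unfolding h_eq by (intro integrable_mult_indicator H') simp
    have [measurable]: "h \<in> borel_measurable lborel" using h by auto
    have hbox: "(LINT p|lborel. indicator (box c d) p * h p) = 0" for c d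
    proof -
      obtain l u where lu: "box c d \<inter> box a b = box l u" unfolding box_Int_box by blast
      show ?thesis
      proof (cases "box l u = {}")
        case True
        then have "indicator (box c d) p * h p = 0" for p using lu by (auto simp: h_def indicator_def)
        then have "(\<lambda>p. indicator (box c d) p * h p) = (\<lambda>p. 0)" by blast
        then show ?thesis by simp
      next
        case False
        \<comment> \<open>A nonempty open box has \<open>cbox l u\<close> as its closure; the empty
          box is treated apart because its corners say nothing about a and b.\<close>
        have "cbox l u \<subseteq> cbox a b" using lu False box_subset_cbox[of a b]
          by (subst closure_box[OF False, symmetric], intro closure_minimal) auto
        then have "(LINT p|\<mu>. indicator (box l u) p * H p) = 0" using sub by (intro integral_box_zero[OF H z]) auto
        moreover have "indicator \<Omega> p *\<^sub>R (indicator (box l u) p * H p) = indicator (box c d) p * h p" for p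
          using lu[symmetric] sub' by (auto simp: h_def indicator_def)
        ultimately show ?thesis by (simp add: integral_restrict_space)
      qed
    qed
    have fin: "(\<integral>\<^sup>+p. ennreal (h p) \<partial>lborel) < \<infinity>" "(\<integral>\<^sup>+p. ennreal (- h p) \<partial>lborel) < \<infinity>"
      using h by (auto simp: real_integrable_def less_top)
    \<comment> \<open>Since \<open>ennreal\<close> truncates at zero, the two densities are the
      positive and the negative part of h.\<close>
    have "density lborel (\<lambda>p. ennreal (h p)) = density lborel (\<lambda>p. ennreal (- h p))"
    proof (rule measure_eqI_generator_eq)
      let ?E = "range (\<lambda>(a, b). box a b::pt set)"
      let ?A = "\<lambda>n::nat. box (- (real n *\<^sub>R One)) (real n *\<^sub>R One) :: pt set"
      have E: "X \<in> ?E \<longleftrightarrow> (\<exists>c d. X = box c d)" for X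
        by (auto simp: image_iff split_paired_Ex)
      show "Int_stable ?E" 
      proof (rule Int_stableI)
        fix X Y assume "X \<in> ?E" "Y \<in> ?E"
        then obtain c d c' d' where XY: "X = box c d" "Y = box c' d'" unfolding E by blast
        show "X \<inter> Y \<in> ?E" unfolding E unfolding XY box_Int_box by blast
      qed
      show "?E \<subseteq> Pow UNIV" "sets (density lborel (\<lambda>p. ennreal (h p))) = sigma_sets UNIV ?E"
        "sets (density lborel (\<lambda>p. ennreal (- h p))) = sigma_sets UNIV ?E"
        by (simp_all add: borel_eq_box)
      show "range ?A \<subseteq> ?E" using E by blast
      show "(\<Union>i. ?A i) = UNIV" by (rule UN_box_eq_UNIV)
      show "emeasure (density lborel (\<lambda>p. ennreal (h p))) (?A i) \<noteq> \<infinity>" for i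
      proof -
        have "(\<integral>\<^sup>+p. ennreal (h p) * indicator (?A i) p \<partial>lborel) \<le> (\<integral>\<^sup>+p. ennreal (h p) \<partial>lborel)"
          by (rule nn_integral_mono) (auto simp: indicator_def)
        with fin show ?thesis by (auto simp: emeasure_density)
      qed
      show "emeasure (density lborel (\<lambda>p. ennreal (h p))) X = emeasure (density lborel (\<lambda>p. ennreal (- h p))) X" if "X \<in> ?E" for X
      proof -
        from that[unfolded E] obtain c d where X: "X = box c d" by blast
        define g where "g p = indicator X p * h p" for p
        have g: "integrable lborel g" using integrable_mult_indicator[OF _ h, of X] X by (simp add: g_def[abs_def])
        have "(\<integral>\<^sup>+p. ennreal (g p) \<partial>lborel) < \<infinity>" "(\<integral>\<^sup>+p. ennreal (- g p) \<partial>lborel) < \<infinity>"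
          using g by (auto simp: real_integrable_def less_top)
        moreover have "(LINT p|lborel. g p) = 0" using hbox X by (simp add: g_def)
        ultimately have "(\<integral>\<^sup>+p. ennreal (g p) \<partial>lborel) = (\<integral>\<^sup>+p. ennreal (- g p) \<partial>lborel)"
          unfolding real_lebesgue_integral_def[OF g] by (metis eq_iff_diff_eq_0 infinity_ennreal_def ennreal_enn2real)
        moreover have "ennreal (g p) = ennreal (h p) * indicator X p" "ennreal (- g p) = ennreal (- h p) * indicator X p" for p
          by (auto simp: g_def indicator_def)
        ultimately show ?thesis using X by (simp add: emeasure_density)
      qed
    qed
    then have "AE p in lborel. ennreal (h p) = ennreal (- h p)"
      by (intro sigma_finite_measure.density_unique[OF sigma_finite_lborel]) auto
    then show ?thesis
    proof eventually_elim
      fix p assume "ennreal (h p) = ennreal (- h p)"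
      then have "h p = 0" by (cases "0 \<le> h p") (auto simp: ennreal_neg)
      then show "p \<in> box a b \<longrightarrow> H p = 0" by (auto simp: h_def)
    qed
  qed
  obtain \<D> where \<D>: "countable \<D>" "\<D> \<subseteq> Pow \<Omega>" "\<And>X. X \<in> \<D> \<Longrightarrow> \<exists>a b. X = cbox a b" "\<Union>\<D> = \<Omega>"
    by (rule open_countable_Union_open_cbox[OF open_dom]) blast
  have "AE p in lborel. \<forall>X\<in>\<D>. p \<in> X \<longrightarrow> H p = 0"
    unfolding AE_ball_countable[OF \<D>(1)]
  proof
    fix X assume "X \<in> \<D>"
    from \<D>(3)[OF this] obtain a b where X: "X = cbox a b" by blast
    have sub: "cbox a b \<subseteq> \<Omega>" using \<open>X \<in> \<D>\<close> \<D>(2) X by blast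
    \<comment> \<open>The covering consists of closed boxes while the local statement concerns open
      ones; the faces in between are null sets.\<close>
    have "emeasure lborel (cbox a b - box a b) = 0"
    proof (subst emeasure_Diff)
      have "emeasure lborel (cbox a b) = emeasure lborel (box a b)"
        by (simp only: emeasure_lborel_cbox_eq emeasure_lborel_box_eq)
      then show "emeasure lborel (cbox a b) - emeasure lborel (box a b) = 0"
        using emeasure_lborel_box_finite[of a b] by (intro diff_eq_0_ennreal) auto
    qed (use emeasure_lborel_box_finite[of a b] box_subset_cbox[of a b] in auto)
    then have "AE p in lborel. p \<notin> cbox a b - box a b" by (intro AE_not_in) auto
    with local[OF sub] show "AE p in lborel. p \<in> X \<longrightarrow> H p = 0"
      by eventually_elim (auto simp: X)
  qed
  then have "AE p in lborel. p \<in> \<Omega> \<longrightarrow> H p = 0"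
    by eventually_elim (use \<D>(4) in blast)
  then show ?thesis by (simp add: AE_mu)
qed

text \<open>The fundamental lemma for each coordinate of the difference. It identifies the chosen
  representative \<open>weak_grad\<close> with any gradient given explicitly.\<close>

lemma weak_gradient_unique:
  assumes u: "L2 \<mu> u" and G: "L2 \<mu> G" "has_weak_gradient \<Omega> u G" and H: "L2 \<mu> H" "has_weak_gradient \<Omega> u H"
  shows "AE p in \<mu>. G p = H p"
proof -
  have "AE p in \<mu>. (G p - H p) \<bullet> b = 0" for b
  proof (rule fundamental_lemma)
    show "integrable \<mu> (\<lambda>p. (G p - H p) \<bullet> b)"
      by (intro L2_integrable L2_inner_const L2_diff G H)
    fix \<phi> D\<phi> assume \<phi>: "test_function \<Omega> \<phi> D\<phi>"
    note I = test_mult_integrable[OF \<phi> u G(1)] test_mult_integrable[OF \<phi> u H(1)]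
    have "(LINT p|\<mu>. \<phi> p *\<^sub>R G p) = (LINT p|\<mu>. \<phi> p *\<^sub>R H p)"
      using G(2)[unfolded has_weak_gradient_mu, rule_format, OF \<phi>]
        H(2)[unfolded has_weak_gradient_mu, rule_format, OF \<phi>] by simp
    then have "(LINT p|\<mu>. \<phi> p *\<^sub>R G p - \<phi> p *\<^sub>R H p) \<bullet> b = 0" using I by simp
    moreover have "(\<phi> p *\<^sub>R G p - \<phi> p *\<^sub>R H p) \<bullet> b = \<phi> p * ((G p - H p) \<bullet> b)" for p
      by (simp add: algebra_simps inner_simps)
    ultimately show "(LINT p|\<mu>. \<phi> p * ((G p - H p) \<bullet> b)) = 0"
      using I by (subst (asm) integral_inner_left[symmetric]) auto
  qed
  then have "AE p in \<mu>. \<forall>b\<in>Basis. (G p - H p) \<bullet> b = 0"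
    by (subst AE_ball_countable) (auto intro: countable_finite)
  then show ?thesis
  proof eventually_elim
    fix p assume "\<forall>b\<in>Basis. (G p - H p) \<bullet> b = 0"
    then have "G p - H p = 0" by (rule euclidean_all_zero_iff[THEN iffD1])
    then show "G p = H p" by simp
  qed
qed

section \<open>Sobolev pairs, zero boundary values and traces\<close>

definition Sob :: "(pt \<Rightarrow> real) \<Rightarrow> (pt \<Rightarrow> pt) \<Rightarrow> bool" where
  "Sob u G \<longleftrightarrow> L2 \<mu> u \<and> L2 \<mu> G \<and> has_weak_gradient \<Omega> u G"

lemma W12_Sob: "W12 \<Omega> u \<longleftrightarrow> (\<exists>G. Sob u G)"
  by (auto simp: W12_def Sob_def L2_on_mu)

lemma Sob_weak_grad:
  assumes "W12 \<Omega> u" shows "Sob u (weak_grad \<Omega> u)"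
proof -
  have "\<exists>G. L2_on \<Omega> G \<and> has_weak_gradient \<Omega> u G" "L2_on \<Omega> u" using assms by (auto simp: W12_def)
  from someI_ex[OF this(1)] this(2) show ?thesis
    unfolding weak_grad_def Sob_def by (simp add: L2_on_mu)
qed

lemma Sob_weak_grad_AE: "Sob u G \<Longrightarrow> AE p in \<mu>. weak_grad \<Omega> u p = G p"
  using Sob_weak_grad[of u] weak_gradient_unique[of u _ G] unfolding W12_Sob Sob_def by blast

lemma C1_lim_Sob:
  assumes "\<And>k. C1_grad (\<phi> k) (D\<phi> k)" "L2_lim \<mu> \<phi> u" "L2_lim \<mu> D\<phi> G"
  shows "Sob u G"
  using assms has_weak_gradient_lim[OF C1_has_weak_gradient assms(2,3)]
  by (auto simp: Sob_def L2_lim_def)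

text \<open>The Sobolev space with zero boundary values, as the closure of the test functions. The
  gradient is a second argument, so that limits come with an explicit gradient instead of a chosen
  one.\<close>

definition W0 :: "(pt \<Rightarrow> real) \<Rightarrow> (pt \<Rightarrow> pt) \<Rightarrow> bool" where
  "W0 u G \<longleftrightarrow> (\<exists>\<psi> D\<psi>. (\<forall>k. test_function \<Omega> (\<psi> k) (D\<psi> k)) \<and> L2_lim \<mu> \<psi> u \<and> L2_lim \<mu> D\<psi> G)"

lemma W0_L2: "W0 u G \<Longrightarrow> L2 \<mu> u" "W0 u G \<Longrightarrow> L2 \<mu> G"
  by (auto simp: W0_def L2_lim_def)

lemma test_W0: "test_function \<Omega> \<psi> D\<psi> \<Longrightarrow> W0 \<psi> D\<psi>"
  unfolding W0_def by (intro exI[of _ "\<lambda>_. \<psi>"] exI[of _ "\<lambda>_. D\<psi>"]) (auto intro: L2_lim_const test_L2)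

lemma W0_combine:
  assumes "W0 u G" "W0 v H" shows "W0 (\<lambda>p. a * u p + b * v p) (\<lambda>p. a *\<^sub>R G p + b *\<^sub>R H p)"
proof -
  obtain \<phi> D\<phi> \<psi> D\<psi> where *: "\<And>k. test_function \<Omega> (\<phi> k) (D\<phi> k)" "L2_lim \<mu> \<phi> u" "L2_lim \<mu> D\<phi> G"
      "\<And>k. test_function \<Omega> (\<psi> k) (D\<psi> k)" "L2_lim \<mu> \<psi> v" "L2_lim \<mu> D\<psi> H"
    using assms unfolding W0_def by metis
  show ?thesis unfolding W0_def
    by (rule exI[of _ "\<lambda>k p. a * \<phi> k p + b * \<psi> k p"], rule exI[of _ "\<lambda>k p. a *\<^sub>R D\<phi> k p + b *\<^sub>R D\<psi> k p"])
       (use L2_lim_scaleR[OF *(2), of a] L2_lim_scaleR[OF *(5), of b] in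
         \<open>auto intro!: test_function_add test_function_scale L2_lim_add L2_lim_scaleR *\<close>)
qed

lemma W0_diff: "W0 u G \<Longrightarrow> W0 v H \<Longrightarrow> W0 (\<lambda>p. u p - v p) (\<lambda>p. G p - H p)"
  using W0_combine[of u G v H 1 "-1"] by simp

text \<open>Translates the single integral in \<open>has_trace\<close> into separate L2 convergence
  of the functions and of their gradients.\<close>

lemma L2_lim_sum_sq:
  assumes "\<And>k. L2 \<mu> (f k)" "L2 \<mu> u" "\<And>k. L2 \<mu> (F k)" "L2 \<mu> G"
  shows "(\<lambda>k. LINT p:\<Omega>|lborel. (f k p - u p)\<^sup>2 + (norm (F k p - G p))\<^sup>2) \<longlonglongrightarrow> 0 \<longleftrightarrow>
     L2_lim \<mu> f (u :: pt \<Rightarrow> real) \<and> L2_lim \<mu> F (G :: pt \<Rightarrow> 'b::euclidean_space)"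
proof -
  have eq: "(LINT p:\<Omega>|lborel. (f k p - u p)\<^sup>2 + (norm (F k p - G p))\<^sup>2) =
     (LINT p|\<mu>. (norm (f k p - u p))\<^sup>2) + (LINT p|\<mu>. (norm (F k p - G p))\<^sup>2)" for k
    unfolding set_lint_mu[OF dom_borel]
    using L2_sq_integrable[OF L2_diff[OF assms(1,2)], of k] L2_sq_integrable[OF L2_diff[OF assms(3,4)], of k]
    by (subst Bochner_Integration.integral_add[symmetric]) auto
  show ?thesis unfolding eq
  proof
    assume *: "(\<lambda>k. (LINT p|\<mu>. (norm (f k p - u p))\<^sup>2) + (LINT p|\<mu>. (norm (F k p - G p))\<^sup>2)) \<longlonglongrightarrow> 0"
    have "(\<lambda>k. LINT p|\<mu>. (norm (f k p - u p))\<^sup>2) \<longlonglongrightarrow> 0"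
      by (rule tendsto_sandwich[OF _ _ tendsto_const *]) auto
    moreover have "(\<lambda>k. LINT p|\<mu>. (norm (F k p - G p))\<^sup>2) \<longlonglongrightarrow> 0"
      by (rule tendsto_sandwich[OF _ _ tendsto_const *]) auto
    ultimately show "L2_lim \<mu> f u \<and> L2_lim \<mu> F G" using assms by (auto simp: L2_lim_def)
  next
    assume "L2_lim \<mu> f u \<and> L2_lim \<mu> F G"
    then show "(\<lambda>k. (LINT p|\<mu>. (norm (f k p - u p))\<^sup>2) + (LINT p|\<mu>. (norm (F k p - G p))\<^sup>2)) \<longlonglongrightarrow> 0"
      unfolding L2_lim_def using tendsto_add[of _ 0 _ _ 0] by force
  qed
qed

lemma has_trace_obtain:
  assumes "has_trace \<Omega> \<Sigma> u h"
  obtains \<phi> D\<phi> where "\<And>k. C1_grad (\<phi> k) (D\<phi> k)" "L2_lim \<mu> \<phi> u" "L2_lim \<mu> D\<phi> (weak_grad \<Omega> u)"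
    "\<And>a b. (a, b) \<in> \<Sigma> \<Longrightarrow> L2_segment_tendsto a b \<phi> h"
proof -
  from assms obtain \<phi> D\<phi> where *: "W12 \<Omega> u" "\<And>k. C1_grad (\<phi> k) (D\<phi> k)"
        "(\<lambda>k. LINT p:\<Omega>|lborel. (\<phi> k p - u p)\<^sup>2 + (norm (D\<phi> k p - weak_grad \<Omega> u p))\<^sup>2) \<longlonglongrightarrow> 0"
        "\<forall>(a, b)\<in>\<Sigma>. L2_segment_tendsto a b \<phi> h"
    unfolding has_trace_def by blast
  have "L2 \<mu> u" "L2 \<mu> (weak_grad \<Omega> u)" using Sob_weak_grad[OF *(1)] by (auto simp: Sob_def)
  then have "L2_lim \<mu> \<phi> u \<and> L2_lim \<mu> D\<phi> (weak_grad \<Omega> u)"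
    by (intro L2_lim_sum_sq[THEN iffD1] *(3) C1_L2[OF *(2)])
  with * show ?thesis by (intro that) auto
qed

lemma L2_lim_cong_AE:
  assumes "L2_lim M f u" "v \<in> borel_measurable M" "AE x in M. u x = v x"
  shows "L2_lim M f v"
proof -
  have v: "L2 M v" using L2_cong_AE[of M u v] assms by (auto simp: L2_lim_def)
  have "(LINT x|M. (norm (f k x - u x))\<^sup>2) = (LINT x|M. (norm (f k x - v x))\<^sup>2)" for k
  proof (rule integral_cong_AE)
    show "AE x in M. (norm (f k x - u x))\<^sup>2 = (norm (f k x - v x))\<^sup>2"
      using assms(3) by eventually_elim simp
    have [measurable]: "f k \<in> borel_measurable M" "u \<in> borel_measurable M"
      using assms(1) by (auto simp: L2_lim_def L2_def)
    note assms(2)[measurable]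
    show "(\<lambda>x. (norm (f k x - u x))\<^sup>2) \<in> borel_measurable M" "(\<lambda>x. (norm (f k x - v x))\<^sup>2) \<in> borel_measurable M"
      by measurable
  qed
  with assms(1) v show ?thesis by (simp add: L2_lim_def)
qed

text \<open>If the approximants already have the prescribed values on every edge, the boundary
  integrals are zero for each of them. All traces constructed below, on the boundary and on the
  axes, are obtained in this way.\<close>

lemma has_trace_exact:
  assumes \<phi>: "\<And>k. C1_grad (\<phi> k) (D\<phi> k)" "L2_lim \<mu> \<phi> u" "L2_lim \<mu> D\<phi> G"
    and h: "\<And>a b p k. (a, b) \<in> \<Sigma> \<Longrightarrow> p \<in> closed_segment a b \<Longrightarrow> \<phi> k p = h p"
  shows "has_trace \<Omega> \<Sigma> u h"
proof -
  have Sob: "Sob u G" by (rule C1_lim_Sob[OF \<phi>])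
  then have W: "W12 \<Omega> u" by (auto simp: W12_Sob)
  have S2: "Sob u (weak_grad \<Omega> u)" by (rule Sob_weak_grad[OF W])
  have "L2_lim \<mu> D\<phi> (weak_grad \<Omega> u)"
    by (rule L2_lim_cong_AE[OF \<phi>(3)])
       (use S2 Sob_weak_grad_AE[OF Sob] in \<open>auto simp: Sob_def L2_def elim: eventually_mono\<close>)
  then have "(\<lambda>k. LINT p:\<Omega>|lborel. (\<phi> k p - u p)\<^sup>2 + (norm (D\<phi> k p - weak_grad \<Omega> u p))\<^sup>2) \<longlonglongrightarrow> 0"
    using \<phi> by (subst L2_lim_sum_sq) (auto simp: L2_lim_def)
  moreover have "L2_segment_tendsto a b \<phi> h" if "(a, b) \<in> \<Sigma>" for a b
  proof -
    have eq: "h (linepath a b t) = \<phi> k (linepath a b t)" if t: "t \<in> {0..1}" for t k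
      using h[OF \<open>(a, b) \<in> \<Sigma>\<close> linepath_in_path[OF t]] by simp
    \<comment> \<open>On the edge h coincides with every approximant; the one with index 0 serves to
      show continuity.\<close>
    have cont: "continuous_on {0..1} (\<lambda>t. h (linepath a b t))"
    proof (subst continuous_on_cong[OF refl eq[of _ 0]])
      show "continuous_on {0..1} (\<lambda>t. \<phi> 0 (linepath a b t))"
        by (rule continuous_on_compose2[OF C1_grad_continuous(1)[OF \<phi>(1)[of 0]] continuous_on_linepath]) auto
    qed
    have "set_integrable lborel {0..1} (\<lambda>t. h (linepath a b t))" "set_integrable lborel {0..1} (\<lambda>t. (h (linepath a b t))\<^sup>2)"
      unfolding set_integrable_def by (intro borel_integrable_compact cont continuous_intros compact_Icc)+
    moreover have "(LINT t:{0..1}|lborel. (\<phi> k (linepath a b t) - h (linepath a b t))\<^sup>2) = 0" for k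
    proof -
      have "(LINT t:{0..1}|lborel. (\<phi> k (linepath a b t) - h (linepath a b t))\<^sup>2) = (LINT t:{0..1::real}|lborel. 0)"
        by (rule set_lebesgue_integral_cong) (auto simp: eq[of _ k])
      then show ?thesis by simp
    qed
    ultimately show ?thesis
      unfolding L2_segment_tendsto_def set_borel_measurable_def set_integrable_def by auto
  qed
  ultimately show ?thesis
    unfolding has_trace_def using W \<phi>(1) by blast
qed

end

section \<open>The Poincare and Ladyzhenskaya inequalities\<close>

lemma nn_integral_lborel_translate:
  fixes f :: "'a::euclidean_space \<Rightarrow> ennreal"
  assumes "f \<in> borel_measurable borel"
  shows "(\<integral>\<^sup>+p. f (p + v) \<partial>lborel) = (\<integral>\<^sup>+p. f p \<partial>lborel)"
proof -
  have "(\<integral>\<^sup>+p. f p \<partial>lborel) = (\<integral>\<^sup>+p. f p \<partial>(distr lborel borel ((+) v)))" by (simp add: lborel_distr_plus)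
  also have "\<dots> = (\<integral>\<^sup>+p. f (v + p) \<partial>lborel)" by (rule nn_integral_distr) (use assms in auto)
  finally show ?thesis by (simp add: add.commute)
qed

text \<open>The fundamental theorem of calculus, followed by Cauchy-Schwarz against the constant 1
  on the interval.\<close>

lemma increment_sq_le:
  fixes f :: "real \<Rightarrow> real"
  assumes "a \<le> b" and f: "\<And>t. a \<le> t \<Longrightarrow> t \<le> b \<Longrightarrow> (f has_real_derivative f' t) (at t)" and cont: "continuous_on {a..b} f'"
  shows "(f b - f a)\<^sup>2 \<le> (b - a) * (LINT t|lborel. indicator {a..b} t * (f' t)\<^sup>2)"
proof -
  have "(LINT t|lborel. indicator {a..b} t *\<^sub>R f' t) = f b - f a"
    by (rule integral_FTC_atLeastAtMost[OF assms(1) _ cont])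
       (use f in \<open>auto simp: has_real_derivative_iff_has_vector_derivative intro: has_vector_derivative_at_within\<close>)
  then have "(f b - f a)\<^sup>2 = (LINT t|lborel. indicator {a..b} t \<bullet> (indicator {a..b} t * f' t))\<^sup>2"
    by (simp add: inner_real_def mult.assoc[symmetric] flip: indicator_inter_arith)
  also have "\<dots> \<le> (LINT t|lborel. (norm (indicator {a..b} t :: real))\<^sup>2) * (LINT t|lborel. (norm (indicator {a..b} t * f' t))\<^sup>2)"
  proof (rule L2_Cauchy_Schwarz)
    have *: "(norm (indicator {a..b} t * f' t))\<^sup>2 = indicator {a..b} t *\<^sub>R (f' t)\<^sup>2" for t by (simp add: indicator_def)
    have "integrable lborel (\<lambda>t. indicator {a..b} t *\<^sub>R f' t)" "integrable lborel (\<lambda>t. indicator {a..b} t *\<^sub>R (f' t)\<^sup>2)"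
      by (intro borel_integrable_compact compact_Icc continuous_intros cont)+
    then show "L2 lborel (\<lambda>t. indicator {a..b} t * f' t)" unfolding L2_def * by auto
    have **: "(norm (indicator {a..b} t :: real))\<^sup>2 = indicator {a..b} t" for t by (simp add: indicator_def)
    show "L2 lborel (indicator {a..b} :: real \<Rightarrow> real)" unfolding L2_def ** by (auto simp: emeasure_lborel_Icc_eq intro!: integrable_real_indicator)
  qed
  also have "(\<lambda>t. (norm (indicator {a..b} t :: real))\<^sup>2) = indicator {a..b}" by (auto simp: indicator_def)
  also have "(\<lambda>t. (norm (indicator {a..b} t * f' t))\<^sup>2) = (\<lambda>t. indicator {a..b} t * (f' t)\<^sup>2)" by (auto simp: indicator_def)
  finally show ?thesis using assms(1) by simp
qed

text \<open>Stated with extended nonnegative integrals, so that Tonelli's theorem can exchange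
  integration over lines and over points without integrability conditions.\<close>

lemma C1_line_sq_le:
  assumes C: "C1_grad \<phi> D\<phi>" and "0 \<le> T" and e: "norm e = 1"
  shows "ennreal ((\<phi> (p + T *\<^sub>R e) - \<phi> p)\<^sup>2) \<le> ennreal T * (\<integral>\<^sup>+t. ennreal (indicator {0..T} t * (norm (D\<phi> (p + t *\<^sub>R e)))\<^sup>2) \<partial>lborel)"
proof -
  define f' where "f' t = D\<phi> (p + t *\<^sub>R e) \<bullet> e" for t
  have cont: "continuous_on A (\<lambda>t. D\<phi> (p + t *\<^sub>R e))" for A
    by (rule continuous_on_compose2[OF C1_grad_continuous(2)[OF C]]) (auto intro!: continuous_intros)
  have "(\<phi> (p + T *\<^sub>R e) - \<phi> (p + 0 *\<^sub>R e))\<^sup>2 \<le> (T - 0) * (LINT t|lborel. indicator {0..T} t * (f' t)\<^sup>2)"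
    by (rule increment_sq_le[OF assms(2)]) (auto simp: f'_def intro!: C1_grad_along_line[OF C] continuous_intros cont)
  also have "\<dots> \<le> T * (LINT t|lborel. indicator {0..T} t *\<^sub>R (norm (D\<phi> (p + t *\<^sub>R e)))\<^sup>2)"
    unfolding diff_zero
  proof (intro mult_left_mono integral_mono \<open>0 \<le> T\<close>)
    have "integrable lborel (\<lambda>t. indicator {0..T} t *\<^sub>R (f' t)\<^sup>2)"
      unfolding f'_def by (intro borel_integrable_compact compact_Icc continuous_intros cont)
    then show "integrable lborel (\<lambda>t. indicator {0..T} t * (f' t)\<^sup>2)" by simp
    show "integrable lborel (\<lambda>t. indicator {0..T} t *\<^sub>R (norm (D\<phi> (p + t *\<^sub>R e)))\<^sup>2)"
      by (intro borel_integrable_compact compact_Icc continuous_intros cont)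
    fix t
    have "\<bar>f' t\<bar> \<le> norm (D\<phi> (p + t *\<^sub>R e))" using Cauchy_Schwarz_ineq2[of "D\<phi> (p + t *\<^sub>R e)" e] e by (simp add: f'_def)
    then have "\<bar>f' t\<bar>\<^sup>2 \<le> (norm (D\<phi> (p + t *\<^sub>R e)))\<^sup>2" by (intro power_mono) auto
    then show "indicator {0..T} t * (f' t)\<^sup>2 \<le> indicator {0..T} t *\<^sub>R (norm (D\<phi> (p + t *\<^sub>R e)))\<^sup>2"
      by (simp add: indicator_def)
  qed
  finally have "ennreal ((\<phi> (p + T *\<^sub>R e) - \<phi> p)\<^sup>2) \<le> ennreal (T * (LINT t|lborel. indicator {0..T} t *\<^sub>R (norm (D\<phi> (p + t *\<^sub>R e)))\<^sup>2))"
    by (intro ennreal_leI) simp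
  also have "\<dots> = ennreal T * ennreal (LINT t|lborel. indicator {0..T} t *\<^sub>R (norm (D\<phi> (p + t *\<^sub>R e)))\<^sup>2)"
    using \<open>0 \<le> T\<close> by (simp add: ennreal_mult')
  also have "ennreal (LINT t|lborel. indicator {0..T} t *\<^sub>R (norm (D\<phi> (p + t *\<^sub>R e)))\<^sup>2) =
      (\<integral>\<^sup>+t. ennreal (indicator {0..T} t *\<^sub>R (norm (D\<phi> (p + t *\<^sub>R e)))\<^sup>2) \<partial>lborel)"
    by (intro nn_integral_eq_integral[symmetric] borel_integrable_compact compact_Icc continuous_intros cont) (auto simp: indicator_def)
  finally show ?thesis by simp
qed

text \<open>Integrate the derivative of \<phi>^2 from a zero of \<phi> behind p; since 2 |\<phi>|
  |D\<phi>| is at most the sum of the squares, the integrand on the right dominates. Extending the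
  integral to the whole line makes the bound the same for all points of that line.\<close>

lemma C1_line_product_le:
  assumes C: "C1_grad \<phi> D\<phi>" and "0 \<le> R" and e: "norm e = 1" and z: "\<phi> (p - R *\<^sub>R e) = 0"
  shows "ennreal ((\<phi> p)\<^sup>2) \<le> (\<integral>\<^sup>+t. ennreal ((\<phi> (p + t *\<^sub>R e))\<^sup>2 + (norm (D\<phi> (p + t *\<^sub>R e)))\<^sup>2) \<partial>lborel)"
proof -
  define g where "g t = (\<phi> (p + t *\<^sub>R e))\<^sup>2 + (norm (D\<phi> (p + t *\<^sub>R e)))\<^sup>2" for t
  define f' where "f' t = 2 * \<phi> (p + t *\<^sub>R e) * (D\<phi> (p + t *\<^sub>R e) \<bullet> e)" for t
  have cont: "continuous_on A (\<lambda>t. D\<phi> (p + t *\<^sub>R e))" "continuous_on A (\<lambda>t. \<phi> (p + t *\<^sub>R e))" for A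
    by (rule continuous_on_compose2[OF C1_grad_continuous(2)[OF C]] continuous_on_compose2[OF C1_grad_continuous(1)[OF C]];
        auto intro!: continuous_intros)+
  have "(LINT t|lborel. indicator {-R..0} t *\<^sub>R f' t) = (\<phi> (p + 0 *\<^sub>R e))\<^sup>2 - (\<phi> (p + (-R) *\<^sub>R e))\<^sup>2"
  proof (rule integral_FTC_atLeastAtMost)
    show "((\<lambda>t. (\<phi> (p + t *\<^sub>R e))\<^sup>2) has_vector_derivative f' t) (at t within {-R..0})" for t
      unfolding has_real_derivative_iff_has_vector_derivative[symmetric] f'_def
      by (rule DERIV_subset[where s=UNIV]) (auto intro!: derivative_eq_intros C1_grad_along_line[OF C])
    show "continuous_on {-R..0} f'" unfolding f'_def by (intro continuous_intros cont)
  qed (use assms(2) in simp)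
  then have "(\<phi> p)\<^sup>2 = (LINT t|lborel. indicator {-R..0} t *\<^sub>R f' t)" using z by simp
  also have "\<dots> \<le> (LINT t|lborel. indicator {-R..0} t *\<^sub>R g t)"
  proof (intro integral_mono)
    show "integrable lborel (\<lambda>t. indicator {-R..0} t *\<^sub>R f' t)" "integrable lborel (\<lambda>t. indicator {-R..0} t *\<^sub>R g t)"
      unfolding f'_def g_def by (intro borel_integrable_compact compact_Icc continuous_intros cont)+
    fix t
    have "\<bar>D\<phi> (p + t *\<^sub>R e) \<bullet> e\<bar> \<le> norm (D\<phi> (p + t *\<^sub>R e))" using Cauchy_Schwarz_ineq2[of "D\<phi> (p + t *\<^sub>R e)" e] e by simp
    then have "2 * \<bar>\<phi> (p + t *\<^sub>R e)\<bar> * \<bar>D\<phi> (p + t *\<^sub>R e) \<bullet> e\<bar> \<le> 2 * \<bar>\<phi> (p + t *\<^sub>R e)\<bar> * norm (D\<phi> (p + t *\<^sub>R e))"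
      by (intro mult_left_mono) auto
    also have "\<dots> \<le> g t" using sum_squares_bound[of "\<bar>\<phi> (p + t *\<^sub>R e)\<bar>" "norm (D\<phi> (p + t *\<^sub>R e))"] by (simp add: g_def)
    finally have "\<bar>f' t\<bar> \<le> g t" by (simp add: f'_def abs_mult)
    then have "f' t \<le> g t" by simp
    then show "indicator {-R..0} t *\<^sub>R f' t \<le> indicator {-R..0} t *\<^sub>R g t"
      by (simp add: indicator_def)
  qed
  finally have "ennreal ((\<phi> p)\<^sup>2) \<le> ennreal (LINT t|lborel. indicator {-R..0} t *\<^sub>R g t)" by (rule ennreal_leI)
  also have "\<dots> = (\<integral>\<^sup>+t. ennreal (indicator {-R..0} t *\<^sub>R g t) \<partial>lborel)"
    unfolding g_def
    by (intro nn_integral_eq_integral[symmetric] borel_integrable_compact compact_Icc continuous_intros cont) (auto simp: indicator_def)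
  also have "\<dots> \<le> (\<integral>\<^sup>+t. ennreal (g t) \<partial>lborel)"
    by (intro nn_integral_mono ennreal_leI) (auto simp: indicator_def g_def)
  finally show ?thesis by (simp add: g_def)
qed

context plane_domain
begin

lemma nn_integral_mu_support:
  assumes "\<And>p. p \<notin> \<Omega> \<Longrightarrow> f p = 0"
  shows "(\<integral>\<^sup>+p. f p \<partial>\<mu>) = (\<integral>\<^sup>+p. f p \<partial>lborel)"
proof -
  have "f p * indicator \<Omega> p = f p" for p using assms[of p] by (cases "p \<in> \<Omega>") auto
  then show ?thesis by (simp add: nn_integral_restrict_space)
qed

text \<open>Integrating over the segment in both directions gives a bound that does not depend on
  the side on which the point leaves the domain. By Tonelli and translation invariance the factor is
  then T from the line estimate times the length 2 T of the segment.\<close>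

lemma test_poincare:
  assumes \<psi>: "test_function \<Omega> \<psi> D\<psi>" and T: "0 \<le> T" and e: "norm e = 1"
    and exit: "\<And>p. p \<in> \<Omega> \<Longrightarrow> p + T *\<^sub>R e \<notin> \<Omega> \<or> p - T *\<^sub>R e \<notin> \<Omega>"
  shows "(LINT p|\<mu>. (\<psi> p)\<^sup>2) \<le> 2 * T\<^sup>2 * (LINT p|\<mu>. (norm (D\<psi> p))\<^sup>2)"
proof -
  note C = test_function_C1[OF \<psi>]
  note [measurable] = C1_grad_borel[OF C]
  obtain K where K: "K \<subseteq> \<Omega>" "\<And>p. p \<notin> K \<Longrightarrow> \<psi> p = 0" "\<And>p. p \<notin> K \<Longrightarrow> D\<psi> p = 0"
    using test_function_support[OF \<psi>] by metis
  define I where "I = (\<integral>\<^sup>+p. ennreal ((norm (D\<psi> p))\<^sup>2) \<partial>lborel)"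
  have dir: "ennreal ((\<psi> p)\<^sup>2) \<le> ennreal T * (\<integral>\<^sup>+t. ennreal (indicator {-T..T} t * (norm (D\<psi> (p + t *\<^sub>R e)))\<^sup>2) \<partial>lborel)" for p
  proof (cases "p \<in> \<Omega>")
    case False
    then have "p \<notin> K" using K(1) by blast
    then show ?thesis using K(2) by simp
  next
    case True
    define R where "R = (\<integral>\<^sup>+t. ennreal (indicator {-T..T} t * (norm (D\<psi> (p + t *\<^sub>R e)))\<^sup>2) \<partial>lborel)"
    show ?thesis
    proof (cases "p + T *\<^sub>R e \<in> \<Omega>")
      case False
      then have "\<psi> (p + T *\<^sub>R e) = 0" using K(1) K(2) by blast
      then have "ennreal ((\<psi> p)\<^sup>2) \<le> ennreal T * (\<integral>\<^sup>+t. ennreal (indicator {0..T} t * (norm (D\<psi> (p + t *\<^sub>R e)))\<^sup>2) \<partial>lborel)"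
        using C1_line_sq_le[OF C T e, of p] by simp
      also have "\<dots> \<le> ennreal T * R" unfolding R_def
        by (intro mult_left_mono nn_integral_mono ennreal_leI) (use T in \<open>auto simp: indicator_def\<close>)
      finally show ?thesis by (simp add: R_def)
    next
      \<comment> \<open>Here the point leaves backwards; the substitution t \<mapsto> -t places its
        segment in [-T, 0].\<close>
      case False': True
      then have "p + T *\<^sub>R (-e) \<notin> \<Omega>" using exit[OF True] by simp
      then have "\<psi> (p + T *\<^sub>R (-e)) = 0" using K(1) K(2) by blast
      then have "ennreal ((\<psi> p)\<^sup>2) \<le> ennreal T * (\<integral>\<^sup>+t. ennreal (indicator {0..T} t * (norm (D\<psi> (p + t *\<^sub>R (-e))))\<^sup>2) \<partial>lborel)"
        using C1_line_sq_le[OF C T, of "-e" p] e by simp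
      also have "(\<integral>\<^sup>+t. ennreal (indicator {0..T} t * (norm (D\<psi> (p + t *\<^sub>R (-e))))\<^sup>2) \<partial>lborel)
          = (\<integral>\<^sup>+t. ennreal (indicator {0..T} (-t) * (norm (D\<psi> (p + t *\<^sub>R e)))\<^sup>2) \<partial>lborel)"
        by (subst nn_integral_real_affine[where c="-1" and t=0]) auto
      also have "ennreal T * \<dots> \<le> ennreal T * R" unfolding R_def
        by (intro mult_left_mono nn_integral_mono ennreal_leI) (use T in \<open>auto simp: indicator_def\<close>)
      finally show ?thesis by (simp add: R_def)
    qed
  qed
  have "(\<integral>\<^sup>+p. ennreal ((\<psi> p)\<^sup>2) \<partial>lborel) \<le> (\<integral>\<^sup>+p. ennreal T * (\<integral>\<^sup>+t. ennreal (indicator {-T..T} t * (norm (D\<psi> (p + t *\<^sub>R e)))\<^sup>2) \<partial>lborel) \<partial>lborel)"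
    by (intro nn_integral_mono dir)
  also have "\<dots> = ennreal T * (\<integral>\<^sup>+p. (\<integral>\<^sup>+t. ennreal (indicator {-T..T} t * (norm (D\<psi> (p + t *\<^sub>R e)))\<^sup>2) \<partial>lborel) \<partial>lborel)"
    by (rule nn_integral_cmult) measurable
  also have "(\<integral>\<^sup>+p. (\<integral>\<^sup>+t. ennreal (indicator {-T..T} t * (norm (D\<psi> (p + t *\<^sub>R e)))\<^sup>2) \<partial>lborel) \<partial>lborel) =
     (\<integral>\<^sup>+t. (\<integral>\<^sup>+p. ennreal (indicator {-T..T} t * (norm (D\<psi> (p + t *\<^sub>R e)))\<^sup>2) \<partial>lborel) \<partial>lborel)"
    by (rule lborel_pair.Fubini'[symmetric]) measurable
  also have "\<dots> = (\<integral>\<^sup>+t. indicator {-T..T} t * I \<partial>lborel)"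
  proof (rule nn_integral_cong)
    fix t
    have "(\<integral>\<^sup>+p. ennreal (indicator {-T..T} t * (norm (D\<psi> (p + t *\<^sub>R e)))\<^sup>2) \<partial>lborel) =
       (\<integral>\<^sup>+p. indicator {-T..T} t * ennreal ((norm (D\<psi> (p + t *\<^sub>R e)))\<^sup>2) \<partial>lborel)"
      by (intro nn_integral_cong) (auto simp: indicator_def)
    also have "\<dots> = indicator {-T..T} t * (\<integral>\<^sup>+p. ennreal ((norm (D\<psi> (p + t *\<^sub>R e)))\<^sup>2) \<partial>lborel)"
      by (rule nn_integral_cmult) measurable
    also have "(\<integral>\<^sup>+p. ennreal ((norm (D\<psi> (p + t *\<^sub>R e)))\<^sup>2) \<partial>lborel) = I"
      unfolding I_def by (rule nn_integral_lborel_translate[where f="\<lambda>p. ennreal ((norm (D\<psi> p))\<^sup>2)"]) measurable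
    finally show "(\<integral>\<^sup>+p. ennreal (indicator {-T..T} t * (norm (D\<psi> (p + t *\<^sub>R e)))\<^sup>2) \<partial>lborel) = indicator {-T..T} t * I" .
  qed
  also have "\<dots> = ennreal (2 * T) * I" using T by (subst nn_integral_multc) auto
  also have "ennreal T * (ennreal (2 * T) * I) = ennreal (T * (2 * T)) * I"
    using T by (simp add: ennreal_mult mult.assoc)
  also have "T * (2 * T) = 2 * T\<^sup>2" by (simp add: power2_eq_square)
  finally have *: "(\<integral>\<^sup>+p. ennreal ((\<psi> p)\<^sup>2) \<partial>lborel) \<le> ennreal (2 * T\<^sup>2) * I" .
  have 1: "(\<integral>\<^sup>+p. ennreal ((\<psi> p)\<^sup>2) \<partial>lborel) = ennreal (LINT p|\<mu>. (\<psi> p)\<^sup>2)"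
  proof (subst nn_integral_mu_support[symmetric])
    show "ennreal ((\<psi> p)\<^sup>2) = 0" if "p \<notin> \<Omega>" for p using that K(1) K(2)[of p] by force
    show "(\<integral>\<^sup>+p. ennreal ((\<psi> p)\<^sup>2) \<partial>\<mu>) = ennreal (LINT p|\<mu>. (\<psi> p)\<^sup>2)"
      using L2_sq_integrable[OF test_L2(1)[OF \<psi>]] by (intro nn_integral_eq_integral) auto
  qed
  have 2: "I = ennreal (LINT p|\<mu>. (norm (D\<psi> p))\<^sup>2)"
    unfolding I_def
  proof (subst nn_integral_mu_support[symmetric])
    show "ennreal ((norm (D\<psi> p))\<^sup>2) = 0" if "p \<notin> \<Omega>" for p using that K(1) K(3)[of p] by force
    show "(\<integral>\<^sup>+p. ennreal ((norm (D\<psi> p))\<^sup>2) \<partial>\<mu>) = ennreal (LINT p|\<mu>. (norm (D\<psi> p))\<^sup>2)"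
      using L2_sq_integrable[OF test_L2(2)[OF \<psi>]] by (intro nn_integral_eq_integral) auto
  qed
  have "ennreal (LINT p|\<mu>. (\<psi> p)\<^sup>2) \<le> ennreal (2 * T\<^sup>2 * (LINT p|\<mu>. (norm (D\<psi> p))\<^sup>2))"
    using * unfolding 1 2 by (simp add: ennreal_mult)
  then show ?thesis by (subst (asm) ennreal_le_iff) auto
qed

text \<open>The square of \<psi> is bounded by a horizontal line integral, a function of y alone,
  and by a vertical one, a function of x alone. The product of the two bounds integrates to the
  product of their integrals.\<close>

lemma test_ladyzhenskaya:
  assumes \<psi>: "test_function \<Omega> \<psi> D\<psi>"
  shows "(LINT p|\<mu>. (\<psi> p) ^ 4) \<le> ((LINT p|\<mu>. (\<psi> p)\<^sup>2) + (LINT p|\<mu>. (norm (D\<psi> p))\<^sup>2))\<^sup>2"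
proof -
  note C = test_function_C1[OF \<psi>]
  note [measurable] = C1_grad_borel[OF C]
  obtain K where K: "compact K" "K \<subseteq> \<Omega>" "\<And>p. p \<notin> K \<Longrightarrow> \<psi> p = 0" "\<And>p. p \<notin> K \<Longrightarrow> D\<psi> p = 0"
    using test_function_support[OF \<psi>] by metis
  obtain R0 where R0: "\<And>p. p \<in> K \<Longrightarrow> norm p \<le> R0" using compact_imp_bounded[OF K(1)] by (auto simp: bounded_iff)
  define g where "g p = (\<psi> p)\<^sup>2 + (norm (D\<psi> p))\<^sup>2" for p
  have [measurable]: "g \<in> borel_measurable borel" unfolding g_def by measurable
  define G where "G = (\<integral>\<^sup>+p. ennreal (g p) \<partial>lborel)"
  have line: "ennreal ((\<psi> p)\<^sup>2) \<le> (\<integral>\<^sup>+t. ennreal (g (p + t *\<^sub>R e)) \<partial>lborel)" if e: "norm e = 1" for p e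
  proof -
    \<comment> \<open>Far enough for p - R e to lie outside the support, where the line estimate may
      start.\<close>
    define R where "R = \<bar>R0\<bar> + norm p + 1"
    have "R = norm (R *\<^sub>R e)" using e by (simp add: R_def)
    also have "\<dots> \<le> norm (p - R *\<^sub>R e) + norm p" using norm_triangle_ineq2[of "R *\<^sub>R e" p] by (simp add: norm_minus_commute)
    finally have "R0 < norm (p - R *\<^sub>R e)" by (simp add: R_def)
    then have "p - R *\<^sub>R e \<notin> K" using R0 leD by blast
    then show ?thesis unfolding g_def
      by (intro C1_line_product_le[OF C _ e, of R] K) (simp add: R_def)
  qed
  define a where "a y = (\<integral>\<^sup>+s. ennreal (g (s, y)) \<partial>lborel)" for y
  define b where "b x = (\<integral>\<^sup>+s. ennreal (g (x, s)) \<partial>lborel)" for x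
  have [measurable]: "a \<in> borel_measurable borel" "b \<in> borel_measurable borel"
    unfolding a_def b_def by measurable
  have la: "ennreal ((\<psi> (x, y))\<^sup>2) \<le> a y" for x y
  proof -
    have "ennreal ((\<psi> (x, y))\<^sup>2) \<le> (\<integral>\<^sup>+t. ennreal (g (x + 1 * t, y)) \<partial>lborel)"
      using line[of "(1, 0)" "(x, y)"] by simp
    also have "\<dots> = a y" unfolding a_def by (subst (2) nn_integral_real_affine[where c=1 and t=x]) auto
    finally show ?thesis .
  qed
  have lb: "ennreal ((\<psi> (x, y))\<^sup>2) \<le> b x" for x y
  proof -
    have "ennreal ((\<psi> (x, y))\<^sup>2) \<le> (\<integral>\<^sup>+t. ennreal (g (x, y + 1 * t)) \<partial>lborel)"
      using line[of "(0, 1)" "(x, y)"] by simp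
    also have "\<dots> = b x" unfolding b_def by (subst (2) nn_integral_real_affine[where c=1 and t=y]) auto
    finally show ?thesis .
  qed
  have Gb: "(\<integral>\<^sup>+x. b x \<partial>lborel) = G"
    unfolding G_def b_def lborel_prod[symmetric] by (rule lborel.nn_integral_fst) (simp add: lborel_prod)
  have Ga: "(\<integral>\<^sup>+y. a y \<partial>lborel) = G"
    unfolding G_def a_def lborel_prod[symmetric]
    by (rule lborel_pair.nn_integral_snd[where f="\<lambda>p. ennreal (g p)"]) (simp add: lborel_prod)
  have "(\<integral>\<^sup>+p. ennreal ((\<psi> p)^4) \<partial>lborel) = (\<integral>\<^sup>+x. (\<integral>\<^sup>+y. ennreal ((\<psi> (x, y))^4) \<partial>lborel) \<partial>lborel)"
    unfolding lborel_prod[symmetric] by (rule lborel.nn_integral_fst[symmetric]) (simp add: lborel_prod)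
  also have "\<dots> \<le> (\<integral>\<^sup>+x. (\<integral>\<^sup>+y. b x * a y \<partial>lborel) \<partial>lborel)"
  proof (intro nn_integral_mono)
    fix x y
    have "ennreal ((\<psi> (x, y))^4) = ennreal ((\<psi> (x, y))\<^sup>2) * ennreal ((\<psi> (x, y))\<^sup>2)"
      by (simp flip: ennreal_mult power_add)
    also have "\<dots> \<le> b x * a y" by (intro mult_mono la lb) auto
    finally show "ennreal ((\<psi> (x, y))^4) \<le> b x * a y" .
  qed
  also have "\<dots> = (\<integral>\<^sup>+x. b x * G \<partial>lborel)" by (subst nn_integral_cmult) (auto simp: Ga)
  also have "\<dots> = G * G" by (subst nn_integral_multc) (auto simp: Gb)
  finally have *: "(\<integral>\<^sup>+p. ennreal ((\<psi> p)^4) \<partial>lborel) \<le> G * G" .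
  have g0: "g p = 0" if "p \<notin> \<Omega>" for p using that K(2) K(3,4)[of p] by (force simp: g_def)
  have int: "integrable \<mu> (\<lambda>p. (\<psi> p)\<^sup>2)" "integrable \<mu> (\<lambda>p. (norm (D\<psi> p))\<^sup>2)"
    using L2_sq_integrable[OF test_L2(1)[OF \<psi>]] L2_sq_integrable[OF test_L2(2)[OF \<psi>]] by auto
  have int4: "integrable \<mu> (\<lambda>p. (\<psi> p)^4)"
    using L2_sq_integrable[OF continuous_L2[of "\<lambda>p. (\<psi> p)\<^sup>2"]] C1_grad_continuous(1)[OF C]
    by (auto intro!: continuous_intros)
  have 1: "(\<integral>\<^sup>+p. ennreal ((\<psi> p)^4) \<partial>lborel) = ennreal (LINT p|\<mu>. (\<psi> p)^4)"
  proof (subst nn_integral_mu_support[symmetric])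
    show "ennreal ((\<psi> p)^4) = 0" if "p \<notin> \<Omega>" for p using that K(2) K(3)[of p] by force
    show "(\<integral>\<^sup>+p. ennreal ((\<psi> p)^4) \<partial>\<mu>) = ennreal (LINT p|\<mu>. (\<psi> p)^4)"
      using int4 by (intro nn_integral_eq_integral) auto
  qed
  have 2: "G = ennreal ((LINT p|\<mu>. (\<psi> p)\<^sup>2) + (LINT p|\<mu>. (norm (D\<psi> p))\<^sup>2))"
    unfolding G_def
  proof (subst nn_integral_mu_support[symmetric])
    show "ennreal (g p) = 0" if "p \<notin> \<Omega>" for p using g0[OF that] by simp
    have "(\<integral>\<^sup>+p. ennreal (g p) \<partial>\<mu>) = ennreal (LINT p|\<mu>. g p)"
      using int by (intro nn_integral_eq_integral) (auto simp: g_def)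
    then show "(\<integral>\<^sup>+p. ennreal (g p) \<partial>\<mu>) = ennreal ((LINT p|\<mu>. (\<psi> p)\<^sup>2) + (LINT p|\<mu>. (norm (D\<psi> p))\<^sup>2))"
      using int by (simp add: g_def)
  qed
  show ?thesis using * unfolding 1 2
    by (subst (asm) ennreal_mult[symmetric]) (auto simp: power2_eq_square)
qed

lemma W0_poincare:
  assumes "W0 u G" and T: "0 \<le> T" and e: "norm e = 1"
    and exit: "\<And>p. p \<in> \<Omega> \<Longrightarrow> p + T *\<^sub>R e \<notin> \<Omega> \<or> p - T *\<^sub>R e \<notin> \<Omega>"
  shows "(LINT p|\<mu>. (u p)\<^sup>2) \<le> 2 * T\<^sup>2 * (LINT p|\<mu>. (norm (G p))\<^sup>2)"
proof -
  obtain \<psi> D\<psi> where \<psi>: "\<And>k. test_function \<Omega> (\<psi> k) (D\<psi> k)" "L2_lim \<mu> \<psi> u" "L2_lim \<mu> D\<psi> G"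
    using assms(1) unfolding W0_def by metis
  have 1: "(\<lambda>k. LINT p|\<mu>. (\<psi> k p)\<^sup>2) \<longlonglongrightarrow> (LINT p|\<mu>. (u p)\<^sup>2)"
    using L2_lim_norm_sq[OF \<psi>(2)] by simp
  show ?thesis
    by (rule LIMSEQ_le[OF 1 tendsto_mult_left[OF L2_lim_norm_sq[OF \<psi>(3)]]])
       (use test_poincare[OF \<psi>(1) T e exit] in blast)
qed

text \<open>Fourth powers are not continuous under L2 convergence, so the bound passes to the limit
  by Fatou's lemma along a subsequence that converges almost everywhere.\<close>

lemma W0_ladyzhenskaya:
  assumes "W0 u G"
  shows "integrable \<mu> (\<lambda>p. (u p)^4)" "(LINT p|\<mu>. (u p)^4) \<le> ((LINT p|\<mu>. (u p)\<^sup>2) + (LINT p|\<mu>. (norm (G p))\<^sup>2))\<^sup>2"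
proof -
  obtain \<psi>0 D\<psi>0 where \<psi>0: "\<And>k. test_function \<Omega> (\<psi>0 k) (D\<psi>0 k)" "L2_lim \<mu> \<psi>0 u" "L2_lim \<mu> D\<psi>0 G"
    using assms(1) unfolding W0_def by metis
  obtain r where r: "strict_mono (r::nat\<Rightarrow>nat)" "AE p in \<mu>. (\<lambda>k. \<psi>0 (r k) p) \<longlonglongrightarrow> u p"
    using L2_lim_AE_subseq[OF \<psi>0(2)] by blast
  define \<psi> where "\<psi> k = \<psi>0 (r k)" for k
  define D\<psi> where "D\<psi> k = D\<psi>0 (r k)" for k
  have \<psi>: "\<And>k. test_function \<Omega> (\<psi> k) (D\<psi> k)" "L2_lim \<mu> \<psi> u" "L2_lim \<mu> D\<psi> G"
    unfolding \<psi>_def[abs_def] D\<psi>_def[abs_def] using \<psi>0(1) L2_lim_subseq[OF \<psi>0(2) r(1)] L2_lim_subseq[OF \<psi>0(3) r(1)] by auto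
  define c where "c = ((LINT p|\<mu>. (u p)\<^sup>2) + (LINT p|\<mu>. (norm (G p))\<^sup>2))\<^sup>2"
  have lim: "(\<lambda>k. ((LINT p|\<mu>. (\<psi> k p)\<^sup>2) + (LINT p|\<mu>. (norm (D\<psi> k p))\<^sup>2))\<^sup>2) \<longlonglongrightarrow> c"
    unfolding c_def using L2_lim_norm_sq[OF \<psi>(2)] L2_lim_norm_sq[OF \<psi>(3)] by (auto intro!: tendsto_intros)
  \<comment> \<open>The bounds for the approximants merely converge to c, so Fatou's lemma is
    applied with a slack e that is removed at the end.\<close>
  have F: "integrable \<mu> (\<lambda>p. (u p)^4) \<and> (LINT p|\<mu>. (u p)^4) \<le> c + e" if e: "e > 0" for e
  proof (rule Fatou_integral[where f="\<lambda>k p. (\<psi> k p)^4"])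
    show "integrable \<mu> (\<lambda>p. (\<psi> k p)^4)" for k
      using L2_sq_integrable[OF continuous_L2[of "\<lambda>p. (\<psi> k p)\<^sup>2"]] C1_grad_continuous(1)[OF test_function_C1[OF \<psi>(1)]]
      by (auto intro!: continuous_intros)
    have [measurable]: "u \<in> borel_measurable \<mu>" using \<psi>(2) by (auto simp: L2_lim_def L2_def)
    show "(\<lambda>p. (u p)^4) \<in> borel_measurable \<mu>" by measurable
    show "AE p in \<mu>. (\<lambda>k. (\<psi> k p)^4) \<longlonglongrightarrow> (u p)^4"
      using r(2) unfolding \<psi>_def by eventually_elim (intro tendsto_intros)
    have "\<forall>\<^sub>F k in sequentially. ((LINT p|\<mu>. (\<psi> k p)\<^sup>2) + (LINT p|\<mu>. (norm (D\<psi> k p))\<^sup>2))\<^sup>2 < c + e"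
      using order_tendstoD(2)[OF lim, of "c + e"] e by simp
    then show "\<forall>\<^sub>F k in sequentially. (LINT p|\<mu>. (\<psi> k p)^4) \<le> c + e"
    proof eventually_elim
      case (elim k)
      show ?case using test_ladyzhenskaya[OF \<psi>(1), of k] elim by linarith
    qed
  qed auto
  show "integrable \<mu> (\<lambda>p. (u p)^4)" using F[of 1] by simp
  show "(LINT p|\<mu>. (u p)^4) \<le> ((LINT p|\<mu>. (u p)\<^sup>2) + (LINT p|\<mu>. (norm (G p))\<^sup>2))\<^sup>2"
  proof (rule field_le_epsilon)
    fix e :: real assume "0 < e"
    from F[OF this] show "(LINT p|\<mu>. (u p)^4) \<le> ((LINT p|\<mu>. (u p)\<^sup>2) + (LINT p|\<mu>. (norm (G p))\<^sup>2))\<^sup>2 + e"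
      by (simp add: c_def)
  qed
qed

end

section \<open>Functions with vanishing trace\<close>

text \<open>On a horizontal line, \<phi>^2 is at most twice its value on the graph plus 2 \<delta>
  times the gradient integral over the slice; integration across the width \<delta> produces both
  factors. The sign s selects the side of the graph.\<close>

lemma nn_integral_graph_strip:
  fixes c :: "real \<Rightarrow> real"
  assumes C: "C1_grad \<phi> D\<phi>" and c: "c \<in> borel_measurable borel" and Y: "Y \<in> sets borel" and s: "\<bar>s\<bar> = 1" and \<delta>: "0 < \<delta>"
  defines "T \<equiv> {p. snd p \<in> Y \<and> 0 < s * (fst p - c (snd p)) \<and> s * (fst p - c (snd p)) < \<delta>}"
  shows "(\<integral>\<^sup>+p. ennreal ((\<phi> p)\<^sup>2) * indicator T p \<partial>lborel) \<le>
     ennreal (2 * \<delta>) * (\<integral>\<^sup>+y. ennreal ((\<phi> (c y, y))\<^sup>2) * indicator Y y \<partial>lborel) +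
     ennreal (2 * \<delta>\<^sup>2) * (\<integral>\<^sup>+p. ennreal ((norm (D\<phi> p))\<^sup>2) * indicator T p \<partial>lborel)"
proof -
  note [measurable] = C1_grad_borel[OF C] c Y
  have s2: "s * s = 1" using s by (metis abs_mult_self_eq mult_1)
  have T[measurable]: "T \<in> sets borel"
  proof -
    have [measurable]: "(fst :: pt \<Rightarrow> real) \<in> borel_measurable borel" "(snd :: pt \<Rightarrow> real) \<in> borel_measurable borel"
      by (intro borel_measurable_continuous_onI continuous_intros)+
    have "T = {p \<in> space borel. snd p \<in> Y \<and> 0 < s * (fst p - c (snd p)) \<and> s * (fst p - c (snd p)) < \<delta>}" by (simp add: T_def)
    also have "\<dots> \<in> sets borel" by measurable
    finally show ?thesis .
  qed
  define J where "J y = (\<integral>\<^sup>+x. ennreal ((norm (D\<phi> (x, y)))\<^sup>2) * indicator T (x, y) \<partial>lborel)" for y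
  have [measurable]: "J \<in> borel_measurable borel" unfolding J_def by measurable
  have shift: "(\<integral>\<^sup>+x. f x \<partial>lborel) = (\<integral>\<^sup>+t. f (c y + s * t) \<partial>lborel)" if "f \<in> borel_measurable borel" for f y
    using nn_integral_real_affine[OF that, of s "c y"] s by auto
  have slice: "(\<integral>\<^sup>+x. ennreal ((\<phi> (x, y))\<^sup>2) * indicator T (x, y) \<partial>lborel) \<le>
      ennreal (2 * \<delta>) * (ennreal ((\<phi> (c y, y))\<^sup>2) * indicator Y y) + ennreal (2 * \<delta>\<^sup>2) * J y" for y
  proof (cases "y \<in> Y")
    case False
    then have "indicator T (x, y) = (0::ennreal)" for x by (simp add: T_def)
    then show ?thesis by simp
  next
    case True
    have ind: "indicator T (c y + s * t, y) = (indicator {0<..<\<delta>} t :: ennreal)" for t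
      using True s2 by (simp add: T_def indicator_def mult.assoc[symmetric])
    have Jy: "J y = (\<integral>\<^sup>+t. ennreal ((norm (D\<phi> (c y + s * t, y)))\<^sup>2) * indicator {0<..<\<delta>} t \<partial>lborel)"
      unfolding J_def by (subst shift[where y=y]) (auto simp: ind)
    have pt: "ennreal ((\<phi> (c y + s * t, y))\<^sup>2) \<le> ennreal (2 * (\<phi> (c y, y))\<^sup>2) + ennreal (2 * \<delta>) * J y" if t: "t \<in> {0<..<\<delta>}" for t
    proof -
      have i0: "ennreal ((\<phi> ((c y, y) + t *\<^sub>R (s, 0)) - \<phi> (c y, y))\<^sup>2) \<le> ennreal t *
          (\<integral>\<^sup>+\<tau>. ennreal (indicator {0..t} \<tau> * (norm (D\<phi> ((c y, y) + \<tau> *\<^sub>R (s, 0))))\<^sup>2) \<partial>lborel)"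
        by (rule C1_line_sq_le[OF C]) (use t s in \<open>auto simp: norm_prod_def\<close>)
      have i1: "(\<integral>\<^sup>+\<tau>. ennreal (indicator {0..t} \<tau> * (norm (D\<phi> ((c y, y) + \<tau> *\<^sub>R (s, 0))))\<^sup>2) \<partial>lborel) \<le> J y"
        unfolding Jy
      proof (rule nn_integral_mono_AE)
        \<comment> \<open>The strip does not contain the graph, so the end point \<tau> = 0 is
          discarded as a null set.\<close>
        have "AE \<tau> in lborel. \<tau> \<noteq> (0::real)" by (rule AE_lborel_singleton)
        then show "AE \<tau> in lborel. ennreal (indicator {0..t} \<tau> * (norm (D\<phi> ((c y, y) + \<tau> *\<^sub>R (s, 0))))\<^sup>2)
            \<le> ennreal ((norm (D\<phi> (c y + s * \<tau>, y)))\<^sup>2) * indicator {0<..<\<delta>} \<tau>"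
          by eventually_elim (use t in \<open>auto simp: indicator_def mult.commute\<close>)
      qed
      have "ennreal ((\<phi> ((c y, y) + t *\<^sub>R (s, 0)) - \<phi> (c y, y))\<^sup>2) \<le> ennreal t * J y"
        by (rule order_trans[OF i0 mult_left_mono[OF i1]]) simp
      also have "\<dots> \<le> ennreal \<delta> * J y" using t by (intro mult_right_mono ennreal_leI) auto
      finally have 1: "ennreal ((\<phi> (c y + s * t, y) - \<phi> (c y, y))\<^sup>2) \<le> ennreal \<delta> * J y" by (simp add: mult.commute)
      have "(\<phi> (c y + s * t, y))\<^sup>2 \<le> 2 * (\<phi> (c y, y))\<^sup>2 + 2 * (\<phi> (c y + s * t, y) - \<phi> (c y, y))\<^sup>2"
        using norm_add_sq_le[of "\<phi> (c y, y)" "\<phi> (c y + s * t, y) - \<phi> (c y, y)"] by simp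
      then have "ennreal ((\<phi> (c y + s * t, y))\<^sup>2) \<le> ennreal (2 * (\<phi> (c y, y))\<^sup>2 + 2 * (\<phi> (c y + s * t, y) - \<phi> (c y, y))\<^sup>2)"
        by (rule ennreal_leI)
      also have "\<dots> = ennreal (2 * (\<phi> (c y, y))\<^sup>2) + 2 * ennreal ((\<phi> (c y + s * t, y) - \<phi> (c y, y))\<^sup>2)"
        by (simp add: ennreal_mult)
      also have "\<dots> \<le> ennreal (2 * (\<phi> (c y, y))\<^sup>2) + 2 * (ennreal \<delta> * J y)"
        by (intro add_left_mono mult_left_mono 1) auto
      also have "2 * (ennreal \<delta> * J y) = ennreal (2 * \<delta>) * J y" using \<delta> by (simp add: ennreal_mult mult.assoc)
      finally show ?thesis .
    qed
    have "(\<integral>\<^sup>+x. ennreal ((\<phi> (x, y))\<^sup>2) * indicator T (x, y) \<partial>lborel) =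
        (\<integral>\<^sup>+t. ennreal ((\<phi> (c y + s * t, y))\<^sup>2) * indicator {0<..<\<delta>} t \<partial>lborel)"
      by (subst shift[where y=y]) (auto simp: ind)
    also have "\<dots> \<le> (\<integral>\<^sup>+t. (ennreal (2 * (\<phi> (c y, y))\<^sup>2) + ennreal (2 * \<delta>) * J y) * indicator {0<..<\<delta>} t \<partial>lborel)"
      by (intro nn_integral_mono) (use pt in \<open>auto simp: indicator_def\<close>)
    also have "\<dots> = (ennreal (2 * (\<phi> (c y, y))\<^sup>2) + ennreal (2 * \<delta>) * J y) * ennreal \<delta>"
      using \<delta> by (subst nn_integral_cmult_indicator) auto
    also have "\<dots> = ennreal (2 * (\<phi> (c y, y))\<^sup>2) * ennreal \<delta> + ennreal (2 * \<delta>) * J y * ennreal \<delta>"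
      by (rule distrib_right)
    also have "ennreal (2 * (\<phi> (c y, y))\<^sup>2) * ennreal \<delta> = ennreal (2 * \<delta>) * ennreal ((\<phi> (c y, y))\<^sup>2)"
      using \<delta> by (simp add: ennreal_mult mult_ac)
    also have "ennreal (2 * \<delta>) * J y * ennreal \<delta> = ennreal (2 * \<delta> * \<delta>) * J y"
      using \<delta> by (simp add: ennreal_mult mult_ac)
    finally show ?thesis using True by (simp add: power2_eq_square mult.assoc)
  qed
  have snd: "(\<integral>\<^sup>+p. f p \<partial>lborel) = (\<integral>\<^sup>+y. (\<integral>\<^sup>+x. f (x, y) \<partial>lborel) \<partial>lborel)" if "f \<in> borel_measurable borel" for f :: "pt \<Rightarrow> ennreal"
    unfolding lborel_prod[symmetric]
    by (rule lborel_pair.nn_integral_snd[where f=f, symmetric]) (use that in \<open>simp add: lborel_prod\<close>)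
  have "(\<integral>\<^sup>+p. ennreal ((\<phi> p)\<^sup>2) * indicator T p \<partial>lborel) \<le>
     (\<integral>\<^sup>+y. ennreal (2 * \<delta>) * (ennreal ((\<phi> (c y, y))\<^sup>2) * indicator Y y) + ennreal (2 * \<delta>\<^sup>2) * J y \<partial>lborel)"
    by (subst snd) (auto intro!: nn_integral_mono slice)
  also have "\<dots> = (\<integral>\<^sup>+y. ennreal (2 * \<delta>) * (ennreal ((\<phi> (c y, y))\<^sup>2) * indicator Y y) \<partial>lborel) + (\<integral>\<^sup>+y. ennreal (2 * \<delta>\<^sup>2) * J y \<partial>lborel)"
    by (rule nn_integral_add) measurable
  also have "(\<integral>\<^sup>+y. ennreal (2 * \<delta>) * (ennreal ((\<phi> (c y, y))\<^sup>2) * indicator Y y) \<partial>lborel) = ennreal (2 * \<delta>) * (\<integral>\<^sup>+y. ennreal ((\<phi> (c y, y))\<^sup>2) * indicator Y y \<partial>lborel)"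
    by (rule nn_integral_cmult) measurable
  also have "(\<integral>\<^sup>+y. ennreal (2 * \<delta>\<^sup>2) * J y \<partial>lborel) = ennreal (2 * \<delta>\<^sup>2) * (\<integral>\<^sup>+y. J y \<partial>lborel)"
    by (rule nn_integral_cmult) measurable
  also have "(\<integral>\<^sup>+y. J y \<partial>lborel) = (\<integral>\<^sup>+p. ennreal ((norm (D\<phi> p))\<^sup>2) * indicator T p \<partial>lborel)"
    unfolding J_def by (subst snd) auto
  finally show ?thesis .
qed

text \<open>Taken over the unit parameter interval instead of arc length, so that a quarter turn
  acts just by replacing the end points.\<close>

definition edge_energy :: "(pt \<Rightarrow> real) \<Rightarrow> pt \<Rightarrow> pt \<Rightarrow> real" where
  "edge_energy \<phi> a b = (LINT t:{0..1}|lborel. (\<phi> (linepath a b t))\<^sup>2)"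

lemma linepath_C1_continuous: "C1_grad \<phi> D\<phi> \<Longrightarrow> continuous_on A (\<lambda>t. \<phi> (linepath a b t))"
  by (rule continuous_on_compose2[OF C1_grad_continuous(1) continuous_on_linepath]) auto

lemma edge_energy_nonneg: "0 \<le> edge_energy \<phi> a b"
  unfolding edge_energy_def set_lebesgue_integral_def by (intro Bochner_Integration.integral_nonneg) (auto simp: indicator_def)

text \<open>Substitution of the edge parameter for the second coordinate, which has to increase
  along the edge.\<close>

lemma nn_integral_edge:
  assumes C: "C1_grad \<phi> D\<phi>" and c: "c \<in> borel_measurable borel" and ab: "snd a < snd b"
    and on: "\<And>t. t \<in> {0..1} \<Longrightarrow> c (snd a + t * (snd b - snd a)) = fst a + t * (fst b - fst a)"
  shows "(\<integral>\<^sup>+y. ennreal ((\<phi> (c y, y))\<^sup>2) * indicator {snd a..snd b} y \<partial>lborel) = ennreal ((snd b - snd a) * edge_energy \<phi> a b)"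
proof -
  note [measurable] = C1_grad_borel[OF C] c
  define d where "d = snd b - snd a"
  have d: "0 < d" using ab by (simp add: d_def)
  have lp: "linepath a b t = (fst a + t * (fst b - fst a), snd a + t * (snd b - snd a))" for t
    by (simp add: linepath_def prod_eq_iff algebra_simps)
  have "(\<integral>\<^sup>+y. ennreal ((\<phi> (c y, y))\<^sup>2) * indicator {snd a..snd b} y \<partial>lborel) =
     ennreal \<bar>d\<bar> * (\<integral>\<^sup>+t. ennreal ((\<phi> (c (snd a + d * t), snd a + d * t))\<^sup>2) * indicator {snd a..snd b} (snd a + d * t) \<partial>lborel)"
    by (rule nn_integral_real_affine) (use d in auto)
  also have "(\<integral>\<^sup>+t. ennreal ((\<phi> (c (snd a + d * t), snd a + d * t))\<^sup>2) * indicator {snd a..snd b} (snd a + d * t) \<partial>lborel) =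
     (\<integral>\<^sup>+t. ennreal (indicator {0..1} t *\<^sub>R (\<phi> (linepath a b t))\<^sup>2) \<partial>lborel)"
  proof (rule nn_integral_cong)
    fix t
    have "(snd a + d * t \<in> {snd a..snd b}) = (t \<in> {0..1})"
    proof -
      have "snd b = snd a + d" by (simp add: d_def)
      then show ?thesis using d by (auto simp: zero_le_mult_iff)
    qed
    then show "ennreal ((\<phi> (c (snd a + d * t), snd a + d * t))\<^sup>2) * indicator {snd a..snd b} (snd a + d * t) =
        ennreal (indicator {0..1} t *\<^sub>R (\<phi> (linepath a b t))\<^sup>2)"
      using on[of t] by (simp add: lp indicator_def d_def mult.commute)
  qed
  also have "\<dots> = ennreal (edge_energy \<phi> a b)"
    unfolding edge_energy_def set_lebesgue_integral_def
    by (intro nn_integral_eq_integral borel_integrable_compact compact_Icc continuous_intros linepath_C1_continuous[OF C])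
       (auto simp: indicator_def)
  also have "ennreal \<bar>d\<bar> * ennreal (edge_energy \<phi> a b) = ennreal (d * edge_energy \<phi> a b)"
    using d edge_energy_nonneg by (simp add: ennreal_mult)
  finally show ?thesis by (simp add: d_def)
qed

section \<open>Quarter turns of the plane\<close>

lemma pt_norm: "norm p = sqrt ((fst p)\<^sup>2 + (snd p)\<^sup>2)" for p :: pt
  by (cases p) (simp add: norm_Pair)

definition rot :: "pt \<Rightarrow> pt" where "rot p = (- snd p, fst p)"
definition irot :: "pt \<Rightarrow> pt" where "irot p = (snd p, - fst p)"

lemma rot_irot [simp]: "rot (irot p) = p" "irot (rot p) = p"
  by (simp_all add: rot_def irot_def)

lemma rot_linear: "bounded_linear rot" "bounded_linear irot"
  unfolding rot_def irot_def by (intro bounded_linear_Pair bounded_linear_minus bounded_linear_fst bounded_linear_snd)+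

lemma rot_adjoint: "rot p \<bullet> q = p \<bullet> irot q"
  by (simp add: rot_def irot_def inner_prod_def)

lemma norm_irot [simp]: "norm (irot p) = norm p"
  by (simp add: pt_norm irot_def add.commute)

lemma C1_grad_rot: "C1_grad \<phi> D\<phi> \<Longrightarrow> C1_grad (\<lambda>p. \<phi> (rot p)) (\<lambda>p. irot (D\<phi> (rot p)))"
  by (rule C1_grad_compose_linear[OF _ rot_linear(1) rot_adjoint rot_linear(2)])

text \<open>Tonelli in both orders, with the substitution y \<mapsto> -y in the inner
  integral.\<close>

lemma nn_integral_rot:
  assumes f: "f \<in> borel_measurable borel"
  shows "(\<integral>\<^sup>+p. f (rot p) \<partial>lborel) = (\<integral>\<^sup>+p. f p \<partial>lborel)"
proof -
  have r: "rot \<in> borel_measurable borel"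
    by (intro borel_measurable_continuous_onI linear_continuous_on rot_linear)
  have fr: "(\<lambda>p. f (rot p)) \<in> borel_measurable borel" by (rule measurable_compose[OF r f])
  have "(\<integral>\<^sup>+p. f (rot p) \<partial>lborel) = (\<integral>\<^sup>+x. (\<integral>\<^sup>+y. f (rot (x, y)) \<partial>lborel) \<partial>lborel)"
    unfolding lborel_prod[symmetric] by (rule lborel.nn_integral_fst[symmetric]) (use fr in \<open>simp add: lborel_prod\<close>)
  also have "\<dots> = (\<integral>\<^sup>+x. (\<integral>\<^sup>+y. f (y, x) \<partial>lborel) \<partial>lborel)"
  proof (rule nn_integral_cong)
    fix x :: real
    have m: "(\<lambda>y. f (y, x)) \<in> borel_measurable borel"
      by (rule measurable_compose[OF _ f]) (intro borel_measurable_continuous_onI continuous_intros)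
    show "(\<integral>\<^sup>+y. f (rot (x, y)) \<partial>lborel) = (\<integral>\<^sup>+y. f (y, x) \<partial>lborel)"
      using nn_integral_real_affine[OF m, of "-1" 0] by (simp add: rot_def)
  qed
  also have "\<dots> = (\<integral>\<^sup>+p. f p \<partial>lborel)"
    unfolding lborel_prod[symmetric]
    by (rule lborel_pair.nn_integral_snd[where f=f]) (use f in \<open>simp add: lborel_prod\<close>)
  finally show ?thesis .
qed

lemma edge_energy_rot: "edge_energy (\<lambda>p. \<phi> (rot p)) a b = edge_energy \<phi> (rot a) (rot b)"
proof -
  have "rot (linepath a b t) = linepath (rot a) (rot b) t" for t
    by (simp add: linepath_def rot_def)
  then show ?thesis by (simp add: edge_energy_def)
qed

text \<open>All edges are oriented counterclockwise; therefore a quarter turn respects the order of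
  the end points.\<close>

lemma boundary_edges_rot: "(a, b) \<in> boundary_edges \<rho> \<epsilon> \<Longrightarrow> (rot a, rot b) \<in> boundary_edges \<rho> \<epsilon>"
  unfolding boundary_edges_def inner_edges_def outer_edges_def Un_iff insert_iff empty_iff Pair_inject
  by (elim disjE conjE FalseE) (simp_all add: rot_def)

section \<open>The domain and the strips along its boundary\<close>

locale well =
  fixes \<rho> \<epsilon> :: real
  assumes rho: "0 < \<rho>" "\<rho> < 1" and eps: "0 < \<epsilon>" "\<epsilon> < 1/2" "\<epsilon> < 1 - \<rho>"
begin

lemma Om_iff: "p \<in> Om \<rho> \<epsilon> \<longleftrightarrow> \<bar>fst p\<bar> < 1 - \<epsilon> \<and> \<bar>snd p\<bar> < 1 - \<epsilon> \<and> \<rho> < \<bar>fst p\<bar> + \<bar>snd p\<bar> \<and> \<bar>fst p\<bar> + \<bar>snd p\<bar> < 1"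
  by (cases p) (simp add: Om_def max_abs_sum_diff)

sublocale plane_domain "Om \<rho> \<epsilon>"
proof
  have Om: "Om \<rho> \<epsilon> = {p. \<bar>fst p\<bar> < 1 - \<epsilon> \<and> \<bar>snd p\<bar> < 1 - \<epsilon> \<and> \<rho> < \<bar>fst p\<bar> + \<bar>snd p\<bar> \<and> \<bar>fst p\<bar> + \<bar>snd p\<bar> < 1}"
    using Om_iff by blast
  show "open (Om \<rho> \<epsilon>)"
    unfolding Om by (intro open_Collect_conj open_Collect_less continuous_intros)
  show "bounded (Om \<rho> \<epsilon>)"
    unfolding bounded_iff
  proof (intro exI ballI)
    fix p assume "p \<in> Om \<rho> \<epsilon>"
    then have "\<bar>fst p\<bar> + \<bar>snd p\<bar> < 1" by (simp add: Om_iff)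
    moreover have "norm p \<le> \<bar>fst p\<bar> + \<bar>snd p\<bar>" unfolding pt_norm by (rule sqrt_sum_squares_le_sum_abs)
    ultimately show "norm p \<le> 1" by simp
  qed
qed

text \<open>The bound \<epsilon> keeps the outer strip in the right half plane, the bound 1 -
  \<epsilon> - \<rho> keeps each strip away from the other boundary component, and the bound \<rho>
  ensures that close to the inner boundary |x| or |y| is smaller than \<rho>.\<close>

definition \<delta>\<^sub>0 :: real where "\<delta>\<^sub>0 = min \<epsilon> (min \<rho> (1 - \<epsilon> - \<rho>))"

lemma delta0: "0 < \<delta>\<^sub>0" "\<delta>\<^sub>0 \<le> \<epsilon>" "\<delta>\<^sub>0 \<le> \<rho>" "\<delta>\<^sub>0 \<le> 1 - \<epsilon> - \<rho>"
  using rho eps by (auto simp: \<delta>\<^sub>0_def)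

text \<open>Closeness to the boundary is measured by the slack in the defining inequalities, which
  is exactly what cut-offs built from affine functions can detect.\<close>

definition strip :: "real \<Rightarrow> pt set" where
  "strip \<delta> = {p \<in> Om \<rho> \<epsilon>. \<not> (\<bar>fst p\<bar> \<le> 1 - \<epsilon> - \<delta> \<and> \<bar>snd p\<bar> \<le> 1 - \<epsilon> - \<delta> \<and> \<bar>fst p\<bar> + \<bar>snd p\<bar> \<le> 1 - \<delta> \<and> \<rho> + \<delta> \<le> \<bar>fst p\<bar> + \<bar>snd p\<bar>)}"

lemma strip_borel [simp, measurable]: "strip \<delta> \<in> sets borel"
proof -
  have "strip \<delta> = Om \<rho> \<epsilon> - {p. \<bar>fst p\<bar> \<le> 1 - \<epsilon> - \<delta> \<and> \<bar>snd p\<bar> \<le> 1 - \<epsilon> - \<delta> \<and> \<bar>fst p\<bar> + \<bar>snd p\<bar> \<le> 1 - \<delta> \<and> \<rho> + \<delta> \<le> \<bar>fst p\<bar> + \<bar>snd p\<bar>}"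
    by (auto simp: strip_def)
  moreover have "closed {p::pt. \<bar>fst p\<bar> \<le> 1 - \<epsilon> - \<delta> \<and> \<bar>snd p\<bar> \<le> 1 - \<epsilon> - \<delta> \<and> \<bar>fst p\<bar> + \<bar>snd p\<bar> \<le> 1 - \<delta> \<and> \<rho> + \<delta> \<le> \<bar>fst p\<bar> + \<bar>snd p\<bar>}"
    by (intro closed_Collect_conj closed_Collect_le continuous_intros)
  ultimately show ?thesis by auto
qed

lemma strip_rot [simp]: "rot p \<in> strip \<delta> \<longleftrightarrow> p \<in> strip \<delta>"
  by (auto simp: strip_def rot_def Om_iff add.commute)

text \<open>
  The domain is invariant under quarter turns, so that only the right-hand part of its boundary has to be
  written as a graph over the second coordinate.
\<close>

definition outer_graph :: "real \<Rightarrow> real" where "outer_graph y = min (1 - \<epsilon>) (1 - \<bar>y\<bar>)"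

definition outer_strip :: "real \<Rightarrow> pt set" where
  "outer_strip \<delta> = {p. snd p \<in> {-(1 - \<epsilon>)<..<1 - \<epsilon>} \<and> 0 < (-1) * (fst p - outer_graph (snd p)) \<and> (-1) * (fst p - outer_graph (snd p)) < \<delta>}"

definition inner_strip :: "real \<Rightarrow> pt set" where
  "inner_strip \<delta> = {p. snd p \<in> {-\<rho><..<\<rho>} \<and> 0 < 1 * (fst p - (\<rho> - \<bar>snd p\<bar>)) \<and> 1 * (fst p - (\<rho> - \<bar>snd p\<bar>)) < \<delta>}"

lemma strips_subset:
  assumes "0 < \<delta>" "\<delta> \<le> \<delta>\<^sub>0" shows "outer_strip \<delta> \<subseteq> strip \<delta>" "inner_strip \<delta> \<subseteq> strip \<delta>"
proof -
  note d = assms delta0 rho eps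
  show "outer_strip \<delta> \<subseteq> strip \<delta>"
  proof
    fix p assume "p \<in> outer_strip \<delta>"
    then show "p \<in> strip \<delta>" using d
      unfolding outer_strip_def strip_def outer_graph_def Om_iff by (simp add: min_def split: if_splits; linarith)
  qed
  show "inner_strip \<delta> \<subseteq> strip \<delta>"
  proof
    fix p assume "p \<in> inner_strip \<delta>"
    then show "p \<in> strip \<delta>" using d
      unfolding inner_strip_def strip_def Om_iff by simp linarith
  qed
qed

text \<open>Some quarter turn brings the nearby piece of the boundary to the right-hand side, where
  it is a graph.\<close>

lemma strip_cover:
  assumes "0 < \<delta>" "\<delta> \<le> \<delta>\<^sub>0" "p \<in> strip \<delta>"
  shows "\<exists>k\<in>{0,1,2,3}. (irot ^^ k) p \<in> outer_strip \<delta> \<union> inner_strip \<delta>"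
proof -
  note d = assms(1,2) delta0 rho eps
  obtain x y where p: "p = (x, y)" by force
  have out: "(x, y) \<in> outer_strip \<delta>"
    if "\<bar>y\<bar> < 1 - \<epsilon>" "x < 1 - \<epsilon>" "x + \<bar>y\<bar> < 1" "1 - \<epsilon> - \<delta> < x \<or> 1 - \<delta> < x + \<bar>y\<bar>" for x y
    using that unfolding outer_strip_def outer_graph_def by (auto simp: min_def)
  have inn: "(x, y) \<in> inner_strip \<delta>" if "\<bar>y\<bar> < \<rho>" "\<rho> < x + \<bar>y\<bar>" "x + \<bar>y\<bar> < \<rho> + \<delta>" for x y
    using that unfolding inner_strip_def by auto
  have O: "\<bar>x\<bar> < 1 - \<epsilon>" "\<bar>y\<bar> < 1 - \<epsilon>" "\<rho> < \<bar>x\<bar> + \<bar>y\<bar>" "\<bar>x\<bar> + \<bar>y\<bar> < 1"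
    using assms(3) by (auto simp: p strip_def Om_iff)
  have "1 - \<epsilon> - \<delta> < \<bar>x\<bar> \<or> 1 - \<epsilon> - \<delta> < \<bar>y\<bar> \<or> 1 - \<delta> < \<bar>x\<bar> + \<bar>y\<bar> \<or> \<bar>x\<bar> + \<bar>y\<bar> < \<rho> + \<delta>"
    using assms(3) by (auto simp: p strip_def)
  then have "(x, y) \<in> outer_strip \<delta> \<union> inner_strip \<delta> \<or> (y, -x) \<in> outer_strip \<delta> \<union> inner_strip \<delta> \<or>
     (-x, -y) \<in> outer_strip \<delta> \<union> inner_strip \<delta> \<or> (-y, x) \<in> outer_strip \<delta> \<union> inner_strip \<delta>"
  proof (elim disjE)
    assume h: "1 - \<epsilon> - \<delta> < \<bar>x\<bar>"
    show ?thesis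
    proof (cases "0 \<le> x")
      case True then have "(x, y) \<in> outer_strip \<delta>" using h O by (intro out) auto
      then show ?thesis by blast
    next
      case False then have "(-x, -y) \<in> outer_strip \<delta>" using h O by (intro out) auto
      then show ?thesis by blast
    qed
  next
    assume h: "1 - \<epsilon> - \<delta> < \<bar>y\<bar>"
    show ?thesis
    proof (cases "0 \<le> y")
      case True then have "(y, -x) \<in> outer_strip \<delta>" using h O by (intro out) auto
      then show ?thesis by blast
    next
      case False then have "(-y, x) \<in> outer_strip \<delta>" using h O by (intro out) auto
      then show ?thesis by blast
    qed
  next
    assume h: "1 - \<delta> < \<bar>x\<bar> + \<bar>y\<bar>"
    show ?thesis
    proof (cases "0 \<le> x")
      case True then have "(x, y) \<in> outer_strip \<delta>" using h O by (intro out) auto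
      then show ?thesis by blast
    next
      case False then have "(-x, -y) \<in> outer_strip \<delta>" using h O by (intro out) auto
      then show ?thesis by blast
    qed
  next
    assume h: "\<bar>x\<bar> + \<bar>y\<bar> < \<rho> + \<delta>"
    show ?thesis
    proof (cases "\<bar>y\<bar> < \<rho>")
      case True
      show ?thesis
      proof (cases "0 \<le> x")
        case x: True then have "(x, y) \<in> inner_strip \<delta>" using h O True by (intro inn) auto
        then show ?thesis by blast
      next
        case x: False then have "(-x, -y) \<in> inner_strip \<delta>" using h O True by (intro inn) auto
        then show ?thesis by blast
      qed
    next
      case False
      \<comment> \<open>From |y| \<ge> \<rho> follows |x| < \<delta> \<le> \<rho>, so that a turn
        exchanging the coordinates puts the point beside the inner graph.\<close>
      then have "\<bar>x\<bar> < \<rho>" using h d by linarith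
      show ?thesis
      proof (cases "0 \<le> y")
        case y: True then have "(y, -x) \<in> inner_strip \<delta>" using h O \<open>\<bar>x\<bar> < \<rho>\<close> by (intro inn) auto
        then show ?thesis by blast
      next
        case y: False then have "(-y, x) \<in> inner_strip \<delta>" using h O \<open>\<bar>x\<bar> < \<rho>\<close> by (intro inn) auto
        then show ?thesis by blast
      qed
    qed
  qed
  moreover have "(irot ^^ 0) p = (x, y)" "(irot ^^ 1) p = (y, -x)" "(irot ^^ 2) p = (-x, -y)" "(irot ^^ 3) p = (-y, x)"
    by (simp_all add: p irot_def numeral_eq_Suc)
  ultimately show ?thesis by auto
qed

end

section \<open>Cut-off functions near the boundary\<close>

definition cutoff :: "real \<Rightarrow> (pt \<Rightarrow> real) \<Rightarrow> (pt \<Rightarrow> pt) \<Rightarrow> bool" where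
  "cutoff M \<zeta> D\<zeta> \<longleftrightarrow> C1_grad \<zeta> D\<zeta> \<and> (\<forall>p. 0 \<le> \<zeta> p \<and> \<zeta> p \<le> 1 \<and> norm (D\<zeta> p) \<le> M)"

lemma cutoff_mult:
  assumes "cutoff M \<zeta> D\<zeta>" "cutoff N \<eta> D\<eta>"
  shows "cutoff (M + N) (\<lambda>p. \<zeta> p * \<eta> p) (\<lambda>p. \<zeta> p *\<^sub>R D\<eta> p + \<eta> p *\<^sub>R D\<zeta> p)"
  unfolding cutoff_def
proof (intro conjI allI)
  fix p
  have c: "0 \<le> \<zeta> p" "\<zeta> p \<le> 1" "norm (D\<zeta> p) \<le> M" "0 \<le> \<eta> p" "\<eta> p \<le> 1" "norm (D\<eta> p) \<le> N"
    using assms unfolding cutoff_def by blast+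
  have "norm (\<zeta> p *\<^sub>R D\<eta> p + \<eta> p *\<^sub>R D\<zeta> p) \<le> norm (\<zeta> p *\<^sub>R D\<eta> p) + norm (\<eta> p *\<^sub>R D\<zeta> p)" by (rule norm_triangle_ineq)
  also have "\<dots> = \<zeta> p * norm (D\<eta> p) + \<eta> p * norm (D\<zeta> p)" using c by simp
  also have "\<dots> \<le> 1 * norm (D\<eta> p) + 1 * norm (D\<zeta> p)" using c by (intro add_mono mult_right_mono) auto
  finally show "norm (\<zeta> p *\<^sub>R D\<eta> p + \<eta> p *\<^sub>R D\<zeta> p) \<le> M + N" using c by simp
  show "0 \<le> \<zeta> p * \<eta> p" "\<zeta> p * \<eta> p \<le> 1" using c by (auto intro: mult_le_one)
qed (use assms in \<open>auto simp: cutoff_def intro: C1_grad_mult\<close>)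

lemma cutoff_compl: "cutoff M \<zeta> D\<zeta> \<Longrightarrow> cutoff M (\<lambda>p. 1 - \<zeta> p) (\<lambda>p. - D\<zeta> p)"
  using C1_grad_diff[OF C1_grad_const[of 1], of \<zeta> D\<zeta>] by (auto simp: cutoff_def)

text \<open>The step is 0 where the affine function is at most \<delta>/2 and 1 where it is at least
  \<delta>. The bound is 2 for the slope of the step times 4 / \<delta> for the gradient
  inside.\<close>

lemma cutoff_affine:
  assumes \<delta>: "0 < \<delta>" and ab: "\<bar>a\<bar> \<le> 1" "\<bar>b\<bar> \<le> 1"
  shows "\<exists>D. cutoff (8 / \<delta>) (\<lambda>p. smoothstep (2 * (a * fst p + b * snd p + c) / \<delta> - 1)) D"
proof -
  define \<phi> where "\<phi> p = (2 * a / \<delta>) * fst p + (2 * b / \<delta>) * snd p + (2 * c / \<delta> - 1)" for p :: pt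
  have C: "C1_grad (\<lambda>p. smoothstep (\<phi> p)) (\<lambda>p. smoothstep' (\<phi> p) *\<^sub>R (2 * a / \<delta>, 2 * b / \<delta>))"
    unfolding \<phi>_def by (rule C1_grad_smoothstep[OF C1_grad_affine])
  have n: "norm (2 * a / \<delta>, 2 * b / \<delta>) \<le> 4 / \<delta>"
  proof -
    have "norm (2 * a / \<delta>, 2 * b / \<delta>) \<le> \<bar>2 * a / \<delta>\<bar> + \<bar>2 * b / \<delta>\<bar>"
      unfolding pt_norm fst_conv snd_conv by (rule sqrt_sum_squares_le_sum_abs)
    also have "\<dots> \<le> 2 / \<delta> + 2 / \<delta>" using \<delta> ab by (intro add_mono) (auto simp: field_simps abs_mult)
    finally show ?thesis by simp
  qed
  have "norm (smoothstep' (\<phi> p) *\<^sub>R (2 * a / \<delta>, 2 * b / \<delta>)) \<le> 2 * (4 / \<delta>)" for p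
    using mult_mono[OF smoothstep'_le n, of "\<phi> p"] by (simp del: scaleR_Pair)
  with C have "cutoff (8 / \<delta>) (\<lambda>p. smoothstep (\<phi> p)) (\<lambda>p. smoothstep' (\<phi> p) *\<^sub>R (2 * a / \<delta>, 2 * b / \<delta>))"
    by (auto simp: cutoff_def smoothstep_bounds)
  moreover have "\<phi> p = 2 * (a * fst p + b * snd p + c) / \<delta> - 1" for p
    using \<delta> by (simp add: \<phi>_def field_simps)
  ultimately show ?thesis by auto
qed

context well
begin

text \<open>The graph estimate for both strips. The right outer graph consists of three edges, each
  contributing at most \<eta>; a strip thus contributes 2 \<delta> times 3 \<eta> and 2 \<delta>^2
  times the gradient integral, and there are two strips.\<close>

lemma strip_nn_bound:
  assumes C: "C1_grad \<phi> D\<phi>" and \<delta>: "0 < \<delta>" "\<delta> \<le> \<delta>\<^sub>0" and "0 \<le> \<eta>"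
    and edges: "\<And>a b. (a, b) \<in> boundary_edges \<rho> \<epsilon> \<Longrightarrow> edge_energy \<phi> a b \<le> \<eta>"
  defines "R \<equiv> \<lambda>\<delta> \<eta> D\<phi>. ennreal (12 * \<delta> * \<eta>) + ennreal (4 * \<delta>\<^sup>2) * (\<integral>\<^sup>+p. ennreal ((norm (D\<phi> p :: pt))\<^sup>2) * indicator (strip \<delta>) p \<partial>lborel)"
  shows "(\<integral>\<^sup>+p. ennreal ((\<phi> p)\<^sup>2) * indicator (outer_strip \<delta> \<union> inner_strip \<delta>) p \<partial>lborel) \<le> R \<delta> \<eta> D\<phi>"
proof -
  note [measurable] = C1_grad_borel[OF C]
  have og: "outer_graph \<in> borel_measurable borel" "(\<lambda>y. \<rho> - \<bar>y\<bar>) \<in> borel_measurable borel"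
    unfolding outer_graph_def by measurable
  define I where "I = (\<integral>\<^sup>+p. ennreal ((norm (D\<phi> p :: pt))\<^sup>2) * indicator (strip \<delta>) p \<partial>lborel)"
  have sub: "(\<integral>\<^sup>+p. ennreal ((norm (D\<phi> p))\<^sup>2) * indicator T p \<partial>lborel) \<le> I" if "T \<subseteq> strip \<delta>" for T
    unfolding I_def by (intro nn_integral_mono mult_left_mono) (use that in \<open>auto simp: indicator_def\<close>)
  have edge: "(\<integral>\<^sup>+y. ennreal ((\<phi> (c y, y))\<^sup>2) * indicator {l..u} y \<partial>lborel) \<le> ennreal \<eta>"
    if "((x0, l), (x1, u)) \<in> boundary_edges \<rho> \<epsilon>" "c \<in> borel_measurable borel" "l < u" "u - l \<le> 1"
       "\<And>t. t \<in> {0..1} \<Longrightarrow> c (l + t * (u - l)) = x0 + t * (x1 - x0)" for c x0 x1 l u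
  proof -
    have "(\<integral>\<^sup>+y. ennreal ((\<phi> (c y, y))\<^sup>2) * indicator {l..u} y \<partial>lborel) = ennreal ((u - l) * edge_energy \<phi> (x0, l) (x1, u))"
      using nn_integral_edge[OF C that(2), of "(x0, l)" "(x1, u)"] that by simp
    also have "\<dots> \<le> ennreal \<eta>"
      using mult_mono[OF \<open>u - l \<le> 1\<close> edges[OF that(1)]] edge_energy_nonneg by (intro ennreal_leI) auto
    finally show ?thesis .
  qed
  have out: "(\<integral>\<^sup>+y. ennreal ((\<phi> (outer_graph y, y))\<^sup>2) * indicator {-(1 - \<epsilon>)<..<1 - \<epsilon>} y \<partial>lborel) \<le> ennreal (3 * \<eta>)"
  proof -
    let ?f = "\<lambda>y. ennreal ((\<phi> (outer_graph y, y))\<^sup>2)"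
    have e1: "(\<integral>\<^sup>+y. ?f y * indicator {-(1 - \<epsilon>)..-\<epsilon>} y \<partial>lborel) \<le> ennreal \<eta>"
    proof (rule edge[OF _ og(1)])
      show "((\<epsilon>, -(1 - \<epsilon>)), (1 - \<epsilon>, -\<epsilon>)) \<in> boundary_edges \<rho> \<epsilon>" by (simp add: boundary_edges_def outer_edges_def)
      show "outer_graph (-(1 - \<epsilon>) + t * (-\<epsilon> - -(1 - \<epsilon>))) = \<epsilon> + t * (1 - \<epsilon> - \<epsilon>)" if "t \<in> {0..1}" for t
      proof -
        \<comment> \<open>Naming the product leaves a linear goal for the evaluation of minimum and
          absolute value.\<close>
        define z where "z = t * (1 - \<epsilon> - \<epsilon>)"
        have z: "t * (-\<epsilon> - -(1 - \<epsilon>)) = z" by (simp add: z_def algebra_simps)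
        have "0 \<le> z" "z \<le> 1 - \<epsilon> - \<epsilon>" using that eps by (auto simp: z_def intro: mult_left_le_one_le)
        then show ?thesis using eps unfolding z z_def[symmetric] outer_graph_def by (simp add: min_def abs_if)
      qed
    qed (use eps in auto)
    have e2: "(\<integral>\<^sup>+y. ?f y * indicator {-\<epsilon>..\<epsilon>} y \<partial>lborel) \<le> ennreal \<eta>"
    proof (rule edge[OF _ og(1)])
      show "((1 - \<epsilon>, -\<epsilon>), (1 - \<epsilon>, \<epsilon>)) \<in> boundary_edges \<rho> \<epsilon>" by (simp add: boundary_edges_def outer_edges_def)
      show "outer_graph (-\<epsilon> + t * (\<epsilon> - -\<epsilon>)) = 1 - \<epsilon> + t * (1 - \<epsilon> - (1 - \<epsilon>))" if "t \<in> {0..1}" for t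
      proof -
        define z where "z = t * (\<epsilon> - -\<epsilon>)"
        have "0 \<le> z" "z \<le> \<epsilon> - -\<epsilon>" using that eps by (auto simp: z_def intro: mult_left_le_one_le)
        then show ?thesis using eps unfolding z_def[symmetric] outer_graph_def by (simp add: min_def abs_if)
      qed
    qed (use eps in auto)
    have e3: "(\<integral>\<^sup>+y. ?f y * indicator {\<epsilon>..1 - \<epsilon>} y \<partial>lborel) \<le> ennreal \<eta>"
    proof (rule edge[OF _ og(1)])
      show "((1 - \<epsilon>, \<epsilon>), (\<epsilon>, 1 - \<epsilon>)) \<in> boundary_edges \<rho> \<epsilon>" by (simp add: boundary_edges_def outer_edges_def)
      show "outer_graph (\<epsilon> + t * (1 - \<epsilon> - \<epsilon>)) = 1 - \<epsilon> + t * (\<epsilon> - (1 - \<epsilon>))" if "t \<in> {0..1}" for t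
      proof -
        define z where "z = t * (1 - \<epsilon> - \<epsilon>)"
        have z: "t * (\<epsilon> - (1 - \<epsilon>)) = - z" by (simp add: z_def algebra_simps)
        have "0 \<le> z" "z \<le> 1 - \<epsilon> - \<epsilon>" using that eps by (auto simp: z_def intro: mult_left_le_one_le)
        then show ?thesis using eps unfolding z z_def[symmetric] outer_graph_def by (simp add: min_def abs_if)
      qed
    qed (use eps in auto)
    have "(\<integral>\<^sup>+y. ?f y * indicator {-(1 - \<epsilon>)<..<1 - \<epsilon>} y \<partial>lborel) \<le>
      (\<integral>\<^sup>+y. ?f y * indicator {-(1 - \<epsilon>)..-\<epsilon>} y + ?f y * indicator {-\<epsilon>..\<epsilon>} y + ?f y * indicator {\<epsilon>..1 - \<epsilon>} y \<partial>lborel)"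
      by (intro nn_integral_mono) (auto simp: indicator_def)
    also have "\<dots> = (\<integral>\<^sup>+y. ?f y * indicator {-(1 - \<epsilon>)..-\<epsilon>} y \<partial>lborel) + (\<integral>\<^sup>+y. ?f y * indicator {-\<epsilon>..\<epsilon>} y \<partial>lborel)
        + (\<integral>\<^sup>+y. ?f y * indicator {\<epsilon>..1 - \<epsilon>} y \<partial>lborel)"
      using og by (subst nn_integral_add; (subst nn_integral_add)?) auto
    also have "\<dots> \<le> ennreal \<eta> + ennreal \<eta> + ennreal \<eta>" by (intro add_mono e1 e2 e3)
    also have "\<dots> = ennreal (3 * \<eta>)" using \<open>0 \<le> \<eta>\<close> by (simp flip: ennreal_plus)
    finally show ?thesis .
  qed
  have inn: "(\<integral>\<^sup>+y. ennreal ((\<phi> (\<rho> - \<bar>y\<bar>, y))\<^sup>2) * indicator {-\<rho><..<\<rho>} y \<partial>lborel) \<le> ennreal (3 * \<eta>)"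
  proof -
    let ?f = "\<lambda>y. ennreal ((\<phi> (\<rho> - \<bar>y\<bar>, y))\<^sup>2)"
    have e1: "(\<integral>\<^sup>+y. ?f y * indicator {-\<rho>..0} y \<partial>lborel) \<le> ennreal \<eta>"
    proof (rule edge[OF _ og(2)])
      show "((0, -\<rho>), (\<rho>, 0)) \<in> boundary_edges \<rho> \<epsilon>" by (simp add: boundary_edges_def inner_edges_def)
      show "\<rho> - \<bar>-\<rho> + t * (0 - -\<rho>)\<bar> = 0 + t * (\<rho> - 0)" if "t \<in> {0..1}" for t
      proof -
        have "t * \<rho> \<le> \<rho>" using that rho by (auto intro: mult_left_le_one_le)
        then show ?thesis by simp
      qed
    qed (use rho in auto)
    have e2: "(\<integral>\<^sup>+y. ?f y * indicator {0..\<rho>} y \<partial>lborel) \<le> ennreal \<eta>"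
    proof (rule edge[OF _ og(2)])
      show "((\<rho>, 0), (0, \<rho>)) \<in> boundary_edges \<rho> \<epsilon>" by (simp add: boundary_edges_def inner_edges_def)
      show "\<rho> - \<bar>0 + t * (\<rho> - 0)\<bar> = \<rho> + t * (0 - \<rho>)" if "t \<in> {0..1}" for t
        using that rho by simp
    qed (use rho in auto)
    have "(\<integral>\<^sup>+y. ?f y * indicator {-\<rho><..<\<rho>} y \<partial>lborel) \<le>
      (\<integral>\<^sup>+y. ?f y * indicator {-\<rho>..0} y + ?f y * indicator {0..\<rho>} y \<partial>lborel)"
      by (intro nn_integral_mono) (auto simp: indicator_def)
    also have "\<dots> = (\<integral>\<^sup>+y. ?f y * indicator {-\<rho>..0} y \<partial>lborel) + (\<integral>\<^sup>+y. ?f y * indicator {0..\<rho>} y \<partial>lborel)"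
      by (rule nn_integral_add) auto
    also have "\<dots> \<le> ennreal \<eta> + ennreal \<eta>" by (intro add_mono e1 e2)
    \<comment> \<open>The inner graph has two edges; the larger factor gives both strips the same
      constants.\<close>
    also have "\<dots> \<le> ennreal (3 * \<eta>)" using \<open>0 \<le> \<eta>\<close> by (simp flip: ennreal_plus add: ennreal_leI)
    finally show ?thesis .
  qed
  have bnd: "ennreal (2 * \<delta>) * a + ennreal (2 * \<delta>\<^sup>2) * b \<le> ennreal (6 * \<delta> * \<eta>) + ennreal (2 * \<delta>\<^sup>2) * I"
    if "a \<le> ennreal (3 * \<eta>)" "b \<le> I" for a b
  proof -
    have "ennreal (2 * \<delta>) * ennreal (3 * \<eta>) = ennreal (6 * \<delta> * \<eta>)"
      using \<delta> \<open>0 \<le> \<eta>\<close> by (subst ennreal_mult[symmetric]) auto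
    then show ?thesis using add_mono[OF mult_left_mono[OF that(1), of "ennreal (2 * \<delta>)"] mult_left_mono[OF that(2), of "ennreal (2 * \<delta>\<^sup>2)"]]
      by simp
  qed
  have T1: "(\<integral>\<^sup>+p. ennreal ((\<phi> p)\<^sup>2) * indicator (outer_strip \<delta>) p \<partial>lborel) \<le> ennreal (6 * \<delta> * \<eta>) + ennreal (2 * \<delta>\<^sup>2) * I"
    using order_trans[OF nn_integral_graph_strip[OF C og(1), of "{-(1 - \<epsilon>)<..<1 - \<epsilon>}" "-1" \<delta>, folded outer_strip_def] bnd[OF out sub]]
      strips_subset[OF \<delta>] \<delta> by simp
  have T2: "(\<integral>\<^sup>+p. ennreal ((\<phi> p)\<^sup>2) * indicator (inner_strip \<delta>) p \<partial>lborel) \<le> ennreal (6 * \<delta> * \<eta>) + ennreal (2 * \<delta>\<^sup>2) * I"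
    using order_trans[OF nn_integral_graph_strip[OF C og(2), of "{-\<rho><..<\<rho>}" 1 \<delta>, folded inner_strip_def] bnd[OF inn sub]]
      strips_subset[OF \<delta>] \<delta> by simp
  have [measurable]: "(fst :: pt \<Rightarrow> real) \<in> borel_measurable borel" "(snd :: pt \<Rightarrow> real) \<in> borel_measurable borel"
    by (intro borel_measurable_continuous_onI continuous_intros)+
  note og[measurable]
  have "outer_strip \<delta> = {p \<in> space borel. snd p \<in> {-(1 - \<epsilon>)<..<1 - \<epsilon>} \<and> 0 < (-1) * (fst p - outer_graph (snd p)) \<and> (-1) * (fst p - outer_graph (snd p)) < \<delta>}"
     "inner_strip \<delta> = {p \<in> space borel. snd p \<in> {-\<rho><..<\<rho>} \<and> 0 < 1 * (fst p - (\<rho> - \<bar>snd p\<bar>)) \<and> 1 * (fst p - (\<rho> - \<bar>snd p\<bar>)) < \<delta>}"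
    by (simp_all add: outer_strip_def inner_strip_def)
  then have [measurable]: "outer_strip \<delta> \<in> sets borel" "inner_strip \<delta> \<in> sets borel"
    by (simp_all del: mult_1 mult_minus1)
  have "(\<integral>\<^sup>+p. ennreal ((\<phi> p)\<^sup>2) * indicator (outer_strip \<delta> \<union> inner_strip \<delta>) p \<partial>lborel) \<le>
     (\<integral>\<^sup>+p. ennreal ((\<phi> p)\<^sup>2) * indicator (outer_strip \<delta>) p + ennreal ((\<phi> p)\<^sup>2) * indicator (inner_strip \<delta>) p \<partial>lborel)"
    by (intro nn_integral_mono) (auto simp: indicator_def)
  also have "\<dots> = (\<integral>\<^sup>+p. ennreal ((\<phi> p)\<^sup>2) * indicator (outer_strip \<delta>) p \<partial>lborel) + (\<integral>\<^sup>+p. ennreal ((\<phi> p)\<^sup>2) * indicator (inner_strip \<delta>) p \<partial>lborel)"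
    by (rule nn_integral_add) measurable
  also have "\<dots> \<le> (ennreal (6 * \<delta> * \<eta>) + ennreal (2 * \<delta>\<^sup>2) * I) + (ennreal (6 * \<delta> * \<eta>) + ennreal (2 * \<delta>\<^sup>2) * I)"
    by (intro add_mono T1 T2)
  also have "\<dots> = (ennreal (6 * \<delta> * \<eta>) + ennreal (6 * \<delta> * \<eta>)) + (ennreal (2 * \<delta>\<^sup>2) + ennreal (2 * \<delta>\<^sup>2)) * I"
    by (simp only: distrib_right add_ac)
  also have "ennreal (6 * \<delta> * \<eta>) + ennreal (6 * \<delta> * \<eta>) = ennreal (12 * \<delta> * \<eta>)"
    using \<delta> \<open>0 \<le> \<eta>\<close> by (simp flip: ennreal_plus)
  also have "ennreal (2 * \<delta>\<^sup>2) + ennreal (2 * \<delta>\<^sup>2) = ennreal (4 * \<delta>\<^sup>2)"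
    by (simp flip: ennreal_plus)
  finally show ?thesis by (simp add: R_def I_def)
qed

text \<open>Induction on the number of quarter turns, with \<phi> replaced by its composition with
  \<open>rot\<close>; edges and strip are invariant. Measurability of the turned indicator is part
  of the claim because it is inherited through the same induction.\<close>

lemma strip_nn_bound_rot:
  assumes "C1_grad \<phi> D\<phi>" and \<delta>: "0 < \<delta>" "\<delta> \<le> \<delta>\<^sub>0" and "0 \<le> \<eta>"
    and "\<And>a b. (a, b) \<in> boundary_edges \<rho> \<epsilon> \<Longrightarrow> edge_energy \<phi> a b \<le> \<eta>"
  shows "(\<integral>\<^sup>+p. ennreal ((\<phi> p)\<^sup>2) * indicator (outer_strip \<delta> \<union> inner_strip \<delta>) ((irot ^^ k) p) \<partial>lborel)
     \<le> ennreal (12 * \<delta> * \<eta>) + ennreal (4 * \<delta>\<^sup>2) * (\<integral>\<^sup>+p. ennreal ((norm (D\<phi> p :: pt))\<^sup>2) * indicator (strip \<delta>) p \<partial>lborel)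
    \<and> (\<lambda>p. indicator (outer_strip \<delta> \<union> inner_strip \<delta>) ((irot ^^ k) p) :: ennreal) \<in> borel_measurable borel"
  using assms(1,5)
proof (induction k arbitrary: \<phi> D\<phi>)
  case 0
  have [measurable]: "(fst :: pt \<Rightarrow> real) \<in> borel_measurable borel" "(snd :: pt \<Rightarrow> real) \<in> borel_measurable borel"
    by (intro borel_measurable_continuous_onI continuous_intros)+
  have [measurable]: "outer_graph \<in> borel_measurable borel" unfolding outer_graph_def by measurable
  have "outer_strip \<delta> = {p \<in> space borel. snd p \<in> {-(1 - \<epsilon>)<..<1 - \<epsilon>} \<and> 0 < (-1) * (fst p - outer_graph (snd p)) \<and> (-1) * (fst p - outer_graph (snd p)) < \<delta>}"
     "inner_strip \<delta> = {p \<in> space borel. snd p \<in> {-\<rho><..<\<rho>} \<and> 0 < 1 * (fst p - (\<rho> - \<bar>snd p\<bar>)) \<and> 1 * (fst p - (\<rho> - \<bar>snd p\<bar>)) < \<delta>}"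
    by (simp_all add: outer_strip_def inner_strip_def)
  then have "outer_strip \<delta> \<in> sets borel" "inner_strip \<delta> \<in> sets borel"
    by (simp_all del: mult_1 mult_minus1)
  then show ?case using strip_nn_bound[OF 0(1) \<delta> assms(4) 0(2)] by simp
next
  case (Suc k)
  let ?T = "outer_strip \<delta> \<union> inner_strip \<delta>"
  note [measurable] = C1_grad_borel[OF Suc.prems(1)]
  have [measurable]: "irot \<in> borel_measurable borel"
    by (intro borel_measurable_continuous_onI linear_continuous_on rot_linear)
  have IH: "(\<integral>\<^sup>+p. ennreal ((\<phi> (rot p))\<^sup>2) * indicator ?T ((irot ^^ k) p) \<partial>lborel)
     \<le> ennreal (12 * \<delta> * \<eta>) + ennreal (4 * \<delta>\<^sup>2) * (\<integral>\<^sup>+p. ennreal ((norm (irot (D\<phi> (rot p))))\<^sup>2) * indicator (strip \<delta>) p \<partial>lborel)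
    \<and> (\<lambda>p. indicator ?T ((irot ^^ k) p) :: ennreal) \<in> borel_measurable borel"
    by (rule Suc.IH[OF C1_grad_rot[OF Suc.prems(1)]])
       (auto simp: edge_energy_rot intro: Suc.prems(2) boundary_edges_rot)
  have m0: "(\<lambda>p. indicator ?T ((irot ^^ k) p) :: ennreal) \<in> borel_measurable borel" using IH by blast
  have m: "(\<lambda>p. indicator ?T ((irot ^^ Suc k) p) :: ennreal) \<in> borel_measurable borel"
    using measurable_compose[OF \<open>irot \<in> borel_measurable borel\<close> m0] by (simp add: funpow_swap1)
  have [measurable]: "(\<lambda>p. indicator ?T ((irot ^^ k) (irot p)) :: ennreal) \<in> borel_measurable borel"
    using m by (simp add: funpow_swap1)
  have eq: "(\<integral>\<^sup>+p. ennreal ((\<phi> (rot p))\<^sup>2) * indicator ?T ((irot ^^ k) p) \<partial>lborel) =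
     (\<integral>\<^sup>+p. ennreal ((\<phi> p)\<^sup>2) * indicator ?T ((irot ^^ Suc k) p) \<partial>lborel)"
    using nn_integral_rot[of "\<lambda>p. ennreal ((\<phi> p)\<^sup>2) * indicator ?T ((irot ^^ k) (irot p))"]
    by (simp add: funpow_swap1)
  have "(\<integral>\<^sup>+p. ennreal ((norm (irot (D\<phi> (rot p))))\<^sup>2) * indicator (strip \<delta>) p \<partial>lborel) =
      (\<integral>\<^sup>+p. ennreal ((norm (D\<phi> (rot p)))\<^sup>2) * indicator (strip \<delta>) (rot p) \<partial>lborel)"
    by (simp add: indicator_def)
  also have "\<dots> = (\<integral>\<^sup>+p. ennreal ((norm (D\<phi> p))\<^sup>2) * indicator (strip \<delta>) p \<partial>lborel)"
    by (rule nn_integral_rot[where f="\<lambda>p. ennreal ((norm (D\<phi> p))\<^sup>2) * indicator (strip \<delta>) p"]) measurable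
  finally show ?case using IH m unfolding eq by simp
qed

text \<open>
  The factor \<open>\<delta>\<^sup>2\<close> compensates the squared gradient of a cut-off at distance \<open>\<delta>\<close> from the boundary.
\<close>

lemma strip_bound:
  assumes C: "C1_grad \<phi> D\<phi>" and \<delta>: "0 < \<delta>" "\<delta> \<le> \<delta>\<^sub>0" and \<eta>: "0 \<le> \<eta>"
    and edges: "\<And>a b. (a, b) \<in> boundary_edges \<rho> \<epsilon> \<Longrightarrow> edge_energy \<phi> a b \<le> \<eta>"
  shows "(LINT p|\<mu>. indicator (strip \<delta>) p * (\<phi> p)\<^sup>2) \<le> 48 * \<delta> * \<eta> + 16 * \<delta>\<^sup>2 * (LINT p|\<mu>. indicator (strip \<delta>) p * (norm (D\<phi> p))\<^sup>2)"
proof -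
  let ?T = "outer_strip \<delta> \<union> inner_strip \<delta>"
  note [measurable] = C1_grad_borel[OF C]
  define J where "J = (LINT p|\<mu>. indicator (strip \<delta>) p * (norm (D\<phi> p))\<^sup>2)"
  have conv: "(\<integral>\<^sup>+p. ennreal ((norm (f p))\<^sup>2) * indicator (strip \<delta>) p \<partial>lborel) = ennreal (LINT p|\<mu>. indicator (strip \<delta>) p * (norm (f p))\<^sup>2)"
    if f: "L2 \<mu> f" for f :: "pt \<Rightarrow> 'b::euclidean_space"
  proof -
    have "(\<integral>\<^sup>+p. ennreal ((norm (f p))\<^sup>2) * indicator (strip \<delta>) p \<partial>lborel) = (\<integral>\<^sup>+p. ennreal ((norm (f p))\<^sup>2) * indicator (strip \<delta>) p \<partial>\<mu>)"
      by (rule nn_integral_mu_support[symmetric]) (auto simp: strip_def)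
    also have "\<dots> = (\<integral>\<^sup>+p. ennreal (indicator (strip \<delta>) p * (norm (f p))\<^sup>2) \<partial>\<mu>)"
      by (intro nn_integral_cong) (auto simp: indicator_def)
    also have "\<dots> = ennreal (LINT p|\<mu>. indicator (strip \<delta>) p * (norm (f p))\<^sup>2)"
    proof (rule nn_integral_eq_integral)
      have "strip \<delta> \<subseteq> Om \<rho> \<epsilon>" by (auto simp: strip_def)
      then have "strip \<delta> \<in> sets \<mu>" by (simp add: sets_restrict_space_iff)
      from integrable_mult_indicator[OF this L2_sq_integrable[OF f]]
      show "integrable \<mu> (\<lambda>p. indicator (strip \<delta>) p * (norm (f p))\<^sup>2)" by simp
    qed auto
    finally show ?thesis .
  qed
  have J0: "0 \<le> J" unfolding J_def by (intro Bochner_Integration.integral_nonneg) auto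
  define B where "B = 12 * \<delta> * \<eta> + 4 * \<delta>\<^sup>2 * J"
  have B0: "0 \<le> B" using \<delta> \<eta> J0 by (simp add: B_def)
  have k: "(\<integral>\<^sup>+p. ennreal ((\<phi> p)\<^sup>2) * indicator ?T ((irot ^^ k) p) \<partial>lborel) \<le> ennreal B"
    "(\<lambda>p. indicator ?T ((irot ^^ k) p) :: ennreal) \<in> borel_measurable borel" for k
  proof -
    have "ennreal (12 * \<delta> * \<eta>) + ennreal (4 * \<delta>\<^sup>2) * (\<integral>\<^sup>+p. ennreal ((norm (D\<phi> p))\<^sup>2) * indicator (strip \<delta>) p \<partial>lborel) = ennreal B"
      unfolding conv[OF C1_L2(2)[OF C]] J_def[symmetric] B_def using \<delta> \<eta> J0 by (simp add: ennreal_mult ennreal_plus)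
    then show "(\<integral>\<^sup>+p. ennreal ((\<phi> p)\<^sup>2) * indicator ?T ((irot ^^ k) p) \<partial>lborel) \<le> ennreal B"
      "(\<lambda>p. indicator ?T ((irot ^^ k) p) :: ennreal) \<in> borel_measurable borel"
      using strip_nn_bound_rot[OF C \<delta> \<eta> edges, of k] by simp_all
  qed
  note k(2)[measurable]
  have "ennreal (LINT p|\<mu>. indicator (strip \<delta>) p * (\<phi> p)\<^sup>2) = (\<integral>\<^sup>+p. ennreal ((\<phi> p)\<^sup>2) * indicator (strip \<delta>) p \<partial>lborel)"
    using conv[OF C1_L2(1)[OF C]] by simp
  \<comment> \<open>Four turned copies of the right-hand strips cover everything, which multiplies
    the constants 12 and 4 by four.\<close>
  also have "\<dots> \<le> (\<integral>\<^sup>+p. (\<Sum>k\<in>{0,1,2,3}. ennreal ((\<phi> p)\<^sup>2) * indicator ?T ((irot ^^ k) p)) \<partial>lborel)"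
  proof (rule nn_integral_mono)
    fix p
    show "ennreal ((\<phi> p)\<^sup>2) * indicator (strip \<delta>) p \<le> (\<Sum>k\<in>{0,1,2,3}. ennreal ((\<phi> p)\<^sup>2) * indicator ?T ((irot ^^ k) p))"
    proof (cases "p \<in> strip \<delta>")
      case True
      then obtain j where j: "j \<in> {0,1,2,3}" "(irot ^^ j) p \<in> ?T" using strip_cover[OF \<delta>] by blast
      have "ennreal ((\<phi> p)\<^sup>2) * indicator ?T ((irot ^^ j) p) \<le> (\<Sum>k\<in>{0,1,2,3}. ennreal ((\<phi> p)\<^sup>2) * indicator ?T ((irot ^^ k) p))"
        by (rule member_le_sum) (use j in auto)
      then show ?thesis using True j(2) by simp
    qed simp
  qed
  also have "\<dots> = (\<Sum>k\<in>{0,1,2,3}. \<integral>\<^sup>+p. ennreal ((\<phi> p)\<^sup>2) * indicator ?T ((irot ^^ k) p) \<partial>lborel)"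
    by (rule nn_integral_sum) measurable
  also have "\<dots> \<le> (\<Sum>k\<in>{0,1,2,3::nat}. ennreal B)" by (intro sum_mono k(1))
  also have "\<dots> = ennreal (4 * B)" using B0 by (simp add: ennreal_mult)
  finally have "(LINT p|\<mu>. indicator (strip \<delta>) p * (\<phi> p)\<^sup>2) \<le> 4 * B" using B0 by simp
  then show ?thesis by (simp add: B_def J_def algebra_simps)
qed

text \<open>A product of twelve smooth steps with gradients at most 8 / \<delta>, hence 96 /
  \<delta>. The outer region is an intersection of eight half planes and gives a plain product; the
  exterior of the inner square is a union of four, so complements are multiplied there.\<close>

lemma boundary_cutoff:
  assumes \<delta>: "0 < \<delta>"
  obtains \<zeta> D\<zeta> K where "C1_grad \<zeta> D\<zeta>" "\<And>p. 0 \<le> \<zeta> p \<and> \<zeta> p \<le> 1" "\<And>p. norm (D\<zeta> p) \<le> 96 / \<delta>"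
    "\<And>p. p \<in> Om \<rho> \<epsilon> \<Longrightarrow> p \<notin> strip \<delta> \<Longrightarrow> \<zeta> p = 1 \<and> D\<zeta> p = 0"
    "compact K" "K \<subseteq> Om \<rho> \<epsilon>" "\<And>p. p \<notin> K \<Longrightarrow> \<zeta> p = 0"
proof -
  define A where "A a b c p = smoothstep (2 * (a * fst p + b * snd p + c) / \<delta> - 1)" for a b c and p :: pt
  have cut: "\<exists>D. cutoff (8 / \<delta>) (A a b c) D" if "\<bar>a\<bar> \<le> 1" "\<bar>b\<bar> \<le> 1" for a b c
    unfolding A_def using cutoff_affine[OF \<delta> that] .
  have mult: "\<exists>D. cutoff (M + N) (\<lambda>p. f p * h p) D" if "\<exists>D. cutoff M f D" "\<exists>D. cutoff N h D" for M N f h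
    using that cutoff_mult by blast
  have compl: "\<exists>D. cutoff M (\<lambda>p. 1 - f p) D" if "\<exists>D. cutoff M f D" for M f
    using that cutoff_compl by blast
  define \<zeta> where "\<zeta> p = (A (-1) 0 (1-\<epsilon>) p * A 1 0 (1-\<epsilon>) p * (A 0 (-1) (1-\<epsilon>) p * A 0 1 (1-\<epsilon>) p)) *
     (A (-1) (-1) 1 p * A (-1) 1 1 p * (A 1 (-1) 1 p * A 1 1 1 p)) *
     (1 - ((1 - A 1 1 (-\<rho>) p) * (1 - A (-1) (-1) (-\<rho>) p) * ((1 - A 1 (-1) (-\<rho>) p) * (1 - A (-1) 1 (-\<rho>) p))))" for p
  have "\<exists>D. cutoff (((8/\<delta> + 8/\<delta>) + (8/\<delta> + 8/\<delta>)) + ((8/\<delta> + 8/\<delta>) + (8/\<delta> + 8/\<delta>)) + ((8/\<delta> + 8/\<delta>) + (8/\<delta> + 8/\<delta>))) \<zeta> D"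
    unfolding \<zeta>_def by (intro mult compl cut) auto
  then obtain D\<zeta> where D: "cutoff (96 / \<delta>) \<zeta> D\<zeta>" by auto
  have A1: "A a b c p = 1" if "\<delta> \<le> a * fst p + b * snd p + c" for a b c p
    unfolding A_def by (rule smoothstep_eq) (use that \<delta> in \<open>simp add: field_simps\<close>)
  have A0: "A a b c p = 0" if "a * fst p + b * snd p + c \<le> \<delta> / 2" for a b c p
    unfolding A_def by (rule smoothstep_eq) (use that \<delta> in \<open>simp add: field_simps\<close>)
  have \<zeta>1: "\<zeta> p = 1" if "p \<in> Om \<rho> \<epsilon>" "p \<notin> strip \<delta>" for p
  proof -
    have h: "\<bar>fst p\<bar> \<le> 1 - \<epsilon> - \<delta>" "\<bar>snd p\<bar> \<le> 1 - \<epsilon> - \<delta>" "\<bar>fst p\<bar> + \<bar>snd p\<bar> \<le> 1 - \<delta>" "\<rho> + \<delta> \<le> \<bar>fst p\<bar> + \<bar>snd p\<bar>"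
      using that by (auto simp: strip_def)
    have o: "A (-1) 0 (1-\<epsilon>) p = 1" "A 1 0 (1-\<epsilon>) p = 1" "A 0 (-1) (1-\<epsilon>) p = 1" "A 0 1 (1-\<epsilon>) p = 1"
      "A (-1) (-1) 1 p = 1" "A (-1) 1 1 p = 1" "A 1 (-1) 1 p = 1" "A 1 1 1 p = 1"
      by (rule A1; use h in linarith)+
    have "\<rho> + \<delta> \<le> fst p + snd p \<or> \<rho> + \<delta> \<le> - fst p - snd p \<or> \<rho> + \<delta> \<le> fst p - snd p \<or> \<rho> + \<delta> \<le> - fst p + snd p"
      using h(4) by linarith
    then have "A 1 1 (-\<rho>) p = 1 \<or> A (-1) (-1) (-\<rho>) p = 1 \<or> A 1 (-1) (-\<rho>) p = 1 \<or> A (-1) 1 (-\<rho>) p = 1"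
      using A1[of 1 p 1 "-\<rho>"] A1[of "-1" p "-1" "-\<rho>"] A1[of 1 p "-1" "-\<rho>"] A1[of "-1" p 1 "-\<rho>"] by auto
    then show ?thesis unfolding \<zeta>_def o by auto
  qed
  \<comment> \<open>Half the distance: the steps vanish up to slack \<delta>/2, so the support is
    compactly contained in the domain.\<close>
  define K where "K = {p::pt. \<bar>fst p\<bar> \<le> 1 - \<epsilon> - \<delta>/2 \<and> \<bar>snd p\<bar> \<le> 1 - \<epsilon> - \<delta>/2 \<and> \<bar>fst p\<bar> + \<bar>snd p\<bar> \<le> 1 - \<delta>/2 \<and> \<rho> + \<delta>/2 \<le> \<bar>fst p\<bar> + \<bar>snd p\<bar>}"
  have Ksub: "K \<subseteq> Om \<rho> \<epsilon>" using \<delta> by (auto simp: K_def Om_iff)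
  have "closed K" unfolding K_def by (intro closed_Collect_conj closed_Collect_le continuous_intros)
  then have "compact K" using bounded_subset[OF bounded_dom Ksub] by (simp add: compact_eq_bounded_closed)
  have \<zeta>0: "\<zeta> p = 0" if "p \<notin> K" for p
  proof (cases "\<rho> + \<delta>/2 \<le> \<bar>fst p\<bar> + \<bar>snd p\<bar>")
    case False
    have "A 1 1 (-\<rho>) p = 0" "A (-1) (-1) (-\<rho>) p = 0" "A 1 (-1) (-\<rho>) p = 0" "A (-1) 1 (-\<rho>) p = 0"
      by (rule A0; use False in linarith)+
    then show ?thesis unfolding \<zeta>_def by simp
  next
    case True
    then have "1 - \<epsilon> - \<delta>/2 < fst p \<or> 1 - \<epsilon> - \<delta>/2 < - fst p \<or> 1 - \<epsilon> - \<delta>/2 < snd p \<or> 1 - \<epsilon> - \<delta>/2 < - snd p \<or>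
       1 - \<delta>/2 < fst p + snd p \<or> 1 - \<delta>/2 < fst p - snd p \<or> 1 - \<delta>/2 < - fst p + snd p \<or> 1 - \<delta>/2 < - fst p - snd p"
      using that unfolding K_def by auto
    then have "A (-1) 0 (1-\<epsilon>) p = 0 \<or> A 1 0 (1-\<epsilon>) p = 0 \<or> A 0 (-1) (1-\<epsilon>) p = 0 \<or> A 0 1 (1-\<epsilon>) p = 0 \<or>
      A (-1) (-1) 1 p = 0 \<or> A (-1) 1 1 p = 0 \<or> A 1 (-1) 1 p = 0 \<or> A 1 1 1 p = 0"
      using A0[of "-1" p 0 "1-\<epsilon>"] A0[of 1 p 0 "1-\<epsilon>"] A0[of 0 p "-1" "1-\<epsilon>"] A0[of 0 p 1 "1-\<epsilon>"]
       A0[of "-1" p "-1" 1] A0[of "-1" p 1 1] A0[of 1 p "-1" 1] A0[of 1 p 1 1] by auto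
    then show ?thesis unfolding \<zeta>_def by auto
  qed
  have C: "C1_grad \<zeta> D\<zeta>" and b: "\<And>p. 0 \<le> \<zeta> p \<and> \<zeta> p \<le> 1" "\<And>p. norm (D\<zeta> p) \<le> 96 / \<delta>" using D by (auto simp: cutoff_def)
  have "D\<zeta> p = 0" if "\<zeta> p = 1" for p by (rule C1_grad_max_zero[OF C]) (use b(1) that in simp)
  with \<zeta>1 show ?thesis by (intro that[OF C b _ \<open>compact K\<close> Ksub \<zeta>0]) auto
qed

text \<open>Each point of the open domain eventually lies outside the shrinking strips, and
  dominated convergence applies.\<close>

lemma strip_integrals_tendsto:
  assumes f: "integrable \<mu> (f :: pt \<Rightarrow> real)" and d: "d \<longlonglongrightarrow> 0"
  shows "(\<lambda>n. LINT p|\<mu>. indicator (strip (d n)) p * f p) \<longlonglongrightarrow> 0"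
proof -
  have [measurable]: "f \<in> borel_measurable \<mu>" "\<And>n. indicator (strip (d n)) \<in> borel_measurable \<mu>"
    using f by (auto intro!: borel_measurable_mu)
  have "(\<lambda>n. LINT p|\<mu>. indicator (strip (d n)) p * f p) \<longlonglongrightarrow> (LINT p|\<mu>. 0)"
  proof (rule integral_dominated_convergence[where w="\<lambda>p. \<bar>f p\<bar>"])
    show "AE p in \<mu>. (\<lambda>n. indicator (strip (d n)) p * f p) \<longlonglongrightarrow> 0"
    proof (rule AE_I2)
      fix p assume "p \<in> space \<mu>"
      then have p: "p \<in> Om \<rho> \<epsilon>" by (simp add: space_restrict_space)
      define m where "m = min (1 - \<epsilon> - \<bar>fst p\<bar>) (min (1 - \<epsilon> - \<bar>snd p\<bar>) (min (1 - (\<bar>fst p\<bar> + \<bar>snd p\<bar>)) (\<bar>fst p\<bar> + \<bar>snd p\<bar> - \<rho>)))"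
      have "0 < m" using p by (auto simp: m_def Om_iff)
      then have "\<forall>\<^sub>F n in sequentially. d n < m" using order_tendstoD(2)[OF d] by blast
      then have "\<forall>\<^sub>F n in sequentially. indicator (strip (d n)) p * f p = 0"
        by eventually_elim (auto simp: strip_def m_def indicator_def)
      then show "(\<lambda>n. indicator (strip (d n)) p * f p) \<longlonglongrightarrow> 0" by (rule tendsto_eventually)
    qed
    show "AE p in \<mu>. norm (indicator (strip (d n)) p * f p) \<le> \<bar>f p\<bar>" for n
      by (auto simp: indicator_def)
  qed (use f in auto)
  then show ?thesis by simp
qed

text \<open>The gradient error splits into \<zeta> (D\<phi> - G), (\<zeta> - 1) G and \<phi>
  D\<zeta>. The last term is dangerous: its square carries 1 / \<delta>^2, which
  \<open>strip_bound\<close> compensates at the price of \<eta> / \<delta>.\<close>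

lemma cutoff_error:
  assumes C: "C1_grad \<phi> D\<phi>" and u: "L2 \<mu> u" and G: "L2 \<mu> G" and \<delta>: "0 < \<delta>" "\<delta> \<le> \<delta>\<^sub>0" and \<eta>: "0 \<le> \<eta>"
    and edges: "\<And>a b. (a, b) \<in> boundary_edges \<rho> \<epsilon> \<Longrightarrow> edge_energy \<phi> a b \<le> \<eta>"
  shows "\<exists>\<psi> D\<psi>. test_function (Om \<rho> \<epsilon>) \<psi> D\<psi> \<and>
    (LINT p|\<mu>. (norm (\<psi> p - u p))\<^sup>2) \<le> 2 * (LINT p|\<mu>. (norm (\<phi> p - u p))\<^sup>2) + 2 * (LINT p|\<mu>. indicator (strip \<delta>) p * (norm (u p))\<^sup>2) \<and>
    (LINT p|\<mu>. (norm (D\<psi> p - G p))\<^sup>2) \<le> 2000000 * ((LINT p|\<mu>. (norm (D\<phi> p - G p))\<^sup>2)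
       + (LINT p|\<mu>. indicator (strip \<delta>) p * (norm (G p))\<^sup>2) + \<eta> / \<delta>)"
proof -
  obtain \<zeta> D\<zeta> K where \<zeta>: "C1_grad \<zeta> D\<zeta>" "\<And>p. 0 \<le> \<zeta> p \<and> \<zeta> p \<le> 1" "\<And>p. norm (D\<zeta> p) \<le> 96 / \<delta>"
    "\<And>p. p \<in> Om \<rho> \<epsilon> \<Longrightarrow> p \<notin> strip \<delta> \<Longrightarrow> \<zeta> p = 1 \<and> D\<zeta> p = 0"
    "compact K" "K \<subseteq> Om \<rho> \<epsilon>" "\<And>p. p \<notin> K \<Longrightarrow> \<zeta> p = 0"
    using boundary_cutoff[OF \<delta>(1)] by blast
  define S :: "pt \<Rightarrow> real" where "S = indicator (strip \<delta>)"
  define \<psi> where "\<psi> p = \<phi> p * \<zeta> p" for p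
  define D\<psi> where "D\<psi> p = \<phi> p *\<^sub>R D\<zeta> p + \<zeta> p *\<^sub>R D\<phi> p" for p
  have "C1_grad \<psi> D\<psi>" unfolding \<psi>_def D\<psi>_def by (rule C1_grad_mult[OF C \<zeta>(1)])
  moreover have "\<forall>p. p \<notin> K \<longrightarrow> \<psi> p = 0" using \<zeta>(7) by (simp add: \<psi>_def)
  ultimately have test: "test_function (Om \<rho> \<epsilon>) \<psi> D\<psi>" unfolding test_function_def using \<zeta>(5,6) by blast
  have sub: "strip \<delta> \<subseteq> Om \<rho> \<epsilon>" by (auto simp: strip_def)
  have Sint: "integrable \<mu> (\<lambda>p. S p * f p)" if "integrable \<mu> f" for f :: "pt \<Rightarrow> real"
    using integrable_mult_indicator[OF _ that, of "strip \<delta>"] sub by (simp add: S_def sets_restrict_space_iff)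
  note L\<phi> = C1_L2(1)[OF C] and LD = C1_L2(2)[OF C]
  have iu: "integrable \<mu> (\<lambda>p. S p * (norm (u p))\<^sup>2)" and iG: "integrable \<mu> (\<lambda>p. S p * (norm (G p))\<^sup>2)"
    and i\<phi>: "integrable \<mu> (\<lambda>p. S p * (norm (\<phi> p))\<^sup>2)" and iD: "integrable \<mu> (\<lambda>p. S p * (norm (D\<phi> p))\<^sup>2)"
    by (intro Sint L2_sq_integrable u G L\<phi> LD)+
  have id: "integrable \<mu> (\<lambda>p. (norm (\<phi> p - u p))\<^sup>2)" "integrable \<mu> (\<lambda>p. (norm (D\<phi> p - G p))\<^sup>2)"
    by (intro L2_sq_integrable L2_diff u G L\<phi> LD)+
  have S1: "S p = 1 \<or> S p = 0 \<and> \<zeta> p = 1 \<and> D\<zeta> p = 0" if "p \<in> space \<mu>" for p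
    using \<zeta>(4)[of p] that by (auto simp: S_def indicator_def space_restrict_space)
  have scale: "(norm (a *\<^sub>R x))\<^sup>2 \<le> (norm x)\<^sup>2" if "\<bar>a\<bar> \<le> 1" for a and x :: "'b::real_normed_vector"
  proof -
    have "\<bar>a\<bar>\<^sup>2 \<le> 1\<^sup>2" using that by (intro power_mono) auto
    then show ?thesis by (simp add: power_mult_distrib mult_left_le_one_le)
  qed
  have scaleS: "(norm ((\<zeta> p - 1) *\<^sub>R x))\<^sup>2 \<le> S p * (norm x)\<^sup>2" if "p \<in> space \<mu>" for p and x :: "'b::real_normed_vector"
    using S1[OF that] scale[of "\<zeta> p - 1" x] \<zeta>(2)[of p] by (auto simp del: scaleR_left.diff norm_scaleR)
  have e1: "(LINT p|\<mu>. (norm (\<psi> p - u p))\<^sup>2) \<le> (LINT p|\<mu>. 2 * (norm (\<phi> p - u p))\<^sup>2 + 2 * (S p * (norm (u p))\<^sup>2))"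
  proof (rule integral_mono)
    fix p assume p: "p \<in> space \<mu>"
    have "\<psi> p - u p = \<zeta> p *\<^sub>R (\<phi> p - u p) + (\<zeta> p - 1) *\<^sub>R u p" by (simp add: \<psi>_def algebra_simps)
    then have "(norm (\<psi> p - u p))\<^sup>2 \<le> 2 * (norm (\<zeta> p *\<^sub>R (\<phi> p - u p)))\<^sup>2 + 2 * (norm ((\<zeta> p - 1) *\<^sub>R u p))\<^sup>2"
      by (simp only: norm_add_sq_le)
    also have "\<dots> \<le> 2 * (norm (\<phi> p - u p))\<^sup>2 + 2 * (S p * (norm (u p))\<^sup>2)"
      by (intro add_mono mult_left_mono scale scaleS p) (use \<zeta>(2)[of p] in auto)
    finally show "(norm (\<psi> p - u p))\<^sup>2 \<le> 2 * (norm (\<phi> p - u p))\<^sup>2 + 2 * (S p * (norm (u p))\<^sup>2)" .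
  next
    show "integrable \<mu> (\<lambda>p. (norm (\<psi> p - u p))\<^sup>2)" by (intro L2_sq_integrable L2_diff test_L2[OF test] u)
    show "integrable \<mu> (\<lambda>p. 2 * (norm (\<phi> p - u p))\<^sup>2 + 2 * (S p * (norm (u p))\<^sup>2))"
      by (intro Bochner_Integration.integrable_add integrable_mult_right id iu)
  qed
  have e2: "(LINT p|\<mu>. (norm (D\<psi> p - G p))\<^sup>2) \<le> (LINT p|\<mu>. 2 * (norm (D\<phi> p - G p))\<^sup>2 +
       2 * (2 * (S p * (norm (G p))\<^sup>2) + 2 * ((96 / \<delta>)\<^sup>2 * (S p * (norm (\<phi> p))\<^sup>2))))"
  proof (rule integral_mono)
    fix p assume p: "p \<in> space \<mu>"
    have eq: "D\<psi> p - G p = \<zeta> p *\<^sub>R (D\<phi> p - G p) + ((\<zeta> p - 1) *\<^sub>R G p + \<phi> p *\<^sub>R D\<zeta> p)" by (simp add: D\<psi>_def scaleR_diff_right scaleR_diff_left)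
    have z: "(norm (\<phi> p *\<^sub>R D\<zeta> p))\<^sup>2 \<le> (96 / \<delta>)\<^sup>2 * (S p * (norm (\<phi> p))\<^sup>2)"
    proof (cases "S p = 1")
      case True
      have "(norm (D\<zeta> p))\<^sup>2 \<le> (96 / \<delta>)\<^sup>2" by (intro power_mono \<zeta>(3)) auto
      then show ?thesis using True mult_right_mono[of "(norm (D\<zeta> p))\<^sup>2" "(96 / \<delta>)\<^sup>2" "(\<phi> p)\<^sup>2"]
        by (simp add: power_mult_distrib mult.commute)
    next
      case False then show ?thesis using S1[OF p] by auto
    qed
    have "(norm (D\<psi> p - G p))\<^sup>2 \<le> 2 * (norm (\<zeta> p *\<^sub>R (D\<phi> p - G p)))\<^sup>2 + 2 * (norm ((\<zeta> p - 1) *\<^sub>R G p + \<phi> p *\<^sub>R D\<zeta> p))\<^sup>2"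
      unfolding eq by (rule norm_add_sq_le)
    also have "\<dots> \<le> 2 * (norm (\<zeta> p *\<^sub>R (D\<phi> p - G p)))\<^sup>2 + 2 * (2 * (norm ((\<zeta> p - 1) *\<^sub>R G p))\<^sup>2 + 2 * (norm (\<phi> p *\<^sub>R D\<zeta> p))\<^sup>2)"
      by (intro add_left_mono mult_left_mono norm_add_sq_le) auto
    also have "\<dots> \<le> 2 * (norm (D\<phi> p - G p))\<^sup>2 + 2 * (2 * (S p * (norm (G p))\<^sup>2) + 2 * ((96 / \<delta>)\<^sup>2 * (S p * (norm (\<phi> p))\<^sup>2)))"
      by (intro add_mono mult_left_mono scale scaleS p z) (use \<zeta>(2)[of p] in auto)
    finally show "(norm (D\<psi> p - G p))\<^sup>2 \<le> 2 * (norm (D\<phi> p - G p))\<^sup>2 + 2 * (2 * (S p * (norm (G p))\<^sup>2) + 2 * ((96 / \<delta>)\<^sup>2 * (S p * (norm (\<phi> p))\<^sup>2)))" .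
  next
    show "integrable \<mu> (\<lambda>p. (norm (D\<psi> p - G p))\<^sup>2)" by (intro L2_sq_integrable L2_diff test_L2[OF test] G)
    show "integrable \<mu> (\<lambda>p. 2 * (norm (D\<phi> p - G p))\<^sup>2 + 2 * (2 * (S p * (norm (G p))\<^sup>2) + 2 * ((96 / \<delta>)\<^sup>2 * (S p * (norm (\<phi> p))\<^sup>2))))"
      by (intro Bochner_Integration.integrable_add integrable_mult_right id iG i\<phi>)
  qed
  have e3: "(LINT p|\<mu>. S p * (norm (D\<phi> p))\<^sup>2) \<le> (LINT p|\<mu>. 2 * (norm (D\<phi> p - G p))\<^sup>2 + 2 * (S p * (norm (G p))\<^sup>2))"
  proof (rule integral_mono[OF iD])
    show "integrable \<mu> (\<lambda>p. 2 * (norm (D\<phi> p - G p))\<^sup>2 + 2 * (S p * (norm (G p))\<^sup>2))"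
      by (intro Bochner_Integration.integrable_add integrable_mult_right id iG)
    show "S p * (norm (D\<phi> p))\<^sup>2 \<le> 2 * (norm (D\<phi> p - G p))\<^sup>2 + 2 * (S p * (norm (G p))\<^sup>2)" for p
      using norm_add_sq_le[of "D\<phi> p - G p" "G p"] by (auto simp: S_def indicator_def)
  qed
  define a where "a = (LINT p|\<mu>. (norm (D\<phi> p - G p))\<^sup>2)"
  define t where "t = (LINT p|\<mu>. S p * (norm (G p))\<^sup>2)"
  define w where "w = (LINT p|\<mu>. S p * (norm (\<phi> p))\<^sup>2)"
  have pos: "0 \<le> a" "0 \<le> t" unfolding a_def t_def S_def by (auto intro!: Bochner_Integration.integral_nonneg)
  have e2': "(LINT p|\<mu>. (norm (D\<psi> p - G p))\<^sup>2) \<le> 2 * a + 4 * t + 4 * (96 / \<delta>)\<^sup>2 * w"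
  proof -
    have "(LINT p|\<mu>. 2 * (norm (D\<phi> p - G p))\<^sup>2 + 2 * (2 * (S p * (norm (G p))\<^sup>2) + 2 * ((96 / \<delta>)\<^sup>2 * (S p * (norm (\<phi> p))\<^sup>2))))
      = 2 * a + 2 * (2 * t + 2 * ((96 / \<delta>)\<^sup>2 * w))"
      unfolding a_def t_def w_def using id iG i\<phi> by simp
    then show ?thesis using e2 by (simp add: mult.assoc)
  qed
  have e3': "(LINT p|\<mu>. S p * (norm (D\<phi> p))\<^sup>2) \<le> 2 * a + 2 * t"
  proof -
    have "(LINT p|\<mu>. 2 * (norm (D\<phi> p - G p))\<^sup>2 + 2 * (S p * (norm (G p))\<^sup>2)) = 2 * a + 2 * t"
      unfolding a_def t_def using id iG by simp
    then show ?thesis using e3 by linarith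
  qed
  have "w \<le> 48 * \<delta> * \<eta> + 16 * \<delta>\<^sup>2 * (LINT p|\<mu>. S p * (norm (D\<phi> p))\<^sup>2)"
    using strip_bound[OF C \<delta> \<eta> edges] by (simp add: w_def S_def)
  also have "\<dots> \<le> 48 * \<delta> * \<eta> + 16 * \<delta>\<^sup>2 * (2 * a + 2 * t)"
    by (intro add_left_mono mult_left_mono e3') auto
  \<comment> \<open>Division by \<delta>^2 turns \<delta> \<eta> into \<eta> / \<delta> and leaves
    the gradient terms bounded.\<close>
  finally have "(1 / \<delta>)\<^sup>2 * w \<le> (1 / \<delta>)\<^sup>2 * (48 * \<delta> * \<eta> + 16 * \<delta>\<^sup>2 * (2 * a + 2 * t))" by (intro mult_left_mono) auto
  also have "\<dots> = 48 * (\<eta> / \<delta>) + 32 * a + 32 * t" using \<delta>(1) by (simp add: field_simps power2_eq_square)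
  finally have w: "(1 / \<delta>)\<^sup>2 * w \<le> 48 * (\<eta> / \<delta>) + 32 * a + 32 * t" .
  have "4 * (96 / \<delta>)\<^sup>2 * w = 36864 * ((1 / \<delta>)\<^sup>2 * w)" by (simp add: power_divide)
  also have "\<dots> \<le> 36864 * (48 * (\<eta> / \<delta>) + 32 * a + 32 * t)" using w by (intro mult_left_mono) auto
  finally have "(LINT p|\<mu>. (norm (D\<psi> p - G p))\<^sup>2) \<le> 2 * a + 4 * t + 36864 * (48 * (\<eta> / \<delta>) + 32 * a + 32 * t)" using e2' by linarith
  \<comment> \<open>A round bound: the largest coefficient on the left is 36864 * 48, where 36864 =
    4 * 96^2.\<close>
  also have "\<dots> \<le> 2000000 * (a + t + \<eta> / \<delta>)"
  proof -
    have "2 * a + 4 * t + 36864 * (48 * q + 32 * a + 32 * t) \<le> 2000000 * (a + t + q)" if "0 \<le> q" for q :: real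
      using that pos by (simp add: distrib_left)
    moreover have "0 \<le> \<eta> / \<delta>" using \<delta> \<eta> by simp
    ultimately show ?thesis by blast
  qed
  finally have f2: "(LINT p|\<mu>. (norm (D\<psi> p - G p))\<^sup>2) \<le> 2000000 * (a + t + \<eta> / \<delta>)" .
  have f1: "(LINT p|\<mu>. (norm (\<psi> p - u p))\<^sup>2) \<le> 2 * (LINT p|\<mu>. (norm (\<phi> p - u p))\<^sup>2) + 2 * (LINT p|\<mu>. S p * (norm (u p))\<^sup>2)"
    using e1 id iu by simp
  show ?thesis using test f1 f2 unfolding a_def t_def S_def by blast
qed

text \<open>The order of the choices is essential: \<delta> is fixed first, making u and G small on
  the strip; then k is taken so large that the approximation errors and \<eta> / \<delta> are small
  too.\<close>

lemma zero_trace_W0: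
  assumes C: "\<And>k. C1_grad (\<phi> k) (D\<phi> k)" and u: "L2_lim \<mu> \<phi> u" and G: "L2_lim \<mu> D\<phi> G"
    and edges: "\<And>a b. (a, b) \<in> boundary_edges \<rho> \<epsilon> \<Longrightarrow> (\<lambda>k. edge_energy (\<phi> k) a b) \<longlonglongrightarrow> 0"
  shows "W0 u G"
proof -
  have L: "L2 \<mu> u" "L2 \<mu> G" using u G by (auto simp: L2_lim_def)
  define d where "d n = \<delta>\<^sub>0 / real (Suc n)" for n
  have d: "0 < d n" "d n \<le> \<delta>\<^sub>0" for n using delta0 by (auto simp: d_def field_simps)
  have d0: "d \<longlonglongrightarrow> 0"
    unfolding d_def using tendsto_mult_right[OF LIMSEQ_inverse_real_of_nat, of \<delta>\<^sub>0] by (simp add: field_simps)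
  define \<eta> where "\<eta> k = (\<Sum>(a, b)\<in>boundary_edges \<rho> \<epsilon>. edge_energy (\<phi> k) a b)" for k
  have fin: "finite (boundary_edges \<rho> \<epsilon>)" by (simp add: boundary_edges_def inner_edges_def outer_edges_def)
  have \<eta>: "0 \<le> \<eta> k" "(a, b) \<in> boundary_edges \<rho> \<epsilon> \<Longrightarrow> edge_energy (\<phi> k) a b \<le> \<eta> k" for k a b
  proof -
    show "0 \<le> \<eta> k" unfolding \<eta>_def by (intro sum_nonneg) (auto simp: edge_energy_nonneg)
    show "edge_energy (\<phi> k) a b \<le> \<eta> k" if "(a, b) \<in> boundary_edges \<rho> \<epsilon>"
      using member_le_sum[OF that, of "\<lambda>(a, b). edge_energy (\<phi> k) a b"] fin
      by (auto simp: \<eta>_def edge_energy_nonneg)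
  qed
  have \<eta>0: "\<eta> \<longlonglongrightarrow> 0"
    unfolding \<eta>_def by (rule tendsto_null_sum) (use edges in auto)
  have ex: "\<exists>\<psi> D\<psi>. test_function (Om \<rho> \<epsilon>) \<psi> D\<psi> \<and> (LINT p|\<mu>. (norm (\<psi> p - u p))\<^sup>2) \<le> e \<and> (LINT p|\<mu>. (norm (D\<psi> p - G p))\<^sup>2) \<le> e"
    if e: "0 < e" for e
  proof -
    have l1: "(\<lambda>n. 2 * (LINT p|\<mu>. indicator (strip (d n)) p * (norm (u p))\<^sup>2)) \<longlonglongrightarrow> 2 * 0"
     and l2: "(\<lambda>n. 2000000 * (LINT p|\<mu>. indicator (strip (d n)) p * (norm (G p))\<^sup>2)) \<longlonglongrightarrow> 2000000 * 0"
      by (intro tendsto_mult_left strip_integrals_tendsto L2_sq_integrable L d0)+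
    have "\<forall>\<^sub>F n in sequentially. 2 * (LINT p|\<mu>. indicator (strip (d n)) p * (norm (u p))\<^sup>2) < e/2 \<and>
       2000000 * (LINT p|\<mu>. indicator (strip (d n)) p * (norm (G p))\<^sup>2) < e/2"
      using e by (intro eventually_conj order_tendstoD(2)[OF l1] order_tendstoD(2)[OF l2]) auto
    then obtain n where n: "2 * (LINT p|\<mu>. indicator (strip (d n)) p * (norm (u p))\<^sup>2) < e/2"
       "2000000 * (LINT p|\<mu>. indicator (strip (d n)) p * (norm (G p))\<^sup>2) < e/2"
      using eventually_happens'[OF sequentially_bot] by blast
    have u0: "(\<lambda>k. LINT p|\<mu>. (norm (\<phi> k p - u p))\<^sup>2) \<longlonglongrightarrow> 0" and G0: "(\<lambda>k. LINT p|\<mu>. (norm (D\<phi> k p - G p))\<^sup>2) \<longlonglongrightarrow> 0"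
      using u G by (auto simp: L2_lim_def)
    have l3: "(\<lambda>k. 2 * (LINT p|\<mu>. (norm (\<phi> k p - u p))\<^sup>2)) \<longlonglongrightarrow> 2 * 0" by (intro tendsto_mult_left u0)
    have l4: "(\<lambda>k. 2000000 * ((LINT p|\<mu>. (norm (D\<phi> k p - G p))\<^sup>2) + \<eta> k / d n)) \<longlonglongrightarrow> 2000000 * (0 + 0 / d n)"
      by (intro tendsto_mult_left tendsto_add tendsto_divide G0 \<eta>0 tendsto_const) (use d[of n] in auto)
    have "\<forall>\<^sub>F k in sequentially. 2 * (LINT p|\<mu>. (norm (\<phi> k p - u p))\<^sup>2) < e/2 \<and>
        2000000 * ((LINT p|\<mu>. (norm (D\<phi> k p - G p))\<^sup>2) + \<eta> k / d n) < e/2"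
      using e by (intro eventually_conj order_tendstoD(2)[OF l3] order_tendstoD(2)[OF l4]) auto
    then obtain k where k: "2 * (LINT p|\<mu>. (norm (\<phi> k p - u p))\<^sup>2) < e/2"
       "2000000 * ((LINT p|\<mu>. (norm (D\<phi> k p - G p))\<^sup>2) + \<eta> k / d n) < e/2"
      using eventually_happens'[OF sequentially_bot] by blast
    from cutoff_error[OF C[of k] L d(1)[of n] d(2)[of n] \<eta>(1)[of k] \<eta>(2)[where k=k]]
    obtain \<psi> D\<psi> where \<psi>: "test_function (Om \<rho> \<epsilon>) \<psi> D\<psi>"
      "(LINT p|\<mu>. (norm (\<psi> p - u p))\<^sup>2) \<le> 2 * (LINT p|\<mu>. (norm (\<phi> k p - u p))\<^sup>2) + 2 * (LINT p|\<mu>. indicator (strip (d n)) p * (norm (u p))\<^sup>2)"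
      "(LINT p|\<mu>. (norm (D\<psi> p - G p))\<^sup>2) \<le> 2000000 * ((LINT p|\<mu>. (norm (D\<phi> k p - G p))\<^sup>2)
       + (LINT p|\<mu>. indicator (strip (d n)) p * (norm (G p))\<^sup>2) + \<eta> k / d n)" by blast
    have "(LINT p|\<mu>. (norm (\<psi> p - u p))\<^sup>2) \<le> e" using \<psi>(2) n(1) k(1) by linarith
    moreover have "(LINT p|\<mu>. (norm (D\<psi> p - G p))\<^sup>2) \<le> e"
      using \<psi>(3) n(2) k(2) unfolding distrib_left by linarith
    ultimately show ?thesis using \<psi>(1) by blast
  qed
  have "\<forall>n. \<exists>\<psi> D\<psi>. test_function (Om \<rho> \<epsilon>) \<psi> D\<psi> \<and> (LINT p|\<mu>. (norm (\<psi> p - u p))\<^sup>2) \<le> 1 / real (Suc n) \<and> (LINT p|\<mu>. (norm (D\<psi> p - G p))\<^sup>2) \<le> 1 / real (Suc n)"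
    by (intro allI ex) simp
  from choice[OF this] obtain \<psi> where "\<forall>n. \<exists>D\<psi>. test_function (Om \<rho> \<epsilon>) (\<psi> n) D\<psi> \<and>
    (LINT p|\<mu>. (norm (\<psi> n p - u p))\<^sup>2) \<le> 1 / real (Suc n) \<and> (LINT p|\<mu>. (norm (D\<psi> p - G p))\<^sup>2) \<le> 1 / real (Suc n)" by blast
  from choice[OF this] obtain D\<psi> where \<psi>: "\<And>n. test_function (Om \<rho> \<epsilon>) (\<psi> n) (D\<psi> n)"
    "\<And>n. (LINT p|\<mu>. (norm (\<psi> n p - u p))\<^sup>2) \<le> 1 / real (Suc n)" "\<And>n. (LINT p|\<mu>. (norm (D\<psi> n p - G p))\<^sup>2) \<le> 1 / real (Suc n)"
    by blast
  have z: "(\<lambda>n. 1 / real (Suc n)) \<longlonglongrightarrow> 0" using LIMSEQ_inverse_real_of_nat by (simp add: inverse_eq_divide)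
  have "(\<lambda>n. LINT p|\<mu>. (norm (\<psi> n p - u p))\<^sup>2) \<longlonglongrightarrow> 0"
    by (rule tendsto_sandwich[OF _ _ tendsto_const z]) (use \<psi> in auto)
  moreover have "(\<lambda>n. LINT p|\<mu>. (norm (D\<psi> n p - G p))\<^sup>2) \<longlonglongrightarrow> 0"
    by (rule tendsto_sandwich[OF _ _ tendsto_const z]) (use \<psi> in auto)
  ultimately have "L2_lim \<mu> \<psi> u" "L2_lim \<mu> D\<psi> G" unfolding L2_lim_def using L test_L2[OF \<psi>(1)] by blast+
  with \<psi>(1) show ?thesis unfolding W0_def by blast
qed

text \<open>Both sequences have the same limit in L2 of the edge. The length factor in the
  definition of the trace is divided out, which needs distinct end points.\<close>

lemma edge_energy_diff_tendsto:
  assumes C: "\<And>k. C1_grad (\<phi> k) (D\<phi> k)" "\<And>k. C1_grad (\<psi> k) (D\<psi> k)" and "a \<noteq> b"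
    and h: "L2_segment_tendsto a b \<phi> h" "L2_segment_tendsto a b \<psi> h"
  shows "(\<lambda>k. edge_energy (\<lambda>p. \<phi> k p - \<psi> k p) a b) \<longlonglongrightarrow> 0"
proof -
  let ?l = "linepath a b"
  let ?M = "restrict_space lborel {0..1::real}"
  have eq: "(LINT t:{0..1}|lborel. f t) = (LINT t|?M. f t)" for f :: "real \<Rightarrow> real"
    by (simp add: set_lebesgue_integral_def integral_restrict_space)
  have hL: "L2 ?M (\<lambda>t. h (?l t))"
    using h(1) by (simp add: L2_segment_tendsto_def L2_def set_borel_measurable_def set_integrable_def
        borel_measurable_restrict_space_iff integrable_restrict_space)
  have CL: "L2 ?M (\<lambda>t. f (?l t))" if "C1_grad f Df" for f Df
  proof -
    have "integrable lborel (\<lambda>t. indicator {0..1} t *\<^sub>R f (?l t))" "integrable lborel (\<lambda>t. indicator {0..1} t *\<^sub>R (f (?l t))\<^sup>2)"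
      by (intro borel_integrable_compact compact_Icc continuous_intros linepath_C1_continuous[OF that])+
    then show ?thesis
      by (simp add: L2_def borel_measurable_restrict_space_iff integrable_restrict_space borel_measurable_integrable)
  qed
  have lim: "L2_lim ?M (\<lambda>k t. \<phi> k (?l t)) (\<lambda>t. h (?l t))" if C: "\<And>k. C1_grad (\<phi> k) (D\<phi> k)" and h: "L2_segment_tendsto a b \<phi> h" for \<phi> D\<phi>
  proof -
    have "(\<lambda>k. (1 / dist a b) * (dist a b * (LINT t|?M. (\<phi> k (?l t) - h (?l t))\<^sup>2))) \<longlonglongrightarrow> (1 / dist a b) * 0"
      using h by (intro tendsto_mult_left) (simp add: L2_segment_tendsto_def eq)
    then have "(\<lambda>k. LINT t|?M. (\<phi> k (?l t) - h (?l t))\<^sup>2) \<longlonglongrightarrow> 0" using \<open>a \<noteq> b\<close> by simp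
    then show ?thesis using CL[OF C] hL by (simp add: L2_lim_def)
  qed
  from L2_lim_norm_sq[OF L2_lim_diff[OF lim[OF C(1) h(1)] lim[OF C(2) h(2)]]]
  show ?thesis by (simp add: edge_energy_def eq)
qed

text \<open>Equality of traces becomes membership in the closure of the test functions, where
  Poincare, Ladyzhenskaya and the weak equation can be used.\<close>

theorem same_trace_W0:
  assumes "has_trace (Om \<rho> \<epsilon>) (boundary_edges \<rho> \<epsilon>) u h" "has_trace (Om \<rho> \<epsilon>) (boundary_edges \<rho> \<epsilon>) v h"
  shows "W0 (\<lambda>p. u p - v p) (\<lambda>p. weak_grad (Om \<rho> \<epsilon>) u p - weak_grad (Om \<rho> \<epsilon>) v p)"
proof -
  obtain \<phi> D\<phi> where \<phi>: "\<And>k. C1_grad (\<phi> k) (D\<phi> k)" "L2_lim \<mu> \<phi> u" "L2_lim \<mu> D\<phi> (weak_grad (Om \<rho> \<epsilon>) u)"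
    "\<And>a b. (a, b) \<in> boundary_edges \<rho> \<epsilon> \<Longrightarrow> L2_segment_tendsto a b \<phi> h"
    using has_trace_obtain[OF assms(1)] by blast
  obtain \<psi> D\<psi> where \<psi>: "\<And>k. C1_grad (\<psi> k) (D\<psi> k)" "L2_lim \<mu> \<psi> v" "L2_lim \<mu> D\<psi> (weak_grad (Om \<rho> \<epsilon>) v)"
    "\<And>a b. (a, b) \<in> boundary_edges \<rho> \<epsilon> \<Longrightarrow> L2_segment_tendsto a b \<psi> h"
    using has_trace_obtain[OF assms(2)] by blast
  have ne: "a \<noteq> b" if "(a, b) \<in> boundary_edges \<rho> \<epsilon>" for a b
    using that rho eps unfolding boundary_edges_def inner_edges_def outer_edges_def Un_iff insert_iff empty_iff Pair_inject
    by (elim disjE conjE FalseE) auto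
  show ?thesis
    by (rule zero_trace_W0[OF C1_grad_diff[OF \<phi>(1) \<psi>(1)] L2_lim_diff[OF \<phi>(2) \<psi>(2)] L2_lim_diff[OF \<phi>(3) \<psi>(3)]])
       (rule edge_energy_diff_tendsto[OF \<phi>(1) \<psi>(1) ne \<phi>(4) \<psi>(4)])
qed

end

section \<open>Extension of the boundary data\<close>

text \<open>Continue affinely with the end slopes; clamping the argument of g' to the interval
  yields the derivative of the extension.\<close>

lemma C1_extension_interval:
  fixes g g' :: "real \<Rightarrow> real"
  assumes "a < b" and g: "\<And>t. t \<in> {a..b} \<Longrightarrow> (g has_real_derivative g' t) (at t within {a..b})"
    and cont: "continuous_on {a..b} g'"
  obtains G G' where "\<And>t. (G has_real_derivative G' t) (at t)" "continuous_on UNIV G'" "\<And>t. t \<in> {a..b} \<Longrightarrow> G t = g t"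
proof -
  define G' where "G' t = g' (max a (min b t))" for t
  have G'eq: "G' t = g' t" if "t \<in> {a..b}" for t using that by (simp add: G'_def min_absorb2)
  \<comment> \<open>Extension to the left comes first and to the right afterwards, so that each
    gluing joins two pieces at a single point.\<close>
  define h where "h t = (if t \<in> {..a} then g a + g' a * (t - a) else g t)" for t
  have h: "(h has_vector_derivative G' t) (at t within {..b})" if "t \<le> b" for t
  proof -
    have "(h has_vector_derivative (if t \<in> {..a} then G' t else G' t)) (at t within {..b})"
      unfolding h_def
    proof (rule has_vector_derivative_If_within_closures[where T="{a..b}"])
      show "t \<in> {..a} \<union> {a..b}" "{..b} = {..a} \<union> {a..b}" using that assms(1) by auto
      show "((\<lambda>t. g a + g' a * (t - a)) has_vector_derivative G' t) (at t within {..a} \<union> closure {..a} \<inter> closure {a..b})"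
        if "t \<in> {..a} \<union> closure {..a} \<inter> closure {a..b}"
      proof -
        have "G' t = g' a" using that assms(1) by (auto simp: G'_def)
        then show ?thesis
          unfolding has_real_derivative_iff_has_vector_derivative[symmetric] by (auto intro!: derivative_eq_intros)
      qed
      show "(g has_vector_derivative G' t) (at t within {a..b} \<union> closure {..a} \<inter> closure {a..b})"
        if "t \<in> {a..b} \<union> closure {..a} \<inter> closure {a..b}"
      proof -
        have "{a..b} \<union> closure {..a} \<inter> closure {a..b} = {a..b}" using assms(1) by auto
        then show ?thesis using g[of t] that G'eq[of t]
          by (simp add: has_real_derivative_iff_has_vector_derivative)
      qed
    qed (use assms(1) in auto)
    then show ?thesis by simp
  qed
  define G where "G t = (if t \<in> {..b} then h t else g b + g' b * (t - b))" for t
  have G: "(G has_vector_derivative G' t) (at t)" for t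
  proof -
    have "(G has_vector_derivative (if t \<in> {..b} then G' t else G' t)) (at t within UNIV)"
      unfolding G_def
    proof (rule has_vector_derivative_If_within_closures[where T="{b..}"])
      show "(h has_vector_derivative G' t) (at t within {..b} \<union> closure {..b} \<inter> closure {b..})"
        if "t \<in> {..b} \<union> closure {..b} \<inter> closure {b..}"
      proof -
        have "{..b} \<union> closure {..b} \<inter> closure {b..} = {..b}" by auto
        then show ?thesis using h[of t] that by simp
      qed
      show "((\<lambda>t. g b + g' b * (t - b)) has_vector_derivative G' t) (at t within {b..} \<union> closure {..b} \<inter> closure {b..})"
        if "t \<in> {b..} \<union> closure {..b} \<inter> closure {b..}"
      proof -
        have "G' t = g' b" using that assms(1) by (auto simp: G'_def)
        then show ?thesis
          unfolding has_real_derivative_iff_has_vector_derivative[symmetric] by (auto intro!: derivative_eq_intros)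
      qed
    qed (use assms(1) in \<open>auto simp: h_def\<close>)
    then show ?thesis by simp
  qed
  show ?thesis
  proof (rule that[of G G'])
    show "(G has_real_derivative G' t) (at t)" for t using G by (simp add: has_real_derivative_iff_has_vector_derivative)
    show "continuous_on UNIV G'"
      unfolding G'_def by (rule continuous_on_compose2[OF cont]) (use assms(1) in \<open>auto intro!: continuous_intros\<close>)
    show "G t = g t" if "t \<in> {a..b}" for t using that by (auto simp: G_def h_def)
  qed
qed

text \<open>Hides the gradient, so that introduction rules prove the C1 property of long
  expressions.\<close>

definition C1_fun :: "(pt \<Rightarrow> real) \<Rightarrow> bool" where "C1_fun \<phi> \<longleftrightarrow> (\<exists>D\<phi>. C1_grad \<phi> D\<phi>)"

lemma C1_fun_intros:
  "C1_fun (\<lambda>p. c)" "C1_fun fst" "C1_fun snd"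
  "C1_fun \<phi> \<Longrightarrow> C1_fun \<psi> \<Longrightarrow> C1_fun (\<lambda>p. \<phi> p + \<psi> p)"
  "C1_fun \<phi> \<Longrightarrow> C1_fun \<psi> \<Longrightarrow> C1_fun (\<lambda>p. \<phi> p - \<psi> p)"
  "C1_fun \<phi> \<Longrightarrow> C1_fun \<psi> \<Longrightarrow> C1_fun (\<lambda>p. \<phi> p * \<psi> p)"
  unfolding C1_fun_def
  using C1_grad_const C1_grad_affine[of 1 0 0] C1_grad_affine[of 0 1 0] C1_grad_add C1_grad_diff C1_grad_mult by (simp, blast)+

lemma C1_fun_uminus: "C1_fun \<phi> \<Longrightarrow> C1_fun (\<lambda>p. - \<phi> p)"
  using C1_fun_intros(5)[OF C1_fun_intros(1)[of 0], of \<phi>] by simp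

lemma C1_fun_compose:
  assumes "\<And>t. (h has_real_derivative h' t) (at t)" "continuous_on UNIV h'" "C1_fun \<phi>"
  shows "C1_fun (\<lambda>p. h (\<phi> p))"
  using C1_grad_compose[OF _ assms(1,2)] assms(3) unfolding C1_fun_def by blast

text \<open>A C1 substitute for the positive part.\<close>

definition pos_sq :: "real \<Rightarrow> real" where "pos_sq t = (max 0 t)\<^sup>2"

lemma pos_sq_derivative: "(pos_sq has_real_derivative 2 * max 0 t) (at t)"
proof -
  have "((\<lambda>t. if t \<le> 0 then 0 else t\<^sup>2) has_real_derivative 2 * max 0 t) (at t)"
    by (rule has_real_derivative_If_le) (auto intro!: derivative_eq_intros simp: max_def)
  moreover have "pos_sq = (\<lambda>t. if t \<le> 0 then 0 else t\<^sup>2)" by (auto simp: pos_sq_def fun_eq_iff max_def)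
  ultimately show ?thesis by simp
qed

lemma C1_fun_pos_sq: "C1_fun \<phi> \<Longrightarrow> C1_fun (\<lambda>p. pos_sq (\<phi> p))"
  by (rule C1_fun_compose[OF pos_sq_derivative]) (auto intro!: continuous_intros)

lemma C1_fun_smoothstep: "C1_fun \<phi> \<Longrightarrow> C1_fun (\<lambda>p. smoothstep (\<phi> p))"
  by (rule C1_fun_compose[OF smoothstep_derivative smoothstep'_continuous])

lemma smoothstep_symmetric: "smoothstep t + smoothstep (1 - t) = 1"
proof -
  have "3 * t\<^sup>2 - 2 * t ^ 3 + (3 * (1 - t)\<^sup>2 - 2 * (1 - t) ^ 3) = 1"
    by (simp add: power2_eq_square power3_eq_cube algebra_simps)
  then show ?thesis by (auto simp: smoothstep_def)
qed

section \<open>A C1 extension with the parity of the boundary data\<close>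

definition reflect :: "pt \<Rightarrow> pt" where "reflect p = (- fst p, snd p)"
definition reflect' :: "pt \<Rightarrow> pt" where "reflect' p = (fst p, - snd p)"

context well
begin

text \<open>Designed so that y * rescale x = \<epsilon> on the line x + y = 1 up to x = 1 -
  \<epsilon>, and rescale (1 - \<epsilon>) = 1. A profile evaluated at y * rescale x is thus the
  profile itself on the short edge and its end value on the long edge. Beyond 1 - \<epsilon> the
  tangent avoids the pole at x = 1.\<close>

definition rescale :: "real \<Rightarrow> real" where
  "rescale x = (if x \<le> 1 - \<epsilon> then \<epsilon> / (1 - x) else 1 + (x - (1 - \<epsilon>)) / \<epsilon>)"

lemma rescale_derivative: "(rescale has_real_derivative \<epsilon> / (1 - min x (1 - \<epsilon>))\<^sup>2) (at x)"
proof -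
  have "((\<lambda>x. if x \<le> 1 - \<epsilon> then \<epsilon> / (1 - x) else 1 + (x - (1 - \<epsilon>)) / \<epsilon>) has_real_derivative \<epsilon> / (1 - min x (1 - \<epsilon>))\<^sup>2) (at x)"
  proof (rule has_real_derivative_If_le)
    fix t assume "t \<le> 1 - \<epsilon>"
    then show "((\<lambda>x. \<epsilon> / (1 - x)) has_real_derivative \<epsilon> / (1 - min t (1 - \<epsilon>))\<^sup>2) (at t)"
      using eps by (auto intro!: derivative_eq_intros simp: power2_eq_square)
  next
    fix t assume "1 - \<epsilon> \<le> t"
    then show "((\<lambda>x. 1 + (x - (1 - \<epsilon>)) / \<epsilon>) has_real_derivative \<epsilon> / (1 - min t (1 - \<epsilon>))\<^sup>2) (at t)"
      using eps by (auto intro!: derivative_eq_intros simp: power2_eq_square)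
  qed (use eps in auto)
  then show ?thesis by (simp add: rescale_def[abs_def])
qed

lemma C1_fun_rescale: "C1_fun \<phi> \<Longrightarrow> C1_fun (\<lambda>p. rescale (\<phi> p))"
proof (rule C1_fun_compose[OF rescale_derivative])
  have "1 - min x (1 - \<epsilon>) \<noteq> 0" for x using eps by auto
  then show "continuous_on UNIV (\<lambda>x. \<epsilon> / (1 - min x (1 - \<epsilon>))\<^sup>2)" by (intro continuous_intros) auto
qed

text \<open>Blends the contributions of the two short edges adjacent to a long one. By the symmetry
  of the smooth step the weights add up to 1 on the long edge, and on a short edge its own weight
  alone survives.\<close>

definition weight :: "real \<Rightarrow> real" where "weight t = smoothstep ((t - \<epsilon>) / (1 - 2 * \<epsilon>))"

lemma weight_eq: "t \<le> \<epsilon> \<Longrightarrow> weight t = 0" "1 - \<epsilon> \<le> t \<Longrightarrow> weight t = 1" "weight t + weight (1 - t) = 1"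
proof -
  show "weight t = 0" if "t \<le> \<epsilon>"
    unfolding weight_def by (rule smoothstep_eq) (use that eps in \<open>auto simp: divide_nonpos_pos\<close>)
  show "weight t = 1" if "1 - \<epsilon> \<le> t"
    unfolding weight_def by (rule smoothstep_eq) (use that eps in \<open>auto simp: field_simps\<close>)
  have "(1 - t - \<epsilon>) / (1 - 2 * \<epsilon>) = 1 - (t - \<epsilon>) / (1 - 2 * \<epsilon>)" using eps by (simp add: field_simps)
  then show "weight t + weight (1 - t) = 1" unfolding weight_def using smoothstep_symmetric by simp
qed

text \<open>Interpolates from 0 on the inner square to 1 on the outer boundary. The four squared
  positive parts detect |x| + |y| > \<rho> in a C1 way and are permuted by the reflections.\<close>

definition ring :: "pt \<Rightarrow> real" where
  "ring p = smoothstep ((pos_sq (fst p + snd p - \<rho>) + pos_sq (- (fst p + snd p) - \<rho>) +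
      (pos_sq (fst p - snd p - \<rho>) + pos_sq (- (fst p - snd p) - \<rho>))) / (1 - \<epsilon> - \<rho>)\<^sup>2)"

lemma ring_inner: "\<bar>fst p\<bar> + \<bar>snd p\<bar> \<le> \<rho> \<Longrightarrow> ring p = 0"
proof -
  assume h: "\<bar>fst p\<bar> + \<bar>snd p\<bar> \<le> \<rho>"
  have "pos_sq (fst p + snd p - \<rho>) = 0" "pos_sq (- (fst p + snd p) - \<rho>) = 0" "pos_sq (fst p - snd p - \<rho>) = 0" "pos_sq (- (fst p - snd p) - \<rho>) = 0"
    using h by (auto simp: pos_sq_def max_def)
  then show ?thesis by (simp add: ring_def smoothstep_eq)
qed

lemma ring_outer: "1 - \<epsilon> \<le> \<bar>fst p\<bar> + \<bar>snd p\<bar> \<Longrightarrow> ring p = 1"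
proof -
  assume h: "1 - \<epsilon> \<le> \<bar>fst p\<bar> + \<bar>snd p\<bar>"
  define c where "c = 1 - \<epsilon> - \<rho>"
  have c: "0 < c" using eps by (simp add: c_def)
  have sq: "c\<^sup>2 \<le> pos_sq t" if "c \<le> t" for t using that c by (auto simp: pos_sq_def max_def intro!: power_mono)
  have p0: "0 \<le> pos_sq t" for t by (simp add: pos_sq_def)
  have "c \<le> fst p + snd p - \<rho> \<or> c \<le> - (fst p + snd p) - \<rho> \<or> c \<le> fst p - snd p - \<rho> \<or> c \<le> - (fst p - snd p) - \<rho>"
    using h unfolding c_def by linarith
  then have "c\<^sup>2 \<le> pos_sq (fst p + snd p - \<rho>) + pos_sq (- (fst p + snd p) - \<rho>) + (pos_sq (fst p - snd p - \<rho>) + pos_sq (- (fst p - snd p) - \<rho>))"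
    using sq[of "fst p + snd p - \<rho>"] sq[of "- (fst p + snd p) - \<rho>"] sq[of "fst p - snd p - \<rho>"] sq[of "- (fst p - snd p) - \<rho>"]
      p0[of "fst p + snd p - \<rho>"] p0[of "- (fst p + snd p) - \<rho>"] p0[of "fst p - snd p - \<rho>"] p0[of "- (fst p - snd p) - \<rho>"]
    by linarith
  then show ?thesis unfolding ring_def c_def[symmetric] by (intro smoothstep_eq) (use c in simp)
qed

text \<open>C1 on the whole plane, as approximants of traces must be, and with the parity of the
  boundary data, so that adding test functions gives a class invariant under reflections combined
  with the sign change of the first component.\<close>

lemma boundary_extension:
  assumes g: "admissible_profile s \<epsilon> g"
  obtains F1 D1 F3 D3 where "C1_grad F1 D1" "C1_grad F3 D3"
    "\<And>a b p. (a, b) \<in> boundary_edges \<rho> \<epsilon> \<Longrightarrow> p \<in> closed_segment a b \<Longrightarrow> F1 p = q1b s \<rho> \<epsilon> g p \<and> F3 p = q3b s \<rho> \<epsilon> p"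
    "\<And>p. F1 (reflect p) = - F1 p" "\<And>p. F1 (reflect' p) = - F1 p" "\<And>p. F3 (reflect p) = F3 p" "\<And>p. F3 (reflect' p) = F3 p"
proof -
  from g obtain g' where g': "continuous_on {-\<epsilon>..\<epsilon>} g'" "\<And>t. t \<in> {-\<epsilon>..\<epsilon>} \<Longrightarrow> (g has_real_derivative g' t) (at t within {-\<epsilon>..\<epsilon>})"
    and odd: "\<And>t. t \<in> {-\<epsilon>..\<epsilon>} \<Longrightarrow> g (- t) = - g t" and g_end: "g \<epsilon> = s/2"
    unfolding admissible_profile_def by blast
  have "-\<epsilon> < \<epsilon>" using eps by simp
  from C1_extension_interval[OF this g'(2) g'(1)]
  obtain G0 G0' where G0: "\<And>t. (G0 has_real_derivative G0' t) (at t)" "continuous_on UNIV G0'" "\<And>t. t \<in> {-\<epsilon>..\<epsilon>} \<Longrightarrow> G0 t = g t"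
    by blast
  \<comment> \<open>The odd part is odd on the whole line; on [-\<epsilon>, \<epsilon>] it still
    equals g, which is odd there.\<close>
  define G where "G t = (G0 t - G0 (- t)) / 2" for t
  have Geq: "G t = g t" if "t \<in> {-\<epsilon>..\<epsilon>}" for t
    using that G0(3)[of t] G0(3)[of "-t"] odd[of t] by (simp add: G_def)
  have Godd: "G (- t) = - G t" for t by (simp add: G_def minus_divide_left)
  have Gend: "G \<epsilon> = s/2" "G (-\<epsilon>) = - (s/2)" using Geq[of \<epsilon>] g_end eps Godd[of \<epsilon>] by auto
  have "C1_fun (\<lambda>p. G (\<phi> p))" if "C1_fun \<phi>" for \<phi>
  proof -
    have "C1_fun (\<lambda>p. (1/2) * (G0 (\<phi> p) - G0 (- \<phi> p)))"
      by (intro C1_fun_intros C1_fun_compose[OF G0(1,2)] C1_fun_uminus that)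
    then show ?thesis by (simp add: G_def)
  qed
  note C1_G = this
  \<comment> \<open>One term for each short edge, with the sign of the boundary data; since G is
    odd, H is odd in each variable.\<close>
  define H where "H p = weight (fst p) * G (snd p * rescale (fst p)) - weight (- fst p) * G (snd p * rescale (- fst p))
     + (weight (snd p) * G (fst p * rescale (snd p)) - weight (- snd p) * G (fst p * rescale (- snd p)))" for p
  have C1_weight: "C1_fun (\<lambda>p. weight (\<phi> p))" if "C1_fun \<phi>" for \<phi>
  proof -
    have "C1_fun (\<lambda>p. smoothstep ((1 / (1 - 2 * \<epsilon>)) * (\<phi> p - \<epsilon>)))" by (intro C1_fun_smoothstep C1_fun_intros that)
    then show ?thesis by (simp add: weight_def)
  qed
  have CH: "C1_fun H" unfolding H_def
    by (intro C1_fun_intros C1_weight C1_G C1_fun_rescale C1_fun_uminus)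
  have Cr: "C1_fun ring"
  proof -
    have "C1_fun (\<lambda>p. smoothstep ((1 / (1 - \<epsilon> - \<rho>)\<^sup>2) * (pos_sq (fst p + snd p - \<rho>) + pos_sq (- (fst p + snd p) - \<rho>) +
      (pos_sq (fst p - snd p - \<rho>) + pos_sq (- (fst p - snd p) - \<rho>)))))"
      by (intro C1_fun_smoothstep C1_fun_intros C1_fun_pos_sq C1_fun_uminus)
    then show ?thesis by (simp add: ring_def[abs_def])
  qed
  define F1 where "F1 p = ring p * H p" for p
  define F3 where "F3 p = - (s/6) * ring p" for p
  have "C1_fun F1" "C1_fun F3" unfolding F1_def F3_def by (intro C1_fun_intros CH Cr)+
  then obtain D1 D3 where D: "C1_grad F1 D1" "C1_grad F3 D3" unfolding C1_fun_def by blast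
  have ring_refl: "ring (reflect p) = ring p" "ring (reflect' p) = ring p" for p
    by (simp_all add: ring_def reflect_def reflect'_def add_ac)
  have H_refl: "H (reflect p) = - H p" "H (reflect' p) = - H p" for p
    by (simp_all add: H_def reflect_def reflect'_def Godd)
  have m1: "rescale (1 - \<epsilon>) = 1" using eps by (simp add: rescale_def)
  have m2: "b * rescale a = \<epsilon>" if "a + b = 1" "a \<le> 1 - \<epsilon>" for a b
  proof -
    have "b = 1 - a" "1 - a > 0" using that eps by auto
    then show ?thesis using that(2) by (simp add: rescale_def)
  qed
  have w0: "weight (- t) = 0" if "0 \<le> t" for t using that eps by (intro weight_eq) auto
  have H_C1: "H (x, y) = s/2" if "x + y = 1" "\<epsilon> \<le> x" "x \<le> 1 - \<epsilon>" for x y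
  proof -
    have "y * rescale x = \<epsilon>" "x * rescale y = \<epsilon>" using m2[of x y] m2[of y x] that by auto
    moreover have "weight (- x) = 0" "weight (- y) = 0" using w0 that eps by auto
    moreover have "weight y = 1 - weight x" 
    proof -
      have "y = 1 - x" using that(1) by simp
      then show ?thesis using weight_eq(3)[of x] by simp
    qed
    ultimately have "H (x, y) = (weight x + (1 - weight x)) * (s/2)"
      unfolding distrib_right by (simp add: H_def Gend(1))
    then show ?thesis by simp
  qed
  have H_S1: "H (1 - \<epsilon>, y) = g y" if "\<bar>y\<bar> \<le> \<epsilon>" for y
  proof -
    have "weight y = 0" "weight (- y) = 0" "weight (- (1 - \<epsilon>)) = 0" "weight (1 - \<epsilon>) = 1" using that eps by (auto intro!: weight_eq)
    then show ?thesis using Geq[of y] that by (simp add: H_def m1 abs_le_iff)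
  qed
  have H_S2: "H (x, 1 - \<epsilon>) = g x" if "\<bar>x\<bar> \<le> \<epsilon>" for x
  proof -
    have "weight x = 0" "weight (- x) = 0" "weight (- (1 - \<epsilon>)) = 0" "weight (1 - \<epsilon>) = 1" using that eps by (auto intro!: weight_eq)
    then show ?thesis using Geq[of x] that by (simp add: H_def m1 abs_le_iff)
  qed
  have Hr: "H (- x, y) = - H (x, y)" "H (x, - y) = - H (x, y)" for x y
    using H_refl(1)[of "(x, y)"] H_refl(2)[of "(x, y)"] by (auto simp: reflect_def reflect'_def)
  have H_out: "H p = q1b s \<rho> \<epsilon> g p" if "p \<in> Gamma_out \<epsilon>" "p \<notin> Gamma_in \<rho>" for p
  proof -
    obtain x y where p: "p = (x, y)" by force
    have c1: "H p = s/2" if "p \<in> C1 \<epsilon>" using that H_C1[of x y] by (simp add: p C1_def)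
    have c3: "H p = s/2" if "p \<in> C3 \<epsilon>" using that H_C1[of "-x" "-y"] Hr[of x "-y"] Hr[of x y] by (simp add: p C3_def)
    have c2: "H p = - (s/2)" if "p \<in> C2 \<epsilon>" using that H_C1[of "-x" y] Hr[of x y] by (simp add: p C2_def)
    have c4: "H p = - (s/2)" if "p \<in> C4 \<epsilon>" using that H_C1[of x "-y"] Hr[of x y] by (simp add: p C4_def)
    have s1: "H p = g (snd p)" if "p \<in> S1 \<epsilon>" using that H_S1[of y] by (simp add: p S1_def)
    have s2: "H p = g (fst p)" if "p \<in> S2 \<epsilon>" using that H_S2[of x] by (simp add: p S2_def)
    have s3: "H p = - g (snd p)" if "p \<in> S3 \<epsilon>" using that H_S1[of y] Hr(1)[of "1 - \<epsilon>" y] by (auto simp: p S3_def)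
    have s4: "H p = - g (fst p)" if "p \<in> S4 \<epsilon>" using that H_S2[of x] Hr(2)[of x "1 - \<epsilon>"] by (auto simp: p S4_def)
    show ?thesis using that c1 c2 c3 c4 s1 s2 s3 s4 unfolding q1b_def Gamma_out_def by auto
  qed
  have G_out: "1 - \<epsilon> \<le> \<bar>fst p\<bar> + \<bar>snd p\<bar>" if "p \<in> Gamma_out \<epsilon>" for p
    using that eps by (cases p) (auto simp: Gamma_out_def C1_def C2_def C3_def C4_def S1_def S2_def S3_def S4_def)
  have G_in: "\<bar>fst p\<bar> + \<bar>snd p\<bar> = \<rho>" if "p \<in> Gamma_in \<rho>" for p
    using that by (cases p) (simp add: Gamma_in_def max_abs_sum_diff)
  have val: "F1 p = q1b s \<rho> \<epsilon> g p \<and> F3 p = q3b s \<rho> \<epsilon> p" if "p \<in> Gamma_in \<rho> \<union> Gamma_out \<epsilon>" for p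
  proof (cases "p \<in> Gamma_in \<rho>")
    case True
    then show ?thesis using ring_inner[of p] G_in[of p] by (simp add: F1_def F3_def q1b_def q3b_def)
  next
    case False
    with that have "p \<in> Gamma_out \<epsilon>" by simp
    then show ?thesis using False ring_outer[OF G_out[of p]] H_out[of p] by (simp add: F1_def F3_def q3b_def)
  qed
  have "p \<in> Gamma_in \<rho> \<union> Gamma_out \<epsilon>" if "(a, b) \<in> boundary_edges \<rho> \<epsilon>" "p \<in> closed_segment a b" for a b p
    using that boundary_edges_frontier[of \<rho> \<epsilon>] frontier_Om[of \<rho> \<epsilon>] rho eps by fastforce
  with val show ?thesis
    by (intro that[OF D]) (simp_all add: F1_def F3_def ring_refl H_refl)
qed

end

section \<open>The bulk potential\<close>

text \<open>The multiple of the identity projects the gradient of the potential at a matrix of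
  \<open>S0\<close> onto the traceless matrices.\<close>

definition bulk_grad :: "real \<Rightarrow> real \<Rightarrow> real \<Rightarrow> mat3 \<Rightarrow> mat3" where
  "bulk_grad A B C M = A *\<^sub>R M - B *\<^sub>R (M ** M - (trace (M ** M) / 3) *\<^sub>R mat 1) + (C * trace (M ** M)) *\<^sub>R M"

lemma EL_rhs_bulk_grad: "EL_rhs A B C L lam M = (lam\<^sup>2 / L) *\<^sub>R bulk_grad A B C M"
  by (simp add: EL_rhs_def bulk_grad_def)

lemma mat_inner: "M \<bullet> N = (\<Sum>i\<in>UNIV. \<Sum>j\<in>UNIV. M $ i $ j * N $ i $ j)" for M N :: mat3
  by (simp add: inner_vec_def)

lemma trace_matrix_mult: "trace (M ** transpose N) = M \<bullet> N" for M N :: mat3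
  by (simp add: trace_def matrix_matrix_mult_def transpose_def mat_inner)

lemma trace_scaleR: "trace (c *\<^sub>R M) = c * trace M" for M :: mat3
  by (simp add: trace_def sum_distrib_left)

lemma mat_1_inner: "mat 1 \<bullet> M = trace M" for M :: mat3
  by (simp add: mat_inner mat_def trace_def if_distrib[of "\<lambda>x. x * _"] cong: if_cong)

lemma norm_mat_sq: "(norm M)\<^sup>2 = M \<bullet> M" for M :: mat3
  by (simp add: power2_norm_eq_inner)

text \<open>Entries of the product are inner products of rows and columns; Cauchy-Schwarz for each
  of them makes the sum of squares factorize.\<close>

lemma norm_matrix_mult_le: "norm (M ** N) \<le> norm M * norm N" for M N :: mat3
proof (rule power2_le_imp_le)
  define r where "r i = M $ i" for i
  define c where "c j = transpose N $ j" for j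
  have e: "(M ** N) $ i $ j = r i \<bullet> c j" for i j
    by (simp add: matrix_matrix_mult_def r_def c_def transpose_def inner_vec_def)
  have M: "(norm M)\<^sup>2 = (\<Sum>i\<in>UNIV. (norm (r i))\<^sup>2)"
    unfolding norm_mat_sq by (simp add: inner_vec_def r_def power2_norm_eq_inner)
  have "(norm N)\<^sup>2 = (\<Sum>i\<in>UNIV. \<Sum>j\<in>UNIV. N $ i $ j * N $ i $ j)"
    unfolding norm_mat_sq mat_inner ..
  also have "\<dots> = (\<Sum>j\<in>UNIV. \<Sum>i\<in>UNIV. N $ i $ j * N $ i $ j)" by (rule sum.swap)
  also have "\<dots> = (\<Sum>j\<in>UNIV. (norm (c j))\<^sup>2)"
    unfolding power2_norm_eq_inner by (simp add: inner_vec_def c_def transpose_def)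
  finally have N: "(norm N)\<^sup>2 = (\<Sum>j\<in>UNIV. (norm (c j))\<^sup>2)" .
  have "(norm (M ** N))\<^sup>2 = (\<Sum>i\<in>UNIV. \<Sum>j\<in>UNIV. (r i \<bullet> c j)\<^sup>2)"
    unfolding norm_mat_sq mat_inner e by (simp add: power2_eq_square)
  also have "\<dots> \<le> (\<Sum>i\<in>UNIV. \<Sum>j\<in>UNIV. (norm (r i))\<^sup>2 * (norm (c j))\<^sup>2)"
  proof (intro sum_mono)
    fix i j
    have "\<bar>r i \<bullet> c j\<bar>\<^sup>2 \<le> (norm (r i) * norm (c j))\<^sup>2" by (intro power_mono Cauchy_Schwarz_ineq2) auto
    then show "(r i \<bullet> c j)\<^sup>2 \<le> (norm (r i))\<^sup>2 * (norm (c j))\<^sup>2" by (simp add: power_mult_distrib)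
  qed
  also have "\<dots> = (norm M * norm N)\<^sup>2"
    unfolding power_mult_distrib M N by (simp add: sum_product)
  finally show "(norm (M ** N))\<^sup>2 \<le> (norm M * norm N)\<^sup>2" .
qed simp

lemma matrix_mult_distribs:
  "X ** (Y + Z) = X ** Y + X ** Z" "(Y + Z) ** X = Y ** X + Z ** X"
  "X ** (Y - Z) = X ** Y - X ** Z" "(Y - Z) ** X = Y ** X - Z ** X" for X Y Z :: mat3
  by (simp_all add: vec_eq_iff matrix_matrix_mult_def sum_3 algebra_simps)

lemma S0_sym: "M \<in> S0 \<Longrightarrow> transpose M = M" and S0_trace: "M \<in> S0 \<Longrightarrow> trace M = 0"
  by (auto simp: S0_def)

lemma S0_trace_mult: "N \<in> S0 \<Longrightarrow> trace (M ** N) = M \<bullet> N"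
  using trace_matrix_mult[of M N] S0_sym[of N] by simp

lemma transpose_add: "transpose (M + N) = transpose M + transpose N" for M N :: mat3
  by (simp add: transpose_def vec_eq_iff)

lemma transpose_scaleR: "transpose (c *\<^sub>R M) = c *\<^sub>R transpose M" for M :: mat3
  by (simp add: transpose_def vec_eq_iff)

lemma S0_add: "M \<in> S0 \<Longrightarrow> N \<in> S0 \<Longrightarrow> M + N \<in> S0"
  and S0_scaleR: "M \<in> S0 \<Longrightarrow> c *\<^sub>R M \<in> S0"
  by (simp_all add: S0_def trace_add trace_scaleR transpose_add transpose_scaleR)

lemma S0_diff: "M \<in> S0 \<Longrightarrow> N \<in> S0 \<Longrightarrow> M - N \<in> S0"
  using S0_add[of M "(-1) *\<^sub>R N"] S0_scaleR[of N "-1"] by simp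

lemma bulk_S0: "M \<in> S0 \<Longrightarrow> bulk A B C M = A/2 * (M \<bullet> M) - B/3 * ((M ** M) \<bullet> M) + C/4 * (M \<bullet> M)\<^sup>2"
  by (simp add: bulk_def S0_trace_mult)

lemma bulk_grad_S0_inner:
  "M \<in> S0 \<Longrightarrow> D \<in> S0 \<Longrightarrow> bulk_grad A B C M \<bullet> D = A * (M \<bullet> D) - B * ((M ** M) \<bullet> D) + C * (M \<bullet> M) * (M \<bullet> D)"
  by (simp add: bulk_grad_def S0_trace_mult inner_add_left inner_diff_left mat_1_inner S0_trace)

text \<open>An exact Taylor formula for a quartic polynomial; the cyclic invariance of the trace
  collects the mixed cubic terms.\<close>

lemma bulk_expansion:
  assumes M: "M \<in> S0" and D: "D \<in> S0"
  shows "bulk A B C (M + D) - bulk A B C M - bulk_grad A B C M \<bullet> D =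
     A/2 * (D \<bullet> D) - B * ((M + (1/3) *\<^sub>R D) \<bullet> (D ** D)) + C/4 * ((2 * (M \<bullet> D) + D \<bullet> D)\<^sup>2 + 2 * (M \<bullet> M) * (D \<bullet> D))"
proof -
  have MD: "M + D \<in> S0" by (rule S0_add[OF M D])
  have c: "trace (X ** Y) = trace (Y ** X)" for X Y :: mat3 by (rule trace_mul_sym)
  have t: "((X ** Y) \<bullet> Z) = trace (X ** Y ** Z)" if "Z \<in> S0" for X Y Z :: mat3
    using S0_trace_mult[OF that] by simp
  have cube: "((M + D) ** (M + D)) \<bullet> (M + D) = (M ** M) \<bullet> M + 3 * ((M ** M) \<bullet> D) + 3 * ((D ** D) \<bullet> M) + (D ** D) \<bullet> D"
  proof -
    have "trace (M ** D ** M) = trace (M ** M ** D)" "trace (D ** M ** M) = trace (M ** M ** D)"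
      using c[of "M ** D" M] c[of D "M ** M"] by (simp_all add: matrix_mul_assoc)
    moreover have "trace (M ** D ** D) = trace (D ** D ** M)" "trace (D ** M ** D) = trace (D ** D ** M)"
      using c[of M "D ** D"] c[of "D ** M" D] by (simp_all add: matrix_mul_assoc)
    ultimately show ?thesis
      unfolding t[OF MD] t[OF M] t[OF D]
      by (simp add: matrix_mult_distribs trace_add)
  qed
  have sq: "(M + D) \<bullet> (M + D) = M \<bullet> M + 2 * (M \<bullet> D) + D \<bullet> D"
    by (simp add: inner_add_left inner_add_right inner_commute)
  have i: "(M + (1/3) *\<^sub>R D) \<bullet> (D ** D) = (D ** D) \<bullet> M + (1/3) * ((D ** D) \<bullet> D)"
    by (simp add: inner_add_left inner_add_right inner_commute)
  show ?thesis
    unfolding bulk_S0[OF MD] bulk_S0[OF M] bulk_grad_S0_inner[OF M D] cube sq i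
    by (simp add: power2_eq_square field_simps)
qed

text \<open>The quadratic term costs at most |A|, and the indefinite cubic remainder is absorbed by
  the quartic one up to 3 B^2 / C, uniformly over all matrices.\<close>

definition semiconvexity :: "real \<Rightarrow> real \<Rightarrow> real \<Rightarrow> real" where
  "semiconvexity A B C = \<bar>A\<bar> + 3 * B\<^sup>2 / C"

text \<open>Here a = |M|^2, d = |D|^2, m = M . D and t = |M + D/3|. First t^2 d is bounded by the
  quartic remainder, then B t is split by Young's inequality.\<close>

lemma semiconvexity_scalar:
  fixes a d m t :: real
  assumes "0 < C" and a: "0 \<le> a" and d: "0 \<le> d" and CS: "m\<^sup>2 \<le> a * d" and t: "t\<^sup>2 = a + 2 * m / 3 + d / 9"
  shows "B * t * d \<le> C/4 * ((2 * m + d)\<^sup>2 + 2 * a * d) + 3 * B\<^sup>2 / (2 * C) * d"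
proof -
  define X where "X = (2 * m + d)\<^sup>2"
  \<comment> \<open>Writing d as (2 m + d) - 2 m controls its square by X and, through
    Cauchy-Schwarz, by a * d.\<close>
  have "d\<^sup>2 = ((2 * m + d) - 2 * m)\<^sup>2" by simp
  also have "\<dots> \<le> 2 * (2 * m + d)\<^sup>2 + 2 * (2 * m)\<^sup>2" using norm_diff_sq_le[of "2 * m + d" "2 * m"] by simp
  also have "\<dots> \<le> 2 * X + 8 * (a * d)" using CS by (simp add: X_def power_mult_distrib)
  finally have d2: "d\<^sup>2 \<le> 2 * X + 8 * (a * d)" .
  have "2 * (d * (2 * m + d)) \<le> d\<^sup>2 + X" using sum_squares_bound[of d "2 * m + d"] by (simp add: X_def mult.assoc)
  then have dm: "d * (2 * m + d) \<le> 3/2 * X + 4 * (a * d)" using d2 by simp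
  have "t\<^sup>2 * d = a * d + d * (2 * m + d) / 3 - 2 * d\<^sup>2 / 9" unfolding t by (simp add: field_simps power2_eq_square)
  also have "\<dots> \<le> a * d + (3/2 * X + 4 * (a * d)) / 3"
  proof -
    have "z + u / 3 - 2 * w / 9 \<le> z + (3/2 * X + 4 * z) / 3" if "u \<le> 3/2 * X + 4 * z" "0 \<le> w" for u w z :: real
      using that by simp
    then show ?thesis using dm zero_le_power2[of d] by blast
  qed
  also have "\<dots> = X / 2 + 7/3 * (a * d)" by (simp add: field_simps)
  finally have td: "t\<^sup>2 * d \<le> X / 2 + 7/3 * (a * d)" .
  have X0: "0 \<le> X" "0 \<le> a * d" using a d by (auto simp: X_def)
  \<comment> \<open>The weight is dictated by 3 C / 14 * 7/3 = C / 2, the coefficient of a * d in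
    the quartic remainder.\<close>
  have "0 \<le> (3 * C / 14) * (t - 7 * B / (3 * C))\<^sup>2" using assms(1) by simp
  also have "(3 * C / 14) * (t - 7 * B / (3 * C))\<^sup>2 = 3 * C / 14 * t\<^sup>2 - B * t + 7 * B\<^sup>2 / (6 * C)"
    using assms(1) by (simp add: power2_eq_square field_simps)
  finally have "B * t \<le> 3 * C / 14 * t\<^sup>2 + 7 * B\<^sup>2 / (6 * C)" by simp
  also have "7 * B\<^sup>2 / (6 * C) \<le> 3 * B\<^sup>2 / (2 * C)" using assms(1) by (simp add: field_simps)
  finally have "B * t * d \<le> (3 * C / 14 * t\<^sup>2 + 3 * B\<^sup>2 / (2 * C)) * d" using d by (intro mult_right_mono) auto
  also have "\<dots> = 3 * C / 14 * (t\<^sup>2 * d) + 3 * B\<^sup>2 / (2 * C) * d" by (simp add: algebra_simps)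
  also have "3 * C / 14 * (t\<^sup>2 * d) \<le> 3 * C / 14 * (X / 2 + 7/3 * (a * d))"
    using assms(1) by (intro mult_left_mono td) auto
  also have "\<dots> \<le> C/4 * (X + 2 * a * d)"
    using mult_nonneg_nonneg[OF less_imp_le[OF assms(1)] X0(1)] by (simp add: algebra_simps)
  finally show ?thesis by (simp add: X_def)
qed

lemma bulk_semiconvex:
  assumes "0 < C" "0 \<le> B" and M: "M \<in> S0" and N: "N \<in> S0"
  shows "bulk A B C M + bulk_grad A B C M \<bullet> (N - M) - semiconvexity A B C / 2 * (norm (N - M))\<^sup>2 \<le> bulk A B C N"
proof -
  define D where "D = N - M"
  have D: "D \<in> S0" unfolding D_def by (rule S0_diff[OF N M])
  define t where "t = norm (M + (1/3) *\<^sub>R D)"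
  have t: "t\<^sup>2 = M \<bullet> M + 2 * (M \<bullet> D) / 3 + (D \<bullet> D) / 9"
    unfolding t_def power2_norm_eq_inner by (simp add: inner_add_left inner_add_right inner_commute)
  have CS: "(M \<bullet> D)\<^sup>2 \<le> (M \<bullet> M) * (D \<bullet> D)" by (rule Cauchy_Schwarz_ineq)
  have "(M + (1/3) *\<^sub>R D) \<bullet> (D ** D) \<le> t * norm (D ** D)" unfolding t_def by (rule norm_cauchy_schwarz)
  also have "\<dots> \<le> t * (D \<bullet> D)"
    using norm_matrix_mult_le[of D D] by (intro mult_left_mono) (auto simp: t_def norm_mat_sq[symmetric] power2_eq_square)
  finally have "B * ((M + (1/3) *\<^sub>R D) \<bullet> (D ** D)) \<le> B * (t * (D \<bullet> D))" using assms(2) by (rule mult_left_mono)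
  also have "\<dots> \<le> C/4 * ((2 * (M \<bullet> D) + D \<bullet> D)\<^sup>2 + 2 * (M \<bullet> M) * (D \<bullet> D)) + 3 * B\<^sup>2 / (2 * C) * (D \<bullet> D)"
    using semiconvexity_scalar[OF assms(1) _ _ CS t, of B] by (simp add: mult.assoc)
  finally have 1: "B * ((M + (1/3) *\<^sub>R D) \<bullet> (D ** D)) \<le> C/4 * ((2 * (M \<bullet> D) + D \<bullet> D)\<^sup>2 + 2 * (M \<bullet> M) * (D \<bullet> D)) + 3 * B\<^sup>2 / (2 * C) * (D \<bullet> D)" .
  have "semiconvexity A B C / 2 * (D \<bullet> D) = \<bar>A\<bar> / 2 * (D \<bullet> D) + 3 * B\<^sup>2 / (2 * C) * (D \<bullet> D)"
    by (simp add: semiconvexity_def field_simps)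
  moreover have "- (\<bar>A\<bar> / 2 * (D \<bullet> D)) \<le> A / 2 * (D \<bullet> D)"
    using mult_right_mono[of "- \<bar>A\<bar> / 2" "A / 2" "D \<bullet> D"] by simp
  moreover have "bulk A B C N - bulk A B C M - bulk_grad A B C M \<bullet> D =
     A/2 * (D \<bullet> D) - B * ((M + (1/3) *\<^sub>R D) \<bullet> (D ** D)) + C/4 * ((2 * (M \<bullet> D) + D \<bullet> D)\<^sup>2 + 2 * (M \<bullet> M) * (D \<bullet> D))"
    using bulk_expansion[OF M D, of A B C] by (simp add: D_def)
  ultimately show ?thesis
    using 1 unfolding D_def[symmetric] norm_mat_sq by linarith
qed

text \<open>Apply \<open>bulk_semiconvex\<close> at the midpoint towards both ends: the linear terms
  cancel, and halving the difference turns K / 2 into K / 8.\<close>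

lemma bulk_midpoint:
  assumes "0 < C" "0 \<le> B" and M: "M \<in> S0" and N: "N \<in> S0"
  shows "bulk A B C ((1/2) *\<^sub>R (M + N)) \<le> (bulk A B C M + bulk A B C N) / 2 + semiconvexity A B C / 8 * (norm (M - N))\<^sup>2"
proof -
  define P where "P = (1/2) *\<^sub>R (M + N)"
  have P: "P \<in> S0" unfolding P_def by (intro S0_scaleR S0_add M N)
  have d: "M - P = (1/2) *\<^sub>R (M - N)" "N - P = - ((1/2) *\<^sub>R (M - N))"
    by (simp_all add: P_def vec_eq_iff field_simps)
  have n: "(norm (M - P))\<^sup>2 = (norm (M - N))\<^sup>2 / 4" "(norm (N - P))\<^sup>2 = (norm (M - N))\<^sup>2 / 4"
    unfolding d by (simp_all add: power_mult_distrib power_divide)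
  have i: "bulk_grad A B C P \<bullet> (N - P) = - (bulk_grad A B C P \<bullet> (M - P))" unfolding d by simp
  show ?thesis
    using bulk_semiconvex[OF assms(1,2) P M, of A] bulk_semiconvex[OF assms(1,2) P N, of A]
    unfolding n i P_def[symmetric] by (simp add: field_simps)
qed

text \<open>Controls the second-order term of the energy in a bounded direction D: quadratic in D to
  leading order and of quadratic growth in M, so that L2 norms of the competitor suffice.\<close>

lemma bulk_upper:
  assumes M: "M \<in> S0" and D: "D \<in> S0" and "0 < C" "0 \<le> B"
  shows "bulk A B C (M + D) \<le> bulk A B C M + bulk_grad A B C M \<bullet> D + (\<bar>A\<bar> + B + 3 * C) * (norm D)\<^sup>2 * (1 + (norm M)\<^sup>2 + (norm D)\<^sup>2)"
proof -
  define a where "a = norm M"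
  define d where "d = norm D"
  have nn: "0 \<le> a" "0 \<le> d" by (auto simp: a_def d_def)
  have "\<bar>(M + (1/3) *\<^sub>R D) \<bullet> (D ** D)\<bar> \<le> norm (M + (1/3) *\<^sub>R D) * norm (D ** D)" by (rule Cauchy_Schwarz_ineq2)
  also have "\<dots> \<le> (a + d) * (d * d)"
  proof (rule mult_mono)
    show "norm (M + (1/3) *\<^sub>R D) \<le> a + d" 
    proof -
      have "norm ((1/3) *\<^sub>R D) \<le> norm D" by simp
      then show ?thesis using norm_triangle_ineq[of M "(1/3) *\<^sub>R D"] unfolding a_def d_def by linarith
    qed
  qed (use norm_matrix_mult_le[of D D] in \<open>auto simp: d_def nn a_def\<close>)
  also have "\<dots> \<le> (1 + a\<^sup>2 + d\<^sup>2) * d\<^sup>2"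
  proof -
    have "a + d \<le> 1 + a\<^sup>2 + d\<^sup>2"
    proof -
      have "0 \<le> (a - 1/2)\<^sup>2" "0 \<le> (d - 1/2)\<^sup>2" by auto
      then show ?thesis by (simp add: power2_eq_square algebra_simps)
    qed
    then show ?thesis by (auto simp: power2_eq_square intro: mult_right_mono)
  qed
  finally have "\<bar>(M + (1/3) *\<^sub>R D) \<bullet> (D ** D)\<bar> \<le> (1 + a\<^sup>2 + d\<^sup>2) * d\<^sup>2" .
  then have 1: "- (B * ((M + (1/3) *\<^sub>R D) \<bullet> (D ** D))) \<le> B * ((1 + a\<^sup>2 + d\<^sup>2) * d\<^sup>2)"
    using mult_left_mono[of "- ((M + (1/3) *\<^sub>R D) \<bullet> (D ** D))" "(1 + a\<^sup>2 + d\<^sup>2) * d\<^sup>2" B] assms(4) by simp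
  have "\<bar>2 * (M \<bullet> D) + D \<bullet> D\<bar> \<le> 2 * (a * d) + d\<^sup>2"
    using Cauchy_Schwarz_ineq2[of M D] inner_ge_zero[of D] unfolding a_def d_def norm_mat_sq by linarith
  then have "\<bar>2 * (M \<bullet> D) + D \<bullet> D\<bar>\<^sup>2 \<le> (2 * (a * d) + d\<^sup>2)\<^sup>2" by (intro power_mono) auto
  also have "\<dots> \<le> 2 * (2 * (a * d))\<^sup>2 + 2 * (d\<^sup>2)\<^sup>2" using norm_add_sq_le[of "2 * (a * d)" "d\<^sup>2"] by simp
  also have "\<dots> = (8 * a\<^sup>2 + 2 * d\<^sup>2) * d\<^sup>2" by (simp add: power2_eq_square algebra_simps)
  finally have "(2 * (M \<bullet> D) + D \<bullet> D)\<^sup>2 + 2 * (M \<bullet> M) * (D \<bullet> D) \<le> (10 * a\<^sup>2 + 2 * d\<^sup>2) * d\<^sup>2"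
    by (simp add: norm_mat_sq[symmetric] a_def d_def algebra_simps)
  also have "\<dots> \<le> (12 * (1 + a\<^sup>2 + d\<^sup>2)) * d\<^sup>2" by (intro mult_right_mono) auto
  finally have 2: "C/4 * ((2 * (M \<bullet> D) + D \<bullet> D)\<^sup>2 + 2 * (M \<bullet> M) * (D \<bullet> D)) \<le> C/4 * ((12 * (1 + a\<^sup>2 + d\<^sup>2)) * d\<^sup>2)"
    using assms(3) by (intro mult_left_mono) auto
  have "A / 2 * (D \<bullet> D) \<le> \<bar>A\<bar> * d\<^sup>2" unfolding d_def norm_mat_sq by (intro mult_right_mono) auto
  also have "\<dots> \<le> \<bar>A\<bar> * ((1 + a\<^sup>2 + d\<^sup>2) * d\<^sup>2)" by (intro mult_left_mono) (auto simp: algebra_simps)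
  finally have 3: "A / 2 * (D \<bullet> D) \<le> \<bar>A\<bar> * ((1 + a\<^sup>2 + d\<^sup>2) * d\<^sup>2)" .
  have "bulk A B C (M + D) - bulk A B C M - bulk_grad A B C M \<bullet> D \<le> (\<bar>A\<bar> + B + 3 * C) * ((1 + a\<^sup>2 + d\<^sup>2) * d\<^sup>2)"
    unfolding bulk_expansion[OF M D] using 1 2 3 by (simp add: algebra_simps)
  then show ?thesis unfolding a_def d_def by (simp add: mult_ac)
qed

text \<open>The local Lipschitz constant grows quadratically, which combines with L4 convergence to
  pass to the limit in the cubic term.\<close>

lemma bulk_grad_lipschitz:
  assumes M: "M \<in> S0" and N: "N \<in> S0" and "0 < C" "0 \<le> B"
  shows "norm (bulk_grad A B C M - bulk_grad A B C N) \<le> 4 * (\<bar>A\<bar> + B + C) * (1 + (norm M)\<^sup>2 + (norm N)\<^sup>2) * norm (M - N)"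
proof -
  define D where "D = M - N"
  define m where "m = norm M"
  define n where "n = norm N"
  define d where "d = norm D"
  define w where "w = 1 + m\<^sup>2 + n\<^sup>2"
  have nn: "0 \<le> m" "0 \<le> n" "0 \<le> d" by (auto simp: m_def n_def d_def)
  have mn: "m + n \<le> w"
  proof -
    have "0 \<le> (m - 1/2)\<^sup>2" "0 \<le> (n - 1/2)\<^sup>2" by auto
    then show ?thesis by (simp add: w_def power2_eq_square algebra_simps)
  qed
  have mn2: "2 * (m * n) \<le> m\<^sup>2 + n\<^sup>2" using sum_squares_bound[of m n] by (simp add: mult.assoc)
  have sq: "norm (M ** M - N ** N) \<le> w * d"
  proof -
    have "M ** M - N ** N = M ** D + D ** N"
      by (simp add: D_def matrix_mult_distribs)
    then have "norm (M ** M - N ** N) \<le> norm (M ** D) + norm (D ** N)" by (simp add: norm_triangle_ineq)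
    also have "\<dots> \<le> m * d + d * n" unfolding m_def n_def d_def by (intro add_mono norm_matrix_mult_le)
    also have "\<dots> = (m + n) * d" by (simp add: algebra_simps)
    also have "\<dots> \<le> w * d" by (intro mult_right_mono mn nn)
    finally show ?thesis .
  qed
  have tr: "\<bar>M \<bullet> M - N \<bullet> N\<bar> \<le> (m + n) * d"
  proof -
    have "M \<bullet> M - N \<bullet> N = (M + N) \<bullet> D" unfolding D_def inner_add_left inner_diff_right by (simp add: inner_commute)
    then have "\<bar>M \<bullet> M - N \<bullet> N\<bar> \<le> norm (M + N) * d" unfolding d_def using Cauchy_Schwarz_ineq2[of "M + N" D] by simp
    also have "\<dots> \<le> (m + n) * d" unfolding m_def n_def using nn by (intro mult_right_mono norm_triangle_ineq) auto
    finally show ?thesis .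
  qed
  have cub: "norm ((M \<bullet> M) *\<^sub>R M - (N \<bullet> N) *\<^sub>R N) \<le> 2 * w * d"
  proof -
    have "(M \<bullet> M) *\<^sub>R M - (N \<bullet> N) *\<^sub>R N = (M \<bullet> M) *\<^sub>R D + (M \<bullet> M - N \<bullet> N) *\<^sub>R N"
      by (simp add: D_def scaleR_diff_left scaleR_diff_right)
    then have "norm ((M \<bullet> M) *\<^sub>R M - (N \<bullet> N) *\<^sub>R N) \<le> norm ((M \<bullet> M) *\<^sub>R D) + norm ((M \<bullet> M - N \<bullet> N) *\<^sub>R N)"
      by (simp only: norm_triangle_ineq)
    also have "\<dots> = m\<^sup>2 * d + \<bar>M \<bullet> M - N \<bullet> N\<bar> * n" unfolding m_def norm_mat_sq by (simp add: d_def n_def)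
    also have "\<dots> \<le> m\<^sup>2 * d + ((m + n) * d) * n" by (intro add_left_mono mult_right_mono tr nn)
    also have "\<dots> = (m\<^sup>2 + m * n + n\<^sup>2) * d" by (simp add: algebra_simps power2_eq_square)
    also have "\<dots> \<le> (2 * w) * d"
    proof (intro mult_right_mono nn)
      have "p + q + r \<le> 2 * (1 + p + r)" if "2 * q \<le> p + r" "0 \<le> p" "0 \<le> r" for p q r :: real
        using that by simp
      from this[OF mn2] show "m\<^sup>2 + m * n + n\<^sup>2 \<le> 2 * w" unfolding w_def by simp
    qed
    finally show ?thesis .
  qed
  have n1: "norm (mat 1 :: mat3) \<le> 2"
  proof (rule power2_le_imp_le)
    have "trace (mat 1 :: mat3) = 3" by (simp add: trace_def mat_def)
    then show "(norm (mat 1 :: mat3))\<^sup>2 \<le> 2\<^sup>2" unfolding norm_mat_sq mat_1_inner by simp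
  qed simp
  have eq: "bulk_grad A B C M - bulk_grad A B C N = A *\<^sub>R D - B *\<^sub>R (M ** M - N ** N) + (B * (M \<bullet> M - N \<bullet> N) / 3) *\<^sub>R mat 1
     + C *\<^sub>R ((M \<bullet> M) *\<^sub>R M - (N \<bullet> N) *\<^sub>R N)"
    unfolding bulk_grad_def S0_trace_mult[OF M] S0_trace_mult[OF N] D_def
    by (simp add: vec_eq_iff field_simps)
  have "norm (bulk_grad A B C M - bulk_grad A B C N) \<le> norm (A *\<^sub>R D) + norm (B *\<^sub>R (M ** M - N ** N)) + norm ((B * (M \<bullet> M - N \<bullet> N) / 3) *\<^sub>R (mat 1 :: mat3))
     + norm (C *\<^sub>R ((M \<bullet> M) *\<^sub>R M - (N \<bullet> N) *\<^sub>R N))"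
    unfolding eq by (meson norm_triangle_le norm_triangle_le_diff order_refl add_mono norm_triangle_ineq)
  also have "\<dots> \<le> \<bar>A\<bar> * d + B * (w * d) + B * (w * d) + C * (2 * w * d)"
  proof (intro add_mono)
    show "norm (A *\<^sub>R D) \<le> \<bar>A\<bar> * d" by (simp add: d_def)
    show "norm (B *\<^sub>R (M ** M - N ** N)) \<le> B * (w * d)" using assms(4) sq by (simp add: mult_left_mono)
    show "norm (C *\<^sub>R ((M \<bullet> M) *\<^sub>R M - (N \<bullet> N) *\<^sub>R N)) \<le> C * (2 * w * d)" using assms(3) cub by (simp add: mult_left_mono)
    have "\<bar>M \<bullet> M - N \<bullet> N\<bar> \<le> w * d" using tr mult_right_mono[OF mn nn(3)] by linarith
    then have "\<bar>M \<bullet> M - N \<bullet> N\<bar> * norm (mat 1 :: mat3) \<le> (w * d) * 2" using n1 by (intro mult_mono) auto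
    moreover have "0 \<le> w * d" using nn by (simp add: w_def)
    ultimately have "\<bar>M \<bullet> M - N \<bullet> N\<bar> * norm (mat 1 :: mat3) / 3 \<le> w * d" by linarith
    then have "B * (\<bar>M \<bullet> M - N \<bullet> N\<bar> * norm (mat 1 :: mat3) / 3) \<le> B * (w * d)" using assms(4) by (rule mult_left_mono)
    then show "norm ((B * (M \<bullet> M - N \<bullet> N) / 3) *\<^sub>R (mat 1 :: mat3)) \<le> B * (w * d)" using assms(4) by (simp add: abs_mult)
  qed
  also have "\<dots> \<le> 4 * (\<bar>A\<bar> + B + C) * w * d"
  proof -
    have w1: "1 \<le> w" by (simp add: w_def)
    have "\<bar>A\<bar> * d \<le> \<bar>A\<bar> * (w * d)" using mult_right_mono[OF w1 nn(3)] by (intro mult_left_mono) auto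
    moreover have "0 \<le> \<bar>A\<bar> * (w * d)" "0 \<le> B * (w * d)" "0 \<le> C * (w * d)" using w1 nn assms(3,4) by auto
    ultimately show ?thesis by (simp add: algebra_simps)
  qed
  finally show ?thesis unfolding w_def m_def n_def d_def D_def .
qed

lemma bulk_grad_growth:
  assumes M: "M \<in> S0" and "0 < C" "0 \<le> B"
  shows "norm (bulk_grad A B C M) \<le> 4 * (\<bar>A\<bar> + B + C) * (norm M + norm M ^ 3)"
proof -
  have "(0::mat3) \<in> S0" using S0_scaleR[OF M, of 0] by simp
  moreover have "bulk_grad A B C 0 = 0" by (simp add: bulk_grad_def vec_eq_iff matrix_matrix_mult_def trace_def)
  ultimately show ?thesis using bulk_grad_lipschitz[OF M _ assms(2,3), of 0 A] by (simp add: algebra_simps power2_eq_square power3_eq_cube)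
qed

text \<open>One half of the quartic term absorbs the cubic term by completing a square, the other
  half all quadratic terms - k r^2, with minimum - 2 k^2 / C.\<close>

lemma bulk_bounded_below:
  assumes M: "M \<in> S0" and C: "0 < C" and B: "0 \<le> B"
  shows "- (2 * (\<bar>A\<bar> / 2 + 2 * B\<^sup>2 / C)\<^sup>2 / C) \<le> bulk A B C M"
proof -
  define r where "r = norm M"
  define k where "k = \<bar>A\<bar> / 2 + 2 * B\<^sup>2 / C"
  have r: "0 \<le> r" by (simp add: r_def)
  have "(M ** M) \<bullet> M \<le> norm (M ** M) * norm M" by (rule norm_cauchy_schwarz)
  also have "\<dots> \<le> r * r * r" unfolding r_def by (intro mult_right_mono norm_matrix_mult_le) auto
  finally have "B/3 * ((M ** M) \<bullet> M) \<le> B/3 * (r * r * r)" using B by (intro mult_left_mono) auto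
  also have "\<dots> \<le> (C / 8 * r\<^sup>2 + 2 * B\<^sup>2 / C) * r\<^sup>2"
  proof -
    have "0 \<le> C / 8 * (r - 4 * B / (3 * C))\<^sup>2" using C by simp
    also have "\<dots> = C / 8 * r\<^sup>2 - B / 3 * r + 2 * B\<^sup>2 / (9 * C)" using C by (simp add: power2_eq_square field_simps)
    finally have "B / 3 * r \<le> C / 8 * r\<^sup>2 + 2 * B\<^sup>2 / (9 * C)" by simp
    also have "2 * B\<^sup>2 / (9 * C) \<le> 2 * B\<^sup>2 / C" using C by (simp add: field_simps)
    finally have "(B / 3 * r) * r\<^sup>2 \<le> (C / 8 * r\<^sup>2 + 2 * B\<^sup>2 / C) * r\<^sup>2" by (intro mult_right_mono) auto
    then show ?thesis by (simp add: power2_eq_square mult_ac)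
  qed
  finally have 1: "B/3 * ((M ** M) \<bullet> M) \<le> (C / 8 * r\<^sup>2 + 2 * B\<^sup>2 / C) * r\<^sup>2" .
  have "- (\<bar>A\<bar> / 2 * r\<^sup>2) \<le> A / 2 * r\<^sup>2" using mult_right_mono[of "- \<bar>A\<bar> / 2" "A / 2" "r\<^sup>2"] by simp
  moreover have "0 \<le> C / 8 * (r\<^sup>2 - 4 * k / C)\<^sup>2" using C by simp
  moreover have "C / 8 * (r\<^sup>2 - 4 * k / C)\<^sup>2 = C / 8 * (r\<^sup>2)\<^sup>2 - k * r\<^sup>2 + 2 * k\<^sup>2 / C"
    using C by (simp add: power2_eq_square field_simps)
  moreover have "k * r\<^sup>2 = \<bar>A\<bar> / 2 * r\<^sup>2 + 2 * B\<^sup>2 / C * r\<^sup>2" by (simp add: k_def algebra_simps)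
  moreover have "(C / 8 * r\<^sup>2 + 2 * B\<^sup>2 / C) * r\<^sup>2 = C / 8 * (r\<^sup>2)\<^sup>2 + 2 * B\<^sup>2 / C * r\<^sup>2" by (simp add: algebra_simps power2_eq_square)
  moreover have "C/4 * (r\<^sup>2)\<^sup>2 = C/8 * (r\<^sup>2)\<^sup>2 + C/8 * (r\<^sup>2)\<^sup>2" by simp
  ultimately have "- (2 * k\<^sup>2 / C) \<le> A / 2 * r\<^sup>2 - B/3 * ((M ** M) \<bullet> M) + C/4 * (r\<^sup>2)\<^sup>2" using 1 by linarith
  then show ?thesis unfolding bulk_S0[OF M] norm_mat_sq[symmetric] k_def r_def .
qed

lemma bulk_abs_growth:
  assumes M: "M \<in> S0" and C: "0 < C" and B: "0 \<le> B"
  shows "\<bar>bulk A B C M\<bar> \<le> (\<bar>A\<bar> + B + C) * (1 + 2 * norm M ^ 4)"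
proof -
  define r where "r = norm M"
  have r: "0 \<le> r" by (simp add: r_def)
  have "\<bar>(M ** M) \<bullet> M\<bar> \<le> norm (M ** M) * norm M" by (rule Cauchy_Schwarz_ineq2)
  also have "\<dots> \<le> r * r * r" unfolding r_def by (intro mult_right_mono norm_matrix_mult_le) auto
  finally have c: "\<bar>(M ** M) \<bullet> M\<bar> \<le> r * r * r" .
  have r2: "r\<^sup>2 \<le> 1 + r ^ 4"
    using two_mult_le_squares[of 1 "r\<^sup>2"] by simp
  have r3: "r * r * r \<le> 1 + 2 * r ^ 4"
  proof -
    have "r * r\<^sup>2 \<le> r\<^sup>2 + (r\<^sup>2)\<^sup>2" using two_mult_le_squares[of r "r\<^sup>2"] r by simp
    then show ?thesis using r2 by (simp add: power2_eq_square power4_eq_xxxx mult.assoc)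
  qed
  have "\<bar>bulk A B C M\<bar> \<le> \<bar>A/2 * r\<^sup>2\<bar> + \<bar>B/3 * ((M ** M) \<bullet> M)\<bar> + \<bar>C/4 * (r\<^sup>2)\<^sup>2\<bar>"
    unfolding bulk_S0[OF M] norm_mat_sq[symmetric] r_def by linarith
  also have "\<dots> = \<bar>A\<bar>/2 * r\<^sup>2 + B/3 * \<bar>(M ** M) \<bullet> M\<bar> + C/4 * r ^ 4" using B C by (simp add: abs_mult)
  also have "\<dots> \<le> \<bar>A\<bar> * (1 + 2 * r ^ 4) + B * (1 + 2 * r ^ 4) + C * (1 + 2 * r ^ 4)"
  proof -
    have "0 \<le> r ^ 4" using r by simp
    then have "r\<^sup>2 \<le> 1 + 2 * r ^ 4" "r ^ 4 \<le> 1 + 2 * r ^ 4" using r2 by linarith+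
    then show ?thesis by (intro add_mono mult_mono order_trans[OF c r3]) (use B C r in auto)
  qed
  finally show ?thesis by (simp add: r_def algebra_simps)
qed

section \<open>The span of the two basic matrices\<close>

lemma Q_of_comp:
  "Q_of a b $ 1 $ 1 = - b" "Q_of a b $ 1 $ 2 = - a" "Q_of a b $ 1 $ 3 = 0"
  "Q_of a b $ 2 $ 1 = - a" "Q_of a b $ 2 $ 2 = - b" "Q_of a b $ 2 $ 3 = 0"
  "Q_of a b $ 3 $ 1 = 0" "Q_of a b $ 3 $ 2 = 0" "Q_of a b $ 3 $ 3 = 2 * b"
  by (simp_all add: Q_of_def outer_product_def n1_def n2_def z_hat_def vector_3 field_simps)

lemma Q_of_linear: "Q_of (a * x + b * y) (a * x' + b * y') = a *\<^sub>R Q_of x x' + b *\<^sub>R Q_of y y'"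
  by (simp add: Q_of_def algebra_simps)

lemma Q_of_S0: "Q_of a b \<in> S0"
  by (simp add: S0_def vec_eq_iff forall_3 transpose_def trace_def sum_3 Q_of_comp)

lemma Q_of_inner: "Q_of a b \<bullet> Q_of c d = 2 * a * c + 6 * b * d"
  by (simp add: mat_inner sum_3 Q_of_comp)

lemma Q_of_norm: "(norm (Q_of a b))\<^sup>2 = 2 * a\<^sup>2 + 6 * b\<^sup>2"
  unfolding norm_mat_sq Q_of_inner by (simp add: power2_eq_square)

text \<open>In the common eigenframe \<open>n1\<close>, \<open>n2\<close>, \<open>z_hat\<close> the
  matrices \<open>Q_of\<close> are exactly the traceless diagonal ones. Squares stay diagonal, and
  the projection removes their trace. The witnesses come from the entries (1,2) and (3,3).\<close>

lemma bulk_grad_Q_of: "\<exists>a' b'. bulk_grad A B C (Q_of a b) = Q_of a' b'"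
proof (intro exI)
  define r where "r = 2 * a\<^sup>2 + 6 * b\<^sup>2"
  have t: "trace (Q_of a b ** Q_of a b) = r"
    unfolding S0_trace_mult[OF Q_of_S0] Q_of_inner r_def by (simp add: power2_eq_square)
  show "bulk_grad A B C (Q_of a b) = Q_of (A * a + B * (2 * a * b) + C * r * a) (A * b - B * (b\<^sup>2 - a\<^sup>2 / 3) + C * r * b)"
    unfolding bulk_grad_def t
    by (simp add: vec_eq_iff forall_3 Q_of_comp matrix_matrix_mult_def sum_3 mat_def r_def power2_eq_square field_simps)
qed

section \<open>Critical points are global minimizers\<close>

text \<open>The integrability that pairs with cubic terms; for functions with zero boundary values
  Ladyzhenskaya's inequality supplies it.\<close>

definition L4 :: "'a measure \<Rightarrow> ('a \<Rightarrow> real) \<Rightarrow> bool" where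
  "L4 M u \<longleftrightarrow> u \<in> borel_measurable M \<and> integrable M (\<lambda>x. (u x) ^ 4)"

lemma L4_L2_sq: "L4 M u \<Longrightarrow> L2 M (\<lambda>x. (u x)\<^sup>2)"
  by (auto simp: L4_def L2_def)

lemma add_pow4_le: "(a + b) ^ 4 \<le> 8 * a ^ 4 + 8 * b ^ 4" for a b :: real
proof -
  have "(a + b)\<^sup>2 \<le> 2 * a\<^sup>2 + 2 * b\<^sup>2" using norm_add_sq_le[of a b] by simp
  then have "((a + b)\<^sup>2)\<^sup>2 \<le> (2 * a\<^sup>2 + 2 * b\<^sup>2)\<^sup>2" by (intro power_mono) auto
  also have "\<dots> \<le> 2 * (2 * a\<^sup>2)\<^sup>2 + 2 * (2 * b\<^sup>2)\<^sup>2" using norm_add_sq_le[of "2 * a\<^sup>2" "2 * b\<^sup>2"] by simp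
  finally show ?thesis by (simp add: power_mult_distrib)
qed

lemma L4_bound:
  assumes "f \<in> borel_measurable M" "integrable M g" "AE x in M. (f x) ^ 4 \<le> g x"
  shows "L4 M f"
  unfolding L4_def
proof
  show "integrable M (\<lambda>x. (f x) ^ 4)"
  proof (rule Bochner_Integration.integrable_bound[OF assms(2)])
    show "AE x in M. norm ((f x) ^ 4) \<le> norm (g x)" using assms(3) by eventually_elim simp
  qed (use assms(1) in measurable)
qed fact

lemma L4_add: "L4 M f \<Longrightarrow> L4 M g \<Longrightarrow> L4 M (\<lambda>x. f x + g x)"
  by (rule L4_bound[where g="\<lambda>x. 8 * (f x) ^ 4 + 8 * (g x) ^ 4"]) (auto simp: L4_def add_pow4_le)

lemma L4_cmult: "L4 M f \<Longrightarrow> L4 M (\<lambda>x. c * f x)"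
  by (auto simp: L4_def power_mult_distrib)

lemma L4_zero: "L4 M (\<lambda>x. 0)"
  by (simp add: L4_def)

lemma L4_sum: "(\<And>i. i \<in> I \<Longrightarrow> L4 M (f i)) \<Longrightarrow> L4 M (\<lambda>x. \<Sum>i\<in>I. f i x)"
  by (induction I rule: infinite_finite_induct) (auto intro: L4_add L4_zero)

lemma L4_abs: "L4 M f \<Longrightarrow> L4 M (\<lambda>x. \<bar>f x\<bar>)"
  unfolding L4_def by (intro conjI borel_measurable_abs) auto

lemma (in finite_measure) L4_const: "L4 M (\<lambda>x. c)"
  by (simp add: L4_def)

lemma L4_mult_sq_integrable:
  assumes m: "L4 M m" and d: "L4 M d"
  shows "integrable M (\<lambda>x. (m x)\<^sup>2 * (d x)\<^sup>2)" "L2 M (\<lambda>x. m x * d x)"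
proof -
  have [measurable]: "m \<in> borel_measurable M" "d \<in> borel_measurable M" using m d by (auto simp: L4_def)
  show i: "integrable M (\<lambda>x. (m x)\<^sup>2 * (d x)\<^sup>2)"
    using L2_inner_integrable[OF L4_L2_sq[OF m] L4_L2_sq[OF d]] by simp
  show "L2 M (\<lambda>x. m x * d x)"
    using i by (simp add: L2_def power_mult_distrib)
qed

lemma L4_cubic_integrable:
  assumes m: "L4 M m" and d: "L4 M d"
  shows "integrable M (\<lambda>x. (m x) ^ 3 * d x)"
proof -
  have eq: "(m x)\<^sup>2 \<bullet> (m x * d x) = (m x) ^ 3 * d x" for x by (simp add: power2_eq_square power3_eq_cube)
  show ?thesis using L2_inner_integrable[OF L4_L2_sq[OF m] L4_mult_sq_integrable(2)[OF m d]] unfolding eq .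
qed

text \<open>Hoelder's inequality with exponents 4/3 and 4, from two applications of Cauchy-Schwarz;
  fourth powers are kept to avoid roots.\<close>

lemma L4_cubic_bound:
  assumes m: "L4 M m" and d: "L4 M d"
  shows "(LINT x|M. (m x) ^ 3 * d x) ^ 4 \<le> (LINT x|M. (m x) ^ 4) ^ 3 * (LINT x|M. (d x) ^ 4)"
proof -
  define I where "I = (LINT x|M. (m x) ^ 3 * d x)"
  define J where "J = (LINT x|M. (m x)\<^sup>2 * (d x)\<^sup>2)"
  define a where "a = (LINT x|M. (m x) ^ 4)"
  define b where "b = (LINT x|M. (d x) ^ 4)"
  have a0: "0 \<le> a" by (simp add: a_def)
  have "(LINT x|M. (m x)\<^sup>2 \<bullet> (m x * d x))\<^sup>2 \<le> (LINT x|M. (norm ((m x)\<^sup>2))\<^sup>2) * (LINT x|M. (norm (m x * d x))\<^sup>2)"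
    by (rule L2_Cauchy_Schwarz[OF L4_L2_sq[OF m] L4_mult_sq_integrable(2)[OF m d]])
  moreover have e: "(m x)\<^sup>2 \<bullet> (m x * d x) = (m x) ^ 3 * d x" "(norm ((m x)\<^sup>2))\<^sup>2 = (m x) ^ 4"
    "(norm (m x * d x))\<^sup>2 = (m x)\<^sup>2 * (d x)\<^sup>2" for x
    by (simp_all add: power_mult_distrib power2_eq_square power3_eq_cube power4_eq_xxxx)
  ultimately have 1: "I\<^sup>2 \<le> a * J" unfolding e I_def J_def a_def by blast
  have "(LINT x|M. (m x)\<^sup>2 \<bullet> (d x)\<^sup>2)\<^sup>2 \<le> (LINT x|M. (norm ((m x)\<^sup>2))\<^sup>2) * (LINT x|M. (norm ((d x)\<^sup>2))\<^sup>2)"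
    by (rule L2_Cauchy_Schwarz[OF L4_L2_sq[OF m] L4_L2_sq[OF d]])
  then have 2: "J\<^sup>2 \<le> a * b" by (simp add: J_def a_def b_def)
  have "I ^ 4 = (I\<^sup>2)\<^sup>2" by simp
  also have "\<dots> \<le> (a * J)\<^sup>2" by (intro power_mono 1) auto
  also have "\<dots> = a\<^sup>2 * J\<^sup>2" by (simp add: power_mult_distrib)
  also have "\<dots> \<le> a\<^sup>2 * (a * b)" by (intro mult_left_mono 2) auto
  finally show ?thesis by (simp add: I_def a_def b_def power2_eq_square power3_eq_cube mult_ac)
qed

lemma L4_cubic_mult_integrable:
  assumes m: "L4 M m" and d: "L4 M d" and h: "h \<in> borel_measurable M" "AE x in M. \<bar>h x\<bar> \<le> c * (m x) ^ 3"
  shows "integrable M (\<lambda>x. h x * d x)"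
proof (rule Bochner_Integration.integrable_bound)
  show "integrable M (\<lambda>x. c * ((m x) ^ 3 * \<bar>d x\<bar>))" using L4_cubic_integrable[OF m L4_abs[OF d]] by simp
  show "AE x in M. norm (h x * d x) \<le> norm (c * ((m x) ^ 3 * \<bar>d x\<bar>))"
    using h(2)
  proof eventually_elim
    fix x assume "\<bar>h x\<bar> \<le> c * m x ^ 3"
    then have "\<bar>h x\<bar> * \<bar>d x\<bar> \<le> c * m x ^ 3 * \<bar>d x\<bar>" by (rule mult_right_mono) simp
    then show "norm (h x * d x) \<le> norm (c * ((m x) ^ 3 * \<bar>d x\<bar>))" by (simp add: abs_mult[symmetric] mult.assoc)
  qed
  have [measurable]: "d \<in> borel_measurable M" using d by (simp add: L4_def)
  show "(\<lambda>x. h x * d x) \<in> borel_measurable M" using h by measurable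
qed

text \<open>The form in which nonlinear terms converge: typically h is a component of the bulk
  gradient and m = 1 + |Q|.\<close>

lemma L4_cubic_tendsto:
  assumes m: "L4 M m" and d: "\<And>k. L4 M (d k)" and lim: "(\<lambda>k. LINT x|M. (d k x) ^ 4) \<longlonglongrightarrow> 0"
    and h: "h \<in> borel_measurable M" "AE x in M. \<bar>h x\<bar> \<le> c * (m x) ^ 3"
  shows "(\<lambda>k. LINT x|M. h x * d k x) \<longlonglongrightarrow> 0"
proof -
  have L: "L4 M (\<lambda>x. \<bar>d k x\<bar>)" for k by (rule L4_abs[OF d])
  define I where "I k = (LINT x|M. (m x) ^ 3 * \<bar>d k x\<bar>)" for k
  have z: "(\<lambda>k. (LINT x|M. (m x) ^ 4) ^ 3 * (LINT x|M. (d k x) ^ 4)) \<longlonglongrightarrow> 0"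
    using tendsto_mult_left[OF lim, of "(LINT x|M. (m x) ^ 4) ^ 3"] by simp
  have "(I k) ^ 4 \<le> (LINT x|M. (m x) ^ 4) ^ 3 * (LINT x|M. (d k x) ^ 4)" for k
    using L4_cubic_bound[OF m L[of k]] by (simp add: I_def)
  then have "(\<lambda>k. (I k) ^ 4) \<longlonglongrightarrow> 0"
    by (intro tendsto_sandwich[OF _ _ tendsto_const z]) auto
  then have "I \<longlonglongrightarrow> 0" by simp
  then have I0: "(\<lambda>k. c * I k) \<longlonglongrightarrow> 0" by (rule tendsto_mult_right_zero)
  have "norm (LINT x|M. h x * d k x) \<le> c * I k" for k
  proof -
    have "norm (LINT x|M. h x * d k x) \<le> (LINT x|M. norm (h x * d k x))" by (rule integral_norm_bound)
    also have "\<dots> \<le> (LINT x|M. c * ((m x) ^ 3 * \<bar>d k x\<bar>))"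
    proof (rule integral_mono_AE)
      show "integrable M (\<lambda>x. c * ((m x) ^ 3 * \<bar>d k x\<bar>))" using L4_cubic_integrable[OF m L] by simp
      show "integrable M (\<lambda>x. norm (h x * d k x))" by (intro integrable_norm L4_cubic_mult_integrable[OF m d h])
      show "AE x in M. norm (h x * d k x) \<le> c * ((m x) ^ 3 * \<bar>d k x\<bar>)"
        using h(2)
      proof eventually_elim
        fix x assume "\<bar>h x\<bar> \<le> c * m x ^ 3"
        then have "\<bar>h x\<bar> * \<bar>d k x\<bar> \<le> c * m x ^ 3 * \<bar>d k x\<bar>" by (rule mult_right_mono) simp
        then show "norm (h x * d k x) \<le> c * ((m x) ^ 3 * \<bar>d k x\<bar>)" by (simp add: abs_mult mult.assoc)
      qed
    qed
    finally have "norm (LINT x|M. h x * d k x) \<le> (LINT x|M. c * ((m x) ^ 3 * \<bar>d k x\<bar>))" .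
    then show ?thesis by (simp add: I_def)
  qed
  then show ?thesis by (intro Lim_null_comparison[OF _ I0]) auto
qed

lemma Q_of_split: "Q_of a b $ i $ j = a * Q_of 1 0 $ i $ j + b * Q_of 0 1 $ i $ j"
  using Q_of_linear[of a 1 b 0 0 1] by simp

lemma norm_mat_component: "norm (M - N) ^ 2 = (\<Sum>i\<in>UNIV. \<Sum>j\<in>UNIV. (M $ i $ j - N $ i $ j)\<^sup>2)" for M N :: mat3
  unfolding norm_mat_sq mat_inner by (simp add: power2_eq_square)

text \<open>The smallness condition makes \<open>1 - \<kappa> * K * P\<^sub>0\<close> positive, with
  the Poincare constant \<open>P\<^sub>0\<close>; this is strict convexity of the energy. The
  extension of the boundary data is left abstract, and s is identified with \<open>s_plus\<close>
  where critical points enter.\<close>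

locale ldg = well +
  fixes A B C L lam s :: real and g :: "real \<Rightarrow> real" and F1 F3 :: "pt \<Rightarrow> real" and D1 D3 :: "pt \<Rightarrow> pt"
  assumes coeffs: "0 < C" "0 \<le> B" "0 < L" "0 < lam"
    and small: "lam\<^sup>2 / L * semiconvexity A B C * (2 * (1 - \<rho>)\<^sup>2) < 1"
    and ext: "C1_grad F1 D1" "C1_grad F3 D3"
    and ext_boundary: "\<And>a b p. (a, b) \<in> boundary_edges \<rho> \<epsilon> \<Longrightarrow> p \<in> closed_segment a b \<Longrightarrow>
       F1 p = q1b s \<rho> \<epsilon> g p \<and> F3 p = q3b s \<rho> \<epsilon> p"
begin

abbreviation "\<Omega> \<equiv> Om \<rho> \<epsilon>"
abbreviation "\<kappa> \<equiv> lam\<^sup>2 / L"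
abbreviation "K \<equiv> semiconvexity A B C"
abbreviation "adm \<equiv> admissible_class s \<rho> \<epsilon> g"
abbreviation "wg Q i j \<equiv> weak_grad \<Omega> (\<lambda>p. Q p $ i $ j)"
abbreviation "P\<^sub>0 \<equiv> 2 * (1 - \<rho>)\<^sup>2"

lemma kappa_pos: "0 < \<kappa>" using coeffs by simp

lemma K_nonneg: "0 \<le> K" using coeffs by (simp add: semiconvexity_def)

lemma poincare:
  assumes "W0 u G" shows "(LINT p|\<mu>. (u p)\<^sup>2) \<le> P\<^sub>0 * (LINT p|\<mu>. (norm (G p))\<^sup>2)"
proof (rule W0_poincare[OF assms])
  show "0 \<le> 1 - \<rho>" using rho by simp
  show "norm ((1, 0) :: pt) = 1" by simp
  \<comment> \<open>Moving away from the vertical axis by 1 - \<rho> raises |x| + |y| from above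
    \<rho> to above 1.\<close>
  show "p + (1 - \<rho>) *\<^sub>R (1, 0) \<notin> \<Omega> \<or> p - (1 - \<rho>) *\<^sub>R (1, 0) \<notin> \<Omega>" if "p \<in> \<Omega>" for p
    using that rho by (cases p) (simp add: Om_iff, linarith)
qed

lemma test_boundary_zero:
  assumes "test_function \<Omega> \<psi> D\<psi>" "(a, b) \<in> boundary_edges \<rho> \<epsilon>" "p \<in> closed_segment a b"
  shows "\<psi> p = 0"
proof -
  have "p \<in> frontier \<Omega>" using boundary_edges_frontier[of \<rho> \<epsilon>] rho eps assms(2,3) by fastforce
  then have "p \<notin> \<Omega>" using open_dom by (simp add: frontier_def interior_open)
  moreover obtain K where "K \<subseteq> \<Omega>" "\<And>p. p \<notin> K \<Longrightarrow> \<psi> p = 0"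
    using test_function_support[OF assms(1)] by metis
  ultimately show ?thesis by blast
qed

text \<open>Test functions vanish on the boundary edges, so extension plus test function attains the
  boundary values exactly, and the limits inherit the trace.\<close>

lemma Q_of_admissible:
  assumes "W0 w1 G1" "W0 w3 G3"
  shows "(\<lambda>p. Q_of (F1 p + w1 p) (F3 p + w3 p)) \<in> adm"
    "Sob (\<lambda>p. Q_of (F1 p + w1 p) (F3 p + w3 p) $ i $ j)
       (\<lambda>p. (Q_of 1 0 $ i $ j) *\<^sub>R (D1 p + G1 p) + (Q_of 0 1 $ i $ j) *\<^sub>R (D3 p + G3 p))"
proof -
  obtain \<phi> D\<phi> where \<phi>: "\<And>k. test_function \<Omega> (\<phi> k) (D\<phi> k)" "L2_lim \<mu> \<phi> w1" "L2_lim \<mu> D\<phi> G1"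
    using assms(1) unfolding W0_def by blast
  obtain \<psi> D\<psi> where \<psi>: "\<And>k. test_function \<Omega> (\<psi> k) (D\<psi> k)" "L2_lim \<mu> \<psi> w3" "L2_lim \<mu> D\<psi> G3"
    using assms(2) unfolding W0_def by blast
  define c1 where "c1 i j = Q_of 1 0 $ i $ j" for i j :: 3
  define c3 where "c3 i j = Q_of 0 1 $ i $ j" for i j :: 3
  have eq: "Q_of a b $ i $ j = c1 i j * a + c3 i j * b" for a b i j
    unfolding c1_def c3_def by (subst Q_of_split) (simp add: mult.commute)
  have C: "C1_grad (\<lambda>p. c1 i j * (F1 p + \<phi> k p) + c3 i j * (F3 p + \<psi> k p))
     (\<lambda>p. c1 i j *\<^sub>R (D1 p + D\<phi> k p) + c3 i j *\<^sub>R (D3 p + D\<psi> k p))" for i j k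
    by (intro C1_grad_add C1_grad_cmult ext test_function_C1[OF \<phi>(1)] test_function_C1[OF \<psi>(1)])
  note Fc = L2_lim_const[OF C1_L2(1)[OF ext(1)]] L2_lim_const[OF C1_L2(1)[OF ext(2)]]
    L2_lim_const[OF C1_L2(2)[OF ext(1)]] L2_lim_const[OF C1_L2(2)[OF ext(2)]]
  have l: "L2_lim \<mu> (\<lambda>k p. c1 i j *\<^sub>R (F1 p + \<phi> k p) + c3 i j *\<^sub>R (F3 p + \<psi> k p)) (\<lambda>p. c1 i j *\<^sub>R (F1 p + w1 p) + c3 i j *\<^sub>R (F3 p + w3 p))" for i j
    by (intro L2_lim_add L2_lim_scaleR Fc \<phi> \<psi>)
  have lD: "L2_lim \<mu> (\<lambda>k p. c1 i j *\<^sub>R (D1 p + D\<phi> k p) + c3 i j *\<^sub>R (D3 p + D\<psi> k p)) (\<lambda>p. c1 i j *\<^sub>R (D1 p + G1 p) + c3 i j *\<^sub>R (D3 p + G3 p))" for i j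
    by (intro L2_lim_add L2_lim_scaleR Fc \<phi> \<psi>)
  have tr: "has_trace \<Omega> (boundary_edges \<rho> \<epsilon>) (\<lambda>p. Q_of (F1 p + w1 p) (F3 p + w3 p) $ i $ j) (\<lambda>p. Qb s \<rho> \<epsilon> g p $ i $ j)" for i j
    unfolding Qb_def eq
  proof (rule has_trace_exact[OF C])
    show "L2_lim \<mu> (\<lambda>k p. c1 i j * (F1 p + \<phi> k p) + c3 i j * (F3 p + \<psi> k p)) (\<lambda>p. c1 i j * (F1 p + w1 p) + c3 i j * (F3 p + w3 p))"
      using l[of i j] by simp
    show "c1 i j * (F1 p + \<phi> k p) + c3 i j * (F3 p + \<psi> k p) = c1 i j * q1b s \<rho> \<epsilon> g p + c3 i j * q3b s \<rho> \<epsilon> p"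
      if "(a, b) \<in> boundary_edges \<rho> \<epsilon>" "p \<in> closed_segment a b" for a b p k
      using ext_boundary[OF that] test_boundary_zero[OF \<phi>(1) that] test_boundary_zero[OF \<psi>(1) that] by simp
  qed (rule lD)
  show "Sob (\<lambda>p. Q_of (F1 p + w1 p) (F3 p + w3 p) $ i $ j)
       (\<lambda>p. (Q_of 1 0 $ i $ j) *\<^sub>R (D1 p + G1 p) + (Q_of 0 1 $ i $ j) *\<^sub>R (D3 p + G3 p))"
    unfolding eq[of "F1 _ + w1 _"] c1_def[symmetric] c3_def[symmetric]
    by (rule C1_lim_Sob[OF C _ lD]) (use l[of i j] in simp)
  have "W12 \<Omega> (\<lambda>p. Q_of (F1 p + w1 p) (F3 p + w3 p) $ i $ j)" for i j
    using tr[of i j] unfolding has_trace_def by blast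
  with tr show "(\<lambda>p. Q_of (F1 p + w1 p) (F3 p + w3 p)) \<in> adm"
    unfolding admissible_class_def by (simp add: Q_of_S0)
qed

lemma W0_zero: "W0 (\<lambda>_. 0) (\<lambda>_. 0)"
  by (rule test_W0[OF test_function_zero])

lemma adm_S0: "Q \<in> adm \<Longrightarrow> AE p in \<mu>. Q p \<in> S0"
  unfolding admissible_class_def by (simp add: AE_mu)

lemma adm_Sob: "Q \<in> adm \<Longrightarrow> Sob (\<lambda>p. Q p $ i $ j) (wg Q i j)"
  unfolding admissible_class_def by (auto intro: Sob_weak_grad)

lemma adm_diff_W0: "P \<in> adm \<Longrightarrow> Q \<in> adm \<Longrightarrow> W0 (\<lambda>p. P p $ i $ j - Q p $ i $ j) (\<lambda>p. wg P i j p - wg Q i j p)"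
  unfolding admissible_class_def by (intro same_trace_W0[where h="\<lambda>p. Qb s \<rho> \<epsilon> g p $ i $ j"]) blast+

lemma C1_L4: "C1_grad \<phi> D\<phi> \<Longrightarrow> L4 \<mu> \<phi>"
proof -
  assume C: "C1_grad \<phi> D\<phi>"
  have "L2 \<mu> (\<lambda>p. (\<phi> p)\<^sup>2)" by (intro continuous_L2 continuous_on_power C1_grad_continuous(1)[OF C])
  then show "L4 \<mu> \<phi>"
    unfolding L4_def using borel_measurable_mu[OF C1_grad_borel(1)[OF C]] by (simp add: L2_def)
qed

lemma W0_L4: "W0 u G \<Longrightarrow> L4 \<mu> u"
  unfolding L4_def using W0_ladyzhenskaya(1) W0_L2(1) by (auto simp: L2_def)

lemma adm_component_measurable: "Q \<in> adm \<Longrightarrow> (\<lambda>p. Q p $ i $ j) \<in> borel_measurable \<mu>"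
  using adm_Sob[of Q i j] by (auto simp: Sob_def L2_def)

text \<open>Ladyzhenskaya's inequality is available for zero boundary values; subtracting one fixed
  C1 competitor F reduces the claim to it.\<close>

lemma adm_component_L4:
  assumes "Q \<in> adm" shows "L4 \<mu> (\<lambda>p. Q p $ i $ j)"
proof -
  define F where "F p = Q_of (F1 p + 0) (F3 p + 0)" for p
  have F: "F \<in> adm" unfolding F_def using Q_of_admissible(1)[OF W0_zero W0_zero] by simp
  have "L4 \<mu> (\<lambda>p. Q p $ i $ j - F p $ i $ j)" by (rule W0_L4[OF adm_diff_W0[OF assms F]])
  moreover have "L4 \<mu> (\<lambda>p. F p $ i $ j)"
  proof -
    have "F p $ i $ j = (Q_of 1 0 $ i $ j) * F1 p + (Q_of 0 1 $ i $ j) * F3 p" for p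
      unfolding F_def by (subst Q_of_split) (simp add: mult.commute)
    then show ?thesis using L4_add[OF L4_cmult[OF C1_L4[OF ext(1)]] L4_cmult[OF C1_L4[OF ext(2)]]] by simp
  qed
  ultimately show ?thesis using L4_add by fastforce
qed

lemma component_measurable_imp:
  assumes "\<And>i j. (\<lambda>p. Q p $ i $ j) \<in> borel_measurable M"
  shows "(\<lambda>p. bulk A B C (Q p)) \<in> borel_measurable M" "(\<lambda>p. bulk_grad A B C (Q p) $ i $ j) \<in> borel_measurable M"
    "(\<lambda>p. norm (Q p)) \<in> borel_measurable M"
proof -
  note [measurable] = assms
  show "(\<lambda>p. bulk A B C (Q p)) \<in> borel_measurable M"
    unfolding bulk_def trace_def matrix_matrix_mult_def sum_3 vec_lambda_beta by measurable
  show "(\<lambda>p. bulk_grad A B C (Q p) $ i $ j) \<in> borel_measurable M"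
    unfolding bulk_grad_def trace_def matrix_matrix_mult_def sum_3 vec_lambda_beta
      vector_add_component vector_minus_component vector_scaleR_component by measurable
  show "(\<lambda>p. norm (Q p)) \<in> borel_measurable M"
    unfolding norm_eq_sqrt_inner mat_inner sum_3 by measurable
qed

lemma adm_norm_L4:
  assumes "Q \<in> adm" shows "L4 \<mu> (\<lambda>p. norm (Q p))"
proof (rule L4_bound)
  let ?S = "\<lambda>p. \<Sum>i\<in>UNIV. \<Sum>j\<in>UNIV. \<bar>Q p $ i $ j\<bar>"
  have "L4 \<mu> ?S" by (intro L4_sum L4_abs adm_component_L4 assms)
  then show "integrable \<mu> (\<lambda>p. (?S p) ^ 4)" by (simp add: L4_def)
  show "(\<lambda>p. norm (Q p)) \<in> borel_measurable \<mu>" by (intro component_measurable_imp adm_component_measurable assms)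
  have "norm (Q p) \<le> ?S p" for p
  proof -
    have "norm (Q p) \<le> (\<Sum>i\<in>UNIV. norm (Q p $ i))" unfolding norm_vec_def[of "Q p"] by (rule L2_set_le_sum) auto
    also have "\<dots> \<le> ?S p" by (intro sum_mono norm_le_l1_cart)
    finally show ?thesis .
  qed
  then show "AE p in \<mu>. (norm (Q p)) ^ 4 \<le> (?S p) ^ 4" by (intro AE_I2 power_mono) auto
qed

lemma mat_component_le: "\<bar>M $ i $ j\<bar> \<le> norm M" for M :: mat3
proof -
  have "norm (M $ i $ j) \<le> norm (M $ i)" "norm (M $ i) \<le> norm M" by (rule Finite_Cartesian_Product.norm_nth_le)+
  then show ?thesis by simp
qed

text \<open>The summand 1 lets a single cube dominate both the linear and the cubic growth of the
  gradient.\<close>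

lemma adm_grad_bound:
  assumes "Q \<in> adm"
  shows "L4 \<mu> (\<lambda>p. 1 + norm (Q p))" "(\<lambda>p. bulk_grad A B C (Q p) $ i $ j) \<in> borel_measurable \<mu>"
    "AE p in \<mu>. \<bar>bulk_grad A B C (Q p) $ i $ j\<bar> \<le> 4 * (\<bar>A\<bar> + B + C) * (1 + norm (Q p)) ^ 3"
proof -
  show "L4 \<mu> (\<lambda>p. 1 + norm (Q p))" by (intro L4_add L4_const adm_norm_L4 assms)
  show "(\<lambda>p. bulk_grad A B C (Q p) $ i $ j) \<in> borel_measurable \<mu>"
    by (intro component_measurable_imp adm_component_measurable assms)
  show "AE p in \<mu>. \<bar>bulk_grad A B C (Q p) $ i $ j\<bar> \<le> 4 * (\<bar>A\<bar> + B + C) * (1 + norm (Q p)) ^ 3"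
    using adm_S0[OF assms]
  proof eventually_elim
    fix p assume S: "Q p \<in> S0"
    have "\<bar>bulk_grad A B C (Q p) $ i $ j\<bar> \<le> norm (bulk_grad A B C (Q p))" by (rule mat_component_le)
    also have "\<dots> \<le> 4 * (\<bar>A\<bar> + B + C) * (norm (Q p) + norm (Q p) ^ 3)" by (rule bulk_grad_growth[OF S coeffs(1,2)])
    also have "\<dots> \<le> 4 * (\<bar>A\<bar> + B + C) * (1 + norm (Q p)) ^ 3"
    proof (rule mult_left_mono)
      show "norm (Q p) + norm (Q p) ^ 3 \<le> (1 + norm (Q p)) ^ 3"
        by (simp add: power3_eq_cube algebra_simps)
    qed (use coeffs in auto)
    finally show "\<bar>bulk_grad A B C (Q p) $ i $ j\<bar> \<le> 4 * (\<bar>A\<bar> + B + C) * (1 + norm (Q p)) ^ 3" .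
  qed
qed

text \<open>The equation is given for C1 functions of compact support, while differences of
  admissible maps are limits of those. Ladyzhenskaya's inequality for \<psi> k - d provides the L4
  convergence under which the cubic term passes to the limit.\<close>

lemma weak_solution_tested:
  assumes Q: "Q \<in> adm" and sol: "weak_solution A B C L lam \<Omega> Q" and d: "W0 d G"
  shows "integrable \<mu> (\<lambda>p. bulk_grad A B C (Q p) $ i $ j * d p)"
    "(LINT p|\<mu>. wg Q i j p \<bullet> G p) = - \<kappa> * (LINT p|\<mu>. bulk_grad A B C (Q p) $ i $ j * d p)"
proof -
  obtain \<psi> D\<psi> where \<psi>: "\<And>k. test_function \<Omega> (\<psi> k) (D\<psi> k)" "L2_lim \<mu> \<psi> d" "L2_lim \<mu> D\<psi> G"
    using d unfolding W0_def by blast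
  define h where "h p = bulk_grad A B C (Q p) $ i $ j" for p
  note hb = adm_grad_bound(1)[OF Q] adm_grad_bound(2,3)[OF Q, of i j, folded h_def]
  show int: "integrable \<mu> (\<lambda>p. bulk_grad A B C (Q p) $ i $ j * d p)"
    using L4_cubic_mult_integrable[OF hb(1) W0_L4[OF d] hb(2,3)] by (simp add: h_def)
  have w: "W0 (\<lambda>p. \<psi> k p - d p) (\<lambda>p. D\<psi> k p - G p)" for k by (intro W0_diff test_W0 \<psi> d)
  have "(\<lambda>k. LINT p|\<mu>. (\<psi> k p - d p) ^ 4) \<longlonglongrightarrow> 0"
  proof (rule tendsto_sandwich[OF _ _ tendsto_const])
    have "(\<lambda>k. ((LINT p|\<mu>. (norm (\<psi> k p - d p))\<^sup>2) + (LINT p|\<mu>. (norm (D\<psi> k p - G p))\<^sup>2))\<^sup>2) \<longlonglongrightarrow> (0 + 0)\<^sup>2"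
      using \<psi>(2,3) unfolding L2_lim_def by (intro tendsto_intros) auto
    then show "(\<lambda>k. ((LINT p|\<mu>. (\<psi> k p - d p)\<^sup>2) + (LINT p|\<mu>. (norm (D\<psi> k p - G p))\<^sup>2))\<^sup>2) \<longlonglongrightarrow> 0" by simp
  qed (use W0_ladyzhenskaya(2)[OF w] in auto)
  from L4_cubic_tendsto[OF hb(1) W0_L4[OF w] this hb(2,3)]
  have "(\<lambda>k. LINT p|\<mu>. h p * (\<psi> k p - d p)) \<longlonglongrightarrow> 0" .
  moreover have "(LINT p|\<mu>. h p * (\<psi> k p - d p)) = (LINT p|\<mu>. h p * \<psi> k p) - (LINT p|\<mu>. h p * d p)" for k
    using L4_cubic_mult_integrable[OF hb(1) W0_L4[OF d] hb(2,3)] L4_cubic_mult_integrable[OF hb(1) W0_L4[OF test_W0[OF \<psi>(1)]] hb(2,3)]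
    by (simp add: right_diff_distrib)
  ultimately have 1: "(\<lambda>k. LINT p|\<mu>. h p * \<psi> k p) \<longlonglongrightarrow> (LINT p|\<mu>. h p * d p)" by (simp add: LIM_zero_iff)
  have "L2 \<mu> (wg Q i j)" using adm_Sob[OF Q] by (simp add: Sob_def)
  then have 2: "(\<lambda>k. LINT p|\<mu>. wg Q i j p \<bullet> D\<psi> k p) \<longlonglongrightarrow> (LINT p|\<mu>. wg Q i j p \<bullet> G p)"
    by (intro L2_lim_inner L2_lim_const \<psi>)
  have "(LINT p|\<mu>. wg Q i j p \<bullet> D\<psi> k p) = - \<kappa> * (LINT p|\<mu>. h p * \<psi> k p)" for k
  proof -
    have "- (LINT p|\<mu>. wg Q i j p \<bullet> D\<psi> k p) = (LINT p|\<mu>. EL_rhs A B C L lam (Q p) $ i $ j * \<psi> k p)"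
      using sol \<psi>(1) unfolding weak_solution_def by (simp add: set_lint_mu)
    also have "\<dots> = \<kappa> * (LINT p|\<mu>. h p * \<psi> k p)"
      by (simp add: EL_rhs_bulk_grad h_def mult.assoc)
    finally show ?thesis by simp
  qed
  then have "(LINT p|\<mu>. wg Q i j p \<bullet> G p) = - \<kappa> * (LINT p|\<mu>. h p * d p)"
    using LIMSEQ_unique[OF 2] tendsto_mult_left[OF 1, of "- \<kappa>"] by simp
  then show "(LINT p|\<mu>. wg Q i j p \<bullet> G p) = - \<kappa> * (LINT p|\<mu>. bulk_grad A B C (Q p) $ i $ j * d p)"
    by (simp add: h_def)
qed

lemma adm_bulk_integrable:
  assumes "Q \<in> adm" shows "integrable \<mu> (\<lambda>p. bulk A B C (Q p))"
proof (rule Bochner_Integration.integrable_bound)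
  show "integrable \<mu> (\<lambda>p. (\<bar>A\<bar> + B + C) * (1 + 2 * norm (Q p) ^ 4))"
    using adm_norm_L4[OF assms] by (auto simp: L4_def)
  show "(\<lambda>p. bulk A B C (Q p)) \<in> borel_measurable \<mu>" by (intro component_measurable_imp adm_component_measurable assms)
  show "AE p in \<mu>. norm (bulk A B C (Q p)) \<le> norm ((\<bar>A\<bar> + B + C) * (1 + 2 * norm (Q p) ^ 4))"
    using adm_S0[OF assms]
  proof eventually_elim
    fix p assume "Q p \<in> S0"
    from bulk_abs_growth[OF this coeffs(1,2), of A]
    show "norm (bulk A B C (Q p)) \<le> norm ((\<bar>A\<bar> + B + C) * (1 + 2 * norm (Q p) ^ 4))" by simp
  qed
qed

lemma energy_eq:
  assumes "Q \<in> adm"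
  shows "LdG_energy A B C L lam \<Omega> Q = 1/2 * (\<Sum>i\<in>UNIV. \<Sum>j\<in>UNIV. LINT p|\<mu>. (norm (wg Q i j p))\<^sup>2) + \<kappa> * (LINT p|\<mu>. bulk A B C (Q p))"
proof -
  have i: "integrable \<mu> (\<lambda>p. (norm (wg Q i j p))\<^sup>2)" for i j
    using adm_Sob[OF assms, of i j] L2_sq_integrable[of \<mu> "wg Q i j"] unfolding Sob_def by blast
  show ?thesis
    unfolding LdG_energy_def set_lint_mu[OF dom_borel]
    using i adm_bulk_integrable[OF assms] by simp
qed

text \<open>The Dirichlet energy is expanded exactly, the potential by semiconvexity. The
  first-order terms cancel by the weak equation tested with P - Q, and by Poincare the loss K / 2 |P
  - Q|^2 consumes less than the quadratic gradient term.\<close>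

theorem critical_energy_gap:
  assumes Q: "Q \<in> adm" "weak_solution A B C L lam \<Omega> Q" and P: "P \<in> adm"
  shows "LdG_energy A B C L lam \<Omega> Q + (1 - \<kappa> * K * P\<^sub>0) / 2 * (\<Sum>i\<in>UNIV. \<Sum>j\<in>UNIV. LINT p|\<mu>. (norm (wg P i j p - wg Q i j p))\<^sup>2)
    \<le> LdG_energy A B C L lam \<Omega> P"
proof -
  define d where "d i j p = P p $ i $ j - Q p $ i $ j" for i j p
  define G where "G i j p = wg P i j p - wg Q i j p" for i j p
  have W: "W0 (d i j) (G i j)" for i j unfolding d_def G_def by (rule adm_diff_W0[OF P Q(1)])
  have wL: "L2 \<mu> (wg P i j)" "L2 \<mu> (wg Q i j)" "L2 \<mu> (G i j)" "L2 \<mu> (d i j)" for i j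
    using adm_Sob[OF P] adm_Sob[OF Q(1)] W0_L2[OF W] by (auto simp: Sob_def)
  have e1: "(LINT p|\<mu>. (norm (wg P i j p))\<^sup>2) = (LINT p|\<mu>. (norm (wg Q i j p))\<^sup>2) + 2 * (LINT p|\<mu>. wg Q i j p \<bullet> G i j p) + (LINT p|\<mu>. (norm (G i j p))\<^sup>2)" for i j
  proof -
    have "(norm (wg P i j p))\<^sup>2 = (norm (wg Q i j p))\<^sup>2 + 2 * (wg Q i j p \<bullet> G i j p) + (norm (G i j p))\<^sup>2" for p
      unfolding G_def power2_norm_eq_inner by (simp add: inner_diff_left inner_diff_right inner_commute)
    then show ?thesis
      using L2_sq_integrable[OF wL(2)] L2_inner_integrable[OF wL(2,3)] L2_sq_integrable[OF wL(3)] by simp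
  qed
  have ib: "integrable \<mu> (\<lambda>p. bulk_grad A B C (Q p) $ i $ j * d i j p)"
    and eb: "(LINT p|\<mu>. wg Q i j p \<bullet> G i j p) = - \<kappa> * (LINT p|\<mu>. bulk_grad A B C (Q p) $ i $ j * d i j p)" for i j
    by (rule weak_solution_tested[OF Q W])+
  have id: "integrable \<mu> (\<lambda>p. (d i j p)\<^sup>2)" for i j using L2_sq_integrable[OF wL(4)] by simp
  have "(LINT p|\<mu>. bulk A B C (Q p) + (\<Sum>i\<in>UNIV. \<Sum>j\<in>UNIV. bulk_grad A B C (Q p) $ i $ j * d i j p) - K / 2 * (\<Sum>i\<in>UNIV. \<Sum>j\<in>UNIV. (d i j p)\<^sup>2)) \<le> (LINT p|\<mu>. bulk A B C (P p))"
  proof (rule integral_mono_AE)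
    show "integrable \<mu> (\<lambda>p. bulk A B C (Q p) + (\<Sum>i\<in>UNIV. \<Sum>j\<in>UNIV. bulk_grad A B C (Q p) $ i $ j * d i j p) - K / 2 * (\<Sum>i\<in>UNIV. \<Sum>j\<in>UNIV. (d i j p)\<^sup>2))"
      by (intro Bochner_Integration.integrable_add Bochner_Integration.integrable_diff integrable_mult_right Bochner_Integration.integrable_sum adm_bulk_integrable Q ib id)
    show "AE p in \<mu>. bulk A B C (Q p) + (\<Sum>i\<in>UNIV. \<Sum>j\<in>UNIV. bulk_grad A B C (Q p) $ i $ j * d i j p) - K / 2 * (\<Sum>i\<in>UNIV. \<Sum>j\<in>UNIV. (d i j p)\<^sup>2) \<le> bulk A B C (P p)"
      using adm_S0[OF P] adm_S0[OF Q(1)]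
    proof eventually_elim
      fix p assume S: "P p \<in> S0" "Q p \<in> S0"
      show "bulk A B C (Q p) + (\<Sum>i\<in>UNIV. \<Sum>j\<in>UNIV. bulk_grad A B C (Q p) $ i $ j * d i j p) - K / 2 * (\<Sum>i\<in>UNIV. \<Sum>j\<in>UNIV. (d i j p)\<^sup>2) \<le> bulk A B C (P p)"
        using bulk_semiconvex[OF coeffs(1,2) S(2,1), of A] unfolding norm_mat_component mat_inner by (simp add: d_def)
    qed
  qed (rule adm_bulk_integrable[OF P])
  also have "(LINT p|\<mu>. bulk A B C (Q p) + (\<Sum>i\<in>UNIV. \<Sum>j\<in>UNIV. bulk_grad A B C (Q p) $ i $ j * d i j p) - K / 2 * (\<Sum>i\<in>UNIV. \<Sum>j\<in>UNIV. (d i j p)\<^sup>2)) =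
     (LINT p|\<mu>. bulk A B C (Q p)) + (\<Sum>i\<in>UNIV. \<Sum>j\<in>UNIV. LINT p|\<mu>. bulk_grad A B C (Q p) $ i $ j * d i j p) - K / 2 * (\<Sum>i\<in>UNIV. \<Sum>j\<in>UNIV. LINT p|\<mu>. (d i j p)\<^sup>2)"
    using adm_bulk_integrable[OF Q(1)] ib id by simp
  finally have b: "(LINT p|\<mu>. bulk A B C (Q p)) + (\<Sum>i\<in>UNIV. \<Sum>j\<in>UNIV. LINT p|\<mu>. bulk_grad A B C (Q p) $ i $ j * d i j p) - K / 2 * (\<Sum>i\<in>UNIV. \<Sum>j\<in>UNIV. LINT p|\<mu>. (d i j p)\<^sup>2) \<le> (LINT p|\<mu>. bulk A B C (P p))" .
  define \<Gamma> where "\<Gamma> = (\<Sum>i\<in>UNIV. \<Sum>j\<in>UNIV. LINT p|\<mu>. (norm (G i j p))\<^sup>2)"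
  define X where "X = (\<Sum>i\<in>UNIV. \<Sum>j\<in>UNIV. LINT p|\<mu>. bulk_grad A B C (Q p) $ i $ j * d i j p)"
  define Y where "Y = (\<Sum>i\<in>UNIV. \<Sum>j\<in>UNIV. LINT p|\<mu>. (d i j p)\<^sup>2)"
  have "Y \<le> (\<Sum>i\<in>UNIV. \<Sum>j\<in>UNIV. P\<^sub>0 * (LINT p|\<mu>. (norm (G i j p))\<^sup>2))"
    unfolding Y_def by (intro sum_mono poincare W)
  then have Y: "Y \<le> P\<^sub>0 * \<Gamma>" by (simp add: \<Gamma>_def sum_distrib_left)
  have "\<kappa> * ((LINT p|\<mu>. bulk A B C (Q p)) + X - K / 2 * Y) \<le> \<kappa> * (LINT p|\<mu>. bulk A B C (P p))"
    using b kappa_pos unfolding X_def Y_def by (intro mult_left_mono) auto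
  moreover have "\<kappa> * (K / 2 * Y) \<le> \<kappa> * (K / 2 * (P\<^sub>0 * \<Gamma>))"
    using kappa_pos K_nonneg Y by (intro mult_left_mono) auto
  moreover have "(\<Sum>i\<in>UNIV. \<Sum>j\<in>UNIV. LINT p|\<mu>. (norm (wg P i j p))\<^sup>2) = (\<Sum>i\<in>UNIV. \<Sum>j\<in>UNIV. LINT p|\<mu>. (norm (wg Q i j p))\<^sup>2) - 2 * \<kappa> * X + \<Gamma>"
    unfolding e1 eb X_def \<Gamma>_def by (simp add: sum.distrib sum_distrib_left sum_subtractf sum_negf mult.assoc)
  \<comment> \<open>Pure arithmetic, stated for variables in place of integrals so that the
    remaining inequality is linear.\<close>
  moreover have "1/2 * SQ + k * bq + (1 - k * K * p0) / 2 * \<Gamma> \<le> 1/2 * SP + k * bp"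
    if "k * (bq + X - K / 2 * Y) \<le> k * bp" "k * (K / 2 * Y) \<le> k * (K / 2 * (p0 * \<Gamma>))" "SP = SQ - 2 * k * X + \<Gamma>"
    for k bq bp p0 SP SQ :: real
  proof -
    have "k * (bq + X - K / 2 * Y) = k * bq + k * X - k * (K / 2 * Y)" by (simp add: algebra_simps)
    moreover have "(1 - k * K * p0) / 2 * \<Gamma> = \<Gamma> / 2 - k * (K / 2 * (p0 * \<Gamma>))" by (simp add: field_simps)
    ultimately show ?thesis using that by linarith
  qed
  ultimately show ?thesis
    unfolding energy_eq[OF P] energy_eq[OF Q(1)] \<Gamma>_def[unfolded G_def, symmetric] by blast
qed

text \<open>Equal energies force equal gradients and, by Poincare, equal maps. For uniqueness the
  gap is used a second time with the two critical points exchanged.\<close>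

theorem critical_global_minimizer:
  assumes "s = s_plus A B C" and Q: "Q \<in> adm" "weak_solution A B C L lam \<Omega> Q"
  shows "the_global_minimizer A B C L lam \<rho> \<epsilon> g Q" "unique_critical_point A B C L lam \<rho> \<epsilon> g Q"
proof -
  let ?c = "(1 - \<kappa> * K * P\<^sub>0) / 2"
  have c: "0 < ?c" using small by simp
  have gap: "LdG_energy A B C L lam \<Omega> Q \<le> LdG_energy A B C L lam \<Omega> P \<and>
        (LdG_energy A B C L lam \<Omega> P \<le> LdG_energy A B C L lam \<Omega> Q \<longrightarrow> eq_ae_on \<Omega> P Q)"
    if Q: "Q \<in> adm" "weak_solution A B C L lam \<Omega> Q" and P: "P \<in> adm" for P Q
  proof -
    define n where "n i j = (LINT p|\<mu>. (norm (wg P i j p - wg Q i j p))\<^sup>2)" for i j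
    define N where "N = (\<Sum>i\<in>UNIV. \<Sum>j\<in>UNIV. n i j)"
    have n0: "0 \<le> n i j" for i j by (simp add: n_def)
    have "0 \<le> N" unfolding N_def by (intro sum_nonneg n0)
    have g: "LdG_energy A B C L lam \<Omega> Q + ?c * N \<le> LdG_energy A B C L lam \<Omega> P"
      using critical_energy_gap[OF Q P] by (simp add: N_def n_def)
    have "eq_ae_on \<Omega> P Q" if "LdG_energy A B C L lam \<Omega> P \<le> LdG_energy A B C L lam \<Omega> Q"
    proof -
      have "?c * N \<le> 0" using g that by linarith
      then have "N \<le> 0" using c by (simp add: mult_le_0_iff)
      then have "N = 0" using \<open>0 \<le> N\<close> by simp
      then have nz: "n i j = 0" for i j
        unfolding N_def using n0 by (auto simp: sum_nonneg_eq_0_iff sum_nonneg)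
      have "AE p in \<mu>. P p $ i $ j - Q p $ i $ j = 0" for i j
      proof -
        have W: "W0 (\<lambda>p. P p $ i $ j - Q p $ i $ j) (\<lambda>p. wg P i j p - wg Q i j p)" by (rule adm_diff_W0[OF P Q(1)])
        have "(LINT p|\<mu>. (P p $ i $ j - Q p $ i $ j)\<^sup>2) \<le> 0" using poincare[OF W] nz[of i j] by (simp add: n_def)
        moreover have "0 \<le> (LINT p|\<mu>. (P p $ i $ j - Q p $ i $ j)\<^sup>2)" by simp
        ultimately have "(LINT p|\<mu>. (P p $ i $ j - Q p $ i $ j)\<^sup>2) = 0" by linarith
        moreover have "integrable \<mu> (\<lambda>p. (P p $ i $ j - Q p $ i $ j)\<^sup>2)" using L2_sq_integrable[OF W0_L2(1)[OF W]] by simp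
        ultimately show ?thesis by (subst (asm) integral_nonneg_eq_0_iff_AE) auto
      qed
      then have "AE p in \<mu>. \<forall>i j. P p $ i $ j - Q p $ i $ j = 0" by (simp add: AE_all_countable)
      then have "AE p in \<mu>. P p = Q p" by eventually_elim (simp add: vec_eq_iff)
      then show ?thesis by (simp add: eq_ae_on_def AE_mu)
    qed
    moreover have "0 \<le> ?c * N" using c \<open>0 \<le> N\<close> by simp
    ultimately show ?thesis using g by linarith
  qed
  show "the_global_minimizer A B C L lam \<rho> \<epsilon> g Q"
    unfolding the_global_minimizer_def assms(1)[symmetric] using gap[OF Q] Q(1) by auto
  show "unique_critical_point A B C L lam \<rho> \<epsilon> g Q"
    unfolding unique_critical_point_def critical_point_def assms(1)[symmetric] using gap[OF Q] gap Q by blast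
qed

end

section \<open>Existence of a critical point\<close>

lemma C1_grad_unique: "C1_grad \<phi> D \<Longrightarrow> C1_grad \<phi> E \<Longrightarrow> D = E"
proof
  fix p assume D: "C1_grad \<phi> D" and E: "C1_grad \<phi> E"
  have "(\<lambda>h. h \<bullet> D p) = (\<lambda>h. h \<bullet> E p)"
    by (rule has_derivative_unique[OF C1_grad_GDERIV[OF D, unfolded gderiv_def] C1_grad_GDERIV[OF E, unfolded gderiv_def]])
  from fun_cong[OF this, of "D p - E p"] have "(D p - E p) \<bullet> (D p - E p) = 0" by (simp add: inner_diff_right)
  then show "D p = E p" by simp
qed

text \<open>Makes the energy J a function of q1 and q3 alone; on C1 functions
  \<open>C1_grad_unique\<close> makes the choice unambiguous.\<close>

definition grad :: "(pt \<Rightarrow> real) \<Rightarrow> pt \<Rightarrow> pt" where "grad \<phi> = (SOME D. C1_grad \<phi> D)"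

lemma grad_eq: "C1_grad \<phi> D \<Longrightarrow> grad \<phi> = D"
  unfolding grad_def by (rule some_equality) (assumption, rule C1_grad_unique)

lemma reflect_simps [simp]:
  "reflect (reflect p) = p" "reflect' (reflect' p) = p" "norm (reflect p) = norm p" "norm (reflect' p) = norm p"
  by (simp_all add: reflect_def reflect'_def pt_norm)

lemma reflect_commute: "reflect (reflect' p) = reflect' (reflect p)"
  by (simp add: reflect_def reflect'_def)

lemma reflect_linear: "bounded_linear reflect" "bounded_linear reflect'"
  unfolding reflect_def reflect'_def by (intro bounded_linear_Pair bounded_linear_minus bounded_linear_fst bounded_linear_snd)+

lemma reflect_adjoint: "reflect p \<bullet> q = p \<bullet> reflect q" "reflect' p \<bullet> q = p \<bullet> reflect' q"
  by (simp_all add: reflect_def reflect'_def inner_prod_def)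

lemma nn_integral_reflect:
  assumes f: "f \<in> borel_measurable borel"
  shows "(\<integral>\<^sup>+p. f (reflect p) \<partial>lborel) = (\<integral>\<^sup>+p. f p \<partial>lborel)" "(\<integral>\<^sup>+p. f (reflect' p) \<partial>lborel) = (\<integral>\<^sup>+p. f p \<partial>lborel)"
proof -
  have fst: "(\<integral>\<^sup>+p. h p \<partial>lborel) = (\<integral>\<^sup>+x. (\<integral>\<^sup>+y. h (x, y) \<partial>lborel) \<partial>lborel)"
    if "h \<in> borel_measurable borel" for h :: "pt \<Rightarrow> ennreal"
    unfolding lborel_prod[symmetric]
    by (rule lborel.nn_integral_fst[symmetric]) (use that in \<open>simp add: lborel_prod\<close>)
  have snd: "(\<integral>\<^sup>+p. h p \<partial>lborel) = (\<integral>\<^sup>+y. (\<integral>\<^sup>+x. h (x, y) \<partial>lborel) \<partial>lborel)"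
    if "h \<in> borel_measurable borel" for h :: "pt \<Rightarrow> ennreal"
    unfolding lborel_prod[symmetric]
    by (rule lborel_pair.nn_integral_snd[where f=h, symmetric]) (use that in \<open>simp add: lborel_prod\<close>)
  have r: "reflect \<in> borel_measurable borel" "reflect' \<in> borel_measurable borel"
    by (intro borel_measurable_continuous_onI linear_continuous_on reflect_linear)+
  have m: "(\<lambda>x. f (x, y)) \<in> borel_measurable borel" "(\<lambda>x. f (y, x)) \<in> borel_measurable borel" for y
    by (rule measurable_compose[OF _ f], intro borel_measurable_continuous_onI continuous_intros)+
  show "(\<integral>\<^sup>+p. f (reflect p) \<partial>lborel) = (\<integral>\<^sup>+p. f p \<partial>lborel)"
    unfolding snd[OF f] snd[OF measurable_compose[OF r(1) f]]
    using nn_integral_real_affine[OF m(1), of "-1" _ 0] by (simp add: reflect_def)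
  show "(\<integral>\<^sup>+p. f (reflect' p) \<partial>lborel) = (\<integral>\<^sup>+p. f p \<partial>lborel)"
    unfolding fst[OF f] fst[OF measurable_compose[OF r(2) f]]
    using nn_integral_real_affine[OF m(2), of "-1" _ 0] by (simp add: reflect'_def)
qed

text \<open>The Tonelli computation is first turned into an identity of measures, so that integrands
  of arbitrary sign are covered.\<close>

lemma integral_reflect:
  fixes f :: "pt \<Rightarrow> real"
  assumes T: "T \<in> {reflect, reflect'}" and f: "f \<in> borel_measurable borel"
  shows "(LINT p|lborel. f (T p)) = (LINT p|lborel. f p)"
proof -
  have r: "T \<in> borel_measurable borel"
    using T reflect_linear by (auto intro!: borel_measurable_continuous_onI linear_continuous_on)
  have "distr lborel borel T = lborel"
  proof (rule measure_eqI)
    fix X assume "X \<in> sets (distr lborel borel T)"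
    then have X: "X \<in> sets borel" by simp
    have "emeasure (distr lborel borel T) X = (\<integral>\<^sup>+p. indicator X p \<partial>(distr lborel borel T))" using X by simp
    also have "\<dots> = (\<integral>\<^sup>+p. indicator X (T p) \<partial>lborel)" by (rule nn_integral_distr) (use r X in auto)
    also have "\<dots> = (\<integral>\<^sup>+p. indicator X p \<partial>lborel)" using T nn_integral_reflect[of "indicator X"] X by auto
    finally show "emeasure (distr lborel borel T) X = emeasure lborel X" using X by simp
  qed simp
  then have "(LINT p|lborel. f p) = (LINT p|distr lborel borel T. f p)" by simp
  also have "\<dots> = (LINT p|lborel. f (T p))" by (rule integral_distr) (use r f in auto)
  finally show ?thesis by simp
qed

text \<open>The first coordinate enters through its square, hence the energy is invariant under q1
  \<mapsto> - q1.\<close>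

lemma bulk_Q_of: "bulk A B C (Q_of a b) = A * (a\<^sup>2 + 3 * b\<^sup>2) - 2 * B * (b ^ 3 - b * a\<^sup>2) + C * (a\<^sup>2 + 3 * b\<^sup>2)\<^sup>2"
proof -
  have e1: "(Q_of a b ** Q_of a b) \<bullet> Q_of a b = 6 * (b ^ 3 - b * a\<^sup>2)"
    by (simp add: mat_inner sum_3 matrix_matrix_mult_def Q_of_comp power2_eq_square power3_eq_cube algebra_simps)
  have e2: "Q_of a b \<bullet> Q_of a b = 2 * (a\<^sup>2 + 3 * b\<^sup>2)"
    unfolding Q_of_inner by (simp add: power2_eq_square)
  show ?thesis unfolding bulk_S0[OF Q_of_S0] e1 e2 power_mult_distrib by (simp add: field_simps)
qed

lemma integral_reflect_mu:
  fixes f :: "pt \<Rightarrow> real"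
  assumes "well \<rho> \<epsilon>" and T: "T \<in> {reflect, reflect'}" and f: "f \<in> borel_measurable borel"
  shows "(LINT p|mu (Om \<rho> \<epsilon>). f (T p)) = (LINT p|mu (Om \<rho> \<epsilon>). f p)"
proof -
  interpret well \<rho> \<epsilon> by fact
  have "T p \<in> Om \<rho> \<epsilon> \<longleftrightarrow> p \<in> Om \<rho> \<epsilon>" for p using T by (auto simp: Om_iff reflect_def reflect'_def)
  then have eq: "indicator (Om \<rho> \<epsilon>) p * f (T p) = indicator (Om \<rho> \<epsilon>) (T p) * f (T p)" for p by (simp add: indicator_def)
  have "(\<lambda>p. indicator (Om \<rho> \<epsilon>) p * f p) \<in> borel_measurable borel" using f by measurable
  from integral_reflect[OF T this] show ?thesis by (simp add: integral_restrict_space eq)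
qed

section \<open>Minimization over C1 competitors\<close>

locale ldg_sym = ldg +
  assumes parity: "\<And>p. F1 (reflect p) = - F1 p" "\<And>p. F1 (reflect' p) = - F1 p"
    "\<And>p. F3 (reflect p) = F3 p" "\<And>p. F3 (reflect' p) = F3 p"
begin

text \<open>Competitors stay C1, so that integrands are continuous and oddness is pointwise; Sobolev
  functions arise as their limits.\<close>

definition V :: "(pt \<Rightarrow> real) \<Rightarrow> (pt \<Rightarrow> real) \<Rightarrow> bool" where
  "V q1 q3 \<longleftrightarrow> (\<exists>\<psi>1 E1 \<psi>3 E3. test_function \<Omega> \<psi>1 E1 \<and> test_function \<Omega> \<psi>3 E3 \<and>
     q1 = (\<lambda>p. F1 p + \<psi>1 p) \<and> q3 = (\<lambda>p. F3 p + \<psi>3 p))"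

definition energy_density :: "(pt \<Rightarrow> real) \<Rightarrow> (pt \<Rightarrow> real) \<Rightarrow> pt \<Rightarrow> real" where
  "energy_density q1 q3 p = (norm (grad q1 p))\<^sup>2 + 3 * (norm (grad q3 p))\<^sup>2 + \<kappa> * bulk A B C (Q_of (q1 p) (q3 p))"

text \<open>
  The Landau--de Gennes energy of \<open>Q_of q1 q3\<close>, because \<open>|Q_of q1 q3|\<^sup>2 = 2 q1\<^sup>2 + 6 q3\<^sup>2\<close>.
\<close>

definition J :: "(pt \<Rightarrow> real) \<Rightarrow> (pt \<Rightarrow> real) \<Rightarrow> real" where "J q1 q3 = (LINT p|\<mu>. energy_density q1 q3 p)"

lemma V_test:
  assumes "V q1 q3"
  shows "test_function \<Omega> (\<lambda>p. q1 p - F1 p) (\<lambda>p. grad q1 p - D1 p)" "test_function \<Omega> (\<lambda>p. q3 p - F3 p) (\<lambda>p. grad q3 p - D3 p)"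
    "C1_grad q1 (grad q1)" "C1_grad q3 (grad q3)"
proof -
  obtain \<psi>1 E1 \<psi>3 E3 where t: "test_function \<Omega> \<psi>1 E1" "test_function \<Omega> \<psi>3 E3"
    and q: "q1 = (\<lambda>p. F1 p + \<psi>1 p)" "q3 = (\<lambda>p. F3 p + \<psi>3 p)" using assms unfolding V_def by blast
  have C: "C1_grad q1 (\<lambda>p. D1 p + E1 p)" "C1_grad q3 (\<lambda>p. D3 p + E3 p)"
    unfolding q by (intro C1_grad_add ext test_function_C1[OF t(1)] test_function_C1[OF t(2)])+
  show "test_function \<Omega> (\<lambda>p. q1 p - F1 p) (\<lambda>p. grad q1 p - D1 p)" "test_function \<Omega> (\<lambda>p. q3 p - F3 p) (\<lambda>p. grad q3 p - D3 p)"
    "C1_grad q1 (grad q1)" "C1_grad q3 (grad q3)"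
    unfolding grad_eq[OF C(1)] grad_eq[OF C(2)] using C t by (simp_all add: q)
qed

lemma VI: "test_function \<Omega> (\<lambda>p. q1 p - F1 p) E1 \<Longrightarrow> test_function \<Omega> (\<lambda>p. q3 p - F3 p) E3 \<Longrightarrow> V q1 q3"
  unfolding V_def by (intro exI[of _ "\<lambda>p. q1 p - F1 p"] exI[of _ E1] exI[of _ "\<lambda>p. q3 p - F3 p"] exI[of _ E3]) auto

lemma continuous_integrable: "continuous_on UNIV f \<Longrightarrow> integrable \<mu> f" for f :: "pt \<Rightarrow> real"
  by (rule L2_integrable[OF continuous_L2])

lemma energy_density_continuous:
  assumes "V q1 q3" shows "continuous_on UNIV (energy_density q1 q3)"
proof -
  note c = C1_grad_continuous[OF V_test(3)[OF assms]] C1_grad_continuous[OF V_test(4)[OF assms]]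
  show ?thesis unfolding energy_density_def bulk_Q_of by (intro continuous_intros c)
qed

lemma V_combine:
  assumes "V q1 q3" "V r1 r3"
  shows "V (\<lambda>p. (1/2) * (q1 p + r1 p)) (\<lambda>p. (1/2) * (q3 p + r3 p))"
proof (rule VI)
  have e: "(1/2) * (a + b) - c = (1/2) * (a - c) + (1/2) * (b - c)" for a b c :: real by (simp add: field_simps)
  show "test_function \<Omega> (\<lambda>p. (1/2) * (q1 p + r1 p) - F1 p) (\<lambda>p. (1/2) *\<^sub>R (grad q1 p - D1 p) + (1/2) *\<^sub>R (grad r1 p - D1 p))"
    unfolding e by (intro test_function_add test_function_scale V_test(1)[OF assms(1)] V_test(1)[OF assms(2)])
  show "test_function \<Omega> (\<lambda>p. (1/2) * (q3 p + r3 p) - F3 p) (\<lambda>p. (1/2) *\<^sub>R (grad q3 p - D3 p) + (1/2) *\<^sub>R (grad r3 p - D3 p))"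
    unfolding e by (intro test_function_add test_function_scale V_test(2)[OF assms(1)] V_test(2)[OF assms(2)])
qed

lemma V_diff_W0:
  assumes "V q1 q3" "V r1 r3"
  shows "W0 (\<lambda>p. q1 p - r1 p) (\<lambda>p. grad q1 p - grad r1 p)" "W0 (\<lambda>p. q3 p - r3 p) (\<lambda>p. grad q3 p - grad r3 p)"
  using test_W0[OF test_function_diff[OF V_test(1)[OF assms(1)] V_test(1)[OF assms(2)]]]
    test_W0[OF test_function_diff[OF V_test(2)[OF assms(1)] V_test(2)[OF assms(2)]]] by simp_all

lemma norm_midpoint_sq: "(norm ((1/2) *\<^sub>R (a + b)))\<^sup>2 = (norm a)\<^sup>2 / 2 + (norm b)\<^sup>2 / 2 - (norm (a - b))\<^sup>2 / 4" for a b :: "'a::real_inner"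
proof -
  have "(norm (a + b))\<^sup>2 + (norm (a - b))\<^sup>2 = 2 * (norm a)\<^sup>2 + 2 * (norm b)\<^sup>2"
    unfolding power2_norm_eq_inner by (simp add: inner_add_left inner_add_right inner_diff_left inner_diff_right)
  moreover have "(norm ((1/2) *\<^sub>R (a + b)))\<^sup>2 = (norm (a + b))\<^sup>2 / 4"
    by (simp add: power_mult_distrib power_divide)
  ultimately show ?thesis by simp
qed

text \<open>The parallelogram identity for the gradients and \<open>bulk_midpoint\<close> for the
  potential, whose defect Poincare converts into gradients. This drives both the symmetrization and
  the Cauchy property.\<close>

lemma J_midpoint:
  assumes V: "V q1 q3" "V r1 r3"
  shows "J (\<lambda>p. (1/2) * (q1 p + r1 p)) (\<lambda>p. (1/2) * (q3 p + r3 p)) +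
     (1 - \<kappa> * K * P\<^sub>0) / 4 * ((LINT p|\<mu>. (norm (grad q1 p - grad r1 p))\<^sup>2) + 3 * (LINT p|\<mu>. (norm (grad q3 p - grad r3 p))\<^sup>2))
    \<le> (J q1 q3 + J r1 r3) / 2"
proof -
  note C = V_test(3,4)[OF V(1)] V_test(3,4)[OF V(2)]
  note c = C1_grad_continuous[OF C(1)] C1_grad_continuous[OF C(2)] C1_grad_continuous[OF C(3)] C1_grad_continuous[OF C(4)]
  have gm: "grad (\<lambda>p. (1/2) * (q1 p + r1 p)) = (\<lambda>p. (1/2) *\<^sub>R (grad q1 p + grad r1 p))"
    "grad (\<lambda>p. (1/2) * (q3 p + r3 p)) = (\<lambda>p. (1/2) *\<^sub>R (grad q3 p + grad r3 p))"
    by (intro grad_eq C1_grad_cmult C1_grad_add C)+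
  have pw: "energy_density (\<lambda>p. (1/2) * (q1 p + r1 p)) (\<lambda>p. (1/2) * (q3 p + r3 p)) p \<le>
     energy_density q1 q3 p / 2 + energy_density r1 r3 p / 2 - (norm (grad q1 p - grad r1 p))\<^sup>2 / 4 - 3 * ((norm (grad q3 p - grad r3 p))\<^sup>2 / 4)
       + \<kappa> * (K / 4) * ((q1 p - r1 p)\<^sup>2 + 3 * (q3 p - r3 p)\<^sup>2)" for p
  proof -
    have M: "Q_of ((1/2) * (q1 p + r1 p)) ((1/2) * (q3 p + r3 p)) = (1/2) *\<^sub>R (Q_of (q1 p) (q3 p) + Q_of (r1 p) (r3 p))"
      using Q_of_linear[of "1/2" "q1 p" "1/2" "r1 p" "q3 p" "r3 p"] by (simp add: distrib_left scaleR_add_right)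
    have N: "(norm (Q_of (q1 p) (q3 p) - Q_of (r1 p) (r3 p)))\<^sup>2 = 2 * (q1 p - r1 p)\<^sup>2 + 6 * (q3 p - r3 p)\<^sup>2"
      using Q_of_linear[of 1 "q1 p" "-1" "r1 p" "q3 p" "r3 p"] Q_of_norm[of "q1 p - r1 p" "q3 p - r3 p"] by simp
    have "bulk A B C (Q_of ((1/2) * (q1 p + r1 p)) ((1/2) * (q3 p + r3 p))) \<le> (bulk A B C (Q_of (q1 p) (q3 p)) + bulk A B C (Q_of (r1 p) (r3 p))) / 2
       + K / 8 * (2 * (q1 p - r1 p)\<^sup>2 + 6 * (q3 p - r3 p)\<^sup>2)"
      unfolding M N[symmetric] by (rule bulk_midpoint[OF coeffs(1,2) Q_of_S0 Q_of_S0])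
    then have h1: "\<kappa> * bulk A B C (Q_of ((1/2) * (q1 p + r1 p)) ((1/2) * (q3 p + r3 p))) \<le> \<kappa> * ((bulk A B C (Q_of (q1 p) (q3 p)) + bulk A B C (Q_of (r1 p) (r3 p))) / 2
       + K / 8 * (2 * (q1 p - r1 p)\<^sup>2 + 6 * (q3 p - r3 p)\<^sup>2))"
      using kappa_pos by (intro mult_left_mono) auto
    have e: "k * ((b1 + b2) / 2 + K / 8 * (2 * x + 6 * y)) = k * b1 / 2 + k * b2 / 2 + k * (K / 4) * (x + 3 * y)" for k b1 b2 x y :: real
      by (simp add: field_simps)
    have b: "\<kappa> * bulk A B C (Q_of ((1/2) * (q1 p + r1 p)) ((1/2) * (q3 p + r3 p))) \<le> \<kappa> * bulk A B C (Q_of (q1 p) (q3 p)) / 2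
        + \<kappa> * bulk A B C (Q_of (r1 p) (r3 p)) / 2 + \<kappa> * (K / 4) * ((q1 p - r1 p)\<^sup>2 + 3 * (q3 p - r3 p)\<^sup>2)" using h1 unfolding e .
    have "g1 + 3 * g3 + z \<le> (x1 + 3 * x3 + bq) / 2 + (y1 + 3 * y3 + br) / 2 - d1 / 4 - 3 * (d3 / 4) + w"
      if "g1 = x1 / 2 + y1 / 2 - d1 / 4" "g3 = x3 / 2 + y3 / 2 - d3 / 4" "z \<le> bq / 2 + br / 2 + w" for g1 g3 z x1 x3 y1 y3 d1 d3 bq br w :: real
      unfolding add_divide_distrib using that by linarith
    from this[OF norm_midpoint_sq norm_midpoint_sq b] show ?thesis unfolding energy_density_def gm .
  qed
  note W = V_diff_W0[OF V]
  have i: "integrable \<mu> (energy_density q1 q3)" "integrable \<mu> (energy_density r1 r3)"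
    "integrable \<mu> (energy_density (\<lambda>p. (1/2) * (q1 p + r1 p)) (\<lambda>p. (1/2) * (q3 p + r3 p)))"
    by (intro continuous_integrable energy_density_continuous V V_combine)+
  have i2: "integrable \<mu> (\<lambda>p. (norm (grad q1 p - grad r1 p))\<^sup>2)" "integrable \<mu> (\<lambda>p. (norm (grad q3 p - grad r3 p))\<^sup>2)"
    "integrable \<mu> (\<lambda>p. (q1 p - r1 p)\<^sup>2)" "integrable \<mu> (\<lambda>p. (q3 p - r3 p)\<^sup>2)"
    using L2_sq_integrable[OF W0_L2(2)[OF W(1)]] L2_sq_integrable[OF W0_L2(2)[OF W(2)]]
      L2_sq_integrable[OF W0_L2(1)[OF W(1)]] L2_sq_integrable[OF W0_L2(1)[OF W(2)]] by simp_all
  define g1 where "g1 = (LINT p|\<mu>. (norm (grad q1 p - grad r1 p))\<^sup>2)"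
  define g3 where "g3 = (LINT p|\<mu>. (norm (grad q3 p - grad r3 p))\<^sup>2)"
  define d1 where "d1 = (LINT p|\<mu>. (q1 p - r1 p)\<^sup>2)"
  define d3 where "d3 = (LINT p|\<mu>. (q3 p - r3 p)\<^sup>2)"
  have kK: "0 \<le> \<kappa> * (K / 4)" by (rule mult_nonneg_nonneg[OF less_imp_le[OF kappa_pos] divide_nonneg_nonneg[OF K_nonneg]]) simp
  have pW: "d1 \<le> P\<^sub>0 * g1" "d3 \<le> P\<^sub>0 * g3" unfolding g1_def g3_def d1_def d3_def by (rule poincare[OF W(1)] poincare[OF W(2)])+
  have "J (\<lambda>p. (1/2) * (q1 p + r1 p)) (\<lambda>p. (1/2) * (q3 p + r3 p)) \<le> (LINT p|\<mu>. energy_density q1 q3 p / 2 + energy_density r1 r3 p / 2 - (norm (grad q1 p - grad r1 p))\<^sup>2 / 4 - 3 * ((norm (grad q3 p - grad r3 p))\<^sup>2 / 4)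
       + \<kappa> * (K / 4) * ((q1 p - r1 p)\<^sup>2 + 3 * (q3 p - r3 p)\<^sup>2))"
    unfolding J_def
    by (rule integral_mono[OF i(3) _ pw])
       (intro Bochner_Integration.integrable_add Bochner_Integration.integrable_diff integrable_mult_right integrable_divide i i2)
  also have "\<dots> = J q1 q3 / 2 + J r1 r3 / 2 - g1 / 4 - 3 * (g3 / 4) + \<kappa> * (K / 4) * (d1 + 3 * d3)"
    unfolding J_def g1_def g3_def d1_def d3_def using i i2 by simp
  also have "\<dots> \<le> J q1 q3 / 2 + J r1 r3 / 2 - g1 / 4 - 3 * (g3 / 4) + \<kappa> * (K / 4) * (P\<^sub>0 * g1 + 3 * (P\<^sub>0 * g3))"
    using pW kK by (intro add_left_mono mult_left_mono add_mono) auto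
  finally have "J (\<lambda>p. (1/2) * (q1 p + r1 p)) (\<lambda>p. (1/2) * (q3 p + r3 p)) \<le> J q1 q3 / 2 + J r1 r3 / 2 - g1 / 4 - 3 * (g3 / 4) + \<kappa> * (K / 4) * (P\<^sub>0 * g1 + 3 * (P\<^sub>0 * g3))" .
  moreover have "k * (K / 4) * (p0 * g1 + 3 * (p0 * g3)) - g1 / 4 - 3 * (g3 / 4) = - ((1 - k * K * p0) / 4 * (g1 + 3 * g3))" for k p0 :: real
    by (simp add: field_simps)
  ultimately show ?thesis unfolding g1_def[symmetric] g3_def[symmetric] add_divide_distrib by (smt (verit))
qed

lemma J_bounded_below:
  obtains m where "\<And>q1 q3. V q1 q3 \<Longrightarrow> m \<le> J q1 q3"
proof -
  define k where "k = - (2 * (\<bar>A\<bar> / 2 + 2 * B\<^sup>2 / C)\<^sup>2 / C)"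
  have "(LINT p|\<mu>. \<kappa> * k) \<le> J q1 q3" if V: "V q1 q3" for q1 q3
    unfolding J_def
  proof (rule integral_mono)
    show "integrable \<mu> (energy_density q1 q3)" by (intro continuous_integrable energy_density_continuous V)
    fix p
    have "\<kappa> * k \<le> \<kappa> * bulk A B C (Q_of (q1 p) (q3 p))"
      unfolding k_def using kappa_pos by (intro mult_left_mono bulk_bounded_below Q_of_S0 coeffs) auto
    then show "\<kappa> * k \<le> energy_density q1 q3 p" unfolding energy_density_def by (simp add: add_increasing)
  qed simp
  then show ?thesis by (rule that)
qed

text \<open>The boundary data are odd in the first and even in the second component, so a reflection
  stays in the class when combined with a change of sign of q1.\<close>

lemma V_reflect:
  assumes V: "V q1 q3" and T: "T \<in> {reflect, reflect'}"
  shows "V (\<lambda>p. - q1 (T p)) (\<lambda>p. q3 (T p))" "J (\<lambda>p. - q1 (T p)) (\<lambda>p. q3 (T p)) = J q1 q3"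
proof -
  have lin: "bounded_linear T" and adj: "\<And>x y. T x \<bullet> y = x \<bullet> T y" and F: "\<And>p. F1 (T p) = - F1 p" "\<And>p. F3 (T p) = F3 p" and inO: "\<And>p. T p \<in> \<Omega> \<longleftrightarrow> p \<in> \<Omega>"
    using T reflect_linear reflect_adjoint parity by (auto simp: Om_iff reflect_def reflect'_def)
  have inv: "\<And>p. T (T p) = p" and nrm: "\<And>p. norm (T p) = norm p" using T by auto
  have refl_test: "test_function \<Omega> (\<lambda>p. \<psi> (T p)) (\<lambda>p. T (E (T p)))" if t: "test_function \<Omega> \<psi> E" for \<psi> E
  proof -
    obtain S where S: "compact S" "S \<subseteq> \<Omega>" "\<And>p. p \<notin> S \<Longrightarrow> \<psi> p = 0" using t unfolding test_function_def by blast
    have "compact (T ` S)" by (intro compact_continuous_image linear_continuous_on lin S)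
    moreover have "T ` S \<subseteq> \<Omega>" using S(2) inO by blast
    moreover have "\<psi> (T p) = 0" if "p \<notin> T ` S" for p using S(3)[of "T p"] that inv by (metis imageI)
    ultimately show ?thesis
      unfolding test_function_def using C1_grad_compose_linear[OF test_function_C1[OF t] lin adj lin] by blast
  qed
  note t1 = test_function_scale[OF refl_test[OF V_test(1)[OF V]], of "-1"] and t3 = refl_test[OF V_test(2)[OF V]]
  show "V (\<lambda>p. - q1 (T p)) (\<lambda>p. q3 (T p))"
    by (rule VI[where ?E1.0="\<lambda>p. - 1 *\<^sub>R T (grad q1 (T p) - D1 (T p))" and ?E3.0="\<lambda>p. T (grad q3 (T p) - D3 (T p))"])
       (use t1 t3 in \<open>simp_all add: F\<close>)
  have g: "grad (\<lambda>p. - q1 (T p)) = (\<lambda>p. (-1) *\<^sub>R T (grad q1 (T p)))" "grad (\<lambda>p. q3 (T p)) = (\<lambda>p. T (grad q3 (T p)))"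
    using grad_eq[OF C1_grad_cmult[OF C1_grad_compose_linear[OF V_test(3)[OF V] lin adj lin], of "-1"]]
      grad_eq[OF C1_grad_compose_linear[OF V_test(4)[OF V] lin adj lin]] by simp_all
  have "energy_density (\<lambda>p. - q1 (T p)) (\<lambda>p. q3 (T p)) = (\<lambda>p. energy_density q1 q3 (T p))"
    unfolding energy_density_def[abs_def] g bulk_Q_of by (simp add: nrm)
  then show "J (\<lambda>p. - q1 (T p)) (\<lambda>p. q3 (T p)) = J q1 q3"
    unfolding J_def using integral_reflect_mu[OF well_axioms T borel_measurable_continuous_onI[OF energy_density_continuous[OF V]]] by simp
qed

lemma symmetrize_step:
  assumes V: "V q1 q3" and T: "T \<in> {reflect, reflect'}"
  shows "V (\<lambda>p. (1/2) * (q1 p + - q1 (T p))) (\<lambda>p. (1/2) * (q3 p + q3 (T p)))"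
    "J (\<lambda>p. (1/2) * (q1 p + - q1 (T p))) (\<lambda>p. (1/2) * (q3 p + q3 (T p))) \<le> J q1 q3"
proof -
  note R = V_reflect[OF V T]
  show "V (\<lambda>p. (1/2) * (q1 p + - q1 (T p))) (\<lambda>p. (1/2) * (q3 p + q3 (T p)))"
    by (rule V_combine[OF V R(1)])
  have "0 \<le> (1 - \<kappa> * K * P\<^sub>0) / 4 * ((LINT p|\<mu>. (norm (grad q1 p - grad (\<lambda>p. - q1 (T p)) p))\<^sup>2) + 3 * (LINT p|\<mu>. (norm (grad q3 p - grad (\<lambda>p. q3 (T p)) p))\<^sup>2))"
    using small by (intro mult_nonneg_nonneg add_nonneg_nonneg) auto
  moreover have "a \<le> j" if "0 \<le> x" "a + x \<le> (j + j) / 2" for a x j :: real using that by simp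
  ultimately show "J (\<lambda>p. (1/2) * (q1 p + - q1 (T p))) (\<lambda>p. (1/2) * (q3 p + q3 (T p))) \<le> J q1 q3"
    using J_midpoint[OF V R(1)] unfolding R(2) by blast
qed

text \<open>The two reflections commute; averaging in the second one therefore preserves the oddness
  gained from the first.\<close>

lemma symmetrize:
  assumes V: "V q1 q3"
  obtains r1 r3 where "V r1 r3" "J r1 r3 \<le> J q1 q3" "\<And>p. r1 (reflect p) = - r1 p" "\<And>p. r1 (reflect' p) = - r1 p"
proof -
  define a1 where "a1 p = (1/2) * (q1 p + - q1 (reflect p))" for p
  define a3 where "a3 p = (1/2) * (q3 p + q3 (reflect p))" for p
  have a: "V a1 a3" "J a1 a3 \<le> J q1 q3" unfolding a1_def a3_def by (rule symmetrize_step[OF V]; simp)+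
  define r1 where "r1 p = (1/2) * (a1 p + - a1 (reflect' p))" for p
  define r3 where "r3 p = (1/2) * (a3 p + a3 (reflect' p))" for p
  have r: "V r1 r3" "J r1 r3 \<le> J a1 a3" unfolding r1_def r3_def by (rule symmetrize_step[OF a(1)]; simp)+
  have "a1 (reflect p) = - a1 p" for p by (simp add: a1_def field_simps)
  then have "r1 (reflect p) = - r1 p" for p by (simp add: r1_def reflect_commute[symmetric] field_simps)
  moreover have "r1 (reflect' p) = - r1 p" for p by (simp add: r1_def field_simps)
  ultimately show ?thesis using that r a(2) by (metis order_trans)
qed

lemma V_shift:
  assumes V: "V q1 q3" and t: "test_function \<Omega> z1 E1" "test_function \<Omega> z3 E3"
  shows "V (\<lambda>p. q1 p + c * z1 p) (\<lambda>p. q3 p + c * z3 p)"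
    "grad (\<lambda>p. q1 p + c * z1 p) = (\<lambda>p. grad q1 p + c *\<^sub>R E1 p)" "grad (\<lambda>p. q3 p + c * z3 p) = (\<lambda>p. grad q3 p + c *\<^sub>R E3 p)"
proof -
  have e: "q + c * z - F = (q - F) + c * z" for q z F :: real by simp
  have "test_function \<Omega> (\<lambda>p. q1 p + c * z1 p - F1 p) (\<lambda>p. (grad q1 p - D1 p) + c *\<^sub>R E1 p)"
    "test_function \<Omega> (\<lambda>p. q3 p + c * z3 p - F3 p) (\<lambda>p. (grad q3 p - D3 p) + c *\<^sub>R E3 p)"
    unfolding e by (intro test_function_add test_function_scale V_test[OF V] t)+
  then show "V (\<lambda>p. q1 p + c * z1 p) (\<lambda>p. q3 p + c * z3 p)" by (rule VI)
  show "grad (\<lambda>p. q1 p + c * z1 p) = (\<lambda>p. grad q1 p + c *\<^sub>R E1 p)" "grad (\<lambda>p. q3 p + c * z3 p) = (\<lambda>p. grad q3 p + c *\<^sub>R E3 p)"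
    by (intro grad_eq C1_grad_add C1_grad_cmult V_test[OF V] test_function_C1[OF t(1)] test_function_C1[OF t(2)])+
qed

lemma minimizing_sequence:
  obtains q1 q3 m where "\<And>k. V (q1 k) (q3 k)" "\<And>k. J (q1 k) (q3 k) \<le> m + (1 / real (Suc k))\<^sup>2" "\<And>r1 r3. V r1 r3 \<Longrightarrow> m \<le> J r1 r3"
    "\<And>k p. q1 k (reflect p) = - q1 k p" "\<And>k p. q1 k (reflect' p) = - q1 k p"
proof -
  define S where "S = {J r1 r3 |r1 r3. V r1 r3}"
  obtain b where b: "\<And>q1 q3. V q1 q3 \<Longrightarrow> b \<le> J q1 q3" using J_bounded_below by blast
  have "V F1 F3" by (rule VI[where ?E1.0="\<lambda>_. 0" and ?E3.0="\<lambda>_. 0"]) (simp_all add: test_function_zero)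
  then have ne: "S \<noteq> {}" by (auto simp: S_def)
  have bdd: "bdd_below S" using b by (auto simp: S_def intro!: bdd_belowI[of _ b])
  define m where "m = Inf S"
  have m: "m \<le> J r1 r3" if "V r1 r3" for r1 r3
    unfolding m_def by (rule cInf_lower[OF _ bdd]) (use that in \<open>auto simp: S_def\<close>)
  \<comment> \<open>A witness that is a pair lets one application of \<open>choice\<close> select
    both components.\<close>
  have "\<exists>r. V (fst r) (snd r) \<and> J (fst r) (snd r) \<le> m + (1 / real (Suc k))\<^sup>2 \<and> (\<forall>p. fst r (reflect p) = - fst r p) \<and> (\<forall>p. fst r (reflect' p) = - fst r p)" for k
  proof -
    have "m < m + (1 / real (Suc k))\<^sup>2" by simp
    then obtain x where x: "x \<in> S" "x < m + (1 / real (Suc k))\<^sup>2" using cInf_lessD[OF ne] unfolding m_def by blast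
    then obtain r1 r3 where r: "V r1 r3" "J r1 r3 < m + (1 / real (Suc k))\<^sup>2" unfolding S_def by blast
    obtain a1 a3 where "V a1 a3" "J a1 a3 \<le> J r1 r3" "\<And>p. a1 (reflect p) = - a1 p" "\<And>p. a1 (reflect' p) = - a1 p"
      using symmetrize[OF r(1)] by blast
    with r(2) show ?thesis by (intro exI[of _ "(a1, a3)"]) auto
  qed
  then have "\<forall>k. \<exists>r. V (fst r) (snd r) \<and> J (fst r) (snd r) \<le> m + (1 / real (Suc k))\<^sup>2 \<and> (\<forall>p. fst r (reflect p) = - fst r p) \<and> (\<forall>p. fst r (reflect' p) = - fst r p)" by blast
  from choice[OF this] obtain r where "\<forall>k. V (fst (r k)) (snd (r k)) \<and> J (fst (r k)) (snd (r k)) \<le> m + (1 / real (Suc k))\<^sup>2 \<and>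
     (\<forall>p. fst (r k) (reflect p) = - fst (r k) p) \<and> (\<forall>p. fst (r k) (reflect' p) = - fst (r k) p)" by blast
  with m show ?thesis by (intro that[of "\<lambda>k. fst (r k)" "\<lambda>k. snd (r k)" m]) blast+
qed

text \<open>Midpoints are competitors, so their energy is at least m, and \<open>J_midpoint\<close>
  bounds the gradient differences by the excess over m. Poincare gives the same for the functions
  themselves.\<close>

lemma Cauchy_limit:
  assumes V: "\<And>k. V (q1 k) (q3 k)" and J: "\<And>k. J (q1 k) (q3 k) \<le> m + (1 / real (Suc k))\<^sup>2" and m: "\<And>r1 r3. V r1 r3 \<Longrightarrow> m \<le> J r1 r3"
  obtains u1 H1 u3 H3 where "L2_lim \<mu> q1 u1" "L2_lim \<mu> (\<lambda>k. grad (q1 k)) H1" "L2_lim \<mu> q3 u3" "L2_lim \<mu> (\<lambda>k. grad (q3 k)) H3"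
proof -
  define \<theta> where "\<theta> = (1 - \<kappa> * K * P\<^sub>0) / 4"
  have \<theta>: "0 < \<theta>" using small by (simp add: \<theta>_def)
  define n1 where "n1 k l = (LINT p|\<mu>. (norm (grad (q1 k) p - grad (q1 l) p))\<^sup>2)" for k l
  define n3 where "n3 k l = (LINT p|\<mu>. (norm (grad (q3 k) p - grad (q3 l) p))\<^sup>2)" for k l
  have n0: "0 \<le> n1 k l" "0 \<le> n3 k l" for k l by (simp_all add: n1_def n3_def)
  have key: "\<theta> * (n1 k l + 3 * n3 k l) \<le> (1 / real (Suc N))\<^sup>2" if "N \<le> k" "N \<le> l" for k l N
  proof -
    have s: "(1 / real (Suc k))\<^sup>2 \<le> (1 / real (Suc N))\<^sup>2" if "N \<le> k" for k
      using that by (intro power_mono) (auto simp: field_simps)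
    have "m + \<theta> * (n1 k l + 3 * n3 k l) \<le> (J (q1 k) (q3 k) + J (q1 l) (q3 l)) / 2"
      using J_midpoint[OF V[of k] V[of l]] m[OF V_combine[OF V[of k] V[of l]]] unfolding \<theta>_def n1_def n3_def by linarith
    moreover have "J (q1 k) (q3 k) \<le> m + (1 / real (Suc N))\<^sup>2" "J (q1 l) (q3 l) \<le> m + (1 / real (Suc N))\<^sup>2"
      using J[of k] J[of l] s[OF \<open>N \<le> k\<close>] s[OF \<open>N \<le> l\<close>] by linarith+
    moreover have "x \<le> r" if "m + x \<le> (a + b) / 2" "a \<le> m + r" "b \<le> m + r" for x a b r :: real
      using that by simp
    ultimately show ?thesis by blast
  qed
  have small_n: "\<exists>N. \<forall>k\<ge>N. \<forall>l\<ge>N. n1 k l < e \<and> n3 k l < e" if e: "0 < e" for e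
  proof -
    have "(\<lambda>N. (1 / real (Suc N))\<^sup>2) \<longlonglongrightarrow> 0\<^sup>2"
      using LIMSEQ_inverse_real_of_nat by (intro tendsto_power) (simp add: inverse_eq_divide)
    then have "\<forall>\<^sub>F N in sequentially. (1 / real (Suc N))\<^sup>2 < \<theta> * e"
      using order_tendstoD(2)[of "\<lambda>N. (1 / real (Suc N))\<^sup>2" "0\<^sup>2" sequentially "\<theta> * e"] \<theta> e by simp
    then obtain N where N: "(1 / real (Suc N))\<^sup>2 < \<theta> * e" using eventually_happens'[OF sequentially_bot] by blast
    have "n1 k l < e \<and> n3 k l < e" if "N \<le> k" "N \<le> l" for k l
    proof -
      have "\<theta> * (n1 k l + 3 * n3 k l) < \<theta> * e" using key[OF that] N by linarith
      then have "n1 k l + 3 * n3 k l < e" using \<theta> by simp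
      then show ?thesis using n0[of k l] by linarith
    qed
    then show ?thesis by blast
  qed
  have P0: "0 \<le> P\<^sub>0" by simp
  have P1: "0 < P\<^sub>0 + 1" by (rule add_nonneg_pos[OF P0 zero_less_one])
  have W: "W0 (\<lambda>p. q1 k p - q1 l p) (\<lambda>p. grad (q1 k) p - grad (q1 l) p)" "W0 (\<lambda>p. q3 k p - q3 l p) (\<lambda>p. grad (q3 k) p - grad (q3 l) p)" for k l
    by (rule V_diff_W0[OF V V])+
  have L: "L2 \<mu> (q1 k)" "L2 \<mu> (grad (q1 k))" "L2 \<mu> (q3 k)" "L2 \<mu> (grad (q3 k))" for k
    using C1_L2[OF V_test(3)[OF V]] C1_L2[OF V_test(4)[OF V]] by blast+
  have fn: "\<exists>N. \<forall>k\<ge>N. \<forall>l\<ge>N. (LINT p|\<mu>. (norm (q1 k p - q1 l p))\<^sup>2) < e \<and> (LINT p|\<mu>. (norm (q3 k p - q3 l p))\<^sup>2) < e" if e: "0 < e" for e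
  proof -
    have "0 < e / (P\<^sub>0 + 1)" by (rule divide_pos_pos[OF e P1])
    from small_n[OF this] obtain N where N: "\<And>k l. N \<le> k \<Longrightarrow> N \<le> l \<Longrightarrow> n1 k l < e / (P\<^sub>0 + 1) \<and> n3 k l < e / (P\<^sub>0 + 1)" by blast
    have b: "P\<^sub>0 * x < e" if "x < e / (P\<^sub>0 + 1)" "0 \<le> x" for x
    proof -
      have "P\<^sub>0 * x \<le> (P\<^sub>0 + 1) * x" using that(2) by (simp add: distrib_right)
      also have "\<dots> < (P\<^sub>0 + 1) * (e / (P\<^sub>0 + 1))" by (rule mult_strict_left_mono[OF that(1) P1])
      also have "\<dots> = e" using P1 by (metis nonzero_mult_div_cancel_left times_divide_eq_right less_irrefl)
      finally show ?thesis .
    qed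
    have "(LINT p|\<mu>. (norm (q1 k p - q1 l p))\<^sup>2) < e \<and> (LINT p|\<mu>. (norm (q3 k p - q3 l p))\<^sup>2) < e" if "N \<le> k" "N \<le> l" for k l
    proof -
      have "(LINT p|\<mu>. (q1 k p - q1 l p)\<^sup>2) \<le> P\<^sub>0 * n1 k l" "(LINT p|\<mu>. (q3 k p - q3 l p)\<^sup>2) \<le> P\<^sub>0 * n3 k l"
        unfolding n1_def n3_def by (rule poincare[OF W(1)] poincare[OF W(2)])+
      moreover have "P\<^sub>0 * n1 k l < e" "P\<^sub>0 * n3 k l < e" using b N[OF that] n0[of k l] by blast+
      ultimately show ?thesis unfolding real_norm_def power2_abs by linarith
    qed
    then show ?thesis by blast
  qed
  have c: "\<exists>N. \<forall>k\<ge>N. \<forall>l\<ge>N. (LINT p|\<mu>. (norm (q1 k p - q1 l p))\<^sup>2) < e" "\<exists>N. \<forall>k\<ge>N. \<forall>l\<ge>N. (LINT p|\<mu>. (norm (q3 k p - q3 l p))\<^sup>2) < e"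
    "\<exists>N. \<forall>k\<ge>N. \<forall>l\<ge>N. (LINT p|\<mu>. (norm (grad (q1 k) p - grad (q1 l) p))\<^sup>2) < e"
    "\<exists>N. \<forall>k\<ge>N. \<forall>l\<ge>N. (LINT p|\<mu>. (norm (grad (q3 k) p - grad (q3 l) p))\<^sup>2) < e" if "0 < e" for e
    using fn[OF that] small_n[OF that] unfolding n1_def n3_def by blast+
  obtain u1 where u1: "L2_lim \<mu> q1 u1" by (rule L2_complete[OF L(1) c(1)])
  obtain u3 where u3: "L2_lim \<mu> q3 u3" by (rule L2_complete[OF L(3) c(2)])
  obtain H1 where H1: "L2_lim \<mu> (\<lambda>k. grad (q1 k)) H1" by (rule L2_complete[OF L(2) c(3)])
  obtain H3 where H3: "L2_lim \<mu> (\<lambda>k. grad (q3 k)) H3" by (rule L2_complete[OF L(4) c(4)])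
  show ?thesis by (rule that[OF u1 H1 u3 H3])
qed

lemma V_limit_W0:
  assumes V: "\<And>k. V (q1 k) (q3 k)"
   and l: "L2_lim \<mu> q1 u1" "L2_lim \<mu> (\<lambda>k. grad (q1 k)) H1" "L2_lim \<mu> q3 u3" "L2_lim \<mu> (\<lambda>k. grad (q3 k)) H3"
  shows "W0 (\<lambda>p. u1 p - F1 p) (\<lambda>p. H1 p - D1 p)" "W0 (\<lambda>p. u3 p - F3 p) (\<lambda>p. H3 p - D3 p)"
proof -
  note Fc = L2_lim_const[OF C1_L2(1)[OF ext(1)]] L2_lim_const[OF C1_L2(1)[OF ext(2)]]
    L2_lim_const[OF C1_L2(2)[OF ext(1)]] L2_lim_const[OF C1_L2(2)[OF ext(2)]]
  show "W0 (\<lambda>p. u1 p - F1 p) (\<lambda>p. H1 p - D1 p)"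
    unfolding W0_def
    by (rule exI[of _ "\<lambda>k p. q1 k p - F1 p"], rule exI[of _ "\<lambda>k p. grad (q1 k) p - D1 p"])
       (intro conjI allI V_test(1)[OF V] L2_lim_diff l Fc)
  show "W0 (\<lambda>p. u3 p - F3 p) (\<lambda>p. H3 p - D3 p)"
    unfolding W0_def
    by (rule exI[of _ "\<lambda>k p. q3 k p - F3 p"], rule exI[of _ "\<lambda>k p. grad (q3 k) p - D3 p"])
       (intro conjI allI V_test(2)[OF V] L2_lim_diff l Fc)
qed

text \<open>The first variation of J; the factors 2 and 6 are twice the weights 1 and 3 of the
  squared gradients.\<close>

definition variation :: "(pt \<Rightarrow> real) \<Rightarrow> (pt \<Rightarrow> pt) \<Rightarrow> (pt \<Rightarrow> real) \<Rightarrow> (pt \<Rightarrow> pt) \<Rightarrow> (pt \<Rightarrow> real) \<Rightarrow> (pt \<Rightarrow> pt) \<Rightarrow> (pt \<Rightarrow> real) \<Rightarrow> (pt \<Rightarrow> pt) \<Rightarrow> real" where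
  "variation q1 G1 q3 G3 z1 E1 z3 E3 = 2 * (LINT p|\<mu>. G1 p \<bullet> E1 p) + 6 * (LINT p|\<mu>. G3 p \<bullet> E3 p) +
     \<kappa> * (LINT p|\<mu>. bulk_grad A B C (Q_of (q1 p) (q3 p)) \<bullet> Q_of (z1 p) (z3 p))"

lemma bulk_grad_continuous:
  assumes "continuous_on UNIV q1" "continuous_on UNIV q3" "continuous_on UNIV z1" "continuous_on UNIV z3"
  shows "continuous_on UNIV (\<lambda>p. bulk_grad A B C (Q_of (q1 p) (q3 p)) \<bullet> Q_of (z1 p) (z3 p))"
  unfolding bulk_grad_S0_inner[OF Q_of_S0 Q_of_S0] Q_of_inner
  by (simp add: mat_inner sum_3 matrix_matrix_mult_def Q_of_comp) (intro continuous_intros assms)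

text \<open>
  Along a minimizing sequence with excess \<open>1/(k+1)\<^sup>2\<close> the choice \<open>c = \<plusminus>1/(k+1)\<close> makes the variation tend to zero,
  so that no lower semicontinuity of the energy is needed.
\<close>

lemma J_taylor:
  assumes t: "test_function \<Omega> z1 E1" "test_function \<Omega> z3 E3"
  obtains R where "0 \<le> R" "\<And>q1 q3 c. V q1 q3 \<Longrightarrow> \<bar>c\<bar> \<le> 1 \<Longrightarrow> J (\<lambda>p. q1 p + c * z1 p) (\<lambda>p. q3 p + c * z3 p) \<le>
     J q1 q3 + c * variation q1 (grad q1) q3 (grad q3) z1 E1 z3 E3 + c\<^sup>2 * (R * (1 + (LINT p|\<mu>. (q1 p)\<^sup>2) + (LINT p|\<mu>. (q3 p)\<^sup>2)))"
proof -
  obtain b1 where b1: "0 \<le> b1" "\<And>p. \<bar>z1 p\<bar> \<le> b1" "\<And>p. norm (E1 p) \<le> b1" using test_function_bounded[OF t(1)] by metis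
  obtain b3 where b3: "0 \<le> b3" "\<And>p. \<bar>z3 p\<bar> \<le> b3" "\<And>p. norm (E3 p) \<le> b3" using test_function_bounded[OF t(2)] by metis
  define b where "b = b1 + b3"
  have b: "\<bar>z1 p\<bar> \<le> b" "norm (E1 p) \<le> b" "\<bar>z3 p\<bar> \<le> b" "norm (E3 p) \<le> b" for p
    using b1(1) b1(2,3)[of p] b3(1) b3(2,3)[of p] by (simp_all add: b_def)
  have b2: "(z1 p)\<^sup>2 \<le> b\<^sup>2" "(norm (E1 p))\<^sup>2 \<le> b\<^sup>2" "(z3 p)\<^sup>2 \<le> b\<^sup>2" "(norm (E3 p))\<^sup>2 \<le> b\<^sup>2" for p
    using power_mono[OF b(1)[of p], of 2] power_mono[OF b(2)[of p], of 2] power_mono[OF b(3)[of p], of 2] power_mono[OF b(4)[of p], of 2] by simp_all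
  define T where "T = \<bar>A\<bar> + B + 3 * C"
  \<comment> \<open>Bounds the squared norm 2 z1^2 + 6 z3^2 of the direction; 6 + N then bounds 1 +
    |M|^2 + |c Z|^2 relative to 1 + q1^2 + q3^2 when |c| \<le> 1.\<close>
  define N where "N = 8 * b\<^sup>2"
  define R\<^sub>0 where "R\<^sub>0 = 4 * b\<^sup>2 + \<kappa> * (T * N * (6 + N))"
  \<comment> \<open>The measure of the domain accounts for the integral of the constant 1.\<close>
  define R where "R = R\<^sub>0 * (1 + measure \<mu> (space \<mu>))"
  have nn: "0 \<le> T" "0 \<le> N" using coeffs by (simp_all add: T_def N_def)
  have "0 \<le> \<kappa> * (T * N * (6 + N))" using nn by (intro mult_nonneg_nonneg less_imp_le[OF kappa_pos]) auto
  then have R0: "0 \<le> R\<^sub>0" unfolding R\<^sub>0_def by (rule add_nonneg_nonneg[rotated]) simp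
  show ?thesis
  proof
    show "0 \<le> R" unfolding R_def using R0 by simp
    fix q1 q3 :: "pt \<Rightarrow> real" and c :: real
    assume V: "V q1 q3" and c: "\<bar>c\<bar> \<le> 1"
    have c2: "c\<^sup>2 \<le> 1" using c by (simp add: abs_square_le_1)
    note Vs = V_shift[OF V t, of c]
    define bg where "bg p = bulk_grad A B C (Q_of (q1 p) (q3 p)) \<bullet> Q_of (z1 p) (z3 p)" for p
    have bulk: "\<kappa> * bulk A B C (Q_of (q1 p + c * z1 p) (q3 p + c * z3 p)) \<le>
       \<kappa> * bulk A B C (Q_of (q1 p) (q3 p)) + c * (\<kappa> * bg p) + c\<^sup>2 * (\<kappa> * (T * N * (6 + N)) * (1 + (q1 p)\<^sup>2 + (q3 p)\<^sup>2))" for p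
    proof -
      let ?M = "Q_of (q1 p) (q3 p)" and ?Z = "Q_of (z1 p) (z3 p)"
      have M: "Q_of (q1 p + c * z1 p) (q3 p + c * z3 p) = ?M + c *\<^sub>R ?Z"
        using Q_of_linear[of 1 "q1 p" c "z1 p" "q3 p" "z3 p"] by simp
      have Z: "(norm ?Z)\<^sup>2 \<le> N" unfolding Q_of_norm N_def using b2(1)[of p] b2(3)[of p] by linarith
      have "T * (norm (c *\<^sub>R ?Z))\<^sup>2 * (1 + (norm ?M)\<^sup>2 + (norm (c *\<^sub>R ?Z))\<^sup>2) \<le> T * (c\<^sup>2 * N) * ((6 + N) * (1 + (q1 p)\<^sup>2 + (q3 p)\<^sup>2))"
      proof (intro mult_mono order.refl)
        show "(norm (c *\<^sub>R ?Z))\<^sup>2 \<le> c\<^sup>2 * N" using Z by (simp add: power_mult_distrib mult_left_mono)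
        have "(norm (c *\<^sub>R ?Z))\<^sup>2 \<le> 1 * N" unfolding norm_scaleR power_mult_distrib power2_abs
          using Z c2 nn by (intro mult_mono) auto
        moreover have "0 \<le> N * ((q1 p)\<^sup>2 + (q3 p)\<^sup>2)" using nn by simp
        moreover have "(6 + N) * (1 + (q1 p)\<^sup>2 + (q3 p)\<^sup>2) = 6 + 6 * (q1 p)\<^sup>2 + 6 * (q3 p)\<^sup>2 + N + N * ((q1 p)\<^sup>2 + (q3 p)\<^sup>2)" by (simp add: algebra_simps)
        ultimately show "1 + (norm ?M)\<^sup>2 + (norm (c *\<^sub>R ?Z))\<^sup>2 \<le> (6 + N) * (1 + (q1 p)\<^sup>2 + (q3 p)\<^sup>2)"
          unfolding Q_of_norm[of "q1 p"] using zero_le_power2[of "q1 p"] by linarith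
      qed (use nn in auto)
      then have "bulk A B C (?M + c *\<^sub>R ?Z) \<le> bulk A B C ?M + c * bg p + T * (c\<^sup>2 * N) * ((6 + N) * (1 + (q1 p)\<^sup>2 + (q3 p)\<^sup>2))"
        using bulk_upper[OF Q_of_S0 S0_scaleR[OF Q_of_S0] coeffs(1,2), of A "q1 p" "q3 p" c "z1 p" "z3 p"]
        unfolding T_def[symmetric] by (simp add: bg_def)
      then have "\<kappa> * bulk A B C (?M + c *\<^sub>R ?Z) \<le> \<kappa> * (bulk A B C ?M + c * bg p + T * (c\<^sup>2 * N) * ((6 + N) * (1 + (q1 p)\<^sup>2 + (q3 p)\<^sup>2)))"
        by (rule mult_left_mono) (rule less_imp_le[OF kappa_pos])
      moreover have "k * (x + c * y + T * (c\<^sup>2 * N) * ((6 + N) * w)) = k * x + c * (k * y) + c\<^sup>2 * (k * (T * N * (6 + N)) * w)" for k x y w :: real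
        by (simp add: algebra_simps)
      ultimately show ?thesis unfolding M by simp
    qed
    have pw: "energy_density (\<lambda>p. q1 p + c * z1 p) (\<lambda>p. q3 p + c * z3 p) p \<le>
       energy_density q1 q3 p + c * (2 * (grad q1 p \<bullet> E1 p) + 6 * (grad q3 p \<bullet> E3 p) + \<kappa> * bg p) + c\<^sup>2 * (R\<^sub>0 * (1 + (q1 p)\<^sup>2 + (q3 p)\<^sup>2))" for p
    proof -
      have g: "(norm (G + c *\<^sub>R E))\<^sup>2 = (norm G)\<^sup>2 + c * (2 * (G \<bullet> E)) + c\<^sup>2 * (norm E)\<^sup>2" for G E :: pt
        unfolding power2_norm_eq_inner by (simp add: inner_add_left inner_add_right inner_commute power2_eq_square algebra_simps)
      have "c\<^sup>2 * (norm (E1 p))\<^sup>2 + 3 * (c\<^sup>2 * (norm (E3 p))\<^sup>2) \<le> c\<^sup>2 * b\<^sup>2 + 3 * (c\<^sup>2 * b\<^sup>2)"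
        using b2 by (intro add_mono mult_left_mono) auto
      also have "\<dots> \<le> c\<^sup>2 * (4 * b\<^sup>2 * (1 + (q1 p)\<^sup>2 + (q3 p)\<^sup>2))" by (simp add: algebra_simps)
      finally have e: "c\<^sup>2 * (norm (E1 p))\<^sup>2 + 3 * (c\<^sup>2 * (norm (E3 p))\<^sup>2) \<le> c\<^sup>2 * (4 * b\<^sup>2 * (1 + (q1 p)\<^sup>2 + (q3 p)\<^sup>2))" .
      have "(x1 + c * (2 * y1) + e1) + 3 * (x3 + c * (2 * y3) + e3) + z \<le> (x1 + 3 * x3 + w) + c * (2 * y1 + 6 * y3 + v) + c\<^sup>2 * ((r + r') * u)"
        if "e1 + 3 * e3 \<le> c\<^sup>2 * (r * u)" "z \<le> w + c * v + c\<^sup>2 * (r' * u)" for x1 y1 e1 x3 y3 e3 z w v r r' u :: real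
        using that by (simp add: algebra_simps)
      from this[OF e bulk[of p]] show ?thesis
        unfolding energy_density_def Vs(2,3) g R\<^sub>0_def .
    qed
    note C = V_test(3,4)[OF V] and Cz = test_function_C1[OF t(1)] test_function_C1[OF t(2)]
    note cc = C1_grad_continuous[OF C(1)] C1_grad_continuous[OF C(2)] C1_grad_continuous[OF Cz(1)] C1_grad_continuous[OF Cz(2)]
    have i: "integrable \<mu> (energy_density q1 q3)" "integrable \<mu> (energy_density (\<lambda>p. q1 p + c * z1 p) (\<lambda>p. q3 p + c * z3 p))"
      by (intro continuous_integrable energy_density_continuous V Vs)+
    have i2: "integrable \<mu> (\<lambda>p. grad q1 p \<bullet> E1 p)" "integrable \<mu> (\<lambda>p. grad q3 p \<bullet> E3 p)" "integrable \<mu> bg"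
      "integrable \<mu> (\<lambda>p. (q1 p)\<^sup>2)" "integrable \<mu> (\<lambda>p. (q3 p)\<^sup>2)"
      unfolding bg_def[abs_def] by (intro continuous_integrable bulk_grad_continuous continuous_intros cc)+
    have "J (\<lambda>p. q1 p + c * z1 p) (\<lambda>p. q3 p + c * z3 p) \<le> (LINT p|\<mu>. energy_density q1 q3 p + c * (2 * (grad q1 p \<bullet> E1 p) + 6 * (grad q3 p \<bullet> E3 p) + \<kappa> * bg p) + c\<^sup>2 * (R\<^sub>0 * (1 + (q1 p)\<^sup>2 + (q3 p)\<^sup>2)))"
      unfolding J_def
      by (rule integral_mono[OF i(2) _ pw])
         (intro Bochner_Integration.integrable_add integrable_mult_right i i2 integrable_const)
    also have "\<dots> = J q1 q3 + c * variation q1 (grad q1) q3 (grad q3) z1 E1 z3 E3 + c\<^sup>2 * (R\<^sub>0 * (measure \<mu> (space \<mu>) + (LINT p|\<mu>. (q1 p)\<^sup>2) + (LINT p|\<mu>. (q3 p)\<^sup>2)))"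
      unfolding J_def variation_def bg_def[symmetric] using i i2 by simp
    also have "\<dots> \<le> J q1 q3 + c * variation q1 (grad q1) q3 (grad q3) z1 E1 z3 E3 + c\<^sup>2 * (R * (1 + (LINT p|\<mu>. (q1 p)\<^sup>2) + (LINT p|\<mu>. (q3 p)\<^sup>2)))"
    proof (intro add_left_mono mult_left_mono)
      have "m + x + y \<le> (1 + m) * (1 + x + y)" if "0 \<le> m" "0 \<le> x" "0 \<le> y" for m x y :: real
        using mult_nonneg_nonneg[OF that(1,2)] mult_nonneg_nonneg[OF that(1,3)] by (simp add: algebra_simps)
      then show "R\<^sub>0 * (measure \<mu> (space \<mu>) + (LINT p|\<mu>. (q1 p)\<^sup>2) + (LINT p|\<mu>. (q3 p)\<^sup>2)) \<le> R * (1 + (LINT p|\<mu>. (q1 p)\<^sup>2) + (LINT p|\<mu>. (q3 p)\<^sup>2))"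
        unfolding R_def mult.assoc using R0 by (intro mult_left_mono) auto
    qed simp
    finally show "J (\<lambda>p. q1 p + c * z1 p) (\<lambda>p. q3 p + c * z3 p) \<le>
     J q1 q3 + c * variation q1 (grad q1) q3 (grad q3) z1 E1 z3 E3 + c\<^sup>2 * (R * (1 + (LINT p|\<mu>. (q1 p)\<^sup>2) + (LINT p|\<mu>. (q3 p)\<^sup>2)))" .
  qed
qed

text \<open>Minimality gives 0 \<le> h^2 + c v + c^2 N for |c| \<le> 1; both signs of c = h together
  yield |v| \<le> h (1 + N), and N converges because the sequence does so in L2.\<close>

lemma variation_tendsto_zero:
  assumes V: "\<And>k. V (q1 k) (q3 k)" and J: "\<And>k. J (q1 k) (q3 k) \<le> m + (1 / real (Suc k))\<^sup>2" and m: "\<And>r1 r3. V r1 r3 \<Longrightarrow> m \<le> J r1 r3"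
    and l: "L2_lim \<mu> q1 u1" "L2_lim \<mu> q3 u3" and t: "test_function \<Omega> z1 E1" "test_function \<Omega> z3 E3"
  shows "(\<lambda>k. variation (q1 k) (grad (q1 k)) (q3 k) (grad (q3 k)) z1 E1 z3 E3) \<longlonglongrightarrow> 0"
proof -
  obtain R where R: "0 \<le> R" "\<And>q1 q3 c. V q1 q3 \<Longrightarrow> \<bar>c\<bar> \<le> 1 \<Longrightarrow> J (\<lambda>p. q1 p + c * z1 p) (\<lambda>p. q3 p + c * z3 p) \<le>
     J q1 q3 + c * variation q1 (grad q1) q3 (grad q3) z1 E1 z3 E3 + c\<^sup>2 * (R * (1 + (LINT p|\<mu>. (q1 p)\<^sup>2) + (LINT p|\<mu>. (q3 p)\<^sup>2)))"
    using J_taylor[OF t] by blast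
  define v where "v k = variation (q1 k) (grad (q1 k)) (q3 k) (grad (q3 k)) z1 E1 z3 E3" for k
  define h where "h k = 1 / real (Suc k)" for k
  define N where "N k = R * (1 + (LINT p|\<mu>. (q1 k p)\<^sup>2) + (LINT p|\<mu>. (q3 k p)\<^sup>2))" for k
  have h: "0 < h k" "h k \<le> 1" for k by (simp_all add: h_def)
  have "N \<longlonglongrightarrow> R * (1 + (LINT p|\<mu>. (norm (u1 p))\<^sup>2) + (LINT p|\<mu>. (norm (u3 p))\<^sup>2))"
    unfolding N_def[abs_def] using L2_lim_norm_sq[OF l(1)] L2_lim_norm_sq[OF l(2)] by (intro tendsto_intros) simp_all
  moreover have h0: "h \<longlonglongrightarrow> 0" unfolding h_def[abs_def] using LIMSEQ_inverse_real_of_nat by (simp add: inverse_eq_divide)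
  ultimately have "(\<lambda>k. h k * (1 + N k)) \<longlonglongrightarrow> 0 * (1 + R * (1 + (LINT p|\<mu>. (norm (u1 p))\<^sup>2) + (LINT p|\<mu>. (norm (u3 p))\<^sup>2)))"
    by (intro tendsto_intros)
  then have lim: "(\<lambda>k. h k * (1 + N k)) \<longlonglongrightarrow> 0" by simp
  have "norm (v k) \<le> h k * (1 + N k)" for k
  proof -
    have b: "0 \<le> (h k)\<^sup>2 + c * v k + c\<^sup>2 * N k" if "\<bar>c\<bar> \<le> 1" for c
    proof -
      have "m \<le> J (\<lambda>p. q1 k p + c * z1 p) (\<lambda>p. q3 k p + c * z3 p)" by (rule m[OF V_shift(1)[OF V t]])
      also have "\<dots> \<le> J (q1 k) (q3 k) + c * v k + c\<^sup>2 * N k" unfolding v_def N_def by (rule R(2)[OF V that])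
      also have "\<dots> \<le> m + (h k)\<^sup>2 + c * v k + c\<^sup>2 * N k" using J[of k] unfolding h_def by simp
      finally show ?thesis by simp
    qed
    have "0 \<le> h k * (h k + v k + h k * N k)" "0 \<le> h k * (h k - v k + h k * N k)"
      using b[of "h k"] b[of "- h k"] h[of k] by (simp_all add: power2_eq_square algebra_simps)
    then have "0 \<le> h k + v k + h k * N k" "0 \<le> h k - v k + h k * N k"
      using h(1)[of k] by (simp_all add: zero_le_mult_iff)
    then show ?thesis unfolding distrib_left by (simp add: abs_le_iff)
  qed
  then have "v \<longlonglongrightarrow> 0" by (intro Lim_null_comparison[OF _ lim]) auto
  then show ?thesis by (simp add: v_def[abs_def])
qed

text \<open>
  The nonlinear term is cubic, so convergence in \<open>L\<^sup>4\<close> suffices; it comes from Ladyzhenskaya's inequality.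
\<close>

lemma variation_limit:
  assumes V: "\<And>k. V (q1 k) (q3 k)"
    and l: "L2_lim \<mu> q1 u1" "L2_lim \<mu> (\<lambda>k. grad (q1 k)) H1" "L2_lim \<mu> q3 u3" "L2_lim \<mu> (\<lambda>k. grad (q3 k)) H3"
    and t: "test_function \<Omega> z1 E1" "test_function \<Omega> z3 E3"
  shows "(\<lambda>k. variation (q1 k) (grad (q1 k)) (q3 k) (grad (q3 k)) z1 E1 z3 E3) \<longlonglongrightarrow> variation u1 H1 u3 H3 z1 E1 z3 E3"
proof -
  define Q where "Q p = Q_of (u1 p) (u3 p)" for p
  define Z where "Z p = Q_of (z1 p) (z3 p)" for p
  define Qk where "Qk k p = Q_of (q1 k p) (q3 k p)" for k p
  note W = V_limit_W0[OF V l]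
  have Q: "Q \<in> adm" using Q_of_admissible(1)[OF W] by (simp add: Q_def[abs_def])
  have wk: "W0 (\<lambda>p. q1 k p - u1 p) (\<lambda>p. grad (q1 k) p - H1 p)" "W0 (\<lambda>p. q3 k p - u3 p) (\<lambda>p. grad (q3 k) p - H3 p)" for k
    using W0_diff[OF test_W0[OF V_test(1)[OF V[of k]]] W(1)] W0_diff[OF test_W0[OF V_test(2)[OF V[of k]]] W(2)] by simp_all
  \<comment> \<open>The pointwise distance of the matrices. Its square is an explicit quadratic
    form, so its fourth power is controlled by those of the two components.\<close>
  define \<delta> where "\<delta> k p = norm (Qk k p - Q p)" for k p
  have \<delta>2: "(\<delta> k p)\<^sup>2 = 2 * (q1 k p - u1 p)\<^sup>2 + 6 * (q3 k p - u3 p)\<^sup>2" for k p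
    using Q_of_linear[of 1 "q1 k p" "-1" "u1 p" "q3 k p" "u3 p"] Q_of_norm[of "q1 k p - u1 p" "q3 k p - u3 p"]
    by (simp add: \<delta>_def Qk_def Q_def)
  have \<delta>0: "0 \<le> \<delta> k p" for k p by (simp add: \<delta>_def)
  have \<delta>4: "(\<delta> k p) ^ 4 \<le> 8 * (q1 k p - u1 p) ^ 4 + 72 * (q3 k p - u3 p) ^ 4" for k p
  proof -
    have "(\<delta> k p) ^ 4 = (2 * (q1 k p - u1 p)\<^sup>2 + 6 * (q3 k p - u3 p)\<^sup>2)\<^sup>2" unfolding \<delta>2[symmetric] by simp
    also have "\<dots> \<le> 2 * (2 * (q1 k p - u1 p)\<^sup>2)\<^sup>2 + 2 * (6 * (q3 k p - u3 p)\<^sup>2)\<^sup>2"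
      using norm_add_sq_le[of "2 * (q1 k p - u1 p)\<^sup>2" "6 * (q3 k p - u3 p)\<^sup>2"] by simp
    finally show ?thesis by (simp add: power_mult_distrib)
  qed
  note L4s = W0_L4[OF wk(1)] W0_L4[OF wk(2)]
  have \<delta>L4: "L4 \<mu> (\<delta> k)" for k
  proof (rule L4_bound)
    show "integrable \<mu> (\<lambda>p. 8 * (q1 k p - u1 p) ^ 4 + 72 * (q3 k p - u3 p) ^ 4)" using L4s[of k] by (simp add: L4_def)
    have [measurable]: "(\<lambda>p. q1 k p - u1 p) \<in> borel_measurable \<mu>" "(\<lambda>p. q3 k p - u3 p) \<in> borel_measurable \<mu>" using L4s[of k] by (simp_all add: L4_def)
    have "\<delta> k = (\<lambda>p. sqrt (2 * (q1 k p - u1 p)\<^sup>2 + 6 * (q3 k p - u3 p)\<^sup>2))"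
      unfolding \<delta>2[symmetric] using \<delta>0 by simp
    then show "\<delta> k \<in> borel_measurable \<mu>" by simp
  qed (use \<delta>4 in auto)
  have fourth: "(\<lambda>k. LINT p|\<mu>. (q k p - u p) ^ 4) \<longlonglongrightarrow> 0"
    if w: "\<And>k. W0 (\<lambda>p. q k p - u p) (\<lambda>p. G k p - H p)" and l: "L2_lim \<mu> q u" "L2_lim \<mu> G H" for q u G H
  proof (rule tendsto_sandwich[OF _ _ tendsto_const])
    have "(\<lambda>k. ((LINT p|\<mu>. (norm (q k p - u p))\<^sup>2) + (LINT p|\<mu>. (norm (G k p - H p))\<^sup>2))\<^sup>2) \<longlonglongrightarrow> (0 + 0)\<^sup>2"
      using l unfolding L2_lim_def by (intro tendsto_intros) auto
    then show "(\<lambda>k. ((LINT p|\<mu>. (q k p - u p)\<^sup>2) + (LINT p|\<mu>. (norm (G k p - H p))\<^sup>2))\<^sup>2) \<longlonglongrightarrow> 0" by simp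
  qed (use W0_ladyzhenskaya(2)[OF w] in auto)
  have f8: "(\<lambda>k. 8 * (LINT p|\<mu>. (q1 k p - u1 p) ^ 4) + 72 * (LINT p|\<mu>. (q3 k p - u3 p) ^ 4)) \<longlonglongrightarrow> 8 * 0 + 72 * 0"
    by (intro tendsto_intros fourth[OF wk(1) l(1,2)] fourth[OF wk(2) l(3,4)])
  have l8: "norm (LINT p|\<mu>. (\<delta> k p) ^ 4) \<le> 8 * (LINT p|\<mu>. (q1 k p - u1 p) ^ 4) + 72 * (LINT p|\<mu>. (q3 k p - u3 p) ^ 4)" for k
  proof -
    have "(LINT p|\<mu>. (\<delta> k p) ^ 4) \<le> (LINT p|\<mu>. 8 * (q1 k p - u1 p) ^ 4 + 72 * (q3 k p - u3 p) ^ 4)"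
      using \<delta>L4[of k] L4s[of k] \<delta>4 by (intro integral_mono) (auto simp: L4_def)
    also have "\<dots> = 8 * (LINT p|\<mu>. (q1 k p - u1 p) ^ 4) + 72 * (LINT p|\<mu>. (q3 k p - u3 p) ^ 4)" using L4s[of k] by (simp add: L4_def)
    finally show ?thesis by simp
  qed
  have "(\<lambda>k. 8 * (LINT p|\<mu>. (q1 k p - u1 p) ^ 4) + 72 * (LINT p|\<mu>. (q3 k p - u3 p) ^ 4)) \<longlonglongrightarrow> 0" using f8 by simp
  then have \<delta>lim: "(\<lambda>k. LINT p|\<mu>. (\<delta> k p) ^ 4) \<longlonglongrightarrow> 0"
    by (rule Lim_null_comparison[OF always_eventually[OF allI[OF l8]]])
  define m where "m p = 1 + norm (Q p)" for p
  have mL4: "L4 \<mu> m" unfolding m_def[abs_def] by (rule adm_grad_bound(1)[OF Q])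
  have mm: "(\<lambda>p. (m p) ^ 3) \<in> borel_measurable \<mu>" using mL4 unfolding L4_def by (blast intro: borel_measurable_power)
  have lim1: "(\<lambda>k. LINT p|\<mu>. (m p) ^ 3 * \<delta> k p) \<longlonglongrightarrow> 0"
    by (rule L4_cubic_tendsto[OF mL4 \<delta>L4 \<delta>lim mm, where c=1]) (simp add: m_def)
  \<comment> \<open>The cube of a sequence vanishing in L4, paired with the constant 1 on a set of
    finite measure.\<close>
  have lim2: "(\<lambda>k. LINT p|\<mu>. (\<delta> k p) ^ 3 * 1) \<longlonglongrightarrow> 0"
  proof -
    have "(\<lambda>k. (LINT p|\<mu>. (\<delta> k p) ^ 4) ^ 3 * (LINT p|\<mu>. (1::real) ^ 4)) \<longlonglongrightarrow> 0 ^ 3 * (LINT p|\<mu>. (1::real) ^ 4)"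
      by (intro tendsto_intros \<delta>lim)
    then have "(\<lambda>k. (LINT p|\<mu>. (\<delta> k p) ^ 4) ^ 3 * (LINT p|\<mu>. (1::real) ^ 4)) \<longlonglongrightarrow> 0"
      unfolding power_0_left by simp
    moreover have n4: "norm ((LINT p|\<mu>. (\<delta> k p) ^ 3 * 1) ^ 4) \<le> (LINT p|\<mu>. (\<delta> k p) ^ 4) ^ 3 * (LINT p|\<mu>. (1::real) ^ 4)" for k
      using L4_cubic_bound[OF \<delta>L4[of k] L4_const[of 1]] by simp
    ultimately have "(\<lambda>k. (LINT p|\<mu>. (\<delta> k p) ^ 3 * 1) ^ 4) \<longlonglongrightarrow> 0"
      by (intro Lim_null_comparison[OF always_eventually[OF allI[OF n4]]])
    then show ?thesis by simp
  qed
  obtain b1 where b1: "0 \<le> b1" "\<And>p. \<bar>z1 p\<bar> \<le> b1" using test_function_bounded[OF t(1)] by metis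
  obtain b3 where b3: "0 \<le> b3" "\<And>p. \<bar>z3 p\<bar> \<le> b3" using test_function_bounded[OF t(2)] by metis
  define b where "b = b1 * norm (Q_of 1 0) + b3 * norm (Q_of 0 1)"
  have b0: "0 \<le> b" using b1(1) b3(1) by (simp add: b_def)
  have b: "norm (Z p) \<le> b" for p
  proof -
    have "Z p = z1 p *\<^sub>R Q_of 1 0 + z3 p *\<^sub>R Q_of 0 1" using Q_of_linear[of "z1 p" 1 "z3 p" 0 0 1] by (simp add: Z_def)
    then have "norm (Z p) \<le> \<bar>z1 p\<bar> * norm (Q_of 1 0) + \<bar>z3 p\<bar> * norm (Q_of 0 1)"
      by (metis norm_scaleR norm_triangle_ineq)
    also have "\<dots> \<le> b" unfolding b_def by (intro add_mono mult_right_mono b1 b3) auto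
    finally show ?thesis .
  qed
  define c where "c = 4 * (\<bar>A\<bar> + B + C)"
  have c0: "0 \<le> c" using coeffs by (simp add: c_def)
  define f where "f p = bulk_grad A B C (Q p) \<bullet> Z p" for p
  define fk where "fk k p = bulk_grad A B C (Qk k p) \<bullet> Z p" for k p
  \<comment> \<open>The Lipschitz bound contains the moving norm of Qk; splitting it into the norm
    of Q and \<delta> leaves a fixed weight m^3 times \<delta> and a pure cube of \<delta>.\<close>
  have est: "\<bar>fk k p - f p\<bar> \<le> c * b * (3 * ((m p) ^ 3 * \<delta> k p) + 2 * ((\<delta> k p) ^ 3 * 1))" for k p
  proof -
    have "\<bar>fk k p - f p\<bar> = \<bar>(bulk_grad A B C (Qk k p) - bulk_grad A B C (Q p)) \<bullet> Z p\<bar>" by (simp add: fk_def f_def inner_diff_left)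
    also have "\<dots> \<le> norm (bulk_grad A B C (Qk k p) - bulk_grad A B C (Q p)) * norm (Z p)" by (rule Cauchy_Schwarz_ineq2)
    also have "\<dots> \<le> (c * (1 + (norm (Qk k p))\<^sup>2 + (norm (Q p))\<^sup>2) * \<delta> k p) * b"
      unfolding c_def \<delta>_def Qk_def Q_def
      by (intro mult_mono bulk_grad_lipschitz Q_of_S0 coeffs b mult_nonneg_nonneg) (use coeffs in auto)
    also have "\<dots> = c * b * ((1 + (norm (Qk k p))\<^sup>2 + (norm (Q p))\<^sup>2) * \<delta> k p)" by simp
    also have "\<dots> \<le> c * b * (3 * ((m p) ^ 3 * \<delta> k p) + 2 * ((\<delta> k p) ^ 3 * 1))"
    proof (rule mult_left_mono)
      have "(norm (Qk k p))\<^sup>2 \<le> 2 * (norm (Q p))\<^sup>2 + 2 * (\<delta> k p)\<^sup>2"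
        using norm_add_sq_le[of "Q p" "Qk k p - Q p"] by (simp add: \<delta>_def)
      then have "1 + (norm (Qk k p))\<^sup>2 + (norm (Q p))\<^sup>2 \<le> 1 + 3 * (norm (Q p))\<^sup>2 + 2 * (\<delta> k p)\<^sup>2" by linarith
      also have "\<dots> \<le> 3 * (m p) ^ 3 + 2 * (\<delta> k p)\<^sup>2"
      proof -
        have "1 + 3 * x\<^sup>2 \<le> 3 * (1 + x) ^ 3" if "0 \<le> x" for x :: real
          using that by (simp add: power2_eq_square power3_eq_cube algebra_simps)
        then show ?thesis by (simp add: m_def)
      qed
      finally have "(1 + (norm (Qk k p))\<^sup>2 + (norm (Q p))\<^sup>2) * \<delta> k p \<le> (3 * (m p) ^ 3 + 2 * (\<delta> k p)\<^sup>2) * \<delta> k p"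
        by (rule mult_right_mono) (rule \<delta>0)
      then show "(1 + (norm (Qk k p))\<^sup>2 + (norm (Q p))\<^sup>2) * \<delta> k p \<le> 3 * ((m p) ^ 3 * \<delta> k p) + 2 * ((\<delta> k p) ^ 3 * 1)"
        by (simp add: distrib_right power2_eq_square power3_eq_cube mult.assoc)
    qed (use c0 b0 in simp)
    finally show ?thesis .
  qed
  note Cz = test_function_C1[OF t(1)] test_function_C1[OF t(2)]
  have zL4: "L4 \<mu> (\<lambda>p. Z p $ i $ j)" for i j
  proof -
    have "Z p $ i $ j = (Q_of 1 0 $ i $ j) * z1 p + (Q_of 0 1 $ i $ j) * z3 p" for p
      unfolding Z_def by (subst Q_of_split) (simp add: mult.commute)
    then show ?thesis using L4_add[OF L4_cmult[OF C1_L4[OF Cz(1)]] L4_cmult[OF C1_L4[OF Cz(2)]]] by simp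
  qed
  have fi: "integrable \<mu> f"
    unfolding f_def mat_inner
    by (intro Bochner_Integration.integrable_sum L4_cubic_mult_integrable[OF adm_grad_bound(1)[OF Q] zL4 adm_grad_bound(2,3)[OF Q]])
  have fki: "integrable \<mu> (fk k)" for k
    unfolding fk_def[abs_def] Qk_def Z_def
    by (intro continuous_integrable bulk_grad_continuous C1_grad_continuous(1)[OF V_test(3)[OF V]] C1_grad_continuous(1)[OF V_test(4)[OF V]]
        C1_grad_continuous(1)[OF Cz(1)] C1_grad_continuous(1)[OF Cz(2)])
  have "(\<lambda>k. (LINT p|\<mu>. fk k p) - (LINT p|\<mu>. f p)) \<longlonglongrightarrow> 0"
  proof (rule Lim_null_comparison)
    have "(\<lambda>k. c * b * (3 * (LINT p|\<mu>. (m p) ^ 3 * \<delta> k p) + 2 * (LINT p|\<mu>. (\<delta> k p) ^ 3 * 1))) \<longlonglongrightarrow> c * b * (3 * 0 + 2 * 0)"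
      by (intro tendsto_intros lim1 lim2)
    then show "(\<lambda>k. c * b * (3 * (LINT p|\<mu>. (m p) ^ 3 * \<delta> k p) + 2 * (LINT p|\<mu>. (\<delta> k p) ^ 3 * 1))) \<longlonglongrightarrow> 0" by simp
    have "norm ((LINT p|\<mu>. fk k p) - (LINT p|\<mu>. f p)) \<le> c * b * (3 * (LINT p|\<mu>. (m p) ^ 3 * \<delta> k p) + 2 * (LINT p|\<mu>. (\<delta> k p) ^ 3 * 1))" for k
    proof -
      have i1: "integrable \<mu> (\<lambda>p. (m p) ^ 3 * \<delta> k p)" by (rule L4_cubic_integrable[OF mL4 \<delta>L4])
      have i2: "integrable \<mu> (\<lambda>p. (\<delta> k p) ^ 3 * 1)" by (rule L4_cubic_integrable[OF \<delta>L4 L4_const])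
      have "norm ((LINT p|\<mu>. fk k p) - (LINT p|\<mu>. f p)) = norm (LINT p|\<mu>. fk k p - f p)" using fi fki[of k] by simp
      also have "\<dots> \<le> (LINT p|\<mu>. norm (fk k p - f p))" by (rule integral_norm_bound)
      also have "\<dots> \<le> (LINT p|\<mu>. c * b * (3 * ((m p) ^ 3 * \<delta> k p) + 2 * ((\<delta> k p) ^ 3 * 1)))"
      proof (rule integral_mono)
        show "integrable \<mu> (\<lambda>p. norm (fk k p - f p))" using fi fki[of k] by simp
        show "integrable \<mu> (\<lambda>p. c * b * (3 * ((m p) ^ 3 * \<delta> k p) + 2 * ((\<delta> k p) ^ 3 * 1)))"
          by (intro integrable_mult_right Bochner_Integration.integrable_add i1 i2)
      qed (use est in simp)
      also have "\<dots> = c * b * (3 * (LINT p|\<mu>. (m p) ^ 3 * \<delta> k p) + 2 * (LINT p|\<mu>. (\<delta> k p) ^ 3 * 1))"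
        using i1 i2 by simp
      finally show ?thesis .
    qed
    then show "\<forall>\<^sub>F k in sequentially. norm ((LINT p|\<mu>. fk k p) - (LINT p|\<mu>. f p)) \<le> c * b * (3 * (LINT p|\<mu>. (m p) ^ 3 * \<delta> k p) + 2 * (LINT p|\<mu>. (\<delta> k p) ^ 3 * 1))" by simp
  qed
  then have "(\<lambda>k. LINT p|\<mu>. fk k p) \<longlonglongrightarrow> (LINT p|\<mu>. f p)" by (simp add: LIM_zero_iff)
  moreover have "(\<lambda>k. LINT p|\<mu>. grad (q1 k) p \<bullet> E1 p) \<longlonglongrightarrow> (LINT p|\<mu>. H1 p \<bullet> E1 p)"
    "(\<lambda>k. LINT p|\<mu>. grad (q3 k) p \<bullet> E3 p) \<longlonglongrightarrow> (LINT p|\<mu>. H3 p \<bullet> E3 p)"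
    by (rule L2_lim_inner[OF l(2) L2_lim_const[OF test_L2(2)[OF t(1)]]] L2_lim_inner[OF l(4) L2_lim_const[OF test_L2(2)[OF t(2)]]])+
  ultimately show ?thesis
    unfolding variation_def fk_def Qk_def f_def Q_def Z_def by (intro tendsto_intros)
qed

text \<open>Varying the two components separately gives two scalar equations. Each matrix entry of
  the limit and of its bulk gradient is the same fixed linear combination of the two components, so
  criticality within the span implies the full matrix equation.\<close>

lemma stationary_weak_solution:
  assumes W: "W0 (\<lambda>p. u1 p - F1 p) (\<lambda>p. H1 p - D1 p)" "W0 (\<lambda>p. u3 p - F3 p) (\<lambda>p. H3 p - D3 p)"
    and stat: "\<And>z1 E1 z3 E3. test_function \<Omega> z1 E1 \<Longrightarrow> test_function \<Omega> z3 E3 \<Longrightarrow> variation u1 H1 u3 H3 z1 E1 z3 E3 = 0"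
  shows "(\<lambda>p. Q_of (u1 p) (u3 p)) \<in> adm" "weak_solution A B C L lam \<Omega> (\<lambda>p. Q_of (u1 p) (u3 p))"
proof -
  define Q where "Q p = Q_of (u1 p) (u3 p)" for p
  define c1 where "c1 i j = Q_of 1 0 $ i $ j" for i j :: 3
  define c3 where "c3 i j = Q_of 0 1 $ i $ j" for i j :: 3
  have S: "Sob (\<lambda>p. Q p $ i $ j) (\<lambda>p. c1 i j *\<^sub>R H1 p + c3 i j *\<^sub>R H3 p)" for i j
    using Q_of_admissible(2)[OF W, of i j] by (simp add: Q_def c1_def c3_def)
  have Q: "Q \<in> adm" using Q_of_admissible(1)[OF W] by (simp add: Q_def[abs_def])
  then show "(\<lambda>p. Q_of (u1 p) (u3 p)) \<in> adm" by (simp add: Q_def[abs_def])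
  \<comment> \<open>Coordinates of the bulk gradient in the span, defined through two of its entries
    from which they inherit integrability.\<close>
  define a where "a p = - bulk_grad A B C (Q p) $ 1 $ 2" for p
  define b where "b p = bulk_grad A B C (Q p) $ 3 $ 3 / 2" for p
  have bg: "bulk_grad A B C (Q p) = Q_of (a p) (b p)" for p
  proof -
    obtain a' b' where "bulk_grad A B C (Q p) = Q_of a' b'" using bulk_grad_Q_of unfolding Q_def by blast
    then show ?thesis by (simp add: a_def b_def Q_of_comp)
  qed
  have HL: "L2 \<mu> H1" "L2 \<mu> H3"
    using L2_add[OF W0_L2(2)[OF W(1)] C1_L2(2)[OF ext(1)]] L2_add[OF W0_L2(2)[OF W(2)] C1_L2(2)[OF ext(2)]] by simp_all
  have "- (LINT p|\<mu>. wg Q i j p \<bullet> D\<phi> p) = (LINT p|\<mu>. EL_rhs A B C L lam (Q p) $ i $ j * \<phi> p)"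
    if \<phi>: "test_function \<Omega> \<phi> D\<phi>" for i j \<phi> D\<phi>
  proof -
    have i: "integrable \<mu> (\<lambda>p. bulk_grad A B C (Q p) $ i $ j * \<phi> p)" for i j
      by (rule L4_cubic_mult_integrable[OF adm_grad_bound(1)[OF Q] C1_L4[OF test_function_C1[OF \<phi>]] adm_grad_bound(2,3)[OF Q]])
    have ia: "integrable \<mu> (\<lambda>p. a p * \<phi> p)" using i[of 1 2] by (simp add: a_def)
    have ib: "integrable \<mu> (\<lambda>p. b p * \<phi> p)" using i[of 3 3] by (simp add: b_def)
    have z: "test_function \<Omega> (\<lambda>_. 0) (\<lambda>_. 0)" by (rule test_function_zero)
    have "2 * (LINT p|\<mu>. H1 p \<bullet> D\<phi> p) + \<kappa> * (LINT p|\<mu>. 2 * (a p * \<phi> p)) = 0"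
      using stat[OF \<phi> z] unfolding variation_def bg[unfolded Q_def] Q_of_inner by (simp add: mult.assoc)
    then have s1: "(LINT p|\<mu>. H1 p \<bullet> D\<phi> p) = - (\<kappa> * (LINT p|\<mu>. a p * \<phi> p))" by simp
    have "6 * (LINT p|\<mu>. H3 p \<bullet> D\<phi> p) + \<kappa> * (LINT p|\<mu>. 6 * (b p * \<phi> p)) = 0"
      using stat[OF z \<phi>] unfolding variation_def bg[unfolded Q_def] Q_of_inner by (simp add: mult.assoc)
    then have s3: "(LINT p|\<mu>. H3 p \<bullet> D\<phi> p) = - (\<kappa> * (LINT p|\<mu>. b p * \<phi> p))" by simp
    have D: "L2 \<mu> D\<phi>" by (rule test_L2(2)[OF \<phi>])
    have "(LINT p|\<mu>. wg Q i j p \<bullet> D\<phi> p) = (LINT p|\<mu>. (c1 i j *\<^sub>R H1 p + c3 i j *\<^sub>R H3 p) \<bullet> D\<phi> p)"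
    proof (rule integral_cong_AE)
      show "AE p in \<mu>. wg Q i j p \<bullet> D\<phi> p = (c1 i j *\<^sub>R H1 p + c3 i j *\<^sub>R H3 p) \<bullet> D\<phi> p"
        using Sob_weak_grad_AE[OF S[of i j]] by eventually_elim simp
      show "(\<lambda>p. wg Q i j p \<bullet> D\<phi> p) \<in> borel_measurable \<mu>" "(\<lambda>p. (c1 i j *\<^sub>R H1 p + c3 i j *\<^sub>R H3 p) \<bullet> D\<phi> p) \<in> borel_measurable \<mu>"
        by (rule borel_measurable_inner[OF L2_measurable L2_measurable] conjunct1[OF conjunct2[OF adm_Sob[OF Q, of i j, unfolded Sob_def]]]
            conjunct1[OF conjunct2[OF S[of i j, unfolded Sob_def]]] D)+
    qed
    also have "\<dots> = c1 i j * (LINT p|\<mu>. H1 p \<bullet> D\<phi> p) + c3 i j * (LINT p|\<mu>. H3 p \<bullet> D\<phi> p)"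
      using L2_inner_integrable[OF HL(1) D] L2_inner_integrable[OF HL(2) D] by (simp add: inner_add_left)
    also have "\<dots> = - (\<kappa> * (c1 i j * (LINT p|\<mu>. a p * \<phi> p) + c3 i j * (LINT p|\<mu>. b p * \<phi> p)))"
      unfolding s1 s3 by (simp only: distrib_left mult_minus_right mult.left_commute minus_add_distrib)
    also have "c1 i j * (LINT p|\<mu>. a p * \<phi> p) + c3 i j * (LINT p|\<mu>. b p * \<phi> p) = (LINT p|\<mu>. bulk_grad A B C (Q p) $ i $ j * \<phi> p)"
    proof -
      have "bulk_grad A B C (Q p) $ i $ j * \<phi> p = c1 i j * (a p * \<phi> p) + c3 i j * (b p * \<phi> p)" for p
        unfolding bg by (subst Q_of_split) (simp add: c1_def c3_def algebra_simps)
      then show ?thesis using ia ib by simp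
    qed
    finally show ?thesis by (simp add: EL_rhs_bulk_grad mult.assoc)
  qed
  then show "weak_solution A B C L lam \<Omega> (\<lambda>p. Q_of (u1 p) (u3 p))"
    unfolding weak_solution_def Q_def set_lint_mu[OF dom_borel] by blast
qed

theorem WORS_exists:
  assumes s: "s = s_plus A B C"
  obtains Q where "is_WORS A B C L lam \<rho> \<epsilon> g Q" "Q \<in> adm" "weak_solution A B C L lam \<Omega> Q"
proof -
  obtain q1 q3 m where V: "\<And>k. V (q1 k) (q3 k)" and J: "\<And>k. J (q1 k) (q3 k) \<le> m + (1 / real (Suc k))\<^sup>2" and m: "\<And>r1 r3. V r1 r3 \<Longrightarrow> m \<le> J r1 r3"
    and odd: "\<And>k p. q1 k (reflect p) = - q1 k p" "\<And>k p. q1 k (reflect' p) = - q1 k p"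
    by (rule minimizing_sequence) blast
  obtain u1 H1 u3 H3 where l: "L2_lim \<mu> q1 u1" "L2_lim \<mu> (\<lambda>k. grad (q1 k)) H1" "L2_lim \<mu> q3 u3" "L2_lim \<mu> (\<lambda>k. grad (q3 k)) H3"
    by (rule Cauchy_limit[OF V J m])
  note W = V_limit_W0[OF V l]
  have stat: "variation u1 H1 u3 H3 z1 E1 z3 E3 = 0" if "test_function \<Omega> z1 E1" "test_function \<Omega> z3 E3" for z1 E1 z3 E3
    by (rule LIMSEQ_unique[OF variation_limit[OF V l that] variation_tendsto_zero[OF V J m l(1,3) that]])
  note sol = stationary_weak_solution[OF W stat]
  \<comment> \<open>A point of an axis is fixed by one of the reflections, so an odd function
    vanishes there; the approximants are exactly zero on the axis edges.\<close>
  have axis: "q1 k p = 0" if "(a, b) \<in> axis_edges \<rho> \<epsilon>" "p \<in> closed_segment a b" for k p a b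
  proof -
    have "fst p = 0 \<or> snd p = 0"
      using that by (auto simp: axis_edges_def in_segment)
    then have "reflect p = p \<or> reflect' p = p" by (cases p) (auto simp: reflect_def reflect'_def)
    then show ?thesis using odd[of k p] by auto
  qed
  have tr: "has_trace \<Omega> (axis_edges \<rho> \<epsilon>) u1 (\<lambda>_. 0)"
    by (rule has_trace_exact[OF V_test(3)[OF V] l(1,2) axis])
  have "Sob u1 H1" "Sob u3 H3"
    by (rule C1_lim_Sob[OF V_test(3)[OF V] l(1,2)] C1_lim_Sob[OF V_test(4)[OF V] l(3,4)])+
  then have "W12 \<Omega> u1" "W12 \<Omega> u3" unfolding W12_Sob by blast+
  then have "is_WORS A B C L lam \<rho> \<epsilon> g (\<lambda>p. Q_of (u1 p) (u3 p))"
    unfolding is_WORS_def critical_point_def s[symmetric] using sol tr by blast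
  then show ?thesis using that sol by blast
qed

end

section \<open>The two parameter regimes\<close>

lemma WORS_unique_critical_point:
  assumes "B > 0" "C > 0" "L > 0" "lam > 0" "0 < \<rho>" "\<rho> < 1" "0 < \<epsilon>" "\<epsilon> < min (1/2) (1 - \<rho>)"
    and g: "admissible_profile (s_plus A B C) \<epsilon> g"
    and small: "lam\<^sup>2 / L * semiconvexity A B C * (2 * (1 - \<rho>)\<^sup>2) < 1"
  shows "\<exists>Q. is_WORS A B C L lam \<rho> \<epsilon> g Q \<and> unique_critical_point A B C L lam \<rho> \<epsilon> g Q \<and> the_global_minimizer A B C L lam \<rho> \<epsilon> g Q"
proof -
  interpret well \<rho> \<epsilon> by unfold_locales (use assms in auto)
  obtain F1 D1 F3 D3 where F: "C1_grad F1 D1" "C1_grad F3 D3"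
    "\<And>a b p. (a, b) \<in> boundary_edges \<rho> \<epsilon> \<Longrightarrow> p \<in> closed_segment a b \<Longrightarrow> F1 p = q1b (s_plus A B C) \<rho> \<epsilon> g p \<and> F3 p = q3b (s_plus A B C) \<rho> \<epsilon> p"
    "\<And>p. F1 (reflect p) = - F1 p" "\<And>p. F1 (reflect' p) = - F1 p" "\<And>p. F3 (reflect p) = F3 p" "\<And>p. F3 (reflect' p) = F3 p"
    by (rule boundary_extension[OF g]) blast
  interpret ldg_sym \<rho> \<epsilon> A B C L lam "s_plus A B C" g F1 F3 D1 D3
    by unfold_locales (fact F | use assms in simp)+
  obtain Q where "is_WORS A B C L lam \<rho> \<epsilon> g Q" "Q \<in> admissible_class (s_plus A B C) \<rho> \<epsilon> g" "weak_solution A B C L lam (Om \<rho> \<epsilon>) Q"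
    by (rule WORS_exists[OF refl])
  then show ?thesis using critical_global_minimizer[OF refl] by blast
qed

theorem proposition3p2:
  fixes A B C L :: real
  assumes "A < 0" and "B > 0" and "C > 0" and "L > 0"
  shows
    "(\<forall>\<rho> \<epsilon> g. 0 < \<rho> \<and> \<rho> < 1 \<and> 0 < \<epsilon> \<and> \<epsilon> < min (1/2) (1 - \<rho>) \<and>
        admissible_profile (s_plus A B C) \<epsilon> g \<longrightarrow>
        (\<exists>lam0>0. \<forall>lam. 0 < lam \<and> lam < lam0 \<longrightarrow>
           (\<exists>Q. is_WORS A B C L lam \<rho> \<epsilon> g Q \<and>
                unique_critical_point A B C L lam \<rho> \<epsilon> g Q \<and>
                the_global_minimizer A B C L lam \<rho> \<epsilon> g Q)))
     \<and>
     (\<forall>lam>0. \<exists>\<rho>0. 0 < \<rho>0 \<and> \<rho>0 < 1 \<and>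
        (\<forall>\<rho> \<epsilon> g. \<rho>0 < \<rho> \<and> \<rho> < 1 \<and> 0 < \<epsilon> \<and> \<epsilon> < min (1/2) (1 - \<rho>) \<and>
           admissible_profile (s_plus A B C) \<epsilon> g \<longrightarrow>
           (\<exists>Q. is_WORS A B C L lam \<rho> \<epsilon> g Q \<and>
                unique_critical_point A B C L lam \<rho> \<epsilon> g Q \<and>
                the_global_minimizer A B C L lam \<rho> \<epsilon> g Q)))"
proof (intro conjI allI impI)
  define K where "K = semiconvexity A B C"
  have K: "0 \<le> K" unfolding K_def semiconvexity_def
    by (rule add_nonneg_nonneg[OF abs_ge_zero divide_nonneg_pos]) (use assms in simp_all)
  {
    fix \<rho> \<epsilon> :: real and g
    assume h: "0 < \<rho> \<and> \<rho> < 1 \<and> 0 < \<epsilon> \<and> \<epsilon> < min (1/2) (1 - \<rho>) \<and> admissible_profile (s_plus A B C) \<epsilon> g"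
    \<comment> \<open>Gives lam^2 / L * (2 K + 1) < 1 below the threshold, which suffices because (1
      - \<rho>)^2 \<le> 1. The summand 1 keeps the denominator positive. The value does not involve
      \<rho>, \<epsilon> or g.\<close>
    define lam0 where "lam0 = sqrt (L / (2 * K + 1))"
    have "0 < lam0" unfolding lam0_def using K assms by (intro real_sqrt_gt_zero divide_pos_pos) auto
    moreover have "\<exists>Q. is_WORS A B C L lam \<rho> \<epsilon> g Q \<and> unique_critical_point A B C L lam \<rho> \<epsilon> g Q \<and> the_global_minimizer A B C L lam \<rho> \<epsilon> g Q"
      if lam: "0 < lam" "lam < lam0" for lam
    proof (rule WORS_unique_critical_point)
      have "lam\<^sup>2 < lam0\<^sup>2" using lam by (intro power_strict_mono) auto
      also have "\<dots> = L / (2 * K + 1)" using K assms by (simp add: lam0_def)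
      finally have "lam\<^sup>2 / L < 1 / (2 * K + 1)" using assms K by (simp add: field_simps)
      then have "lam\<^sup>2 / L * (2 * K + 1) < 1" using K by (simp add: pos_less_divide_eq)
      moreover have "lam\<^sup>2 / L * K * (2 * (1 - \<rho>)\<^sup>2) \<le> lam\<^sup>2 / L * K * (2 * 1)"
        using h K assms by (intro mult_left_mono) (auto simp: power_le_one)
      moreover have "0 < lam\<^sup>2 / L" using lam assms by simp
      moreover have "x < 1" if "k * (2 * K + 1) < 1" "x \<le> k * K * (2 * 1)" "0 < k" for x k :: real
        using that by (simp add: algebra_simps)
      ultimately show "lam\<^sup>2 / L * semiconvexity A B C * (2 * (1 - \<rho>)\<^sup>2) < 1" unfolding K_def by blast
    qed (use h lam assms in auto)
    ultimately show "\<exists>lam0>0. \<forall>lam. 0 < lam \<and> lam < lam0 \<longrightarrow>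
           (\<exists>Q. is_WORS A B C L lam \<rho> \<epsilon> g Q \<and>
                unique_critical_point A B C L lam \<rho> \<epsilon> g Q \<and>
                the_global_minimizer A B C L lam \<rho> \<epsilon> g Q)" by blast
  }
  {
    fix lam :: real assume lam: "0 < lam"
    define M where "M = lam\<^sup>2 / L * K"
    have M: "0 \<le> M" using K lam assms by (simp add: M_def)
    \<comment> \<open>Chosen with t < 1 and 2 M t < 1; for \<rho> > 1 - t one has (1 - \<rho>)^2
      \<le> 1 - \<rho> < t, hence 2 M (1 - \<rho>)^2 < 1.\<close>
    define t where "t = 1 / (2 + 2 * M)"
    have t: "0 < t" "t < 1" "2 * M * t < 1" using M by (simp_all add: t_def field_simps)
    have "\<exists>Q. is_WORS A B C L lam \<rho> \<epsilon> g Q \<and> unique_critical_point A B C L lam \<rho> \<epsilon> g Q \<and> the_global_minimizer A B C L lam \<rho> \<epsilon> g Q"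
      if h: "1 - t < \<rho> \<and> \<rho> < 1 \<and> 0 < \<epsilon> \<and> \<epsilon> < min (1/2) (1 - \<rho>) \<and> admissible_profile (s_plus A B C) \<epsilon> g" for \<rho> \<epsilon> g
    proof (rule WORS_unique_critical_point)
      have r: "0 \<le> 1 - \<rho>" "1 - \<rho> \<le> t" "1 - \<rho> \<le> 1" using h t by linarith+
      have "(1 - \<rho>)\<^sup>2 \<le> t * 1" unfolding power2_eq_square using r t by (intro mult_mono) auto
      then have "M * (2 * (1 - \<rho>)\<^sup>2) \<le> M * (2 * t)" using M by (intro mult_left_mono) auto
      then show "lam\<^sup>2 / L * semiconvexity A B C * (2 * (1 - \<rho>)\<^sup>2) < 1" unfolding M_def K_def[symmetric]
        using t(3) unfolding M_def by (metis mult.assoc mult.commute order_le_less_trans)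
    qed (use h t lam assms in auto)
    then show "\<exists>\<rho>0. 0 < \<rho>0 \<and> \<rho>0 < 1 \<and>
        (\<forall>\<rho> \<epsilon> g. \<rho>0 < \<rho> \<and> \<rho> < 1 \<and> 0 < \<epsilon> \<and> \<epsilon> < min (1/2) (1 - \<rho>) \<and>
           admissible_profile (s_plus A B C) \<epsilon> g \<longrightarrow>
           (\<exists>Q. is_WORS A B C L lam \<rho> \<epsilon> g Q \<and>
                unique_critical_point A B C L lam \<rho> \<epsilon> g Q \<and>
                the_global_minimizer A B C L lam \<rho> \<epsilon> g Q))" using t by (intro exI[of _ "1 - t"]) auto
  }
qed

end
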